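(* Let $\mathcal{H}$ be a finite-dimensional Hopf algebra over $\mathbb{C}$, let $\mathcal{U}$ be a compact quantum subgroup of $\mathcal{H}$ with surjective Hopf algebra morphism $\pi:\mathcal{H}\to\mathcal{U}$, and let $A$ be a unital left $\hat{\mathcal{U}}$-module algebra. Then the algebras $A\#\hat{\mathcal{U}}$ and $(A\otimes\mathcal{H})^{\hat{\mathcal{U}}}\#\hat{\mathcal{H}}$ are Morita equivalent (their categories of unital left modules are equivalent).
   Context: All vector spaces and algebras are over $\mathbb{C}$; Sweedler notation $\Delta(x)=\sum x_1\otimes x_2$ is used. For a finite-dimensional Hopf algebra $\mathcal{H}$, its dual $\hat{\mathcal{H}}=\mathcal{H}^*$ is the Hopf algebra with product $(f\star g)(h)=\sum f(h_1)g(h_2)$, coproduct $\Delta_{\hat{\mathcal{H}}}(f)(h\otimes k)=f(hk)$, unit $\epsilon_{\mathcal{H}}$ and counit $f\mapsto f(1)$. A compact quantum subgroup of $\mathcal{H}$ is a finite-dimensional Hopf algebra $\mathcal{U}$ that is unimodular (equivalently, semisimple, equivalently cosemisimple), together with a surjective Hopf algebra morphism $\pi:\mathcal{H}\to\mathcal{U}$. A left $\hat{\mathcal{U}}$-module algebra $A$ is an algebra $A$ with a left $\hat{\mathcal{U}}$-module structure $\beta\rightharpoonup a$ satisfying $\beta\rightharpoonup(aa')=\sum(\beta_1\rightharpoonup a)(\beta_2\rightharpoonup a')$ (here $A$ is unital). The smash product $A\#\hat{\mathcal{U}}$ is $A\otimes\hat{\mathcal{U}}$ with product $(a\#\beta)(a'\#\gamma)=\sum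 a(\beta_1\rightharpoonup a')\#\beta_2\gamma$; similarly for any left $\hat{\mathcal{H}}$-module algebra $B$, $B\#\hat{\mathcal{H}}$ has product $(b\#\alpha)(b'\#\mu)=\sum b(\alpha_1\rightharpoonup b')\#\alpha_2\mu$. $\mathcal{H}$ is a right $\hat{\mathcal{U}}$-module algebra via $h\leftharpoonup\beta=\sum\beta(\pi(h_1))h_2$, and $A\otimes\mathcal{H}$ (tensor product algebra) is a right $\hat{\mathcal{U}}$-module algebra via $(a\otimes h)\leftharpoonup\beta=\sum \overline{S}(\beta_1)\rightharpoonup a\otimes h\leftharpoonup\beta_2$, where $\overline{S}=S_{\hat{\mathcal{U}}}^{-1}$ is the antipode of $\hat{\mathcal{U}}$ with the opposite coproduct. $(A\otimes\mathcal{H})^{\hat{\mathcal{U}}}=\{m\in A\otimes\mathcal{H}: m\leftharpoonup\beta=\beta(1)m\ \forall\beta\in\hat{\mathcal{U}}\}$ is the subalgebra of invariants; it is a left $\hat{\mathcal{H}}$-module algebra via $\alpha\rightharpoonup\sum_i a_i\otimes h_i=\sum_i a_i\otimes(\alpha\rightharpoonup h_i)$, where $\alpha\rightharpoonup h=\sum h_1\alpha(h_2)$. *)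

theory Defs
  imports Complex_Main "HOL-Algebra.Ring" "HOL-Library.FuncSet"
begin

text \<open>A finite-dimensional Hopf algebra with basis e_0,...,e_(n-1) (n = hdim H) is given by
structure constants:  e_i e_j = sum_k hmu i j k e_k;  1 = sum_k heta k e_k;
Delta e_k = sum_(i,j) hdelta k i j e_i (x) e_j;  eps e_k = heps k;  S e_k = sum_l hant k l e_l.\<close>

record hopf =
  hdim :: nat
  hmu :: "nat \<Rightarrow> nat \<Rightarrow> nat \<Rightarrow> complex"
  heta :: "nat \<Rightarrow> complex"
  hdelta :: "nat \<Rightarrow> nat \<Rightarrow> nat \<Rightarrow> complex"
  heps :: "nat \<Rightarrow> complex"
  hant :: "nat \<Rightarrow> nat \<Rightarrow> complex"

definition hopf_alg :: "hopf \<Rightarrow> bool" where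
  "hopf_alg H \<longleftrightarrow> (let n = hdim H; \<mu> = hmu H; \<eta> = heta H; \<Delta> = hdelta H; \<epsilon> = heps H; S = hant H in
     (\<forall>i<n. \<forall>j<n. \<forall>k<n. \<forall>r<n. (\<Sum>l<n. \<mu> i j l * \<mu> l k r) = (\<Sum>l<n. \<mu> j k l * \<mu> i l r)) \<and>
     (\<forall>i<n. \<forall>k<n. (\<Sum>l<n. \<eta> l * \<mu> l i k) = (if i = k then 1 else 0)
                 \<and> (\<Sum>l<n. \<eta> l * \<mu> i l k) = (if i = k then 1 else 0)) \<and>
     (\<forall>k<n. \<forall>a<n. \<forall>b<n. \<forall>c<n. (\<Sum>l<n. \<Delta> k l c * \<Delta> l a b) = (\<Sum>l<n. \<Delta> k a l * \<Delta> l b c)) \<and>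
     (\<forall>k<n. \<forall>j<n. (\<Sum>i<n. \<epsilon> i * \<Delta> k i j) = (if k = j then 1 else 0)
                 \<and> (\<Sum>i<n. \<epsilon> i * \<Delta> k j i) = (if k = j then 1 else 0)) \<and>
     (\<forall>i<n. \<forall>j<n. \<forall>a<n. \<forall>b<n. (\<Sum>k<n. \<mu> i j k * \<Delta> k a b)
        = (\<Sum>p<n. \<Sum>q<n. \<Sum>r<n. \<Sum>s<n. \<Delta> i p q * \<Delta> j r s * \<mu> p r a * \<mu> q s b)) \<and>
     (\<forall>a<n. \<forall>b<n. (\<Sum>k<n. \<eta> k * \<Delta> k a b) = \<eta> a * \<eta> b) \<and>
     (\<forall>i<n. \<forall>j<n. (\<Sum>k<n. \<mu> i j k * \<epsilon> k) = \<epsilon> i * \<epsilon> j) \<and>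
     (\<Sum>k<n. \<eta> k * \<epsilon> k) = 1 \<and>
     (\<forall>k<n. \<forall>r<n. (\<Sum>i<n. \<Sum>j<n. \<Sum>l<n. \<Delta> k i j * S i l * \<mu> l j r) = \<epsilon> k * \<eta> r
                 \<and> (\<Sum>i<n. \<Sum>j<n. \<Sum>l<n. \<Delta> k i j * S j l * \<mu> i l r) = \<epsilon> k * \<eta> r))"

text \<open>Hopf algebra morphism pi : H -> U given by the matrix P: pi(e_i) = sum_(l < hdim U) P i l u_l.\<close>
definition hopf_hom :: "hopf \<Rightarrow> hopf \<Rightarrow> (nat \<Rightarrow> nat \<Rightarrow> complex) \<Rightarrow> bool" where
  "hopf_hom H U P \<longleftrightarrow> (let n = hdim H; m = hdim U in
     (\<forall>i<n. \<forall>j<n. \<forall>l<m. (\<Sum>k<n. hmu H i j k * P k l) = (\<Sum>a<m. \<Sum>b<m. P i a * P j b * hmu U a b l)) \<and>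
     (\<forall>l<m. (\<Sum>k<n. heta H k * P k l) = heta U l) \<and>
     (\<forall>k<n. \<forall>a<m. \<forall>b<m. (\<Sum>l<m. P k l * hdelta U l a b) = (\<Sum>i<n. \<Sum>j<n. hdelta H k i j * P i a * P j b)) \<and>
     (\<forall>k<n. (\<Sum>l<m. P k l * heps U l) = heps H k))"

definition hom_surjective :: "hopf \<Rightarrow> hopf \<Rightarrow> (nat \<Rightarrow> nat \<Rightarrow> complex) \<Rightarrow> bool" where
  "hom_surjective H U P \<longleftrightarrow>
     (\<forall>v :: nat \<Rightarrow> complex. \<exists>c :: nat \<Rightarrow> complex. \<forall>l<hdim U. (\<Sum>i<hdim H. c i * P i l) = v l)"

definition left_integral :: "hopf \<Rightarrow> (nat \<Rightarrow> complex) \<Rightarrow> bool" where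
  "left_integral U L \<longleftrightarrow> (\<forall>i<hdim U. \<forall>k<hdim U.
      (\<Sum>j<hdim U. hmu U i j k * L j) = heps U i * L k)"

definition right_integral :: "hopf \<Rightarrow> (nat \<Rightarrow> complex) \<Rightarrow> bool" where
  "right_integral U L \<longleftrightarrow> (\<forall>i<hdim U. \<forall>k<hdim U.
      (\<Sum>j<hdim U. L j * hmu U j i k) = heps U i * L k)"

definition unimodular :: "hopf \<Rightarrow> bool" where
  "unimodular U \<longleftrightarrow> (\<forall>L. (\<forall>j. j \<ge> hdim U \<longrightarrow> L j = 0) \<longrightarrow> (left_integral U L \<longleftrightarrow> right_integral U L))"

definition compact_quantum_subgroup :: "hopf \<Rightarrow> hopf \<Rightarrow> (nat \<Rightarrow> nat \<Rightarrow> complex) \<Rightarrow> bool" where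
  "compact_quantum_subgroup H U P \<longleftrightarrow>
     hopf_alg U \<and> unimodular U \<and> hopf_hom H U P \<and> hom_surjective H U P"

section \<open>The dual Hopf algebra U^ (coordinates w.r.t. the dual basis)\<close>

definition dvec :: "nat \<Rightarrow> (nat \<Rightarrow> complex) set" where
  "dvec m = {\<beta>. \<forall>l. l \<ge> m \<longrightarrow> \<beta> l = 0}"

definition dlt :: "nat \<Rightarrow> nat \<Rightarrow> complex" where
  "dlt i = (\<lambda>l. if l = i then 1 else 0)"

definition dconv :: "hopf \<Rightarrow> (nat \<Rightarrow> complex) \<Rightarrow> (nat \<Rightarrow> complex) \<Rightarrow> nat \<Rightarrow> complex" where
  "dconv U f g = (\<lambda>k. if k < hdim U then (\<Sum>i<hdim U. \<Sum>j<hdim U. hdelta U k i j * f i * g j) else 0)"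

definition dunit :: "hopf \<Rightarrow> nat \<Rightarrow> complex" where
  "dunit U = (\<lambda>k. if k < hdim U then heps U k else 0)"

definition dcounit :: "hopf \<Rightarrow> (nat \<Rightarrow> complex) \<Rightarrow> complex" where
  "dcounit U f = (\<Sum>k<hdim U. heta U k * f k)"

text \<open>Matrix of the inverse antipode: T with T * S = I; then Sbar(f)(u_l) = f(S^-1 u_l) = sum_p T l p f(u_p).\<close>
definition santi_inv :: "hopf \<Rightarrow> nat \<Rightarrow> nat \<Rightarrow> complex" where
  "santi_inv U = (THE T. (\<forall>l p. (l \<ge> hdim U \<or> p \<ge> hdim U) \<longrightarrow> T l p = 0) \<and>
       (\<forall>l<hdim U. \<forall>r<hdim U. (\<Sum>p<hdim U. T l p * hant U p r) = (if l = r then 1 else 0)))"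

definition complex_algebra :: "(complex \<Rightarrow> 'a::{ring,monoid_mult} \<Rightarrow> 'a) \<Rightarrow> bool" where
  "complex_algebra sc \<longleftrightarrow> (\<forall>x y a b.
      sc (x + y) a = sc x a + sc y a \<and> sc x (a + b) = sc x a + sc x b \<and>
      sc (x * y) a = sc x (sc y a) \<and> sc 1 a = a \<and>
      sc x (a * b) = sc x a * b \<and> sc x (a * b) = a * sc x b)"

definition dual_module_algebra ::
  "hopf \<Rightarrow> (complex \<Rightarrow> 'a::{ring,monoid_mult} \<Rightarrow> 'a) \<Rightarrow> ((nat \<Rightarrow> complex) \<Rightarrow> 'a \<Rightarrow> 'a) \<Rightarrow> bool" where
  "dual_module_algebra U sc act \<longleftrightarrow> (let m = hdim U in
     (\<forall>\<beta>\<in>dvec m. \<forall>\<gamma>\<in>dvec m. \<forall>x y a. act (\<lambda>l. x * \<beta> l + y * \<gamma> l) a = sc x (act \<beta> a) + sc y (act \<gamma> a)) \<and>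
     (\<forall>\<beta>\<in>dvec m. \<forall>a b. act \<beta> (a + b) = act \<beta> a + act \<beta> b) \<and>
     (\<forall>\<beta>\<in>dvec m. \<forall>x a. act \<beta> (sc x a) = sc x (act \<beta> a)) \<and>
     (\<forall>a. act (dunit U) a = a) \<and>
     (\<forall>\<beta>\<in>dvec m. \<forall>\<gamma>\<in>dvec m. \<forall>a. act (dconv U \<beta> \<gamma>) a = act \<beta> (act \<gamma> a)) \<and>
     (\<forall>\<beta>\<in>dvec m. \<forall>a b. act \<beta> (a * b) =
        (\<Sum>i<m. \<Sum>j<m. sc (\<Sum>k<m. hmu U i j k * \<beta> k) (act (dlt i) a * act (dlt j) b))) \<and>
     (\<forall>\<beta>\<in>dvec m. act \<beta> 1 = sc (dcounit U \<beta>) 1))"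

text \<open>Elements: x :: nat => 'a representing sum_i x i # delta_i.\<close>
definition smashU ::
  "hopf \<Rightarrow> (complex \<Rightarrow> 'a::{ring,monoid_mult} \<Rightarrow> 'a) \<Rightarrow> ((nat \<Rightarrow> complex) \<Rightarrow> 'a \<Rightarrow> 'a) \<Rightarrow> (nat \<Rightarrow> 'a) ring" where
  "smashU U sc act = (let m = hdim U in
     \<lparr>carrier = {x. \<forall>i. i \<ge> m \<longrightarrow> x i = 0},
      mult = (\<lambda>x y. (\<lambda>k. if k < m then
          (\<Sum>i<m. \<Sum>j<m. \<Sum>p<m. \<Sum>q<m. sc (hmu U p q i * hdelta U k q j) (x i * act (dlt p) (y j)))
          else 0)),
      one = (\<lambda>l. if l < m then sc (heps U l) 1 else 0),
      zero = (\<lambda>_. 0),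
      add = (\<lambda>x y l. x l + y l)\<rparr>)"

text \<open>Elements of A (x) H: z :: nat => 'a representing sum_k z k (x) e_k.\<close>
definition tmul :: "hopf \<Rightarrow> (complex \<Rightarrow> 'a::{ring,monoid_mult} \<Rightarrow> 'a) \<Rightarrow> (nat \<Rightarrow> 'a) \<Rightarrow> (nat \<Rightarrow> 'a) \<Rightarrow> nat \<Rightarrow> 'a" where
  "tmul H sc z w = (\<lambda>k. if k < hdim H then (\<Sum>i<hdim H. \<Sum>j<hdim H. sc (hmu H i j k) (z i * w j)) else 0)"

definition tone :: "hopf \<Rightarrow> (complex \<Rightarrow> 'a::{ring,monoid_mult} \<Rightarrow> 'a) \<Rightarrow> nat \<Rightarrow> 'a" where
  "tone H sc = (\<lambda>k. if k < hdim H then sc (heta H k) 1 else 0)"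

text \<open>Right U^-action on A (x) H: (a (x) h) <- beta = sum Sbar(beta_1) -> a (x) h <- beta_2,
  with h <- beta = sum beta(pi(h_1)) h_2.\<close>
definition ract ::
  "hopf \<Rightarrow> hopf \<Rightarrow> (nat \<Rightarrow> nat \<Rightarrow> complex) \<Rightarrow> (complex \<Rightarrow> 'a::{ring,monoid_mult} \<Rightarrow> 'a)
     \<Rightarrow> ((nat \<Rightarrow> complex) \<Rightarrow> 'a \<Rightarrow> 'a) \<Rightarrow> (nat \<Rightarrow> 'a) \<Rightarrow> (nat \<Rightarrow> complex) \<Rightarrow> nat \<Rightarrow> 'a" where
  "ract H U P sc act z \<beta> = (\<lambda>j. if j < hdim H then
      (\<Sum>k<hdim H. \<Sum>p<hdim U. \<Sum>q<hdim U. \<Sum>i<hdim H.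
          sc ((\<Sum>s<hdim U. hmu U p q s * \<beta> s) * hdelta H k i j * P i q)
             (act (\<lambda>l. santi_inv U l p) (z k)))
      else 0)"

definition invariants ::
  "hopf \<Rightarrow> hopf \<Rightarrow> (nat \<Rightarrow> nat \<Rightarrow> complex) \<Rightarrow> (complex \<Rightarrow> 'a::{ring,monoid_mult} \<Rightarrow> 'a)
     \<Rightarrow> ((nat \<Rightarrow> complex) \<Rightarrow> 'a \<Rightarrow> 'a) \<Rightarrow> (nat \<Rightarrow> 'a) set" where
  "invariants H U P sc act = {z. (\<forall>k. k \<ge> hdim H \<longrightarrow> z k = 0) \<and>
      (\<forall>\<beta>\<in>dvec (hdim U). ract H U P sc act z \<beta> = (\<lambda>j. sc (dcounit U \<beta>) (z j)))}"

text \<open>Left H^-action on A (x) H: alpha -> (a (x) h) = a (x) sum h_1 alpha(h_2).\<close>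
definition hact :: "hopf \<Rightarrow> (complex \<Rightarrow> 'a::{ring,monoid_mult} \<Rightarrow> 'a) \<Rightarrow> (nat \<Rightarrow> complex) \<Rightarrow> (nat \<Rightarrow> 'a) \<Rightarrow> nat \<Rightarrow> 'a" where
  "hact H sc \<alpha> z = (\<lambda>i. if i < hdim H then (\<Sum>k<hdim H. \<Sum>j<hdim H. sc (hdelta H k i j * \<alpha> j) (z k)) else 0)"

text \<open>The smash product (A (x) H)^U^ # H^. Elements: w :: nat => nat => 'a representing
  sum_l (w l) # delta_l with each w l in the invariant subalgebra.\<close>
definition smashH ::
  "hopf \<Rightarrow> hopf \<Rightarrow> (nat \<Rightarrow> nat \<Rightarrow> complex) \<Rightarrow> (complex \<Rightarrow> 'a::{ring,monoid_mult} \<Rightarrow> 'a)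
     \<Rightarrow> ((nat \<Rightarrow> complex) \<Rightarrow> 'a \<Rightarrow> 'a) \<Rightarrow> (nat \<Rightarrow> nat \<Rightarrow> 'a) ring" where
  "smashH H U P sc act = (let n = hdim H in
     \<lparr>carrier = {w. (\<forall>l<n. w l \<in> invariants H U P sc act) \<and> (\<forall>l. l \<ge> n \<longrightarrow> w l = (\<lambda>_. 0))},
      mult = (\<lambda>w w'. (\<lambda>k. if k < n then (\<lambda>r.
          (\<Sum>i<n. \<Sum>j<n. \<Sum>p<n. \<Sum>q<n. sc (hmu H p q i * hdelta H k q j)
              (tmul H sc (w i) (hact H sc (dlt p) (w' j)) r)))
          else (\<lambda>_. 0))),
      one = (\<lambda>l. if l < n then (\<lambda>r. sc (heps H l) (tone H sc r)) else (\<lambda>_. 0)),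
      zero = (\<lambda>_ _. 0),
      add = (\<lambda>w w' l r. w l r + w' l r)\<rparr>)"

record ('r, 'm) lmod =
  mcar :: "'m set"
  madd :: "'m \<Rightarrow> 'm \<Rightarrow> 'm"
  mzero :: 'm
  mact :: "'r \<Rightarrow> 'm \<Rightarrow> 'm"

definition is_lmod :: "('r, 'x) ring_scheme \<Rightarrow> ('r, 'm) lmod \<Rightarrow> bool" where
  "is_lmod R M \<longleftrightarrow> (let C = mcar M; p = madd M; z = mzero M; a = mact M in
     z \<in> C \<and> (\<forall>x\<in>C. \<forall>y\<in>C. p x y \<in> C) \<and>
     (\<forall>x\<in>C. \<forall>y\<in>C. \<forall>w\<in>C. p (p x y) w = p x (p y w)) \<and>
     (\<forall>x\<in>C. \<forall>y\<in>C. p x y = p y x) \<and>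
     (\<forall>x\<in>C. p z x = x) \<and> (\<forall>x\<in>C. \<exists>y\<in>C. p x y = z) \<and>
     (\<forall>r\<in>carrier R. \<forall>x\<in>C. a r x \<in> C) \<and>
     (\<forall>r\<in>carrier R. \<forall>x\<in>C. \<forall>y\<in>C. a r (p x y) = p (a r x) (a r y)) \<and>
     (\<forall>r\<in>carrier R. \<forall>s\<in>carrier R. \<forall>x\<in>C.
         a (r \<oplus>\<^bsub>R\<^esub> s) x = p (a r x) (a s x) \<and> a (r \<otimes>\<^bsub>R\<^esub> s) x = a r (a s x)) \<and>
     (\<forall>x\<in>C. a \<one>\<^bsub>R\<^esub> x = x))"

definition lhom :: "('r, 'x) ring_scheme \<Rightarrow> ('r, 'm) lmod \<Rightarrow> ('r, 'm) lmod \<Rightarrow> ('m \<Rightarrow> 'm) set" where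
  "lhom R M N = {f. f \<in> extensional (mcar M) \<and> (\<forall>x\<in>mcar M. f x \<in> mcar N) \<and>
      (\<forall>x\<in>mcar M. \<forall>y\<in>mcar M. f (madd M x y) = madd N (f x) (f y)) \<and>
      (\<forall>r\<in>carrier R. \<forall>x\<in>mcar M. f (mact M r x) = mact N r (f x))}"

definition mod_functor ::
  "('r, 'x) ring_scheme \<Rightarrow> ('s, 'y) ring_scheme \<Rightarrow> (('r, 'm) lmod \<Rightarrow> ('s, 'm) lmod)
     \<Rightarrow> (('r, 'm) lmod \<Rightarrow> ('r, 'm) lmod \<Rightarrow> ('m \<Rightarrow> 'm) \<Rightarrow> ('m \<Rightarrow> 'm)) \<Rightarrow> bool" where
  "mod_functor R S F Fm \<longleftrightarrow>
     (\<forall>M. is_lmod R M \<longrightarrow> is_lmod S (F M)) \<and>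
     (\<forall>M N f. is_lmod R M \<and> is_lmod R N \<and> f \<in> lhom R M N \<longrightarrow> Fm M N f \<in> lhom S (F M) (F N)) \<and>
     (\<forall>M. is_lmod R M \<longrightarrow> Fm M M (restrict id (mcar M)) = restrict id (mcar (F M))) \<and>
     (\<forall>M N K f g. is_lmod R M \<and> is_lmod R N \<and> is_lmod R K \<and> f \<in> lhom R M N \<and> g \<in> lhom R N K \<longrightarrow>
        Fm M K (compose (mcar M) g f) = compose (mcar (F M)) (Fm N K g) (Fm M N f))"

text \<open>Equivalence of the categories of unital left R-modules and unital left S-modules whose
  underlying sets live in the (arbitrary) universe type 'm.\<close>
definition module_categories_equivalent ::
  "('r, 'x) ring_scheme \<Rightarrow> ('s, 'y) ring_scheme \<Rightarrow> 'm itself \<Rightarrow> bool" where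
  "module_categories_equivalent R S _ \<longleftrightarrow>
     (\<exists>(F :: ('r, 'm) lmod \<Rightarrow> ('s, 'm) lmod) Fm (G :: ('s, 'm) lmod \<Rightarrow> ('r, 'm) lmod) Gm eta eps.
        mod_functor R S F Fm \<and> mod_functor S R G Gm \<and>
        (\<forall>M. is_lmod R M \<longrightarrow>
            eta M \<in> lhom R M (G (F M)) \<and> bij_betw (eta M) (mcar M) (mcar (G (F M))) \<and>
            (\<forall>N f. is_lmod R N \<and> f \<in> lhom R M N \<longrightarrow>
               compose (mcar M) (Gm (F M) (F N) (Fm M N f)) (eta M) = compose (mcar M) (eta N) f)) \<and>
        (\<forall>N. is_lmod S N \<longrightarrow>
            eps N \<in> lhom S (F (G N)) N \<and> bij_betw (eps N) (mcar (F (G N))) (mcar N) \<and>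
            (\<forall>N' g. is_lmod S N' \<and> g \<in> lhom S N N' \<longrightarrow>
               compose (mcar (F (G N))) (eps N') (Fm (G N) (G N') (Gm N N' g))
                 = compose (mcar (F (G N))) g (eps N))))"

end

theory Submission
  imports Defs "HOL-Library.Function_Algebras"
begin

text \<open>Let \<open>C\<close> be the algebra of matrices over \<open>A\<close>, viewed as endomorphisms of the right \<open>A\<close>-module
  \<open>A \<otimes> H\<close>, that commute with the diagonal coaction of \<open>U\<close>. Letting \<open>z # \<alpha>\<close> act on \<open>A \<otimes> H\<close> as left
  multiplication by \<open>z\<close> after \<open>\<alpha>\<close> identifies the smash product with the dual of \<open>H\<close> with \<open>C\<close>. An
  integral of \<open>U\<close> provides a comodule section \<open>p\<close> of \<open>\<pi>\<close>, hence an idempotent \<open>e = p \<pi>\<close> of \<open>C\<close>, and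
  \<open>eCe\<close>, the algebra of endomorphisms of \<open>A \<otimes> U\<close> commuting with the coaction, is \<open>A # U\<^sup>*\<close> because \<open>U\<close> is cofree.
  It remains to see that \<open>e\<close> is full, and then modules over \<open>C\<close> and \<open>eCe\<close> correspond. Fullness says
  that the \<open>U\<close>-comodule \<open>H\<close> is a direct summand of a power of \<open>U\<close>, i.e. injective, which amounts to
  an element of \<open>H\<close> that is mapped to \<open>1\<close> by averaging over an integral of \<open>U\<close>. If it did not exist,
  the cotensor product of some \<open>U\<close>-comodule with \<open>H\<close> would be larger than expected from dimensions,
  and tensoring with powers of \<open>ker \<pi>\<close> would make this excess grow beyond the trivial bound.\<close>

section \<open>Finite-dimensional Hopf algebras\<close>

text \<open>Elements of a Hopf algebra are represented by their left multiplication operators, so that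
  products can be formed in a ring type.\<close>

typedef lop = "{f :: (nat \<Rightarrow> complex) \<Rightarrow> nat \<Rightarrow> complex.
    (\<forall>v w. f (\<lambda>k. v k + w k) = (\<lambda>k. f v k + f w k)) \<and> (\<forall>c v. f (\<lambda>k. c * v k) = (\<lambda>k. c * f v k))}"
  morphisms app Lop
  by (rule exI[of _ "\<lambda>v. v"]) simp

setup_lifting type_definition_lop

instantiation lop :: ring_1
begin

lift_definition zero_lop :: lop is "\<lambda>v k. 0" by simp
lift_definition one_lop :: lop is "\<lambda>v. v" by simp
lift_definition plus_lop :: "lop \<Rightarrow> lop \<Rightarrow> lop" is "\<lambda>f g v k. f v k + g v k"
  by (auto simp: algebra_simps)
lift_definition minus_lop :: "lop \<Rightarrow> lop \<Rightarrow> lop" is "\<lambda>f g v k. f v k - g v k"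
  by (auto simp: algebra_simps)
lift_definition uminus_lop :: "lop \<Rightarrow> lop" is "\<lambda>f v k. - f v k"
  by (auto simp: algebra_simps)
lift_definition times_lop :: "lop \<Rightarrow> lop \<Rightarrow> lop" is "\<lambda>f g v. f (g v)"
  by auto

instance
proof
  fix a b c :: lop
  show "a + b + c = a + (b + c)" by transfer (auto simp: algebra_simps)
  show "a + b = b + a" by transfer (auto simp: algebra_simps)
  show "0 + a = a" by transfer auto
  show "- a + a = 0" by transfer auto
  show "a - b = a + - b" by transfer auto
  show "a * b * c = a * (b * c)" by transfer auto
  show "(a + b) * c = a * c + b * c" by transfer auto
  show "a * (b + c) = a * b + a * c" by transfer auto
  show "1 * a = a" by transfer auto
  show "a * 1 = a" by transfer auto
  show "0 \<noteq> (1 :: lop)"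
  proof transfer
    show "(\<lambda>v k. 0) \<noteq> (\<lambda>v :: nat \<Rightarrow> complex. v)"
      by (metis one_neq_zero)
  qed
qed

end

lift_definition csc :: "complex \<Rightarrow> lop \<Rightarrow> lop" is "\<lambda>c f v k. c * f v k"
  by (auto simp: algebra_simps)

lemma csc_add_right: "csc c (x + y) = csc c x + csc c y"
  by transfer (auto simp: algebra_simps)
lemma csc_add_left: "csc (c + d) x = csc c x + csc d x"
  by transfer (auto simp: algebra_simps)
lemma csc_csc [simp]: "csc c (csc d x) = csc (c * d) x"
  by transfer (auto simp: algebra_simps)
lemma csc_one [simp]: "csc 1 x = x"
  by transfer auto
lemma csc_zero_left [simp]: "csc 0 x = 0"
  by transfer auto
lemma csc_zero_right [simp]: "csc c 0 = 0"
  by transfer auto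
lemma csc_mult_left [simp]: "csc c x * y = csc c (x * y)"
  by transfer auto
lemma csc_mult_right [simp]: "x * csc c y = csc c (x * y)"
  by transfer auto
lemma csc_sum_right: "csc c (\<Sum>i\<in>I. f i) = (\<Sum>i\<in>I. csc c (f i))"
  by (induction I rule: infinite_finite_induct) (auto simp: csc_add_right)
lemma csc_sum_left: "csc (\<Sum>i\<in>I. f i) x = (\<Sum>i\<in>I. csc (f i) x)"
  by (induction I rule: infinite_finite_induct) (auto simp: csc_add_left)

lemma app_csc [simp]: "app (csc c x) v k = c * app x v k"
  by transfer simp
lemma app_plus [simp]: "app (x + y) v k = app x v k + app y v k"
  by transfer simp
lemma app_zero [simp]: "app 0 v k = 0"
  by transfer simp
lemma app_one [simp]: "app 1 v = v"
  by transfer simp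
lemma app_times [simp]: "app (x * y) v = app x (app y v)"
  by transfer simp
lemma app_sum: "app (\<Sum>i\<in>I. f i) v k = (\<Sum>i\<in>I. app (f i) v k)"
  by (induction I rule: infinite_finite_induct) auto

definition lin :: "(complex \<Rightarrow> 'v \<Rightarrow> 'v) \<Rightarrow> (lop \<Rightarrow> 'v::ab_group_add) \<Rightarrow> bool" where
  "lin s F \<longleftrightarrow> (\<forall>x y. F (x + y) = F x + F y) \<and> (\<forall>c x. F (csc c x) = s c (F x))"

lemma lin_zero: "lin s F \<Longrightarrow> F 0 = 0"
  by (metis add_cancel_right_right lin_def)

lemma lin_add: "lin s F \<Longrightarrow> F (x + y) = F x + F y"
  by (auto simp: lin_def)

lemma lin_sum: "lin s F \<Longrightarrow> F (\<Sum>i\<in>I. f i) = (\<Sum>i\<in>I. F (f i))"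
  by (induction I rule: infinite_finite_induct) (auto simp: lin_zero lin_add)

lemma lin_csc: "lin s F \<Longrightarrow> F (csc c x) = s c (F x)"
  by (auto simp: lin_def)

lemma lin_mult_right: "lin csc F \<Longrightarrow> lin csc (\<lambda>x. F x * y)"
  and lin_mult_left: "lin csc F \<Longrightarrow> lin csc (\<lambda>x. y * F x)"
  by (auto simp: lin_def algebra_simps)

lemma lin_ident: "lin csc (\<lambda>x. x)"
  by (simp add: lin_def)

lemma lin_compose: "lin csc F \<Longrightarrow> lin s G \<Longrightarrow> lin s (\<lambda>x. G (F x))"
  by (auto simp: lin_def)

lemma lin_sumI: "(\<And>i. i \<in> I \<Longrightarrow> lin csc (F i)) \<Longrightarrow> lin csc (\<lambda>x. \<Sum>i\<in>I. F i x)"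
  by (auto simp: lin_def sum.distrib csc_sum_right)

lemma lin_scaled: "lin csc F \<Longrightarrow> lin csc (\<lambda>x. csc c (F x))"
  by (auto simp: lin_def csc_add_right mult.commute)

lemma lin_csc_fun: "lin (*) f \<Longrightarrow> lin csc (\<lambda>x. csc (f x) y)"
  by (auto simp: lin_def csc_add_left)

lemma lin_fun_sumI: "(\<And>i. i \<in> I \<Longrightarrow> lin (*) (F i)) \<Longrightarrow> lin (*) (\<lambda>x. \<Sum>i\<in>I. F i x)"
  by (auto simp: lin_def sum.distrib sum_distrib_left)

lemma lin_fun_scaled: "lin (*) F \<Longrightarrow> lin (*) (\<lambda>x. c * F x)"
  by (auto simp: lin_def algebra_simps)

locale fd_hopf =
  fixes G :: hopf
  assumes hopf: "hopf_alg G"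
begin

abbreviation n where "n \<equiv> hdim G"
abbreviation mu where "mu \<equiv> hmu G"
abbreviation ut where "ut \<equiv> heta G"
abbreviation dl where "dl \<equiv> hdelta G"
abbreviation ep where "ep \<equiv> heps G"
abbreviation an where "an \<equiv> hant G"

lemmas hopf_axs = hopf[unfolded hopf_alg_def Let_def]

lemma mu_assoc: "i < n \<Longrightarrow> j < n \<Longrightarrow> k < n \<Longrightarrow> r < n \<Longrightarrow>
    (\<Sum>l<n. mu i j l * mu l k r) = (\<Sum>l<n. mu j k l * mu i l r)"
  by (rule hopf_axs[THEN conjunct1, rule_format])
lemma mu_unit_l: "i < n \<Longrightarrow> k < n \<Longrightarrow> (\<Sum>l<n. ut l * mu l i k) = (if i = k then 1 else 0)"
  by (rule hopf_axs[THEN conjunct2, THEN conjunct1, rule_format, THEN conjunct1])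
lemma mu_unit_r: "i < n \<Longrightarrow> k < n \<Longrightarrow> (\<Sum>l<n. ut l * mu i l k) = (if i = k then 1 else 0)"
  by (rule hopf_axs[THEN conjunct2, THEN conjunct1, rule_format, THEN conjunct2])
lemma dl_coassoc: "k < n \<Longrightarrow> x < n \<Longrightarrow> y < n \<Longrightarrow> z < n \<Longrightarrow>
    (\<Sum>l<n. dl k l z * dl l x y) = (\<Sum>l<n. dl k x l * dl l y z)"
  by (rule hopf_axs[THEN conjunct2, THEN conjunct2, THEN conjunct1, rule_format])
lemma dl_counit_l: "k < n \<Longrightarrow> j < n \<Longrightarrow> (\<Sum>i<n. ep i * dl k i j) = (if k = j then 1 else 0)"
  by (rule hopf_axs[THEN conjunct2, THEN conjunct2, THEN conjunct2, THEN conjunct1, rule_format, THEN conjunct1])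
lemma dl_counit_r: "k < n \<Longrightarrow> j < n \<Longrightarrow> (\<Sum>i<n. ep i * dl k j i) = (if k = j then 1 else 0)"
  by (rule hopf_axs[THEN conjunct2, THEN conjunct2, THEN conjunct2, THEN conjunct1, rule_format, THEN conjunct2])
lemma dl_mu: "i < n \<Longrightarrow> j < n \<Longrightarrow> x < n \<Longrightarrow> y < n \<Longrightarrow>
    (\<Sum>k<n. mu i j k * dl k x y)
      = (\<Sum>p<n. \<Sum>q<n. \<Sum>r<n. \<Sum>s<n. dl i p q * dl j r s * mu p r x * mu q s y)"
  by (rule hopf_axs[THEN conjunct2, THEN conjunct2, THEN conjunct2, THEN conjunct2, THEN conjunct1, rule_format])
lemma dl_unit: "x < n \<Longrightarrow> y < n \<Longrightarrow> (\<Sum>k<n. ut k * dl k x y) = ut x * ut y"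
  by (rule hopf_axs[THEN conjunct2, THEN conjunct2, THEN conjunct2, THEN conjunct2, THEN conjunct2, THEN conjunct1, rule_format])
lemma ep_mu: "i < n \<Longrightarrow> j < n \<Longrightarrow> (\<Sum>k<n. mu i j k * ep k) = ep i * ep j"
  by (rule hopf_axs[THEN conjunct2, THEN conjunct2, THEN conjunct2, THEN conjunct2, THEN conjunct2, THEN conjunct2, THEN conjunct1, rule_format])
lemma ep_unit: "(\<Sum>k<n. ut k * ep k) = 1"
  by (rule hopf_axs[THEN conjunct2, THEN conjunct2, THEN conjunct2, THEN conjunct2, THEN conjunct2, THEN conjunct2, THEN conjunct2, THEN conjunct1])
lemma an_l: "k < n \<Longrightarrow> r < n \<Longrightarrow> (\<Sum>i<n. \<Sum>j<n. \<Sum>l<n. dl k i j * an i l * mu l j r) = ep k * ut r"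
  by (rule hopf_axs[THEN conjunct2, THEN conjunct2, THEN conjunct2, THEN conjunct2, THEN conjunct2, THEN conjunct2, THEN conjunct2, THEN conjunct2, rule_format, THEN conjunct1])
lemma an_r: "k < n \<Longrightarrow> r < n \<Longrightarrow> (\<Sum>i<n. \<Sum>j<n. \<Sum>l<n. dl k i j * an j l * mu i l r) = ep k * ut r"
  by (rule hopf_axs[THEN conjunct2, THEN conjunct2, THEN conjunct2, THEN conjunct2, THEN conjunct2, THEN conjunct2, THEN conjunct2, THEN conjunct2, rule_format, THEN conjunct2])

text \<open>The left regular representation, extended by the counit beyond the first \<open>n\<close> coordinates
  so that the unit is represented by the identity.\<close>

definition b :: "nat \<Rightarrow> lop" where
  "b i = Lop (\<lambda>v k. if k < n then (\<Sum>j<n. mu i j k * v j) else ep i * v k)"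

definition co :: "nat \<Rightarrow> lop \<Rightarrow> complex" where
  "co p g = app g (\<lambda>k. if k < n then ut k else 0) p"

definition spn :: "lop set" where
  "spn = {g. g = (\<Sum>p<n. csc (co p g) (b p))}"

lemma app_b: "app (b i) v k = (if k < n then (\<Sum>j<n. mu i j k * v j) else ep i * v k)"
proof -
  have "app (b i) = (\<lambda>v k. if k < n then (\<Sum>j<n. mu i j k * v j) else ep i * v k)"
    unfolding b_def
    by (rule Lop_inverse) (auto simp: fun_eq_iff algebra_simps sum.distrib sum_distrib_left)
  then show ?thesis by simp
qed

lemma lop_eqI: "(\<And>v k. app x v k = app y v k) \<Longrightarrow> x = y"
  by (metis app_inject ext)

lemma b_mult:
  assumes "i < n" "j < n"
  shows "b i * b j = (\<Sum>l<n. csc (mu i j l) (b l))"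
proof (rule lop_eqI)
  fix v k
  show "app (b i * b j) v k = app (\<Sum>l<n. csc (mu i j l) (b l)) v k"
  proof (cases "k < n")
    case True
    have "app (b i * b j) v k = (\<Sum>l<n. mu i l k * (\<Sum>r<n. mu j r l * v r))"
      using True by (simp add: app_b)
    also have "\<dots> = (\<Sum>l<n. \<Sum>r<n. mu j r l * mu i l k * v r)"
      by (simp add: sum_distrib_left mult_ac)
    also have "\<dots> = (\<Sum>r<n. (\<Sum>l<n. mu j r l * mu i l k) * v r)"
      by (subst sum.swap) (simp add: sum_distrib_right)
    also have "\<dots> = (\<Sum>r<n. (\<Sum>l<n. mu i j l * mu l r k) * v r)"
      using assms True by (intro sum.cong refl) (simp add: mu_assoc)
    also have "\<dots> = (\<Sum>l<n. \<Sum>r<n. mu i j l * mu l r k * v r)"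
      by (subst sum.swap) (simp add: sum_distrib_right)
    also have "\<dots> = app (\<Sum>l<n. csc (mu i j l) (b l)) v k"
      using True by (simp add: app_sum app_b sum_distrib_left mult_ac)
    finally show ?thesis .
  next
    case False
    have "ep i * ep j = (\<Sum>l<n. mu i j l * ep l)" using assms ep_mu by simp
    then show ?thesis
      using False by (simp add: app_b app_sum flip: sum_distrib_right mult.assoc)
  qed
qed

lemma one_b: "1 = (\<Sum>l<n. csc (ut l) (b l))"
proof (rule lop_eqI)
  fix v k
  show "app 1 v k = app (\<Sum>l<n. csc (ut l) (b l)) v k"
  proof (cases "k < n")
    case True
    have "app (\<Sum>l<n. csc (ut l) (b l)) v k = (\<Sum>l<n. \<Sum>r<n. ut l * mu l r k * v r)"
      using True by (simp add: app_sum app_b sum_distrib_left mult_ac)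
    also have "\<dots> = (\<Sum>r<n. (\<Sum>l<n. ut l * mu l r k) * v r)"
      by (subst sum.swap) (simp add: sum_distrib_right)
    also have "\<dots> = (\<Sum>r<n. (if r = k then 1 else 0) * v r)"
      using True by (intro sum.cong refl) (simp add: mu_unit_l)
    also have "\<dots> = v k" using True by (simp add: if_distrib if_distribR cong: if_cong)
    finally show ?thesis by simp
  next
    case False
    then show ?thesis
      using ep_unit by (simp add: app_b app_sum flip: sum_distrib_right mult.assoc)
  qed
qed

lemma lin_co: "lin (*) (co p)"
  by (simp add: lin_def co_def)

lemmas co_add [simp] = lin_add[OF lin_co]
  and co_csc [simp] = lin_csc[OF lin_co]
  and co_zero [simp] = lin_zero[OF lin_co]
  and co_sum = lin_sum[OF lin_co]

lemma co_b: 
  assumes "i < n" "p < n"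
  shows "co p (b i) = (if i = p then 1 else 0)"
  using mu_unit_r[OF assms] assms by (simp add: co_def app_b mult.commute)

lemma sum_delta_csc: "p \<in> I \<Longrightarrow> finite I \<Longrightarrow> (\<Sum>i\<in>I. csc (if i = p then 1 else 0) (f i)) = f p"
    "p \<in> I \<Longrightarrow> finite I \<Longrightarrow> (\<Sum>i\<in>I. csc (if p = i then 1 else 0) (f i)) = f p"
  by (simp_all add: if_distrib if_distribR cong: if_cong)

lemma sum_delta_mult: "p \<in> I \<Longrightarrow> finite I \<Longrightarrow> (\<Sum>i\<in>I. (if i = p then 1 else 0) * f i) = (f p :: complex)"
    "p \<in> I \<Longrightarrow> finite I \<Longrightarrow> (\<Sum>i\<in>I. (if p = i then 1 else 0) * f i) = f p"
    "p \<in> I \<Longrightarrow> finite I \<Longrightarrow> (\<Sum>i\<in>I. f i * (if i = p then 1 else 0)) = f p"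
    "p \<in> I \<Longrightarrow> finite I \<Longrightarrow> (\<Sum>i\<in>I. f i * (if p = i then 1 else 0)) = f p"
  by (simp_all add: if_distrib if_distribR cong: if_cong)

lemma co_lincomb: "p < n \<Longrightarrow> co p (\<Sum>i<n. csc (f i) (b i)) = f p"
  by (simp add: co_sum co_b sum_delta_mult)

lemma spn_rep: "g \<in> spn \<Longrightarrow> (\<Sum>p<n. csc (co p g) (b p)) = g"
  by (simp add: spn_def)

lemma spn_lincomb: "(\<Sum>i<n. csc (f i) (b i)) \<in> spn"
  by (simp add: spn_def co_lincomb cong: sum.cong_simp)

lemma spn_b [simp]: "i < n \<Longrightarrow> b i \<in> spn"
  using spn_lincomb[of "\<lambda>p. if i = p then 1 else 0"] by (simp add: sum_delta_csc)

lemma spn_zero [simp]: "0 \<in> spn"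
  using spn_lincomb[of "\<lambda>p. 0"] by simp

lemma spn_one [simp]: "1 \<in> spn"
  by (subst one_b) (rule spn_lincomb)

lemma spn_csc [simp]: "g \<in> spn \<Longrightarrow> csc c g \<in> spn"
  unfolding spn_def by (metis (mono_tags, lifting) co_csc csc_csc csc_sum_right mem_Collect_eq sum.cong)

lemma spn_add [simp]: "g \<in> spn \<Longrightarrow> h \<in> spn \<Longrightarrow> g + h \<in> spn"
  unfolding spn_def by (simp add: csc_add_left sum.distrib)

lemma spn_sum [simp]: "(\<And>i. i \<in> I \<Longrightarrow> f i \<in> spn) \<Longrightarrow> (\<Sum>i\<in>I. f i) \<in> spn"
  by (induction I rule: infinite_finite_induct) auto

lemma spn_mult [simp]:
  assumes "g \<in> spn" "h \<in> spn"
  shows "g * h \<in> spn"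
proof -
  have "g * h = (\<Sum>p<n. csc (co p g) (b p)) * (\<Sum>p<n. csc (co p h) (b p))"
    using assms by (simp add: spn_rep)
  also have "\<dots> \<in> spn"
    by (simp add: sum_product b_mult spn_lincomb)
  finally show ?thesis .
qed

lemma spn_lin_eqI:
  assumes "lin s F" "lin s F'" "\<And>i. i < n \<Longrightarrow> F (b i) = F' (b i)" "g \<in> spn"
  shows "F g = F' g"
proof -
  have "F g = F (\<Sum>p<n. csc (co p g) (b p))" using assms by (simp add: spn_rep)
  also have "\<dots> = (\<Sum>p<n. s (co p g) (F' (b p)))"
    using assms by (simp add: lin_sum[OF assms(1)] lin_csc[OF assms(1)])
  also have "\<dots> = F' (\<Sum>p<n. csc (co p g) (b p))"
    by (simp add: lin_sum[OF assms(2)] lin_csc[OF assms(2)])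
  finally show ?thesis using assms by (simp add: spn_rep)
qed

lemma spn_lin_expand:
  assumes "lin s F" "g \<in> spn"
  shows "F g = (\<Sum>p<n. s (co p g) (F (b p)))"
proof -
  have "F g = F (\<Sum>p<n. csc (co p g) (b p))" using assms by (simp add: spn_rep)
  then show ?thesis by (simp add: lin_sum[OF assms(1)] lin_csc[OF assms(1)])
qed

lemma spn_eqI: "g \<in> spn \<Longrightarrow> h \<in> spn \<Longrightarrow> (\<And>p. p < n \<Longrightarrow> co p g = co p h) \<Longrightarrow> g = h"
  using spn_rep[of g] spn_rep[of h] by (metis (no_types, lifting) lessThan_iff sum.cong)

lemma co_b_mult: "i < n \<Longrightarrow> j < n \<Longrightarrow> k < n \<Longrightarrow> co k (b i * b j) = mu i j k"
  by (simp add: b_mult co_lincomb)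

lemma co_one: "p < n \<Longrightarrow> co p 1 = ut p"
  by (subst one_b) (simp add: co_lincomb)

definition cou :: "lop \<Rightarrow> complex" where
  "cou g = (\<Sum>k<n. ep k * co k g)"

lemma lin_cou: "lin (*) cou"
  unfolding cou_def by (intro lin_fun_sumI lin_fun_scaled lin_co)

lemmas cou_add [simp] = lin_add[OF lin_cou]
  and cou_csc [simp] = lin_csc[OF lin_cou]
  and cou_zero [simp] = lin_zero[OF lin_cou]
  and cou_sum = lin_sum[OF lin_cou]

lemma cou_b [simp]: "k < n \<Longrightarrow> cou (b k) = ep k"
  by (simp add: cou_def co_b sum_delta_mult)

lemma cou_one [simp]: "cou 1 = 1"
  using ep_unit by (simp add: cou_def co_one mult.commute)

lemma bilin_eqI:
  assumes "\<And>y. lin s (\<lambda>x. F x y)" "\<And>x. lin s (F x)" "\<And>y. lin s (\<lambda>x. F' x y)" "\<And>x. lin s (F' x)"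
    and "\<And>i j. i < n \<Longrightarrow> j < n \<Longrightarrow> F (b i) (b j) = F' (b i) (b j)" "g \<in> spn" "h \<in> spn"
  shows "F g h = F' g h"
proof -
  have "F (b i) h = F' (b i) h" if "i < n" for i
    by (rule spn_lin_eqI[OF assms(2,4)]) (use assms that in auto)
  then show ?thesis
    using spn_lin_eqI[OF assms(1,3), of h h g] assms by auto
qed

lemma cou_mult [simp]:
  assumes "g \<in> spn" "h \<in> spn"
  shows "cou (g * h) = cou g * cou h"
proof (rule bilin_eqI[where s = "(*)" and F = "\<lambda>g h. cou (g * h)"])
  fix i j assume "i < n" "j < n"
  then show "cou (b i * b j) = cou (b i) * cou (b j)"
    using ep_mu by (simp add: b_mult cou_sum)
qed (use assms in \<open>auto simp: lin_def distrib_left distrib_right\<close>)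

lemma co_mult:
  assumes "g \<in> spn" "h \<in> spn" "k < n"
  shows "co k (g * h) = (\<Sum>i<n. \<Sum>j<n. mu i j k * co i g * co j h)"
proof (rule bilin_eqI[where s = "(*)" and F = "\<lambda>g h. co k (g * h)"])
  fix i j assume "i < n" "j < n"
  then show "co k (b i * b j) = (\<Sum>i'<n. \<Sum>j'<n. mu i' j' k * co i' (b i) * co j' (b j))"
    using assms by (simp add: co_b_mult co_b sum_delta_mult)
qed (use assms in \<open>auto simp: lin_def distrib_left distrib_right sum.distrib sum_distrib_left mult_ac\<close>)

text \<open>\<open>c k j\<close> are the matrix coefficients of the left regular comodule,
  \<open>\<Delta>(b k) = (\<Sum>j. c k j \<otimes> b j)\<close>, and \<open>R q\<close> is \<open>g \<mapsto> g\<^sub>1 \<delta>\<^sub>q(g\<^sub>2)\<close>.\<close>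

definition c :: "nat \<Rightarrow> nat \<Rightarrow> lop" where
  "c k j = (\<Sum>i<n. csc (dl k i j) (b i))"

definition ct :: "nat \<Rightarrow> nat \<Rightarrow> lop" where
  "ct i k = (\<Sum>j<n. csc (dl k i j) (b j))"

definition R :: "nat \<Rightarrow> lop \<Rightarrow> lop" where
  "R q g = (\<Sum>k<n. csc (co k g) (c k q))"

lemma spn_c [simp]: "c k j \<in> spn"
  by (simp add: c_def spn_lincomb)
lemma spn_ct [simp]: "ct k j \<in> spn"
  by (simp add: ct_def spn_lincomb)
lemma spn_R [simp]: "R q g \<in> spn"
  by (simp add: R_def)

lemma lin_R: "lin csc (R q)"
  unfolding R_def by (intro lin_sumI lin_csc_fun lin_co)

lemmas R_add [simp] = lin_add[OF lin_R]
  and R_csc [simp] = lin_csc[OF lin_R]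
  and R_zero [simp] = lin_zero[OF lin_R]
  and R_sum = lin_sum[OF lin_R]

lemma R_b: "k < n \<Longrightarrow> R q (b k) = c k q"
  by (simp add: R_def co_b sum_delta_csc)

lemma co_c: "i < n \<Longrightarrow> co i (c k j) = dl k i j"
  by (simp add: c_def co_lincomb)
lemma co_ct: "j < n \<Longrightarrow> co j (ct i k) = dl k i j"
  by (simp add: ct_def co_lincomb)

lemma R_mult:
  assumes "g \<in> spn" "h \<in> spn" "q < n"
  shows "R q (g * h) = (\<Sum>r<n. \<Sum>s<n. csc (mu r s q) (R r g * R s h))"
proof (rule bilin_eqI[where s = csc and F = "\<lambda>g h. R q (g * h)"])
  fix i j assume ij: "i < n" "j < n"
  show "R q (b i * b j) = (\<Sum>r<n. \<Sum>s<n. csc (mu r s q) (R r (b i) * R s (b j)))" (is "?L = ?R")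
  proof (rule spn_eqI)
    fix x assume x: "x < n"
    have "co x ?L = (\<Sum>l<n. mu i j l * dl l x q)"
      using ij x by (simp add: b_mult R_sum R_b co_sum co_c)
    also have "\<dots> = (\<Sum>p<n. \<Sum>q'<n. \<Sum>r<n. \<Sum>s<n. dl i p q' * dl j r s * mu p r x * mu q' s q)"
      using ij x assms by (simp add: dl_mu)
    also have "\<dots> = (\<Sum>q'<n. \<Sum>p<n. \<Sum>s<n. \<Sum>r<n. dl i p q' * dl j r s * mu p r x * mu q' s q)"
      by (subst sum.swap) (intro sum.cong refl sum.swap)
    also have "\<dots> = (\<Sum>q'<n. \<Sum>s<n. \<Sum>p<n. \<Sum>r<n. dl i p q' * dl j r s * mu p r x * mu q' s q)"
      by (intro sum.cong refl sum.swap)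
    also have "\<dots> = co x ?R"
      using ij x by (simp add: co_sum R_b co_mult co_c sum_distrib_left mult_ac)
    finally show "co x ?L = co x ?R" .
  qed (use ij in auto)
qed (use assms in \<open>auto simp: lin_def algebra_simps csc_add_right sum.distrib csc_sum_right intro!: sum.cong\<close>)

lemma R_one: "q < n \<Longrightarrow> R q 1 = csc (ut q) 1"
proof (rule spn_eqI)
  fix p assume "p < n" "q < n"
  then show "co p (R q 1) = co p (csc (ut q) 1)"
    by (simp add: R_def co_sum co_one co_c dl_unit)
qed auto

lemma sum_ep_c: "k < n \<Longrightarrow> (\<Sum>j<n. csc (ep j) (c k j)) = b k"
  by (rule spn_eqI) (auto simp: co_sum co_c co_b dl_counit_r)

lemma sum_ep_ct: "k < n \<Longrightarrow> (\<Sum>j<n. csc (ep j) (ct j k)) = b k"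
  by (rule spn_eqI) (auto simp: co_sum co_ct co_b dl_counit_l)

lemma sum_ep_R: "g \<in> spn \<Longrightarrow> (\<Sum>q<n. csc (ep q) (R q g)) = g"
  by (rule spn_lin_eqI[where s = csc])
    (auto intro!: lin_sumI lin_scaled lin_R lin_ident simp: R_b sum_ep_c)

definition corep :: "'i set \<Rightarrow> ('i \<Rightarrow> 'i \<Rightarrow> lop) \<Rightarrow> bool" where
  "corep I v \<longleftrightarrow> finite I \<and> (\<forall>i\<in>I. \<forall>j\<in>I. v i j \<in> spn) \<and>
     (\<forall>i\<in>I. \<forall>j\<in>I. \<forall>q<n. R q (v i j) = (\<Sum>t\<in>I. csc (co q (v t j)) (v i t))) \<and>
     (\<forall>i\<in>I. \<forall>j\<in>I. cou (v i j) = (if i = j then 1 else 0))"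

lemma corep_spn: "corep I v \<Longrightarrow> i \<in> I \<Longrightarrow> j \<in> I \<Longrightarrow> v i j \<in> spn"
  by (auto simp: corep_def)
lemma corep_fin: "corep I v \<Longrightarrow> finite I"
  by (auto simp: corep_def)
lemma corep_cou: "corep I v \<Longrightarrow> i \<in> I \<Longrightarrow> j \<in> I \<Longrightarrow> cou (v i j) = (if i = j then 1 else 0)"
  by (auto simp: corep_def)
lemma corep_R: "corep I v \<Longrightarrow> i \<in> I \<Longrightarrow> j \<in> I \<Longrightarrow> q < n \<Longrightarrow>
    R q (v i j) = (\<Sum>t\<in>I. csc (co q (v t j)) (v i t))"
  by (auto simp: corep_def)

lemma corep_c: "corep {..<n} c"
  unfolding corep_def
proof (intro conjI ballI allI impI)
  fix i j q assume *: "i \<in> {..<n}" "j \<in> {..<n}" "q < n"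
  show "R q (c i j) = (\<Sum>t<n. csc (co q (c t j)) (c i t))"
  proof (rule spn_eqI)
    fix p assume p: "p < n"
    have "co p (R q (c i j)) = (\<Sum>k<n. dl i k j * dl k p q)"
      using * p by (simp add: R_def co_sum co_c)
    also have "\<dots> = (\<Sum>k<n. dl i p k * dl k q j)"
      using * p by (simp add: dl_coassoc)
    finally show "co p (R q (c i j)) = co p (\<Sum>t<n. csc (co q (c t j)) (c i t))"
      using * p by (simp add: co_sum co_c mult.commute)
  qed auto
next
  fix i j assume "i \<in> {..<n}" "j \<in> {..<n}"
  then show "cou (c i j) = (if i = j then 1 else 0)"
    by (simp add: cou_def co_c dl_counit_l)
qed auto

lemma corep_ct: "corep {..<n} ct"
  unfolding corep_def
proof (intro conjI ballI allI impI)
  fix i j q assume *: "i \<in> {..<n}" "j \<in> {..<n}" "q < n"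
  show "R q (ct i j) = (\<Sum>t<n. csc (co q (ct t j)) (ct i t))"
  proof (rule spn_eqI)
    fix p assume p: "p < n"
    have "co p (R q (ct i j)) = (\<Sum>k<n. dl j i k * dl k p q)"
      using * p by (simp add: R_def co_sum co_c co_ct)
    also have "\<dots> = (\<Sum>k<n. dl j k q * dl k i p)"
      using * p by (simp add: dl_coassoc)
    finally show "co p (R q (ct i j)) = co p (\<Sum>t<n. csc (co q (ct t j)) (ct i t))"
      using * p by (simp add: co_sum co_ct mult.commute)
  qed auto
next
  fix i j assume "i \<in> {..<n}" "j \<in> {..<n}"
  then show "cou (ct i j) = (if i = j then 1 else 0)"
    by (auto simp add: cou_def co_ct dl_counit_r)
qed auto

definition tens :: "('i \<Rightarrow> 'i \<Rightarrow> lop) \<Rightarrow> ('j \<Rightarrow> 'j \<Rightarrow> lop) \<Rightarrow> 'i \<times> 'j \<Rightarrow> 'i \<times> 'j \<Rightarrow> lop" where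
  "tens v w x y = v (fst x) (fst y) * w (snd x) (snd y)"

lemma corep_tens:
  assumes v: "corep I v" and w: "corep J w"
  shows "corep (I \<times> J) (tens v w)"
  unfolding corep_def
proof (intro conjI ballI allI impI)
  show "finite (I \<times> J)" using assms by (simp add: corep_fin)
  fix x y assume "x \<in> I \<times> J" "y \<in> I \<times> J"
  then obtain i j k l where [simp]: "x = (i, k)" "y = (j, l)" and ij: "i \<in> I" "j \<in> I" and kl: "k \<in> J" "l \<in> J"
    by (cases x, cases y) auto
  note sp = corep_spn[OF v] corep_spn[OF w]
  show "tens v w x y \<in> spn" "cou (tens v w x y) = (if x = y then 1 else 0)"
    using ij kl sp by (auto simp: tens_def corep_cou[OF v] corep_cou[OF w])
  fix q assume q: "q < n"
  have "R q (tens v w x y) = (\<Sum>r<n. \<Sum>s<n. csc (mu r s q)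
      ((\<Sum>t\<in>I. csc (co r (v t j)) (v i t)) * (\<Sum>u\<in>J. csc (co s (w u l)) (w k u))))"
    using ij kl sp q by (simp add: tens_def R_mult corep_R[OF v] corep_R[OF w])
  also have "\<dots> = (\<Sum>r<n. \<Sum>s<n. \<Sum>(t,u)\<in>I\<times>J. csc (mu r s q * co r (v t j) * co s (w u l)) (v i t * w k u))"
    by (simp add: sum_product csc_sum_right sum.cartesian_product case_prod_unfold mult_ac)
  also have "\<dots> = (\<Sum>r<n. \<Sum>(t,u)\<in>I\<times>J. \<Sum>s<n. csc (mu r s q * co r (v t j) * co s (w u l)) (v i t * w k u))"
    unfolding case_prod_unfold by (intro sum.cong refl) (rule sum.swap)
  also have "\<dots> = (\<Sum>(t,u)\<in>I\<times>J. \<Sum>r<n. \<Sum>s<n. csc (mu r s q * co r (v t j) * co s (w u l)) (v i t * w k u))"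
    unfolding case_prod_unfold by (rule sum.swap)
  also have "\<dots> = (\<Sum>(t,u)\<in>I\<times>J. csc (co q (v t j * w u l)) (v i t * w k u))"
    using ij kl sp q by (intro sum.cong refl) (auto simp: co_mult csc_sum_left)
  finally show "R q (tens v w x y) = (\<Sum>t\<in>I \<times> J. csc (co q (tens v w t y)) (tens v w x t))"
    by (simp add: tens_def case_prod_unfold)
qed

definition S :: "lop \<Rightarrow> lop" where
  "S g = (\<Sum>p<n. csc (co p g) (\<Sum>l<n. csc (an p l) (b l)))"

lemma lin_S: "lin csc S"
  unfolding S_def by (intro lin_sumI lin_csc_fun lin_co)

lemmas S_add [simp] = lin_add[OF lin_S]
  and S_csc [simp] = lin_csc[OF lin_S]
  and S_zero [simp] = lin_zero[OF lin_S]
  and S_sum = lin_sum[OF lin_S]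

lemma spn_S [simp]: "S g \<in> spn"
  by (simp add: S_def spn_lincomb)

lemma S_b: "k < n \<Longrightarrow> S (b k) = (\<Sum>l<n. csc (an k l) (b l))"
  by (simp add: S_def co_b sum_delta_csc)

lemma S_R: 
  assumes "g \<in> spn"
  shows "(\<Sum>q<n. S (R q g) * b q) = csc (cou g) 1"
proof (rule spn_lin_eqI[where s = csc and F = "\<lambda>g. \<Sum>q<n. S (R q g) * b q" and F' = "\<lambda>g. csc (cou g) 1"])
  fix k assume k: "k < n"
  show "(\<Sum>q<n. S (R q (b k)) * b q) = csc (cou (b k)) 1"
  proof (rule spn_eqI)
    fix r assume r: "r < n"
    have "co r (\<Sum>q<n. S (R q (b k)) * b q) = (\<Sum>j<n. \<Sum>i<n. \<Sum>l<n. dl k i j * an i l * mu l j r)"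
      using k r by (simp add: R_b c_def S_sum S_b co_sum sum_distrib_right co_b_mult
          mult_ac sum_distrib_left)
    also have "\<dots> = ep k * ut r"
      by (subst sum.swap) (use k r in \<open>simp add: an_l\<close>)
    finally show "co r (\<Sum>q<n. S (R q (b k)) * b q) = co r (csc (cou (b k)) 1)"
      using k r by (simp add: co_one)
  qed (use k in \<open>auto intro!: spn_sum spn_mult\<close>)
qed (use assms in \<open>auto intro!: lin_sumI lin_mult_right lin_compose[OF lin_R lin_S] lin_csc_fun lin_cou\<close>)

lemma R_S: 
  assumes "g \<in> spn"
  shows "(\<Sum>q<n. R q g * S (b q)) = csc (cou g) 1"
proof (rule spn_lin_eqI[where s = csc and F = "\<lambda>g. \<Sum>q<n. R q g * S (b q)" and F' = "\<lambda>g. csc (cou g) 1"])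
  fix k assume k: "k < n"
  show "(\<Sum>q<n. R q (b k) * S (b q)) = csc (cou (b k)) 1"
  proof (rule spn_eqI)
    fix r assume r: "r < n"
    have "co r (\<Sum>q<n. R q (b k) * S (b q)) = (\<Sum>j<n. \<Sum>i<n. \<Sum>l<n. dl k i j * an j l * mu i l r)"
      using k r by (simp add: R_b c_def S_sum S_b co_sum sum_distrib_right sum_distrib_left
          co_b_mult mult_ac cong: sum.cong_simp)
         (intro sum.cong refl sum.swap)
    also have "\<dots> = ep k * ut r"
      by (subst sum.swap) (use k r in \<open>simp add: an_r\<close>)
    finally show "co r (\<Sum>q<n. R q (b k) * S (b q)) = co r (csc (cou (b k)) 1)"
      using k r by (simp add: co_one)
  qed (use k in \<open>auto intro!: spn_sum spn_mult\<close>)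
qed (use assms in \<open>auto intro!: lin_sumI lin_mult_right lin_R lin_csc_fun lin_cou\<close>)

lemma corep_S_left:
  assumes v: "corep I v" and i: "i \<in> I" and j: "j \<in> I"
  shows "(\<Sum>t\<in>I. S (v i t) * v t j) = (if i = j then 1 else 0)"
proof -
  have "(\<Sum>t\<in>I. S (v i t) * v t j) = (\<Sum>t\<in>I. S (v i t) * (\<Sum>q<n. csc (co q (v t j)) (b q)))"
    using v i j by (intro sum.cong refl) (simp add: spn_rep corep_spn)
  also have "\<dots> = (\<Sum>q<n. \<Sum>t\<in>I. csc (co q (v t j)) (S (v i t) * b q))"
    by (subst sum.swap) (simp add: sum_distrib_left)
  also have "\<dots> = (\<Sum>q<n. S (R q (v i j)) * b q)"
    using v i j by (simp add: corep_R S_sum sum_distrib_right)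
  also have "\<dots> = (if i = j then 1 else 0)"
    using v i j by (simp add: S_R corep_spn corep_cou)
  finally show ?thesis .
qed

lemma corep_S_right:
  assumes v: "corep I v" and i: "i \<in> I" and j: "j \<in> I"
  shows "(\<Sum>t\<in>I. v i t * S (v t j)) = (if i = j then 1 else 0)"
proof -
  have "(\<Sum>t\<in>I. v i t * S (v t j)) = (\<Sum>t\<in>I. v i t * S (\<Sum>q<n. csc (co q (v t j)) (b q)))"
    using v i j by (intro sum.cong refl) (simp add: spn_rep corep_spn)
  also have "\<dots> = (\<Sum>q<n. \<Sum>t\<in>I. csc (co q (v t j)) (v i t * S (b q)))"
    by (subst sum.swap) (simp add: sum_distrib_left S_sum)
  also have "\<dots> = (\<Sum>q<n. R q (v i j) * S (b q))"
    using v i j by (simp add: corep_R S_sum sum_distrib_right)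
  also have "\<dots> = (if i = j then 1 else 0)"
    using v i j by (simp add: R_S corep_spn corep_cou)
  finally show ?thesis .
qed

end

lemma matrix_inverse_unique:
  fixes l w r :: "'i \<Rightarrow> 'i \<Rightarrow> 'r::ring_1"
  assumes "finite I"
    and l: "\<And>x z. x \<in> I \<Longrightarrow> z \<in> I \<Longrightarrow> (\<Sum>t\<in>I. l x t * w t z) = (if x = z then 1 else 0)"
    and r: "\<And>x z. x \<in> I \<Longrightarrow> z \<in> I \<Longrightarrow> (\<Sum>t\<in>I. w x t * r t z) = (if x = z then 1 else 0)"
    and "x \<in> I" "y \<in> I"
  shows "l x y = r x y"
proof -
  have "l x y = (\<Sum>z\<in>I. l x z * (if z = y then 1 else 0))"
    using assms by (simp add: if_distrib cong: if_cong)
  also have "\<dots> = (\<Sum>z\<in>I. l x z * (\<Sum>u\<in>I. w z u * r u y))"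
    using assms by simp
  also have "\<dots> = (\<Sum>z\<in>I. \<Sum>u\<in>I. l x z * w z u * r u y)"
    by (simp add: sum_distrib_left mult.assoc)
  also have "\<dots> = (\<Sum>u\<in>I. (\<Sum>z\<in>I. l x z * w z u) * r u y)"
    by (subst sum.swap) (simp add: sum_distrib_right)
  also have "\<dots> = (\<Sum>u\<in>I. (if x = u then 1 else 0) * r u y)"
    using assms by simp
  also have "\<dots> = r x y"
    using assms by (simp add: if_distrib if_distribR cong: if_cong)
  finally show ?thesis .
qed

definition dual_hopf :: "hopf \<Rightarrow> hopf" where
  "dual_hopf G = \<lparr>hdim = hdim G, hmu = (\<lambda>i j k. hdelta G k i j), heta = heps G,
     hdelta = (\<lambda>k i j. hmu G i j k), heps = heta G, hant = (\<lambda>k l. hant G l k)\<rparr>"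

context fd_hopf
begin

lemma S_one [simp]: "S 1 = 1"
proof -
  have "S 1 = S 1 * (\<Sum>q<n. csc (ut q) (b q))"
    by (simp flip: one_b)
  also have "\<dots> = (\<Sum>q<n. S (R q 1) * b q)"
    by (simp add: R_one sum_distrib_left)
  also have "\<dots> = 1" by (simp add: S_R)
  finally show ?thesis .
qed

lemma cou_S [simp]: 
  assumes "g \<in> spn"
  shows "cou (S g) = cou g"
proof -
  have "cou g = cou (csc (cou g) 1)" by simp
  also have "\<dots> = (\<Sum>q<n. cou (S (csc (ep q) (R q g))))"
    using assms by (simp flip: S_R) (simp add: cou_sum mult.commute)
  also have "\<dots> = cou (S g)"
    using assms by (simp only: sum_ep_R flip: cou_sum S_sum)
  finally show ?thesis by simp
qed

lemma S_mult:
  assumes "g \<in> spn" "h \<in> spn"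
  shows "S (g * h) = S h * S g"
proof (rule bilin_eqI[where s = csc and F = "\<lambda>g h. S (g * h)" and F' = "\<lambda>g h. S h * S g"])
  fix k l assume kl: "k < n" "l < n"
  let ?I = "{..<n} \<times> {..<n}"
  have 1: "S (tens c c x y) = S (c (snd x) (snd y)) * S (c (fst x) (fst y))" if "x \<in> ?I" "y \<in> ?I" for x y
  proof (rule matrix_inverse_unique[where I = ?I and w = "tens c c" and l = "\<lambda>x y. S (tens c c x y)"
        and r = "\<lambda>x y. S (c (snd x) (snd y)) * S (c (fst x) (fst y))"])
    fix x z assume "x \<in> ?I" "z \<in> ?I"
    then show "(\<Sum>t\<in>?I. S (tens c c x t) * tens c c t z) = (if x = z then 1 else 0)"
      by (intro corep_S_left corep_tens corep_c)
    have "(\<Sum>t\<in>?I. tens c c x t * (S (c (snd t) (snd z)) * S (c (fst t) (fst z))))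
        = (\<Sum>i<n. \<Sum>j<n. c (fst x) i * (c (snd x) j * S (c j (snd z))) * S (c i (fst z)))"
      by (simp add: sum.cartesian_product tens_def mult.assoc case_prod_unfold)
    also have "\<dots> = (\<Sum>i<n. c (fst x) i * (\<Sum>j<n. c (snd x) j * S (c j (snd z))) * S (c i (fst z)))"
      by (simp add: sum_distrib_left sum_distrib_right)
    also have "\<dots> = (if x = z then 1 else 0)"
      using \<open>x \<in> ?I\<close> \<open>z \<in> ?I\<close> corep_S_right[OF corep_c]
      by (auto simp: prod_eq_iff)
    finally show "(\<Sum>t\<in>?I. tens c c x t * (S (c (snd t) (snd z)) * S (c (fst t) (fst z))))
        = (if x = z then 1 else 0)" .
  qed (use that in auto)
  have "S (b k * b l) = S ((\<Sum>j<n. csc (ep j) (c k j)) * (\<Sum>i<n. csc (ep i) (c l i)))"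
    using kl by (simp add: sum_ep_c)
  also have "\<dots> = (\<Sum>j<n. \<Sum>i<n. csc (ep j * ep i) (S (c l i) * S (c k j)))"
    using kl 1[of "(k,_)" "(l,_)"] 1
    by (auto simp: sum_product S_sum tens_def mult.commute[of "ep _" "ep _"] intro!: sum.cong)
  also have "\<dots> = (\<Sum>i<n. \<Sum>j<n. csc (ep j * ep i) (S (c l i) * S (c k j)))"
    by (rule sum.swap)
  also have "\<dots> = S (\<Sum>i<n. csc (ep i) (c l i)) * S (\<Sum>j<n. csc (ep j) (c k j))"
    by (simp add: sum_product S_sum)
  also have "\<dots> = S (b l) * S (b k)"
    using kl by (simp add: sum_ep_c)
  finally show "S (b k * b l) = S (b l) * S (b k)" .
qed (use assms in \<open>auto simp: lin_def distrib_left distrib_right\<close>)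

lemma an_mu:
  assumes "i < n" "j < n" "r < n"
  shows "(\<Sum>k<n. mu i j k * an k r) = (\<Sum>p<n. \<Sum>q<n. an j p * an i q * mu p q r)"
proof -
  have "(\<Sum>k<n. mu i j k * an k r) = co r (S (b i * b j))"
    using assms by (simp add: b_mult S_sum S_b co_sum co_b sum_delta_mult)
  also have "\<dots> = co r (S (b j) * S (b i))"
    using assms by (simp add: S_mult)
  also have "\<dots> = (\<Sum>p<n. \<Sum>q<n. an j p * an i q * mu p q r)"
    using assms by (simp add: S_b sum_product co_sum co_b_mult mult_ac)
  finally show ?thesis .
qed

lemma dual_hopf_alg: "hopf_alg (dual_hopf G)"
  unfolding hopf_alg_def Let_def dual_hopf_def hopf.simps
proof (intro conjI allI impI)
  fix i j k r assume "i < n" "j < n" "k < n" "r < n"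
  then show "(\<Sum>l<n. dl l i j * dl r l k) = (\<Sum>l<n. dl l j k * dl r i l)"
    using dl_coassoc[of r i j k] by (simp add: mult.commute)
next
  fix i k assume "i < n" "k < n"
  then show "(\<Sum>l<n. ep l * dl k l i) = (if i = k then 1 else 0)"
    and "(\<Sum>l<n. ep l * dl k i l) = (if i = k then 1 else 0)"
    using dl_counit_l[of k i] dl_counit_r[of k i] by auto
next
  fix k x y z assume "k < n" "x < n" "y < n" "z < n"
  then show "(\<Sum>l<n. mu l z k * mu x y l) = (\<Sum>l<n. mu x l k * mu y z l)"
    using mu_assoc[of x y z k] by (simp add: mult.commute)
next
  fix k j assume "k < n" "j < n"
  then show "(\<Sum>i<n. ut i * mu i j k) = (if k = j then 1 else 0)"
    and "(\<Sum>i<n. ut i * mu j i k) = (if k = j then 1 else 0)"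
    using mu_unit_l[of j k] mu_unit_r[of j k] by auto
next
  fix i j x y assume *: "i < n" "j < n" "x < n" "y < n"
  have "(\<Sum>k<n. dl k i j * mu x y k) = (\<Sum>k<n. mu x y k * dl k i j)"
    by (simp add: mult.commute)
  also have "\<dots> = (\<Sum>p<n. \<Sum>q<n. \<Sum>r<n. \<Sum>s<n. dl x p q * dl y r s * mu p r i * mu q s j)"
    using * by (simp add: dl_mu)
  also have "\<dots> = (\<Sum>p<n. \<Sum>r<n. \<Sum>q<n. \<Sum>s<n. dl x p q * dl y r s * mu p r i * mu q s j)"
    by (intro sum.cong refl sum.swap)
  also have "\<dots> = (\<Sum>p<n. \<Sum>q<n. \<Sum>r<n. \<Sum>s<n. mu p q i * mu r s j * dl x p r * dl y q s)"
    by (simp add: mult_ac)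
  finally show "(\<Sum>k<n. dl k i j * mu x y k)
    = (\<Sum>p<n. \<Sum>q<n. \<Sum>r<n. \<Sum>s<n. mu p q i * mu r s j * dl x p r * dl y q s)" .
next
  fix x y assume "x < n" "y < n"
  then show "(\<Sum>k<n. ep k * mu x y k) = ep x * ep y"
    using ep_mu[of x y] by (simp add: mult.commute)
next
  fix i j assume "i < n" "j < n"
  then show "(\<Sum>k<n. dl k i j * ut k) = ut i * ut j"
    using dl_unit[of i j] by (simp add: mult.commute)
next
  show "(\<Sum>k<n. ep k * ut k) = 1"
    using ep_unit by (simp add: mult.commute)
next
  fix k r assume *: "k < n" "r < n"
  have "(\<Sum>i<n. \<Sum>j<n. \<Sum>l<n. mu i j k * an l i * dl r l j)
      = (\<Sum>j<n. \<Sum>i<n. \<Sum>l<n. mu i j k * an l i * dl r l j)"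
    by (rule sum.swap)
  also have "\<dots> = (\<Sum>j<n. \<Sum>l<n. \<Sum>i<n. mu i j k * an l i * dl r l j)"
    by (intro sum.cong refl sum.swap)
  also have "\<dots> = (\<Sum>l<n. \<Sum>j<n. \<Sum>i<n. mu i j k * an l i * dl r l j)"
    by (rule sum.swap)
  also have "\<dots> = ut k * ep r"
    using an_l[of r k] * by (simp add: mult_ac)
  finally show "(\<Sum>i<n. \<Sum>j<n. \<Sum>l<n. mu i j k * an l i * dl r l j) = ut k * ep r" .
  have "(\<Sum>i<n. \<Sum>j<n. \<Sum>l<n. mu i j k * an l j * dl r i l)
      = (\<Sum>i<n. \<Sum>l<n. \<Sum>j<n. mu i j k * an l j * dl r i l)"
    by (intro sum.cong refl sum.swap)
  also have "\<dots> = ut k * ep r"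
    using an_r[of r k] * by (simp add: mult_ac)
  finally show "(\<Sum>i<n. \<Sum>j<n. \<Sum>l<n. mu i j k * an l j * dl r i l) = ut k * ep r" .
qed

text \<open>Antipodes reverse comultiplication because that of the dual Hopf algebra reverses multiplication.\<close>

lemma an_dl:
  assumes "i < n" "j < n" "r < n"
  shows "(\<Sum>k<n. an r k * dl k i j) = (\<Sum>p<n. \<Sum>q<n. an p j * an q i * dl r p q)"
  using fd_hopf.an_mu[OF fd_hopf.intro[OF dual_hopf_alg], of i j r] assms
  by (simp add: dual_hopf_def mult.commute)

lemma R_S_eq:
  assumes "g \<in> spn" "q < n"
  shows "R q (S g) = (\<Sum>t<n. csc (co q (S (R t g))) (S (b t)))"
proof (rule spn_lin_eqI[where s = csc and F = "\<lambda>g. R q (S g)" and F' = "\<lambda>g. \<Sum>t<n. csc (co q (S (R t g))) (S (b t))"])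
  fix k assume k: "k < n"
  show "R q (S (b k)) = (\<Sum>t<n. csc (co q (S (R t (b k)))) (S (b t)))"
  proof (rule spn_eqI)
    fix p assume p: "p < n"
    have "co p (R q (S (b k))) = (\<Sum>l<n. an k l * dl l p q)"
      using k p by (simp add: S_b R_sum R_b co_sum co_c)
    also have "\<dots> = (\<Sum>s<n. \<Sum>t<n. an s q * an t p * dl k s t)"
      using k p assms by (simp add: an_dl)
    also have "\<dots> = (\<Sum>t<n. \<Sum>s<n. an s q * an t p * dl k s t)"
      by (rule sum.swap)
    also have "\<dots> = co p (\<Sum>t<n. csc (co q (S (R t (b k)))) (S (b t)))"
      using k p assms by (simp add: co_sum R_b c_def S_sum S_b co_b
          if_distrib if_distribR sum_distrib_left mult_ac cong: if_cong)
    finally show "co p (R q (S (b k))) = co p (\<Sum>t<n. csc (co q (S (R t (b k)))) (S (b t)))" .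
  qed (use k in auto)
qed (use assms in \<open>auto intro!: lin_sumI lin_csc_fun lin_compose[OF lin_R] lin_compose[OF lin_S] lin_R lin_co\<close>)

lemma corep_transpose_S:
  assumes v: "corep I v"
  shows "corep I (\<lambda>i j. S (v j i))"
  unfolding corep_def
proof (intro conjI ballI allI impI)
  fix i j assume ij: "i \<in> I" "j \<in> I"
  then show "cou (S (v j i)) = (if i = j then 1 else 0)"
    using v by (auto simp: corep_spn corep_cou)
  fix q assume q: "q < n"
  have "R q (S (v j i)) = (\<Sum>s<n. \<Sum>t\<in>I. csc (co s (v t i) * co q (S (v j t))) (S (b s)))"
    using ij q by (simp add: R_S_eq corep_spn[OF v] corep_R[OF v] S_sum co_sum csc_sum_left)
  also have "\<dots> = (\<Sum>t\<in>I. csc (co q (S (v j t))) (S (\<Sum>s<n. csc (co s (v t i)) (b s))))"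
    by (subst sum.swap) (simp add: S_sum csc_sum_right mult.commute)
  also have "\<dots> = (\<Sum>t\<in>I. csc (co q (S (v j t))) (S (v t i)))"
    using ij by (simp add: spn_rep corep_spn[OF v])
  finally show "R q (S (v j i)) = (\<Sum>t\<in>I. csc (co q (S (v j t))) (S (v t i)))" .
qed (use v in \<open>auto simp: corep_fin\<close>)

lemma corep_SS: "corep I v \<Longrightarrow> corep I (\<lambda>i j. S (S (v i j)))"
  by (rule corep_transpose_S[OF corep_transpose_S, of I v])

lemma corep_S_mult_SS:
  assumes v: "corep I v" and i: "i \<in> I" and j: "j \<in> I"
  shows "(\<Sum>t\<in>I. S (S (v t j)) * S (v i t)) = (if i = j then 1 else 0)"
proof -
  have "(\<Sum>t\<in>I. S (S (v t j)) * S (v i t)) = S (\<Sum>t\<in>I. v i t * S (v t j))"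
    using v i j by (simp add: S_sum S_mult corep_spn)
  then show ?thesis using corep_S_right[OF v i j] by auto
qed

lemma corep_SS_mult_S:
  assumes v: "corep I v" and i: "i \<in> I" and j: "j \<in> I"
  shows "(\<Sum>t\<in>I. S (v t j) * S (S (v i t))) = (if i = j then 1 else 0)"
proof -
  have "(\<Sum>t\<in>I. S (v t j) * S (S (v i t))) = S (\<Sum>t\<in>I. S (v i t) * v t j)"
    using v i j by (simp add: S_sum S_mult corep_spn)
  then show ?thesis using corep_S_left[OF v i j] by auto
qed

definition ev :: "(nat \<Rightarrow> complex) \<Rightarrow> lop \<Rightarrow> complex" where
  "ev f g = (\<Sum>k<n. f k * co k g)"

lemma lin_ev: "lin (*) (ev f)"
  unfolding ev_def by (intro lin_fun_sumI lin_fun_scaled lin_co)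

lemmas ev_add [simp] = lin_add[OF lin_ev]
  and ev_csc [simp] = lin_csc[OF lin_ev]
  and ev_zero [simp] = lin_zero[OF lin_ev]
  and ev_sum = lin_sum[OF lin_ev]

lemma ev_b [simp]: "k < n \<Longrightarrow> ev f (b k) = f k"
  by (simp add: ev_def co_b sum_delta_mult)

text \<open>Left integrals in the dual: \<open>g\<^sub>1 f(g\<^sub>2) = f(g) 1\<close>.\<close>

definition lint :: "(nat \<Rightarrow> complex) \<Rightarrow> bool" where
  "lint f \<longleftrightarrow> (\<forall>k<n. (\<Sum>j<n. csc (f j) (c k j)) = csc (f k) 1)"

lemma lint_R:
  assumes "lint f" "g \<in> spn"
  shows "(\<Sum>q<n. csc (f q) (R q g)) = csc (ev f g) 1"
  by (rule spn_lin_eqI[where s = csc])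
    (use assms in \<open>auto intro!: lin_sumI lin_scaled lin_R lin_csc_fun lin_ev simp: R_b lint_def\<close>)

lemma lint_corep:
  assumes f: "lint f" and v: "corep I v" and i: "i \<in> I" and j: "j \<in> I"
  shows "(\<Sum>t\<in>I. csc (ev f (v t j)) (v i t)) = csc (ev f (v i j)) 1"
proof -
  have "csc (ev f (v i j)) 1 = (\<Sum>q<n. \<Sum>t\<in>I. csc (f q * co q (v t j)) (v i t))"
    using i j by (simp add: corep_spn[OF v] corep_R[OF v] csc_sum_right flip: lint_R[OF f])
  also have "\<dots> = (\<Sum>t\<in>I. csc (ev f (v t j)) (v i t))"
    by (subst sum.swap) (simp add: ev_def csc_sum_left)
  finally show ?thesis by simp
qed

lemma lint_mult_S:
  assumes f: "lint f" and v: "corep I v" and w: "w \<in> I" and y: "y \<in> I" and k: "k < n"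
  shows "(\<Sum>l<n. csc (ev f (b l * S (v w y))) (c k l)) = (\<Sum>z\<in>I. csc (ev f (b k * S (v w z))) (v z y))"
proof -
  define X where "X = tens c (\<lambda>i j. S (v j i))"
  have X: "corep ({..<n} \<times> I) X"
    unfolding X_def by (intro corep_tens corep_c corep_transpose_S v)
  have eq: "(\<Sum>l<n. \<Sum>t\<in>I. csc (ev f (b l * S (v w t))) (c k l * S (v t i))) = csc (ev f (b k * S (v w i))) 1"
    if i: "i \<in> I" for i
  proof -
    have "(\<Sum>l<n. \<Sum>t\<in>I. csc (ev f (b l * S (v w t))) (c k l * S (v t i)))
       = (\<Sum>l<n. \<Sum>t\<in>I. csc (ev f ((\<Sum>m<n. csc (ep m) (c l m)) * S (v w t))) (c k l * S (v t i)))"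
      by (simp add: sum_ep_c)
    also have "\<dots> = (\<Sum>l<n. \<Sum>t\<in>I. \<Sum>m<n. csc (ep m * ev f (X (l,t) (m,w))) (X (k,i) (l,t)))"
      by (simp add: X_def tens_def sum_distrib_right ev_sum csc_sum_left)
    also have "\<dots> = (\<Sum>(l,t)\<in>{..<n}\<times>I. \<Sum>m<n. csc (ep m * ev f (X (l,t) (m,w))) (X (k,i) (l,t)))"
      by (rule sum.cartesian_product)
    also have "\<dots> = (\<Sum>m<n. \<Sum>x\<in>{..<n}\<times>I. csc (ep m * ev f (X x (m,w))) (X (k,i) x))"
      unfolding case_prod_unfold by (subst sum.swap) simp
    also have "\<dots> = (\<Sum>m<n. csc (ep m) (\<Sum>x\<in>{..<n}\<times>I. csc (ev f (X x (m,w))) (X (k,i) x)))"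
      by (simp add: csc_sum_right)
    also have "\<dots> = (\<Sum>m<n. csc (ep m) (csc (ev f (X (k,i) (m,w))) 1))"
      using k i w by (simp add: lint_corep[OF f X])
    also have "\<dots> = csc (ev f ((\<Sum>m<n. csc (ep m) (c k m)) * S (v w i))) 1"
      by (simp add: X_def tens_def ev_sum csc_sum_left sum_distrib_right)
    finally show ?thesis using k by (simp add: sum_ep_c)
  qed
  have "(\<Sum>z\<in>I. csc (ev f (b k * S (v w z))) (v z y)) = (\<Sum>z\<in>I. csc (ev f (b k * S (v w z))) 1 * v z y)"
    by simp
  also have "\<dots> = (\<Sum>z\<in>I. \<Sum>l<n. \<Sum>t\<in>I. csc (ev f (b l * S (v w t))) (c k l * S (v t z) * v z y))"
    by (simp add: sum_distrib_right flip: eq)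
  also have "\<dots> = (\<Sum>l<n. \<Sum>z\<in>I. \<Sum>t\<in>I. csc (ev f (b l * S (v w t))) (c k l * S (v t z) * v z y))"
    by (rule sum.swap)
  also have "\<dots> = (\<Sum>l<n. \<Sum>t\<in>I. \<Sum>z\<in>I. csc (ev f (b l * S (v w t))) (c k l * S (v t z) * v z y))"
    by (intro sum.cong refl sum.swap)
  also have "\<dots> = (\<Sum>l<n. \<Sum>t\<in>I. csc (ev f (b l * S (v w t))) (c k l * (\<Sum>z\<in>I. S (v t z) * v z y)))"
    by (simp add: sum_distrib_left csc_sum_right mult.assoc)
  also have "\<dots> = (\<Sum>l<n. \<Sum>t\<in>I. (if t = y then csc (ev f (b l * S (v w t))) (c k l) else 0))"
    using y by (intro sum.cong refl) (simp add: corep_S_left[OF v])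
  also have "\<dots> = (\<Sum>l<n. csc (ev f (b l * S (v w y))) (c k l))"
    using y corep_fin[OF v] by simp
  finally show ?thesis by simp
qed

lemma lint_mult_S_b:
  assumes f: "lint f" and w: "w < n" and k: "k < n"
  shows "(\<Sum>l<n. csc (ev f (b l * S (b w))) (c k l)) = (\<Sum>z<n. csc (ev f (b k * S (c w z))) (b z))"
proof -
  have "(\<Sum>l<n. csc (ev f (b l * S (b w))) (c k l))
      = (\<Sum>l<n. csc (ev f (b l * S (\<Sum>y<n. csc (ep y) (c w y)))) (c k l))"
    using w by (simp add: sum_ep_c)
  also have "\<dots> = (\<Sum>y<n. csc (ep y) (\<Sum>l<n. csc (ev f (b l * S (c w y))) (c k l)))"
    by (simp add: S_sum sum_distrib_left ev_sum csc_sum_left csc_sum_right) (rule sum.swap)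
  also have "\<dots> = (\<Sum>y<n. \<Sum>z<n. csc (ep y) (csc (ev f (b k * S (c w z))) (c z y)))"
    using w k by (simp add: lint_mult_S[OF f corep_c] csc_sum_right)
  also have "\<dots> = (\<Sum>z<n. csc (ev f (b k * S (c w z))) (\<Sum>y<n. csc (ep y) (c z y)))"
    by (subst sum.swap) (simp add: csc_sum_right mult.commute)
  finally show ?thesis by (simp add: sum_ep_c)
qed

text \<open>Every array \<open>\<phi>\<close> gives a left integral
  \<open>g \<mapsto> Tr (h \<mapsto> g\<^sub>1 S\<^sup>2(h\<^sub>1) \<phi>(g\<^sub>2 \<otimes> h\<^sub>2))\<close>; it is the projection of the Hopf module \<open>G\<^sup>*\<close> onto its coinvariants.\<close>

lemma lint_trace:
  fixes \<phi> :: "nat \<times> nat \<Rightarrow> complex"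
  defines "Y \<equiv> tens c (\<lambda>i j. S (S (c i j)))"
  shows "lint (\<lambda>k. \<Sum>i<n. \<Sum>q\<in>{..<n}\<times>{..<n}. co i (Y (k,i) q) * \<phi> q)"
  unfolding lint_def
proof (intro allI impI)
  let ?I = "{..<n} \<times> {..<n}"
  have Y: "corep ?I Y"
    unfolding Y_def by (intro corep_tens corep_c corep_SS)
  fix k assume k: "k < n"
  let ?f = "\<lambda>i p q. co i (Y p q) * \<phi> q"
  define A where "A = (\<Sum>p\<in>?I. \<Sum>q\<in>?I. \<Sum>i<n. \<Sum>j<n. csc (?f i p q) (Y (k,j) p * S (c i j)))"
  have "A = (\<Sum>k'<n. \<Sum>i'<n. \<Sum>q\<in>?I. \<Sum>i<n. \<Sum>j<n. csc (?f i (k',i') q) (Y (k,j) (k',i') * S (c i j)))"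
    unfolding A_def by (subst sum.cartesian_product') simp
  also have "\<dots> = (\<Sum>k'<n. \<Sum>i'<n. \<Sum>q\<in>?I. \<Sum>i<n. csc (?f i (k',i') q) (c k k' * (\<Sum>j<n. S (S (c j i')) * S (c i j))))"
    by (simp add: Y_def tens_def mult.assoc sum_distrib_left csc_sum_right)
  also have "\<dots> = (\<Sum>k'<n. \<Sum>i'<n. \<Sum>q\<in>?I. \<Sum>i<n. if i = i' then csc (?f i (k',i') q) (c k k') else 0)"
    by (intro sum.cong refl) (simp add: corep_S_mult_SS[OF corep_c])
  also have "\<dots> = (\<Sum>k'<n. csc (\<Sum>i<n. \<Sum>q\<in>?I. ?f i (k',i) q) (c k k'))"
    by (simp add: csc_sum_left)
  finally have 1: "A = (\<Sum>k'<n. csc (\<Sum>i<n. \<Sum>q\<in>?I. ?f i (k',i) q) (c k k'))" .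
  have "A = (\<Sum>p\<in>?I. \<Sum>q\<in>?I. \<Sum>j<n. csc (\<phi> q) (Y (k,j) p * S (R j (Y p q))))"
    unfolding A_def R_def by (rule sum.cong[OF refl], rule sum.cong[OF refl], subst sum.swap)
      (simp add: S_sum sum_distrib_left csc_sum_right mult.commute)
  also have "\<dots> = (\<Sum>p\<in>?I. \<Sum>q\<in>?I. \<Sum>j<n. \<Sum>t\<in>?I. csc (\<phi> q * co j (Y t q)) (Y (k,j) p * S (Y p t)))"
    by (intro sum.cong refl) (simp only: corep_R[OF Y] lessThan_iff S_sum S_csc sum_distrib_left csc_sum_right csc_mult_right csc_csc)
  also have "\<dots> = (\<Sum>q\<in>?I. \<Sum>p\<in>?I. \<Sum>j<n. \<Sum>t\<in>?I. csc (\<phi> q * co j (Y t q)) (Y (k,j) p * S (Y p t)))"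
    by (rule sum.swap)
  also have "\<dots> = (\<Sum>q\<in>?I. \<Sum>j<n. \<Sum>p\<in>?I. \<Sum>t\<in>?I. csc (\<phi> q * co j (Y t q)) (Y (k,j) p * S (Y p t)))"
    by (intro sum.cong refl sum.swap)
  also have "\<dots> = (\<Sum>q\<in>?I. \<Sum>j<n. \<Sum>t\<in>?I. \<Sum>p\<in>?I. csc (\<phi> q * co j (Y t q)) (Y (k,j) p * S (Y p t)))"
    by (intro sum.cong refl sum.swap)
  also have "\<dots> = (\<Sum>q\<in>?I. \<Sum>j<n. \<Sum>t\<in>?I. csc (\<phi> q * co j (Y t q)) (\<Sum>p\<in>?I. Y (k,j) p * S (Y p t)))"
    by (simp only: csc_sum_right)
  also have "\<dots> = (\<Sum>q\<in>?I. \<Sum>j<n. \<Sum>t\<in>?I. if (k,j) = t then csc (\<phi> q * co j (Y t q)) 1 else 0)"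
    using k by (intro sum.cong refl) (simp add: corep_S_right[OF Y])
  also have "\<dots> = (\<Sum>q\<in>?I. \<Sum>j<n. csc (?f j (k,j) q) 1)"
    using k by (intro sum.cong refl) (simp only: sum.delta' finite_cartesian_product finite_lessThan, simp add: mult.commute)
  also have "\<dots> = csc (\<Sum>i<n. \<Sum>q\<in>?I. ?f i (k,i) q) 1"
    by (subst sum.swap) (simp only: csc_sum_left)
  finally show "(\<Sum>k'<n. csc (\<Sum>i<n. \<Sum>q\<in>?I. ?f i (k',i) q) (c k k')) = csc (\<Sum>i<n. \<Sum>q\<in>?I. ?f i (k,i) q) 1"
    using 1 by simp
qed

lemma lint_trace_R:
  assumes r: "r < n"
  shows "lint (\<lambda>k. \<Sum>i<n. co i (R r (b k * S (S (b i)))))"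
proof -
  define Y where "Y = tens c (\<lambda>i j. S (S (c i j)))"
  let ?I = "{..<n} \<times> {..<n}"
  have Y: "corep ?I Y"
    unfolding Y_def by (intro corep_tens corep_c corep_SS)
  define e where "e q = ep (fst q) * ep (snd q)" for q :: "nat \<times> nat"
  define y where "y p = b (fst p) * S (S (b (snd p)))" for p
  have y: "y p = (\<Sum>q\<in>?I. csc (e q) (Y p q))" if "p \<in> ?I" for p
  proof -
    have "y p = (\<Sum>l<n. csc (ep l) (c (fst p) l)) * S (S (\<Sum>j<n. csc (ep j) (c (snd p) j)))"
      using that by (auto simp: y_def sum_ep_c)
    then show ?thesis
      by (simp add: S_sum sum_product Y_def tens_def e_def sum.cartesian_product case_prod_unfold mult_ac)
  qed
  have R: "R r (y p) = (\<Sum>t\<in>?I. csc (co r (y t)) (Y p t))" if p: "p \<in> ?I" for p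
  proof -
    have "R r (y p) = (\<Sum>q\<in>?I. csc (e q) (\<Sum>t\<in>?I. csc (co r (Y t q)) (Y p t)))"
      using p r by (simp only: y R_sum R_csc) (intro sum.cong refl arg_cong[of _ _ "csc _"] corep_R[OF Y])
    also have "\<dots> = (\<Sum>t\<in>?I. csc (\<Sum>q\<in>?I. e q * co r (Y t q)) (Y p t))"
      by (simp only: csc_sum_right csc_sum_left csc_csc) (rule sum.swap)
    also have "\<dots> = (\<Sum>t\<in>?I. csc (co r (y t)) (Y p t))"
      by (intro sum.cong refl) (simp only: y co_sum co_csc)
    finally show ?thesis .
  qed
  have "(\<Sum>i<n. co i (R r (b k * S (S (b i))))) = (\<Sum>i<n. \<Sum>q\<in>?I. co i (Y (k,i) q) * co r (y q))"
    if "k < n" for k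
    using R[of "(k,_)"] that
    by (intro sum.cong refl) (simp add: y_def[of "(k,_)"] co_sum mult.commute del: y_def)
  then show ?thesis
    using lint_trace[of "\<lambda>q. co r (y q)"] unfolding lint_def Y_def by simp
qed

lemma lint_exists: "\<exists>f. lint f \<and> (\<exists>g\<in>spn. ev f g \<noteq> 0)"
proof (rule ccontr)
  assume *: "\<not> ?thesis"
  define f where "f r k = (\<Sum>i<n. co i (R r (b k * S (S (b i)))))" for r k
  have ev_f: "ev (f r) g = (\<Sum>j<n. co j (R r (g * S (S (b j)))))" if "g \<in> spn" for r g
    by (rule spn_lin_eqI[where s = "(*)" and F = "ev (f r)"])
      (use that in \<open>auto intro!: lin_fun_sumI lin_compose[OF _ lin_co] lin_compose[OF _ lin_R] lin_mult_right
        lin_ident lin_ev simp: f_def\<close>)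
  have "(\<Sum>i<n. ev (f i) (S (b i))) = (\<Sum>i<n. \<Sum>j<n. co j (R i (S (b i) * S (S (b j)))))"
    by (simp add: ev_f)
  also have "\<dots> = (\<Sum>i<n. \<Sum>j<n. \<Sum>z<n. co z (S (S (b j) * b i)) * dl z j i)"
    by (simp add: S_mult R_def co_sum co_c)
  also have "\<dots> = (\<Sum>i<n. \<Sum>z<n. \<Sum>j<n. co z (S (S (b j) * b i)) * dl z j i)"
    by (intro sum.cong refl sum.swap)
  also have "\<dots> = (\<Sum>z<n. \<Sum>i<n. \<Sum>j<n. co z (S (S (b j) * b i)) * dl z j i)"
    by (rule sum.swap)
  also have "\<dots> = (\<Sum>z<n. co z (S (\<Sum>i<n. S (R i (b z)) * b i)))"
    by (simp add: R_b c_def S_sum co_sum sum_distrib_right mult.commute)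
  also have "\<dots> = (\<Sum>z<n. ep z * ut z)"
    by (simp add: S_R co_one)
  also have "\<dots> = 1" using ep_unit by (simp add: mult.commute)
  finally obtain i where "i < n" "ev (f i) (S (b i)) \<noteq> 0"
    by (metis (no_types, lifting) lessThan_iff sum.neutral zero_neq_one)
  moreover have "lint (f i)" using lint_trace_R[OF \<open>i < n\<close>] by (simp add: f_def[abs_def])
  ultimately show False using * by (meson spn_S)
qed

lemma lint_nondegenerate:
  assumes f: "lint f" and nz: "w \<in> spn" "ev f w \<noteq> 0" and u: "u \<in> spn"
    and zero: "\<And>k. k < n \<Longrightarrow> ev f (b k * S u) = 0"
  shows "u = 0"
proof -
  have 1: "ev f (g * S (R z u)) = 0" if z: "z < n" and g: "g \<in> spn" for z g
  proof -
    have "ev f (b k * S (R z u)) = 0" if k: "k < n" for k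
    proof -
      have "(\<Sum>z<n. csc (ev f (b k * S (R z u))) (b z))
          = (\<Sum>z<n. \<Sum>w<n. csc (co w u * ev f (b k * S (c w z))) (b z))"
        by (simp add: R_def S_sum ev_sum sum_distrib_left csc_sum_left)
      also have "\<dots> = (\<Sum>w<n. csc (co w u) (\<Sum>z<n. csc (ev f (b k * S (c w z))) (b z)))"
        by (subst sum.swap) (simp add: csc_sum_right)
      also have "\<dots> = (\<Sum>w<n. csc (co w u) (\<Sum>l<n. csc (ev f (b l * S (b w))) (c k l)))"
        using k by (simp add: lint_mult_S_b[OF f])
      also have "\<dots> = (\<Sum>l<n. csc (ev f (b l * S (\<Sum>w<n. csc (co w u) (b w)))) (c k l))"
        by (simp add: S_sum sum_distrib_left ev_sum csc_sum_left csc_sum_right) (rule sum.swap)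
      also have "\<dots> = 0" using zero by (simp add: spn_rep[OF u])
      finally have "co z (\<Sum>z<n. csc (ev f (b k * S (R z u))) (b z)) = 0" by simp
      then show ?thesis using z by (simp add: co_lincomb)
    qed
    then show ?thesis
      by (subst spn_lin_expand[OF lin_compose[OF lin_mult_right[OF lin_ident] lin_ev] g]) simp
  qed
  have 2: "(\<Sum>z<n. R z u * S (c z q)) = csc (co q u) 1" if q: "q < n" for q
  proof -
    have "(\<Sum>z<n. R z u * S (c z q)) = (\<Sum>z<n. \<Sum>k<n. csc (co k u) (c k z * S (c z q)))"
      by (simp add: R_def sum_distrib_right)
    also have "\<dots> = (\<Sum>k<n. csc (co k u) (\<Sum>z<n. c k z * S (c z q)))"
      by (subst sum.swap) (simp add: csc_sum_right)
    also have "\<dots> = (\<Sum>k<n. csc (if k = q then 1 else 0) (csc (co k u) 1))"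
      using q by (intro sum.cong refl) (simp add: corep_S_right[OF corep_c])
    finally show ?thesis using q by (simp only: sum_delta_csc lessThan_iff finite_lessThan)
  qed
  have "co q u = 0" if q: "q < n" for q
  proof -
    have "0 = (\<Sum>z<n. ev f (w * S (S (c z q)) * S (R z u)))"
      using nz by (simp add: 1)
    also have "\<dots> = ev f (w * S (\<Sum>z<n. R z u * S (c z q)))"
      by (simp add: S_sum S_mult sum_distrib_left ev_sum mult.assoc)
    also have "\<dots> = co q u * ev f w"
      using q by (simp add: 2)
    finally show ?thesis using nz by simp
  qed
  then show ?thesis using u by (intro spn_eqI) auto
qed

lemma S_inj:
  assumes "u \<in> spn" "S u = 0"
  shows "u = 0"
  using lint_exists lint_nondegenerate[OF _ _ _ assms(1)] assms(2) by force

end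

section \<open>Linear algebra of function spaces\<close>

interpretation fv: vector_space "\<lambda>(c::complex) (f :: 'x \<Rightarrow> complex) x. c * f x"
  by unfold_locales (auto simp: fun_eq_iff algebra_simps)

lemma fun_sum_apply: "(\<Sum>i\<in>I. f i) x = (\<Sum>i\<in>I. (f i x :: 'b::comm_monoid_add))"
  by (induction I rule: infinite_finite_induct) auto

definition supp_on :: "'x set \<Rightarrow> ('x \<Rightarrow> complex) set" where
  "supp_on X = {f. \<forall>x. x \<notin> X \<longrightarrow> f x = 0}"

definition delta :: "'x \<Rightarrow> 'x \<Rightarrow> complex" where
  "delta a x = (if x = a then 1 else 0)"

lemma supp_on_span:
  assumes "finite X"
  shows "supp_on X \<subseteq> fv.span (delta ` X)"
proof
  fix f assume f: "f \<in> supp_on X"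
  have "f = (\<Sum>a\<in>X. (\<lambda>x. f a * delta a x))"
    using f assms by (auto simp: fun_eq_iff fun_sum_apply delta_def supp_on_def if_distrib cong: if_cong)
  also have "\<dots> \<in> fv.span (delta ` X)"
    by (intro fv.span_sum fv.span_scale fv.span_base) auto
  finally show "f \<in> fv.span (delta ` X)" .
qed

lemma supp_on_indep: "finite X \<Longrightarrow> fv.independent (delta ` X)"
proof (rule fv.independent_if_scalars_zero)
  fix f x assume X: "finite X" and 0: "(\<Sum>d\<in>delta ` X. (\<lambda>y. f d * d y)) = (0 :: 'a \<Rightarrow> complex)" and "x \<in> delta ` X"
  then obtain a where a: "a \<in> X" "x = delta a" by auto
  have inj: "inj_on delta X"
    by (rule inj_onI) (metis delta_def zero_neq_one)
  have "0 = (\<Sum>d\<in>delta ` X. (\<lambda>y. f d * d y)) a" using 0 by simp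
  also have "\<dots> = (\<Sum>d\<in>X. f (delta d) * delta d a)"
    using inj by (simp add: fun_sum_apply sum.reindex)
  also have "\<dots> = f x"
    using a X by (simp add: delta_def if_distrib cong: if_cong)
  finally show "f x = 0" by simp
qed auto

lemma subspace_supp_on: "fv.subspace (supp_on X)"
  by (auto simp: fv.subspace_def supp_on_def)

lemma fv_basis_finite:
  assumes "finite X" "V \<subseteq> supp_on X"
  obtains B where "B \<subseteq> V" "fv.independent B" "V \<subseteq> fv.span B" "finite B" "card B = fv.dim V"
proof -
  obtain B where B: "B \<subseteq> V" "fv.independent B" "V \<subseteq> fv.span B"
    using fv.maximal_independent_subset by blast
  have "B \<subseteq> fv.span (delta ` X)" using B assms supp_on_span[of X] by (meson subset_trans)
  then have "finite B"
    using fv.independent_span_bound[of "delta ` X" B] B assms(1) by blast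
  with B show ?thesis using that fv.basis_card_eq_dim by metis
qed

lemma fv_dim_mono:
  assumes "finite X" "V \<subseteq> W" "W \<subseteq> supp_on X"
  shows "fv.dim V \<le> fv.dim W"
proof -
  obtain A where A: "A \<subseteq> V" "fv.independent A" "card A = fv.dim V"
    using fv_basis_finite[OF assms(1) subset_trans[OF assms(2,3)]] by metis
  obtain B where B: "W \<subseteq> fv.span B" "finite B" "card B = fv.dim W"
    using fv_basis_finite[OF assms(1,3)] by metis
  have "A \<subseteq> fv.span B" using A B assms(2) by (meson subset_trans)
  then show ?thesis
    using fv.independent_span_bound[of B A] A B by metis
qed

lemma fv_dim_supp_on:
  assumes "finite X"
  shows "fv.dim (supp_on X) = card X"
proof -
  have "card (delta ` X) = fv.dim (supp_on X)"
    using assms by (intro fv.basis_card_eq_dim supp_on_span supp_on_indep)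
      (auto simp: supp_on_def delta_def)
  moreover have "inj_on delta X"
    by (rule inj_onI) (metis delta_def zero_neq_one)
  ultimately show ?thesis by (simp add: card_image)
qed

lemma fv_dim_le: "finite X \<Longrightarrow> V \<subseteq> supp_on X \<Longrightarrow> fv.dim V \<le> card X"
  using fv_dim_mono[of X V "supp_on X"] by (simp add: fv_dim_supp_on)

lemma fv_dim_eq:
  assumes "finite X" "V \<subseteq> W" "W \<subseteq> supp_on X" "fv.subspace V" "fv.dim W \<le> fv.dim V"
  shows "V = W"
proof (rule ccontr)
  assume "V \<noteq> W"
  then obtain w where w: "w \<in> W" "w \<notin> V" using assms by auto
  obtain A where A: "A \<subseteq> V" "fv.independent A" "card A = fv.dim V" "finite A"
    using fv_basis_finite[OF assms(1) subset_trans[OF assms(2,3)]] by metis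
  obtain B where B: "W \<subseteq> fv.span B" "finite B" "card B = fv.dim W"
    using fv_basis_finite[OF assms(1,3)] by metis
  have "w \<notin> fv.span A" using w A(1) assms(4) fv.span_minimal by blast
  then have "fv.independent (insert w A)" "w \<notin> A"
    using A(2) fv.independent_insertI fv.span_base by (metis, metis)
  moreover have "insert w A \<subseteq> fv.span B" using A B w assms by auto
  ultimately have "card (insert w A) \<le> card B"
    using fv.independent_span_bound[of B "insert w A"] B by auto
  then show False using A B \<open>w \<notin> A\<close> assms by simp
qed

definition flin :: "(('x \<Rightarrow> complex) \<Rightarrow> 'y \<Rightarrow> complex) \<Rightarrow> bool" where
  "flin f \<longleftrightarrow> (\<forall>u v. f (u + v) = f u + f v) \<and> (\<forall>c u. f (\<lambda>x. c * u x) = (\<lambda>y. c * f u y))"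

lemma flin_linear: "flin f \<Longrightarrow> Vector_Spaces.linear (\<lambda>(c::complex) f x. c * f x) (\<lambda>c f x. c * f x) f"
  unfolding Vector_Spaces.linear_iff flin_def by (simp add: fv.vector_space_axioms)

interpretation fvp: vector_space_pair "\<lambda>(c::complex) (f :: 'x \<Rightarrow> complex) x. c * f x"
  "\<lambda>(c::complex) (f :: 'y \<Rightarrow> complex) x. c * f x"
  ..

lemma rank_nullity:
  fixes f :: "('x \<Rightarrow> complex) \<Rightarrow> 'y \<Rightarrow> complex"
  assumes X: "finite X" "V \<subseteq> supp_on X" and V: "fv.subspace V"
    and Y: "finite Y" "W \<subseteq> supp_on Y" and f: "flin f" "f ` V \<subseteq> W"
  shows "fv.dim V \<le> fv.dim {v\<in>V. f v = 0} + fv.dim W"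
proof -
  note lf = flin_linear[OF f(1)]
  let ?K = "{v\<in>V. f v = 0}"
  have f0: "f 0 = 0" using fvp.linear_0[OF lf] .
  have K: "fv.subspace ?K"
    using V f0 f(1) by (auto simp: fv.subspace_def flin_def zero_fun_def)
  obtain A where A: "A \<subseteq> ?K" "fv.independent A" "?K \<subseteq> fv.span A" "card A = fv.dim ?K" "finite A"
    using fv_basis_finite[OF X(1), of ?K] subset_trans[OF _ X(2), of ?K] by (metis (no_types, lifting) mem_Collect_eq subsetI)
  obtain B where B: "A \<subseteq> B" "B \<subseteq> V" "fv.independent B" "V \<subseteq> fv.span B"
  proof -
    have "A \<subseteq> V" using A(1) by auto
    then show ?thesis using that fv.maximal_independent_subset_extend[of A V] A(2) by metis
  qed
  have "B \<subseteq> fv.span (delta ` X)" using B X(2) supp_on_span[OF X(1)] by (meson subset_trans)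
  then have "finite B"
    using fv.independent_span_bound[of "delta ` X" B] B X(1) by blast
  have inj: "inj_on f (fv.span (B - A))"
    unfolding fvp.linear_inj_on_iff_eq_0[OF lf fv.subspace_span]
  proof
    fix x assume x: "x \<in> fv.span (B - A)"
    show "f x = 0 \<longrightarrow> x = 0"
    proof
      assume "f x = 0"
      moreover have "x \<in> V"
        using x B(2) V fv.span_minimal[of "B - A" V] by blast
      ultimately have "x \<in> fv.span A" using A by auto
      then have "fv.representation B x = fv.representation A x"
        "fv.representation B x = fv.representation (B - A) x"
        using x B by (auto intro!: fv.representation_extend)
      then have "{d. fv.representation B x d \<noteq> 0} = {}"
        using fv.representation_ne_zero by (metis (mono_tags, lifting) Collect_empty_eq DiffD2)
      moreover have "(\<Sum>d | fv.representation B x d \<noteq> 0. (\<lambda>y. fv.representation B x d * d y)) = x"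
        using B \<open>x \<in> V\<close> by (intro fv.sum_nonzero_representation_eq) auto
      ultimately show "x = 0" by simp
    qed
  qed
  have "fv.independent (f ` (B - A))"
    using fvp.linear_independent_injective_image[OF lf _ inj] fv.independent_mono[OF B(3)] by auto
  moreover have "f ` (B - A) \<subseteq> W" using B(2) f(2) by blast
  moreover have "inj_on f (B - A)"
    using inj fv.span_superset inj_on_subset by blast
  moreover obtain C where C: "W \<subseteq> fv.span C" "finite C" "card C = fv.dim W"
    using fv_basis_finite[OF Y] by metis
  ultimately have "card (B - A) \<le> fv.dim W"
    using fv.independent_span_bound[of C "f ` (B - A)"] by (auto simp: card_image)
  moreover have "card B = fv.dim V" using B fv.basis_card_eq_dim by blast
  moreover have "card B = card A + card (B - A)"
    using B(1) \<open>finite B\<close> A(5) by (metis card_Diff_subset card_mono le_add_diff_inverse)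
  ultimately show ?thesis using A by simp
qed

lemma fv_dim_inj:
  assumes X: "finite X" "V \<subseteq> supp_on X" and V: "fv.subspace V"
    and Y: "finite Y" "W \<subseteq> supp_on Y" and f: "flin f" "f ` V \<subseteq> W"
    and inj: "\<And>v. v \<in> V \<Longrightarrow> f v = 0 \<Longrightarrow> v = 0"
  shows "fv.dim V \<le> fv.dim W"
proof -
  have "{v\<in>V. f v = 0} \<subseteq> fv.span {}"
  proof
    fix v assume "v \<in> {v\<in>V. f v = 0}"
    then have "v = 0" by (intro inj) simp_all
    then show "v \<in> fv.span {}" by simp
  qed
  from fv.dim_le_card[OF this finite.emptyI] have "fv.dim {v\<in>V. f v = 0} \<le> 0"
    by (simp only: card.empty)
  with rank_nullity[OF X V Y f] show ?thesis by linarith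
qed

lemma injective_matrix_left_inverse:
  fixes M :: "nat \<Rightarrow> nat \<Rightarrow> complex"
  assumes inj: "\<And>u p. (\<And>l. l < n \<Longrightarrow> (\<Sum>p<n. u p * M p l) = 0) \<Longrightarrow> p < n \<Longrightarrow> u p = 0"
  shows "\<exists>T. \<forall>l<n. \<forall>r<n. (\<Sum>p<n. T l p * M p r) = (if l = r then 1 else 0)"
proof -
  define f where "f u l = (if l < n then \<Sum>p<n. u p * M p l else 0)" for u l
  let ?V = "supp_on {..<n} :: (nat \<Rightarrow> complex) set"
  have f: "flin f"
    by (auto simp: flin_def f_def fun_eq_iff algebra_simps sum.distrib sum_distrib_left)
  have im: "fv.subspace (f ` ?V)"
    using fvp.linear_subspace_image[OF flin_linear[OF f] subspace_supp_on] .
  have imV: "f ` ?V \<subseteq> ?V" by (auto simp: supp_on_def f_def)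
  have "fv.dim ?V \<le> fv.dim (f ` ?V)"
  proof (rule fv_dim_inj[where X = "{..<n}" and Y = "{..<n}" and f = f])
    fix v assume v: "v \<in> ?V" and 0: "f v = 0"
    then have "v p = 0" if "p < n" for p
      using inj[of v p] that by (auto simp: f_def fun_eq_iff split: if_splits)
    then show "v = 0" using v by (auto simp: supp_on_def fun_eq_iff)
  qed (use f imV subspace_supp_on in auto)
  then have eq: "f ` ?V = ?V"
    using fv_dim_eq[of "{..<n}" "f ` ?V" ?V] imV im by simp
  have "\<exists>u. \<forall>r<n. (\<Sum>p<n. u p * M p r) = (if l = r then 1 else 0)" if "l < n" for l
  proof -
    have "delta l \<in> f ` ?V" using that unfolding eq by (auto simp: supp_on_def delta_def)
    then obtain u where "delta l = f u" by auto
    then have "\<forall>r<n. (\<Sum>p<n. u p * M p r) = delta l r" by (simp add: f_def)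
    then show ?thesis by (intro exI[of _ u]) (auto simp: delta_def)
  qed
  then show ?thesis by metis
qed

lemma kernel_complement:
  fixes P Q :: "nat \<Rightarrow> nat \<Rightarrow> complex"
  assumes PQ: "\<And>l k. l < m \<Longrightarrow> k < m \<Longrightarrow> (\<Sum>a<n. P l a * Q a k) = (if l = k then 1 else 0)"
  obtains r F F' where "r + m = n"
    and "\<And>s t. s < r \<Longrightarrow> t < r \<Longrightarrow> (\<Sum>a<n. F' s a * F a t) = (if s = t then 1 else 0)"
    and "\<And>a c. a < n \<Longrightarrow> c < n \<Longrightarrow> (\<Sum>s<r. F a s * F' s c) + (\<Sum>l<m. Q a l * P l c) = (if a = c then 1 else 0)"
    and "\<And>l s. l < m \<Longrightarrow> s < r \<Longrightarrow> (\<Sum>a<n. P l a * F a s) = 0"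
proof -
  define K where "K = {u \<in> supp_on {..<n}. \<forall>l<m. (\<Sum>a<n. P l a * u a) = 0}"
  obtain B where B: "B \<subseteq> K" "fv.independent B" "K \<subseteq> fv.span B" "finite B"
  proof -
    have "K \<subseteq> supp_on {..<n}" by (auto simp: K_def)
    then show ?thesis using fv_basis_finite[of "{..<n}" K] that by (metis finite_lessThan)
  qed
  define r where "r = card B"
  obtain h where h: "bij_betw h {..<r} B"
    using ex_bij_betw_nat_finite[OF B(4)] by (auto simp: r_def atLeast0LessThan)
  define w where "w c a = (if a < n then (if a = c then 1 else 0) - (\<Sum>l<m. Q a l * P l c) else 0)" for c a
  have wK: "w c \<in> K" if c: "c < n" for c
  proof -
    have "(\<Sum>a<n. P l a * w c a) = 0" if l: "l < m" for l
    proof -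
      have "(\<Sum>a<n. P l a * w c a) = (\<Sum>a<n. P l a * (if a = c then 1 else 0)) - (\<Sum>a<n. \<Sum>k<m. P l a * Q a k * P k c)"
        by (simp add: w_def algebra_simps sum_subtractf sum_distrib_left)
      also have "(\<Sum>a<n. \<Sum>k<m. P l a * Q a k * P k c) = (\<Sum>k<m. (\<Sum>a<n. P l a * Q a k) * P k c)"
        by (subst sum.swap) (simp add: sum_distrib_right)
      also have "\<dots> = P l c"
        using l by (simp add: PQ if_distrib if_distribR cong: if_cong)
      finally show ?thesis using c by (simp add: if_distrib cong: if_cong)
    qed
    then show ?thesis by (auto simp: K_def supp_on_def w_def)
  qed
  define F where "F a s = h s a" for a s
  define F' where "F' s c = fv.representation B (w c) (h s)" for s c
  have hB: "h s \<in> B" if "s < r" for s using h that by (auto simp: bij_betw_def)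
  have hK: "h s \<in> K" if "s < r" for s using hB B that by auto
  have FF': "(\<Sum>s<r. F a s * F' s c) + (\<Sum>l<m. Q a l * P l c) = (if a = c then 1 else 0)"
    if "a < n" "c < n" for a c
  proof -
    have "w c = (\<Sum>d\<in>B. (\<lambda>x. fv.representation B (w c) d * d x))"
      using B wK[OF that(2)] by (intro fv.sum_representation_eq[symmetric]) auto
    then have "w c a = (\<Sum>d\<in>B. fv.representation B (w c) d * d a)"
      by (metis (no_types, lifting) fun_sum_apply sum.cong)
    also have "\<dots> = (\<Sum>s<r. F a s * F' s c)"
      unfolding F_def F'_def by (subst sum.reindex_bij_betw[OF h, symmetric]) (simp add: mult.commute)
    finally show ?thesis using that by (auto simp: w_def algebra_simps split: if_splits)
  qed
  have PF: "(\<Sum>a<n. P l a * F a s) = 0" if "l < m" "s < r" for l s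
    using hK[OF that(2)] that by (simp add: K_def F_def)
  have F'F: "(\<Sum>a<n. F' s a * F a t) = (if s = t then 1 else 0)" if s: "s < r" and t: "t < r" for s t
  proof -
    have hw: "(\<Sum>a<n. h t a * w a x) = h t x" for x
    proof (cases "x < n")
      case True
      have "(\<Sum>a<n. h t a * w a x) = h t x - (\<Sum>a<n. \<Sum>l<m. h t a * (Q x l * P l a))"
        using True by (simp add: w_def right_diff_distrib sum_subtractf sum_distrib_left if_distrib[of "(*) _"] cong: if_cong)
      also have "(\<Sum>a<n. \<Sum>l<m. h t a * (Q x l * P l a)) = (\<Sum>l<m. Q x l * (\<Sum>a<n. P l a * h t a))"
        by (subst sum.swap) (simp add: sum_distrib_left mult_ac)
      also have "\<dots> = 0" using hK[OF t] by (simp add: K_def)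
      finally show ?thesis by simp
    qed (use hK[OF t] in \<open>auto simp: K_def supp_on_def w_def\<close>)
    have "h t = (\<Sum>a<n. (\<lambda>x. h t a * w a x))"
      by (intro ext) (simp only: hw fun_sum_apply)
    then have "fv.representation B (h t) = fv.representation B (\<Sum>a<n. (\<lambda>x. h t a * w a x))" by simp
    also have "\<dots> = (\<lambda>d. \<Sum>a<n. h t a * fv.representation B (w a) d)"
    proof -
      have w: "w a \<in> fv.span B" if "a < n" for a using wK[OF that] B by auto
      have "fv.representation B (\<Sum>a<n. (\<lambda>x. h t a * w a x))
          = (\<lambda>d. \<Sum>a<n. fv.representation B (\<lambda>x. h t a * w a x) d)"
        by (rule fv.representation_sum[OF B(2)], rule fv.span_scale, rule w) simp
      also have "\<dots> = (\<lambda>d. \<Sum>a<n. h t a * fv.representation B (w a) d)"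
        using w by (intro ext sum.cong refl) (simp add: fv.representation_scale[OF B(2)])
      finally show ?thesis .
    qed
    finally have "(\<Sum>a<n. F' s a * F a t) = fv.representation B (h t) (h s)"
      by (simp add: F_def F'_def mult.commute)
    also have "\<dots> = (if h s = h t then 1 else 0)"
      by (simp only: fv.representation_basis[OF B(2) hB[OF t]])
    also have "h s = h t \<longleftrightarrow> s = t"
      using h s t by (auto simp: bij_betw_def dest: inj_onD)
    finally show ?thesis .
  qed
  have "complex_of_nat (r + m) = (\<Sum>s<r. \<Sum>a<n. F' s a * F a s) + (\<Sum>l<m. \<Sum>a<n. P l a * Q a l)"
    by (simp add: F'F PQ)
  also have "\<dots> = (\<Sum>a<n. (\<Sum>s<r. F a s * F' s a) + (\<Sum>l<m. Q a l * P l a))"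
    by (simp add: sum.distrib mult.commute sum.swap[of _ "{..<n}"])
  also have "\<dots> = complex_of_nat n" by (simp add: FF')
  finally have "r + m = n" using of_nat_eq_iff by blast
  then show ?thesis using that[OF _ F'F FF' PF] by blast
qed

context fd_hopf
begin

lemma lincomb_zero: "(\<Sum>i<n. csc (f i) (b i)) = 0 \<Longrightarrow> i < n \<Longrightarrow> f i = 0"
  using co_lincomb[of i f] by simp

lemma an_inj:
  assumes "\<And>l. l < n \<Longrightarrow> (\<Sum>p<n. u p * an p l) = 0" "p < n"
  shows "u p = 0"
proof -
  have "S (\<Sum>p<n. csc (u p) (b p)) = 0"
  proof (rule spn_eqI)
    fix l assume "l < n"
    then show "co l (S (\<Sum>p<n. csc (u p) (b p))) = co l 0"
      using assms(1) by (simp add: S_sum S_b co_sum co_b if_distrib cong: if_cong)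
  qed auto
  then have "(\<Sum>p<n. csc (u p) (b p)) = 0"
    using S_inj spn_lincomb by blast
  then show ?thesis using assms(2) by (rule lincomb_zero)
qed

lemma santi_inv_unique:
  "\<exists>!T. (\<forall>l p. (l \<ge> n \<or> p \<ge> n) \<longrightarrow> T l p = 0) \<and>
       (\<forall>l<n. \<forall>r<n. (\<Sum>p<n. T l p * an p r) = (if l = r then 1 else 0))" (is "\<exists>!T. ?P T")
proof -
  obtain T where T: "\<forall>l<n. \<forall>r<n. (\<Sum>p<n. T l p * an p r) = (if l = r then 1 else 0)"
    using injective_matrix_left_inverse[of n an] an_inj by blast
  show ?thesis
  proof (rule ex1I)
    show "?P (\<lambda>l p. if l < n \<and> p < n then T l p else 0)"
      using T by auto
    fix T' assume T': "?P T'"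
    show "T' = (\<lambda>l p. if l < n \<and> p < n then T l p else 0)"
    proof (intro ext)
      fix l p
      show "T' l p = (if l < n \<and> p < n then T l p else 0)"
      proof (cases "l < n \<and> p < n")
        case True
        have "(\<Sum>p<n. (T' l p - T l p) * an p r) = 0" if "r < n" for r
          using T T' True that by (simp add: algebra_simps sum_subtractf)
        then show ?thesis using an_inj[of "\<lambda>p. T' l p - T l p" p] True by simp
      qed (use T' in auto)
    qed
  qed
qed

lemma santi_inv_an: "l < n \<Longrightarrow> r < n \<Longrightarrow> (\<Sum>p<n. santi_inv G l p * an p r) = (if l = r then 1 else 0)"
  using theI'[OF santi_inv_unique] unfolding santi_inv_def by blast

definition Si :: "lop \<Rightarrow> lop" where
  "Si g = (\<Sum>p<n. csc (co p g) (\<Sum>l<n. csc (santi_inv G p l) (b l)))"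

lemma lin_Si: "lin csc Si"
  unfolding Si_def by (intro lin_sumI lin_csc_fun lin_co)

lemmas Si_add [simp] = lin_add[OF lin_Si]
  and Si_csc [simp] = lin_csc[OF lin_Si]
  and Si_zero [simp] = lin_zero[OF lin_Si]
  and Si_sum = lin_sum[OF lin_Si]

lemma spn_Si [simp]: "Si g \<in> spn"
  by (simp add: Si_def spn_lincomb)

lemma Si_b: "k < n \<Longrightarrow> Si (b k) = (\<Sum>l<n. csc (santi_inv G k l) (b l))"
  by (simp add: Si_def co_b sum_delta_csc)

lemma S_Si [simp]:
  assumes "g \<in> spn"
  shows "S (Si g) = g"
proof (rule spn_lin_eqI[where s = csc and F = "\<lambda>g. S (Si g)" and F' = "\<lambda>g. g"])
  fix k assume k: "k < n"
  show "S (Si (b k)) = b k"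
  proof (rule spn_eqI)
    fix p assume "p < n"
    then show "co p (S (Si (b k))) = co p (b k)"
      using k by (simp add: Si_b S_sum S_b co_sum co_b santi_inv_an if_distrib cong: if_cong)
  qed (use k in auto)
qed (use assms in \<open>auto intro: lin_compose[OF lin_Si lin_S] lin_ident\<close>)

lemma S_eqD:
  assumes "g \<in> spn" "h \<in> spn" "S g = S h"
  shows "g = h"
proof -
  have neg: "csc (-1) x = - x" for x
    by (metis add.right_inverse add_eq_0_iff csc_add_left csc_one csc_zero_left)
  have "S (g + csc (-1) h) = 0"
    by (simp only: S_add S_csc assms(3)) (simp add: neg)
  then have "g + csc (-1) h = 0"
    by (rule S_inj[rotated]) (use assms in simp)
  then show ?thesis by (simp add: neg)
qed

lemma Si_S [simp]: "g \<in> spn \<Longrightarrow> Si (S g) = g"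
  by (rule S_eqD) auto

lemma Si_mult: "g \<in> spn \<Longrightarrow> h \<in> spn \<Longrightarrow> Si (g * h) = Si h * Si g"
  by (rule S_eqD) (auto simp: S_mult)

lemma Si_one [simp]: "Si 1 = 1"
  by (rule S_eqD) auto

lemma cou_Si [simp]: "g \<in> spn \<Longrightarrow> cou (Si g) = cou g"
  by (metis S_Si cou_S spn_Si)

lemma corep_mult_Si:
  assumes v: "corep I v" and i: "i \<in> I" and j: "j \<in> I"
  shows "(\<Sum>t\<in>I. v t j * Si (v i t)) = (if i = j then 1 else 0)"
proof -
  have "(\<Sum>t\<in>I. v t j * Si (v i t)) = Si (\<Sum>t\<in>I. v i t * S (v t j))"
    using v i j by (simp add: Si_sum Si_mult corep_spn)
  then show ?thesis using corep_S_right[OF v i j] by auto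
qed

lemma corep_Si_mult:
  assumes v: "corep I v" and i: "i \<in> I" and j: "j \<in> I"
  shows "(\<Sum>t\<in>I. Si (v t j) * v i t) = (if i = j then 1 else 0)"
proof -
  have "(\<Sum>t\<in>I. Si (v t j) * v i t) = Si (\<Sum>t\<in>I. S (v i t) * v t j)"
    using v i j by (simp add: Si_sum Si_mult corep_spn)
  then show ?thesis using corep_S_left[OF v i j] by auto
qed

lemma lint_dual_element:
  assumes f: "lint f" and nz: "w \<in> spn" "ev f w \<noteq> 0"
  obtains \<gamma> where "\<And>k. k < n \<Longrightarrow> (\<Sum>u<n. \<gamma> u * ev f (b k * S (b u))) = ep k"
proof -
  have "\<exists>T. \<forall>l<n. \<forall>r<n. (\<Sum>p<n. T l p * ev f (b r * S (b p))) = (if l = r then 1 else 0)"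
  proof (rule injective_matrix_left_inverse)
    fix u p assume 0: "\<And>l. l < n \<Longrightarrow> (\<Sum>p<n. u p * ev f (b l * S (b p))) = 0" and p: "p < n"
    have "(\<Sum>p<n. csc (u p) (b p)) = 0"
      by (rule lint_nondegenerate[OF f nz]) (simp_all add: spn_lincomb S_sum sum_distrib_left ev_sum 0)
    then show "u p = 0" using p by (rule lincomb_zero)
  qed
  then obtain T where T: "\<And>l r. l < n \<Longrightarrow> r < n \<Longrightarrow> (\<Sum>p<n. T l p * ev f (b r * S (b p))) = (if l = r then 1 else 0)"
    by blast
  show ?thesis
  proof (rule that)
    fix k assume k: "k < n"
    have "(\<Sum>u<n. (\<Sum>l<n. ep l * T l u) * ev f (b k * S (b u))) = (\<Sum>l<n. ep l * (\<Sum>u<n. T l u * ev f (b k * S (b u))))"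
      by (simp add: sum_distrib_left sum_distrib_right mult.assoc) (rule sum.swap)
    also have "\<dots> = (\<Sum>l<n. ep l * (if l = k then 1 else 0))"
      using k by (intro sum.cong refl) (simp add: T)
    also have "\<dots> = ep k" using k by (simp add: sum_delta_mult)
    finally show "(\<Sum>u<n. (\<Sum>l<n. ep l * T l u) * ev f (b k * S (b u))) = ep k" .
  qed
qed

lemma corep_reindex:
  assumes v: "corep I v" and h: "bij_betw h J I"
  shows "corep J (\<lambda>x y. v (h x) (h y))"
  unfolding corep_def
proof (intro conjI ballI allI impI)
  have hI: "h x \<in> I" if "x \<in> J" for x using h that by (auto simp: bij_betw_def)
  show "finite J" using corep_fin[OF v] h bij_betw_finite by blast
  fix i j assume ij: "i \<in> J" "j \<in> J"
  then show "v (h i) (h j) \<in> spn" using hI by (simp add: corep_spn[OF v])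
  show "cou (v (h i) (h j)) = (if i = j then 1 else 0)"
    using ij hI h by (auto simp: corep_cou[OF v] bij_betw_def inj_on_def)
  fix q assume q: "q < n"
  show "R q (v (h i) (h j)) = (\<Sum>t\<in>J. csc (co q (v (h t) (h j))) (v (h i) (h t)))"
    using ij hI q by (simp add: corep_R[OF v] sum.reindex_bij_betw[OF h, of "\<lambda>t. csc (co q (v t (h j))) (v (h i) t)"])
qed

lemma corep_sub:
  assumes v: "corep I v" and J: "finite J"
    and id: "\<And>s t. s \<in> J \<Longrightarrow> t \<in> J \<Longrightarrow> (\<Sum>a\<in>I. F' s a * F a t) = (if s = t then 1 else 0)"
    and inv: "\<And>a t. a \<in> I \<Longrightarrow> t \<in> J \<Longrightarrow>
      (\<Sum>e\<in>I. csc (F e t) (v a e)) = (\<Sum>s\<in>J. csc (F a s) (\<Sum>a\<in>I. \<Sum>e\<in>I. csc (F' s a * F e t) (v a e)))"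
  shows "corep J (\<lambda>s t. \<Sum>a\<in>I. \<Sum>e\<in>I. csc (F' s a * F e t) (v a e))"
proof -
  define w where "w s t = (\<Sum>a\<in>I. \<Sum>e\<in>I. csc (F' s a * F e t) (v a e))" for s t
  have fI: "finite I" using v by (rule corep_fin)
  have inv': "(\<Sum>e\<in>I. csc (F e t) (v a e)) = (\<Sum>s\<in>J. csc (F a s) (w s t))" if "a \<in> I" "t \<in> J" for a t
    using inv[OF that] by (simp add: w_def)
  have "corep J w"
    unfolding corep_def
  proof (intro conjI ballI allI impI)
    show "finite J" by fact
    fix s t assume st: "s \<in> J" "t \<in> J"
    show "w s t \<in> spn"
      unfolding w_def using corep_spn[OF v] by (intro spn_sum spn_csc)
    have "cou (w s t) = (\<Sum>a\<in>I. \<Sum>e\<in>I. F' s a * F e t * (if a = e then 1 else 0))"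
      unfolding w_def cou_sum co_csc by (intro sum.cong refl) (simp add: corep_cou[OF v])
    also have "\<dots> = (\<Sum>a\<in>I. F' s a * F a t)"
      using fI by (simp add: if_distrib cong: if_cong)
    finally show "cou (w s t) = (if s = t then 1 else 0)" using st id by simp
    fix q assume q: "q < n"
    have "R q (w s t) = (\<Sum>a\<in>I. \<Sum>e\<in>I. csc (F' s a * F e t) (\<Sum>d\<in>I. csc (co q (v d e)) (v a d)))"
      unfolding w_def using q by (simp only: R_sum R_csc) (intro sum.cong refl arg_cong[of _ _ "csc _"] corep_R[OF v] q)
    also have "\<dots> = (\<Sum>a\<in>I. \<Sum>d\<in>I. \<Sum>e\<in>I. csc (F' s a * F e t * co q (v d e)) (v a d))"
      by (simp only: csc_sum_right csc_csc) (rule sum.cong[OF refl], rule sum.swap)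
    also have "\<dots> = (\<Sum>a\<in>I. \<Sum>d\<in>I. csc (F' s a * co q (\<Sum>e\<in>I. csc (F e t) (v d e))) (v a d))"
      by (simp add: co_sum csc_sum_left sum_distrib_left mult_ac)
    also have "\<dots> = (\<Sum>a\<in>I. \<Sum>d\<in>I. csc (F' s a * co q (\<Sum>r\<in>J. csc (F d r) (w r t))) (v a d))"
      using st by (simp only: inv' cong: sum.cong)
    also have "\<dots> = (\<Sum>a\<in>I. \<Sum>d\<in>I. \<Sum>r\<in>J. csc (co q (w r t)) (csc (F' s a * F d r) (v a d)))"
      by (simp add: co_sum csc_sum_left sum_distrib_left mult_ac)
    also have "\<dots> = (\<Sum>a\<in>I. \<Sum>r\<in>J. \<Sum>d\<in>I. csc (co q (w r t)) (csc (F' s a * F d r) (v a d)))"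
      by (rule sum.cong[OF refl], rule sum.swap)
    also have "\<dots> = (\<Sum>r\<in>J. \<Sum>a\<in>I. \<Sum>d\<in>I. csc (co q (w r t)) (csc (F' s a * F d r) (v a d)))"
      by (rule sum.swap)
    also have "\<dots> = (\<Sum>r\<in>J. csc (co q (w r t)) (w s r))"
      by (simp only: w_def csc_sum_right)
    finally show "R q (w s t) = (\<Sum>r\<in>J. csc (co q (w r t)) (w s r))" .
  qed
  then show ?thesis unfolding w_def .
qed

end

section \<open>Comodules over a quotient Hopf algebra\<close>

locale hopf_surj = H: fd_hopf H + U: fd_hopf U for H U :: hopf +
  fixes P :: "nat \<Rightarrow> nat \<Rightarrow> complex"
  assumes hom: "hopf_hom H U P" and surj: "hom_surjective H U P"
begin

abbreviation n where "n \<equiv> hdim H"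
abbreviation m where "m \<equiv> hdim U"

definition pi :: "nat \<Rightarrow> lop" where
  "pi x = (\<Sum>l<m. csc (P x l) (U.b l))"

definition u :: "nat \<Rightarrow> nat \<Rightarrow> lop" where
  "u x y = (\<Sum>i<n. csc (hdelta H x i y) (pi i))"

definition ur :: "nat \<Rightarrow> nat \<Rightarrow> lop" where
  "ur e a = (\<Sum>l<n. csc (hdelta H a e l) (pi l))"

lemmas hom_axs = hom[unfolded hopf_hom_def Let_def]
lemmas hom_mult = hom_axs[THEN conjunct1, rule_format]
  and hom_unit = hom_axs[THEN conjunct2, THEN conjunct1, rule_format]
  and hom_comult = hom_axs[THEN conjunct2, THEN conjunct2, THEN conjunct1, rule_format]
  and hom_counit = hom_axs[THEN conjunct2, THEN conjunct2, THEN conjunct2, rule_format]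

lemma spn_pi [simp]: "pi x \<in> U.spn"
  by (simp add: pi_def U.spn_lincomb)
lemma spn_u [simp]: "u x y \<in> U.spn"
  by (simp add: u_def)
lemma spn_ur [simp]: "ur x y \<in> U.spn"
  by (simp add: ur_def)

lemma co_pi: "l < m \<Longrightarrow> U.co l (pi x) = P x l"
  by (simp add: pi_def U.co_lincomb)

lemma pi_mult:
  assumes "i < n" "j < n"
  shows "pi i * pi j = (\<Sum>k<n. csc (hmu H i j k) (pi k))"
proof (rule U.spn_eqI)
  fix l assume l: "l < m"
  have "U.co l (pi i * pi j) = (\<Sum>a<m. \<Sum>b<m. P i a * P j b * hmu U a b l)"
    using l by (simp add: U.co_mult co_pi mult_ac)
  also have "\<dots> = (\<Sum>k<n. hmu H i j k * P k l)"
    using hom_mult assms l by simp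
  finally show "U.co l (pi i * pi j) = U.co l (\<Sum>k<n. csc (hmu H i j k) (pi k))"
    using l by (simp add: U.co_sum co_pi)
qed auto

lemma pi_unit: "(\<Sum>k<n. csc (heta H k) (pi k)) = 1"
proof (rule U.spn_eqI)
  fix l assume "l < m"
  then show "U.co l (\<Sum>k<n. csc (heta H k) (pi k)) = U.co l 1"
    using hom_unit by (simp add: U.co_sum co_pi U.co_one)
qed auto

lemma cou_pi [simp]: "k < n \<Longrightarrow> U.cou (pi k) = heps H k"
  using hom_counit by (simp add: U.cou_def co_pi mult.commute)

lemma R_pi:
  assumes "k < n" "q < m"
  shows "U.R q (pi k) = (\<Sum>j<n. csc (P j q) (u k j))"
proof (rule U.spn_eqI)
  fix p assume p: "p < m"
  have "U.co p (U.R q (pi k)) = (\<Sum>l<m. P k l * hdelta U l p q)"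
    using p by (simp add: U.R_def U.co_sum co_pi U.co_c)
  also have "\<dots> = (\<Sum>i<n. \<Sum>j<n. hdelta H k i j * P i p * P j q)"
    using hom_comult assms p by simp
  also have "\<dots> = U.co p (\<Sum>j<n. csc (P j q) (u k j))"
    using p by (subst sum.swap) (simp add: u_def U.co_sum co_pi sum_distrib_left mult_ac)
  finally show "U.co p (U.R q (pi k)) = U.co p (\<Sum>j<n. csc (P j q) (u k j))" .
qed auto

lemma co_u: "l < m \<Longrightarrow> U.co l (u x y) = (\<Sum>i<n. hdelta H x i y * P i l)"
  by (simp add: u_def U.co_sum co_pi)

lemma co_ur: "l < m \<Longrightarrow> U.co l (ur x y) = (\<Sum>i<n. hdelta H y x i * P i l)"
  by (simp add: ur_def U.co_sum co_pi)

lemma dl_ur: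
  assumes "a < n" "e < n" "l < n"
  shows "(\<Sum>d<n. csc (hdelta H a d l) (ur e d)) = (\<Sum>k<n. csc (hdelta H a e k) (u k l))"
proof -
  have "(\<Sum>d<n. csc (hdelta H a d l) (ur e d)) = (\<Sum>s<n. csc (\<Sum>d<n. hdelta H a d l * hdelta H d e s) (pi s))"
    by (simp add: ur_def csc_sum_left csc_sum_right) (rule sum.swap)
  also have "\<dots> = (\<Sum>s<n. csc (\<Sum>k<n. hdelta H a e k * hdelta H k s l) (pi s))"
    using assms by (simp add: H.dl_coassoc)
  also have "\<dots> = (\<Sum>k<n. csc (hdelta H a e k) (u k l))"
    by (simp add: u_def csc_sum_left csc_sum_right) (rule sum.swap)
  finally show ?thesis .
qed

lemma dl_u:
  assumes "x < n" "i < n" "z < n"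
  shows "(\<Sum>k<n. csc (hdelta H x k z) (u k i)) = (\<Sum>t<n. csc (hdelta H t i z) (u x t))"
proof -
  have "(\<Sum>k<n. csc (hdelta H x k z) (u k i)) = (\<Sum>s<n. csc (\<Sum>k<n. hdelta H x k z * hdelta H k s i) (pi s))"
    by (simp add: u_def csc_sum_left csc_sum_right) (rule sum.swap)
  also have "\<dots> = (\<Sum>s<n. csc (\<Sum>t<n. hdelta H x s t * hdelta H t i z) (pi s))"
    using assms by (simp add: H.dl_coassoc)
  also have "\<dots> = (\<Sum>t<n. csc (hdelta H t i z) (u x t))"
    by (simp add: u_def csc_sum_left csc_sum_right mult.commute) (rule sum.swap)
  finally show ?thesis .
qed

lemma corep_u: "U.corep {..<n} u"
  unfolding U.corep_def
proof (intro conjI ballI allI impI)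
  fix x z q assume *: "x \<in> {..<n}" "z \<in> {..<n}" "q < m"
  have "U.R q (u x z) = (\<Sum>i<n. \<Sum>j<n. csc (P j q) (csc (hdelta H x i z) (u i j)))"
    using * by (subst u_def) (simp add: U.R_sum R_pi csc_sum_right mult.commute)
  also have "\<dots> = (\<Sum>j<n. csc (P j q) (\<Sum>i<n. csc (hdelta H x i z) (u i j)))"
    unfolding csc_sum_right by (rule sum.swap)
  also have "\<dots> = (\<Sum>j<n. csc (P j q) (\<Sum>t<n. csc (hdelta H t j z) (u x t)))"
    using * by (simp add: dl_u)
  also have "\<dots> = (\<Sum>t<n. csc (U.co q (u t z)) (u x t))"
    using * by (simp add: co_u csc_sum_left csc_sum_right mult.commute) (rule sum.swap)
  finally show "U.R q (u x z) = (\<Sum>t<n. csc (U.co q (u t z)) (u x t))" .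
next
  fix x z assume "x \<in> {..<n}" "z \<in> {..<n}"
  then show "U.cou (u x z) = (if x = z then 1 else 0)"
    by (simp add: u_def U.cou_sum H.dl_counit_l mult.commute)
qed auto

lemma corep_ur: "U.corep {..<n} ur"
  unfolding U.corep_def
proof (intro conjI ballI allI impI)
  fix x z q assume *: "x \<in> {..<n}" "z \<in> {..<n}" "q < m"
  have "U.R q (ur x z) = (\<Sum>k<n. \<Sum>j<n. csc (P j q) (csc (hdelta H z x k) (u k j)))"
    using * by (subst ur_def) (simp add: U.R_sum R_pi csc_sum_right mult.commute)
  also have "\<dots> = (\<Sum>j<n. csc (P j q) (\<Sum>k<n. csc (hdelta H z x k) (u k j)))"
    unfolding csc_sum_right by (rule sum.swap)
  also have "\<dots> = (\<Sum>j<n. csc (P j q) (\<Sum>t<n. csc (hdelta H z t j) (ur x t)))"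
    using * by (simp add: dl_ur)
  also have "\<dots> = (\<Sum>t<n. csc (U.co q (ur t z)) (ur x t))"
    using * by (simp add: co_ur csc_sum_left csc_sum_right mult.commute) (rule sum.swap)
  finally show "U.R q (ur x z) = (\<Sum>t<n. csc (U.co q (ur t z)) (ur x t))" .
next
  fix x z assume "x \<in> {..<n}" "z \<in> {..<n}"
  then show "U.cou (ur x z) = (if x = z then 1 else 0)"
    by (auto simp: ur_def U.cou_sum H.dl_counit_r mult.commute)
qed auto

lemma u_mult:
  assumes "k < n" "w < n" "y < n"
  shows "(\<Sum>t<n. csc (hmu H k w t) (u t y)) = (\<Sum>l<n. \<Sum>y1<n. csc (hmu H l y1 y) (u k l * u w y1))"
proof -
  have "(\<Sum>t<n. csc (hmu H k w t) (u t y)) = (\<Sum>i<n. csc (\<Sum>t<n. hmu H k w t * hdelta H t i y) (pi i))"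
    by (simp add: u_def csc_sum_left csc_sum_right) (rule sum.swap)
  also have "\<dots> = (\<Sum>i<n. \<Sum>p<n. \<Sum>q<n. \<Sum>r<n. \<Sum>s<n.
      csc (hdelta H k p q * hdelta H w r s * hmu H p r i * hmu H q s y) (pi i))"
    using assms by (simp add: H.dl_mu csc_sum_left)
  also have "\<dots> = (\<Sum>p<n. \<Sum>i<n. \<Sum>q<n. \<Sum>r<n. \<Sum>s<n.
      csc (hdelta H k p q * hdelta H w r s * hmu H p r i * hmu H q s y) (pi i))"
    by (rule sum.swap)
  also have "\<dots> = (\<Sum>p<n. \<Sum>q<n. \<Sum>i<n. \<Sum>r<n. \<Sum>s<n.
      csc (hdelta H k p q * hdelta H w r s * hmu H p r i * hmu H q s y) (pi i))"
    by (intro sum.cong refl sum.swap)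
  also have "\<dots> = (\<Sum>p<n. \<Sum>q<n. \<Sum>r<n. \<Sum>i<n. \<Sum>s<n.
      csc (hdelta H k p q * hdelta H w r s * hmu H p r i * hmu H q s y) (pi i))"
    by (intro sum.cong refl sum.swap)
  also have "\<dots> = (\<Sum>p<n. \<Sum>q<n. \<Sum>r<n. \<Sum>s<n. \<Sum>i<n.
      csc (hdelta H k p q * hdelta H w r s * hmu H p r i * hmu H q s y) (pi i))"
    by (intro sum.cong refl sum.swap)
  also have "\<dots> = (\<Sum>p<n. \<Sum>q<n. \<Sum>r<n. \<Sum>s<n. csc (hdelta H k p q * hdelta H w r s * hmu H q s y) (pi p * pi r))"
    by (intro sum.cong refl) (simp add: pi_mult csc_sum_right mult_ac)
  also have "\<dots> = (\<Sum>p<n. \<Sum>q<n. \<Sum>s<n. \<Sum>r<n. csc (hdelta H k p q * hdelta H w r s * hmu H q s y) (pi p * pi r))"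
    by (intro sum.cong refl sum.swap)
  also have "\<dots> = (\<Sum>q<n. \<Sum>p<n. \<Sum>s<n. \<Sum>r<n. csc (hdelta H k p q * hdelta H w r s * hmu H q s y) (pi p * pi r))"
    by (rule sum.swap)
  also have "\<dots> = (\<Sum>q<n. \<Sum>s<n. \<Sum>p<n. \<Sum>r<n. csc (hdelta H k p q * hdelta H w r s * hmu H q s y) (pi p * pi r))"
    by (intro sum.cong refl sum.swap)
  also have "\<dots> = (\<Sum>l<n. \<Sum>y1<n. csc (hmu H l y1 y) (u k l * u w y1))"
    by (simp add: u_def sum_product csc_sum_right mult_ac)
  finally show ?thesis .
qed

lemma u_unit: "y < n \<Longrightarrow> (\<Sum>k<n. csc (heta H k) (u k y)) = csc (heta H y) 1"
proof -
  assume y: "y < n"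
  have "(\<Sum>k<n. csc (heta H k) (u k y)) = (\<Sum>i<n. csc (\<Sum>k<n. heta H k * hdelta H k i y) (pi i))"
    by (simp add: u_def csc_sum_left csc_sum_right) (rule sum.swap)
  also have "\<dots> = csc (heta H y) (\<Sum>i<n. csc (heta H i) (pi i))"
    using y by (simp add: H.dl_unit csc_sum_right mult.commute)
  finally show ?thesis by (simp add: pi_unit)
qed

lemma ep_ur: "k < n \<Longrightarrow> (\<Sum>j<n. csc (heps H j) (ur j k)) = pi k"
proof -
  assume k: "k < n"
  have "(\<Sum>j<n. csc (heps H j) (ur j k)) = (\<Sum>i<n. csc (\<Sum>j<n. heps H j * hdelta H k j i) (pi i))"
    by (simp add: ur_def csc_sum_left csc_sum_right) (rule sum.swap)
  also have "\<dots> = pi k" using k by (simp add: H.dl_counit_l H.sum_delta_csc)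
  finally show ?thesis .
qed

lemma u_P:
  assumes "k < n" "q < m"
  shows "(\<Sum>j<n. csc (P j q) (u k j)) = (\<Sum>l<m. csc (P k l) (U.c l q))"
proof -
  have "(\<Sum>j<n. csc (P j q) (u k j)) = U.R q (pi k)" using assms by (simp add: R_pi)
  also have "\<dots> = (\<Sum>l<m. csc (P k l) (U.c l q))" by (simp add: pi_def U.R_sum U.R_b)
  finally show ?thesis .
qed

lemma ur_P:
  assumes "a < n" "q < m"
  shows "(\<Sum>d<n. csc (P d q) (ur d a)) = (\<Sum>k<m. csc (P a k) (U.ct q k))"
proof (rule U.spn_eqI)
  fix p assume p: "p < m"
  have "U.co p (\<Sum>d<n. csc (P d q) (ur d a)) = (\<Sum>d<n. \<Sum>i<n. hdelta H a d i * P d q * P i p)"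
    using p by (simp add: U.co_sum co_ur sum_distrib_left mult_ac)
  also have "\<dots> = (\<Sum>l<m. P a l * hdelta U l q p)"
    using hom_comult assms p by simp
  finally show "U.co p (\<Sum>d<n. csc (P d q) (ur d a)) = U.co p (\<Sum>k<m. csc (P a k) (U.ct q k))"
    using p by (simp add: U.co_sum U.co_ct)
qed (auto intro!: U.spn_sum)

end

lemma sum_rot4: "(\<Sum>a\<in>A. \<Sum>b\<in>B. \<Sum>c\<in>C. \<Sum>d\<in>D. f a b c d) = (\<Sum>c\<in>C. \<Sum>d\<in>D. \<Sum>a\<in>A. \<Sum>b\<in>B. f a b c d)"
proof -
  have "(\<Sum>a\<in>A. \<Sum>b\<in>B. \<Sum>c\<in>C. \<Sum>d\<in>D. f a b c d) = (\<Sum>a\<in>A. \<Sum>c\<in>C. \<Sum>b\<in>B. \<Sum>d\<in>D. f a b c d)"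
    by (intro sum.cong refl sum.swap)
  also have "\<dots> = (\<Sum>c\<in>C. \<Sum>a\<in>A. \<Sum>b\<in>B. \<Sum>d\<in>D. f a b c d)"
    by (rule sum.swap)
  also have "\<dots> = (\<Sum>c\<in>C. \<Sum>a\<in>A. \<Sum>d\<in>D. \<Sum>b\<in>B. f a b c d)"
    by (intro sum.cong refl sum.swap)
  also have "\<dots> = (\<Sum>c\<in>C. \<Sum>d\<in>D. \<Sum>a\<in>A. \<Sum>b\<in>B. f a b c d)"
    by (intro sum.cong refl sum.swap)
  finally show ?thesis .
qed

lemma sum_rot5: "(\<Sum>a\<in>A. \<Sum>b\<in>B. \<Sum>c\<in>C. \<Sum>d\<in>D. \<Sum>e\<in>E. f a b c d e) = (\<Sum>c\<in>C. \<Sum>d\<in>D. \<Sum>e\<in>E. \<Sum>a\<in>A. \<Sum>b\<in>B. f a b c d e)"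
proof -
  have "(\<Sum>a\<in>A. \<Sum>b\<in>B. \<Sum>c\<in>C. \<Sum>d\<in>D. \<Sum>e\<in>E. f a b c d e) = (\<Sum>c\<in>C. \<Sum>d\<in>D. \<Sum>a\<in>A. \<Sum>b\<in>B. \<Sum>e\<in>E. f a b c d e)"
    by (rule sum_rot4)
  also have "\<dots> = (\<Sum>c\<in>C. \<Sum>d\<in>D. \<Sum>a\<in>A. \<Sum>e\<in>E. \<Sum>b\<in>B. f a b c d e)"
    by (intro sum.cong refl sum.swap)
  also have "\<dots> = (\<Sum>c\<in>C. \<Sum>d\<in>D. \<Sum>e\<in>E. \<Sum>a\<in>A. \<Sum>b\<in>B. f a b c d e)"
    by (intro sum.cong refl sum.swap)
  finally show ?thesis .
qed

definition cons_set :: "nat \<Rightarrow> nat list set \<Rightarrow> nat list set" where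
  "cons_set k I = (\<lambda>(a, i). a # i) ` ({..<k} \<times> I)"

lemma inj_cons_pair: "inj_on (\<lambda>(a, i). a # i) X"
  by (auto simp: inj_on_def)

lemma cons_mem [simp]: "a # i \<in> cons_set k I \<longleftrightarrow> a < k \<and> i \<in> I"
  by (auto simp: cons_set_def)

lemma finite_cons_set [simp]: "finite I \<Longrightarrow> finite (cons_set k I)"
  by (simp add: cons_set_def)

lemma card_cons_set: "card (cons_set k I) = k * card I"
  by (simp add: cons_set_def card_image[OF inj_cons_pair] card_cartesian_product)

lemma cons_setE:
  assumes "x \<in> cons_set k I"
  obtains a i where "x = a # i" "a < k" "i \<in> I"
  using assms by (auto simp: cons_set_def)

lemma sum_cons_set: "(\<Sum>x\<in>cons_set k I. f x) = (\<Sum>a<k. \<Sum>i\<in>I. f (a # i))"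
  unfolding cons_set_def
  by (subst sum.reindex[OF inj_cons_pair]) (simp add: sum.cartesian_product case_prod_unfold)

text \<open>The \<open>k\<close>-fold power of a function space, with the copies indexed by an added head.\<close>

definition power_space :: "nat \<Rightarrow> nat list set \<Rightarrow> 'y set \<Rightarrow> (nat list \<times> 'y \<Rightarrow> complex) set \<Rightarrow> (nat list \<times> 'y \<Rightarrow> complex) set" where
  "power_space k I Y V = {Z \<in> supp_on (cons_set k I \<times> Y). \<forall>a<k. (\<lambda>(i, y). Z (a # i, y)) \<in> V}"

lemma subspace_power_space:
  assumes "fv.subspace V"
  shows "fv.subspace (power_space k I Y V)"
proof -
  have "(\<lambda>(i, y). 0) = (0 :: nat list \<times> 'a \<Rightarrow> complex)" by (auto simp: fun_eq_iff)
  moreover have "(\<lambda>(i, y). Z (a # i, y) + Z' (a # i, y)) = (\<lambda>(i, y). Z (a # i, y)) + (\<lambda>(i, y). Z' (a # i, y))"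
    for Z Z' :: "nat list \<times> 'a \<Rightarrow> complex" and a by (auto simp: fun_eq_iff)
  moreover have "(\<lambda>(i, y). c * Z (a # i, y)) = (\<lambda>x. c * (\<lambda>(i, y). Z (a # i, y)) x)"
    for c and Z :: "nat list \<times> 'a \<Rightarrow> complex" and a by (auto simp: fun_eq_iff)
  ultimately show ?thesis
    using assms subspace_supp_on[of "cons_set k I \<times> Y"]
    by (auto simp: fv.subspace_def power_space_def)
qed

lemma dim_power_space:
  assumes fin: "finite I" "finite Y" and V: "V \<subseteq> supp_on (I \<times> Y)" "fv.subspace V"
  shows "k * fv.dim V \<le> fv.dim (power_space k I Y V)"
proof -
  obtain B where B: "B \<subseteq> V" "fv.independent B" "V \<subseteq> fv.span B" "finite B" "card B = fv.dim V"
    using fv_basis_finite[OF _ V(1)] fin by (metis finite_cartesian_product)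
  define g where "g x = (\<lambda>(l, y). if l \<noteq> [] \<and> hd l = fst x then snd x (tl l, y) else 0)"
    for x :: "nat \<times> (nat list \<times> 'a \<Rightarrow> complex)"
  have g: "(\<lambda>(i, y). g (a, \<beta>) (a' # i, y)) = (if a' = a then \<beta> else 0)" for a a' \<beta>
    by (auto simp: g_def fun_eq_iff)
  have g': "g (a, \<beta>) (a' # i, y) = (if a' = a then \<beta> (i, y) else 0)" for a a' \<beta> i y
    by (auto simp: g_def)
  have inj: "inj_on g ({..<k} \<times> B)"
  proof (rule inj_onI, clarsimp)
    fix a \<beta> a' \<beta>' assume *: "g (a, \<beta>) = g (a', \<beta>')" "\<beta> \<in> B" "\<beta>' \<in> B"
    have "(\<lambda>(i, y). g (a, \<beta>) (a # i, y)) = (\<lambda>(i, y). g (a', \<beta>') (a # i, y))"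
      using * by simp
    then have "(if a = a then \<beta> else 0) = (if a = a' then \<beta>' else 0)"
      unfolding g .
    moreover have "\<beta> \<noteq> 0" using * B fv.dependent_zero by blast
    ultimately show "a = a' \<and> \<beta> = \<beta>'" by (auto split: if_splits)
  qed
  have sub: "g ` ({..<k} \<times> B) \<subseteq> power_space k I Y V"
  proof (rule image_subsetI)
    fix p assume "p \<in> {..<k} \<times> B"
    then obtain a \<beta> where p: "p = (a, \<beta>)" and a: "a < k" and "\<beta> \<in> B" by auto
    then have \<beta>: "\<beta> \<in> V" using B by auto
    have "g (a, \<beta>) x = 0" if "x \<notin> cons_set k I \<times> Y" for x
    proof (cases x)
      case (Pair l y)
      then show ?thesis
        using that a \<beta> V(1) by (cases l) (auto simp: g_def supp_on_def subset_iff)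
    qed
    then show "g p \<in> power_space k I Y V"
      using \<beta> fv.subspace_0[OF V(2)] by (auto simp: power_space_def supp_on_def g p)
  qed
  have indep: "fv.independent (g ` ({..<k} \<times> B))"
  proof (rule fv.independent_if_scalars_zero)
    fix f x assume 0: "(\<Sum>d\<in>g ` ({..<k} \<times> B). (\<lambda>y. f d * d y)) = 0" and "x \<in> g ` ({..<k} \<times> B)"
    then obtain a \<beta> where a: "a < k" "\<beta> \<in> B" "x = g (a, \<beta>)" by auto
    have "(\<Sum>\<beta>\<in>B. (\<lambda>y. f (g (a, \<beta>)) * \<beta> y)) = 0"
    proof
      fix z show "(\<Sum>\<beta>\<in>B. (\<lambda>y. f (g (a, \<beta>)) * \<beta> y)) z = 0 z"
      proof (cases z)
        case (Pair i y)
        have "0 = (\<Sum>d\<in>g ` ({..<k} \<times> B). (\<lambda>y. f d * d y)) (a # i, y)" using 0 by simp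
        also have "\<dots> = (\<Sum>a'<k. \<Sum>\<beta>\<in>B. f (g (a', \<beta>)) * g (a', \<beta>) (a # i, y))"
          by (simp add: fun_sum_apply sum.reindex[OF inj] sum.cartesian_product case_prod_unfold)
        also have "\<dots> = (\<Sum>a'<k. if a = a' then (\<Sum>\<beta>\<in>B. f (g (a', \<beta>)) * \<beta> (i, y)) else 0)"
          by (intro sum.cong refl) (simp add: g')
        also have "\<dots> = (\<Sum>\<beta>\<in>B. f (g (a, \<beta>)) * \<beta> (i, y))" using a by simp
        finally show ?thesis by (simp add: fun_sum_apply Pair)
      qed
    qed
    from fv.independentD[OF B(2) B(4) subset_refl this a(2)] show "f x = 0" by (simp add: a)
  qed (use B in auto)
  have "finite (cons_set k I \<times> Y)" "power_space k I Y V \<subseteq> supp_on (cons_set k I \<times> Y)"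
    using fin by (auto simp: power_space_def)
  then obtain C where C: "power_space k I Y V \<subseteq> fv.span C" "finite C" "card C = fv.dim (power_space k I Y V)"
    using fv_basis_finite by metis
  have "card (g ` ({..<k} \<times> B)) \<le> card C"
    using fv.independent_span_bound[OF C(2) indep] sub C(1) by (meson subset_trans)
  then show ?thesis
    using B C by (simp add: card_image[OF inj] card_cartesian_product)
qed

context fd_hopf
begin

definition cons_tens :: "(nat \<Rightarrow> nat \<Rightarrow> lop) \<Rightarrow> (nat list \<Rightarrow> nat list \<Rightarrow> lop) \<Rightarrow> nat list \<Rightarrow> nat list \<Rightarrow> lop" where
  "cons_tens w v x y = w (hd x) (hd y) * v (tl x) (tl y)"

lemma corep_cons_tens:
  assumes "corep {..<k} w" "corep I v"
  shows "corep (cons_set k I) (cons_tens w v)"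
proof -
  have "bij_betw (\<lambda>x. (hd x, tl x)) (cons_set k I) ({..<k} \<times> I)"
    by (rule bij_betwI[where g = "\<lambda>(a, i). a # i"]) (auto elim: cons_setE)
  from corep_reindex[OF corep_tens[OF assms] this]
  show ?thesis by (simp add: tens_def cons_tens_def[abs_def])
qed

end

context hopf_surj
begin

text \<open>\<open>Itw I v\<close> is the cotensor product of the right comodule with matrix \<open>v\<close> with \<open>H\<close>:
  the scalar matrices \<open>z\<close> with \<open>v z = z u\<close>.\<close>

definition Itw :: "nat list set \<Rightarrow> (nat list \<Rightarrow> nat list \<Rightarrow> lop) \<Rightarrow> (nat list \<times> nat \<Rightarrow> complex) set" where
  "Itw I v = {z \<in> supp_on (I \<times> {..<n}). \<forall>j\<in>I. \<forall>y<n.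
     (\<Sum>i\<in>I. csc (z (i, y)) (v j i)) = (\<Sum>w<n. csc (z (j, w)) (u w y))}"

lemma Itw_supp: "Itw I v \<subseteq> supp_on (I \<times> {..<n})"
  by (auto simp: Itw_def)

lemma subspace_Itw: "fv.subspace (Itw I v)"
  using subspace_supp_on[of "I \<times> {..<n}"]
  by (auto simp: fv.subspace_def Itw_def csc_add_left sum.distrib simp flip: csc_csc csc_sum_right)

definition phi :: "(nat list \<times> nat \<Rightarrow> complex) \<Rightarrow> nat \<Rightarrow> nat list \<Rightarrow> nat \<Rightarrow> complex" where
  "phi Z d i y = (\<Sum>a<n. \<Sum>l<n. \<Sum>w<n. hdelta H a d l * Z (a # i, w) * hmu H l w y)"

lemma phi_equivariant:
  assumes Z: "Z \<in> power_space n I {..<n} (Itw I v)" and e: "e < n" and j: "j \<in> I" and y: "y < n"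
  shows "(\<Sum>d<n. \<Sum>i\<in>I. csc (phi Z d i y) (ur e d * v j i)) = (\<Sum>t<n. csc (phi Z e j t) (u t y))"
proof -
  have Zi: "(\<Sum>i\<in>I. csc (Z (a # i, w)) (v j i)) = (\<Sum>s<n. csc (Z (a # j, s)) (u s w))" if "a < n" "w < n" for a w
    using Z that j by (auto simp: power_space_def Itw_def)
  have "(\<Sum>d<n. \<Sum>i\<in>I. csc (phi Z d i y) (ur e d * v j i))
      = (\<Sum>d<n. \<Sum>i\<in>I. \<Sum>a<n. \<Sum>l<n. \<Sum>w<n. csc (hdelta H a d l * Z (a # i, w) * hmu H l w y) (ur e d * v j i))"
    by (simp add: phi_def csc_sum_left)
  also have "\<dots> = (\<Sum>a<n. \<Sum>l<n. \<Sum>w<n. \<Sum>d<n. \<Sum>i\<in>I. csc (hdelta H a d l * Z (a # i, w) * hmu H l w y) (ur e d * v j i))"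
    by (rule sum_rot5)
  also have "\<dots> = (\<Sum>a<n. \<Sum>l<n. \<Sum>w<n. csc (hmu H l w y)
      ((\<Sum>d<n. csc (hdelta H a d l) (ur e d)) * (\<Sum>i\<in>I. csc (Z (a # i, w)) (v j i))))"
    by (simp add: sum_product csc_sum_right mult_ac)
  also have "\<dots> = (\<Sum>a<n. \<Sum>l<n. \<Sum>w<n. csc (hmu H l w y)
      ((\<Sum>k<n. csc (hdelta H a e k) (u k l)) * (\<Sum>s<n. csc (Z (a # j, s)) (u s w))))"
    using e by (simp add: dl_ur Zi)
  also have "\<dots> = (\<Sum>a<n. \<Sum>l<n. \<Sum>w<n. \<Sum>k<n. \<Sum>s<n. csc (hdelta H a e k * Z (a # j, s)) (csc (hmu H l w y) (u k l * u s w)))"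
    by (simp add: sum_product csc_sum_right mult_ac)
  also have "\<dots> = (\<Sum>a<n. \<Sum>k<n. \<Sum>s<n. \<Sum>l<n. \<Sum>w<n. csc (hdelta H a e k * Z (a # j, s)) (csc (hmu H l w y) (u k l * u s w)))"
    by (rule sum.cong[OF refl]) (rule sum_rot4)
  also have "\<dots> = (\<Sum>a<n. \<Sum>k<n. \<Sum>s<n. csc (hdelta H a e k * Z (a # j, s)) (\<Sum>t<n. csc (hmu H k s t) (u t y)))"
    using y by (simp add: u_mult csc_sum_right)
  also have "\<dots> = (\<Sum>a<n. \<Sum>k<n. \<Sum>s<n. \<Sum>t<n. csc (hdelta H a e k * Z (a # j, s) * hmu H k s t) (u t y))"
    by (simp add: csc_sum_right mult_ac)
  also have "\<dots> = (\<Sum>a<n. \<Sum>k<n. \<Sum>t<n. \<Sum>s<n. csc (hdelta H a e k * Z (a # j, s) * hmu H k s t) (u t y))"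
    by (intro sum.cong refl sum.swap)
  also have "\<dots> = (\<Sum>a<n. \<Sum>t<n. \<Sum>k<n. \<Sum>s<n. csc (hdelta H a e k * Z (a # j, s) * hmu H k s t) (u t y))"
    by (intro sum.cong refl sum.swap)
  also have "\<dots> = (\<Sum>t<n. \<Sum>a<n. \<Sum>k<n. \<Sum>s<n. csc (hdelta H a e k * Z (a # j, s) * hmu H k s t) (u t y))"
    by (rule sum.swap)
  also have "\<dots> = (\<Sum>t<n. csc (phi Z e j t) (u t y))"
    by (simp add: phi_def csc_sum_left)
  finally show ?thesis .
qed

lemma ep_phi: "(\<Sum>d<n. heps H d * phi Z d i y) = (\<Sum>a<n. \<Sum>w<n. Z (a # i, w) * hmu H a w y)"
proof -
  have "(\<Sum>d<n. heps H d * phi Z d i y) = (\<Sum>d<n. \<Sum>a<n. \<Sum>l<n. \<Sum>w<n. heps H d * hdelta H a d l * (Z (a # i, w) * hmu H l w y))"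
    by (simp add: phi_def sum_distrib_left mult_ac)
  also have "\<dots> = (\<Sum>a<n. \<Sum>d<n. \<Sum>l<n. \<Sum>w<n. heps H d * hdelta H a d l * (Z (a # i, w) * hmu H l w y))"
    by (rule sum.swap)
  also have "\<dots> = (\<Sum>a<n. \<Sum>l<n. \<Sum>d<n. \<Sum>w<n. heps H d * hdelta H a d l * (Z (a # i, w) * hmu H l w y))"
    by (intro sum.cong refl sum.swap)
  also have "\<dots> = (\<Sum>a<n. \<Sum>l<n. (\<Sum>d<n. heps H d * hdelta H a d l) * (\<Sum>w<n. Z (a # i, w) * hmu H l w y))"
    by (simp add: sum_product)
  also have "\<dots> = (\<Sum>a<n. \<Sum>l<n. (if a = l then 1 else 0) * (\<Sum>w<n. Z (a # i, w) * hmu H l w y))"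
    by (intro sum.cong refl) (simp add: H.dl_counit_l)
  also have "\<dots> = (\<Sum>a<n. \<Sum>w<n. Z (a # i, w) * hmu H a w y)"
    by (simp add: H.sum_delta_mult)
  finally show ?thesis .
qed

lemma phi_counit_zero:
  assumes Z: "Z \<in> power_space n I {..<n} (Itw I v)" and v: "U.corep I v"
    and 0: "\<And>i y. i \<in> I \<Longrightarrow> y < n \<Longrightarrow> (\<Sum>d<n. heps H d * phi Z d i y) = 0"
    and t: "t \<in> I" and y: "y < n" and l: "l < m"
  shows "(\<Sum>d<n. P d l * phi Z d t y) = 0"
proof -
  define g where "g i = (\<Sum>d<n. csc (phi Z d i y) (pi d))" for i
  have gv: "(\<Sum>i\<in>I. g i * v j i) = 0" if j: "j \<in> I" for j
  proof -
    have "(\<Sum>i\<in>I. g i * v j i) = (\<Sum>i\<in>I. \<Sum>d<n. \<Sum>e<n. csc (heps H e * phi Z d i y) (ur e d * v j i))"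
      by (simp add: g_def sum_distrib_right csc_sum_right mult.commute flip: ep_ur)
    also have "\<dots> = (\<Sum>i\<in>I. \<Sum>e<n. \<Sum>d<n. csc (heps H e * phi Z d i y) (ur e d * v j i))"
      by (intro sum.cong refl sum.swap)
    also have "\<dots> = (\<Sum>e<n. \<Sum>i\<in>I. \<Sum>d<n. csc (heps H e * phi Z d i y) (ur e d * v j i))"
      by (rule sum.swap)
    also have "\<dots> = (\<Sum>e<n. \<Sum>d<n. \<Sum>i\<in>I. csc (heps H e * phi Z d i y) (ur e d * v j i))"
      by (intro sum.cong refl sum.swap)
    also have "\<dots> = (\<Sum>e<n. csc (heps H e) (\<Sum>t<n. csc (phi Z e j t) (u t y)))"
      using j y by (simp add: csc_sum_right flip: phi_equivariant[OF Z])
    also have "\<dots> = (\<Sum>t<n. csc (\<Sum>e<n. heps H e * phi Z e j t) (u t y))"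
      by (simp add: csc_sum_left csc_sum_right) (rule sum.swap)
    also have "\<dots> = 0" using j by (simp add: 0)
    finally show ?thesis .
  qed
  have "0 = (\<Sum>j\<in>I. \<Sum>i\<in>I. g i * v j i * U.Si (v t j))"
    using gv by (simp flip: sum_distrib_right)
  also have "\<dots> = (\<Sum>i\<in>I. g i * (\<Sum>j\<in>I. v j i * U.Si (v t j)))"
    by (subst sum.swap) (simp add: sum_distrib_left mult.assoc)
  also have "\<dots> = (\<Sum>i\<in>I. g i * (if t = i then 1 else 0))"
    using t by (intro sum.cong refl) (simp add: U.corep_mult_Si[OF v])
  also have "\<dots> = g t"
    using t U.corep_fin[OF v] by (simp add: if_distrib cong: if_cong)
  finally have "U.co l (g t) = 0" by simp
  then show ?thesis using l by (simp add: g_def U.co_sum co_pi mult.commute)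
qed

lemma phi_inj:
  assumes 0: "\<And>d y. d < n \<Longrightarrow> y < n \<Longrightarrow> phi Z d i y = 0" and a: "a < n" and w: "w < n"
  shows "Z (a # i, w) = 0"
proof -
  have z: "(\<Sum>a<n. \<Sum>w<n. csc (Z (a # i, w)) (H.ct d a * H.b w)) = 0" if d: "d < n" for d
  proof -
    have "(\<Sum>a<n. \<Sum>w<n. csc (Z (a # i, w)) (H.ct d a * H.b w))
      = (\<Sum>a<n. \<Sum>w<n. \<Sum>l<n. \<Sum>y<n. csc (hdelta H a d l * Z (a # i, w) * hmu H l w y) (H.b y))"
      by (simp add: H.ct_def sum_distrib_right H.b_mult csc_sum_right mult_ac)
    also have "\<dots> = (\<Sum>a<n. \<Sum>l<n. \<Sum>w<n. \<Sum>y<n. csc (hdelta H a d l * Z (a # i, w) * hmu H l w y) (H.b y))"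
      by (intro sum.cong refl sum.swap)
    also have "\<dots> = (\<Sum>a<n. \<Sum>l<n. \<Sum>y<n. \<Sum>w<n. csc (hdelta H a d l * Z (a # i, w) * hmu H l w y) (H.b y))"
      by (intro sum.cong refl sum.swap)
    also have "\<dots> = (\<Sum>a<n. \<Sum>y<n. \<Sum>l<n. \<Sum>w<n. csc (hdelta H a d l * Z (a # i, w) * hmu H l w y) (H.b y))"
      by (intro sum.cong refl sum.swap)
    also have "\<dots> = (\<Sum>y<n. \<Sum>a<n. \<Sum>l<n. \<Sum>w<n. csc (hdelta H a d l * Z (a # i, w) * hmu H l w y) (H.b y))"
      by (rule sum.swap)
    also have "\<dots> = (\<Sum>y<n. csc (phi Z d i y) (H.b y))"
      by (simp add: phi_def csc_sum_left)
    finally show ?thesis using d by (simp add: 0)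
  qed
  have "0 = (\<Sum>d<n. H.S (H.ct a d) * (\<Sum>e<n. \<Sum>w<n. csc (Z (e # i, w)) (H.ct d e * H.b w)))"
    by (simp add: z)
  also have "\<dots> = (\<Sum>d<n. \<Sum>e<n. \<Sum>w<n. csc (Z (e # i, w)) (H.S (H.ct a d) * H.ct d e * H.b w))"
    by (simp add: sum_distrib_left mult.assoc)
  also have "\<dots> = (\<Sum>e<n. \<Sum>d<n. \<Sum>w<n. csc (Z (e # i, w)) (H.S (H.ct a d) * H.ct d e * H.b w))"
    by (rule sum.swap)
  also have "\<dots> = (\<Sum>e<n. \<Sum>w<n. \<Sum>d<n. csc (Z (e # i, w)) (H.S (H.ct a d) * H.ct d e * H.b w))"
    by (intro sum.cong refl sum.swap)
  also have "\<dots> = (\<Sum>e<n. \<Sum>w<n. csc (Z (e # i, w)) ((\<Sum>d<n. H.S (H.ct a d) * H.ct d e) * H.b w))"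
    by (simp add: sum_distrib_right csc_sum_right)
  also have "\<dots> = (\<Sum>e<n. if a = e then (\<Sum>w<n. csc (Z (e # i, w)) (H.b w)) else 0)"
    using a by (intro sum.cong refl) (simp add: H.corep_S_left[OF H.corep_ct])
  also have "\<dots> = (\<Sum>w<n. csc (Z (a # i, w)) (H.b w))" using a by simp
  finally show ?thesis using H.lincomb_zero[where f = "\<lambda>w. Z (a # i, w)", OF _ w] by simp
qed

lemma P_right_inverse:
  obtains Q where "\<And>l k. l < m \<Longrightarrow> k < m \<Longrightarrow> (\<Sum>a<n. P a l * Q a k) = (if l = k then 1 else 0)"
proof -
  have "\<forall>k. \<exists>c. \<forall>l<m. (\<Sum>i<n. c i * P i l) = (if l = k then 1 else 0)"
    by (rule allI) (rule surj[unfolded hom_surjective_def, rule_format, of "\<lambda>l. if l = _ then 1 else 0"])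
  then obtain c where c: "\<forall>k. \<forall>l<m. (\<Sum>i<n. c k i * P i l) = (if l = k then 1 else 0)"
    by (drule_tac choice) (elim exE)
  show ?thesis
    by (rule that[of "\<lambda>a k. c k a"]) (simp add: c mult.commute[of "P _ _"])
qed

text \<open>Tensoring a corepresentation with the right comodule \<open>ker \<pi>\<close>.\<close>

lemma Itw_growth:
  assumes v: "U.corep I v"
  shows "\<exists>I' v'. U.corep I' v' \<and> card I' + m * card I = n * card I
    \<and> n * fv.dim (Itw I v) \<le> fv.dim (Itw I' v') + n * card I"
proof -
  have fI: "finite I" using v by (rule U.corep_fin)
  obtain Q where Q: "\<And>l k. l < m \<Longrightarrow> k < m \<Longrightarrow> (\<Sum>a<n. P a l * Q a k) = (if l = k then 1 else 0)"
    by (rule P_right_inverse) (rule that)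
  obtain r F F' where r: "r + m = n"
    and F'F: "\<And>s t. s < r \<Longrightarrow> t < r \<Longrightarrow> (\<Sum>a<n. F' s a * F a t) = (if s = t then 1 else 0)"
    and FF': "\<And>a c. a < n \<Longrightarrow> c < n \<Longrightarrow> (\<Sum>s<r. F a s * F' s c) + (\<Sum>l<m. Q a l * P c l) = (if a = c then 1 else 0)"
    and PF: "\<And>l s. l < m \<Longrightarrow> s < r \<Longrightarrow> (\<Sum>a<n. P a l * F a s) = 0"
    by (rule kernel_complement[where m = m and n = n and P = "\<lambda>l a. P a l" and Q = Q, OF Q]) (assumption, assumption, rule that)
  have proj: "x a = (\<Sum>s<r. F a s * (\<Sum>c<n. F' s c * x c))"
    if a: "a < n" and x: "\<And>l. l < m \<Longrightarrow> (\<Sum>c<n. P c l * x c) = 0" for a x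
  proof -
    have "x a = (\<Sum>c<n. (if a = c then 1 else 0) * x c)"
      using a by (simp add: H.sum_delta_mult)
    also have "\<dots> = (\<Sum>c<n. ((\<Sum>s<r. F a s * F' s c) + (\<Sum>l<m. Q a l * P c l)) * x c)"
      using a by (simp add: FF')
    also have "\<dots> = (\<Sum>c<n. \<Sum>s<r. F a s * F' s c * x c) + (\<Sum>c<n. \<Sum>l<m. Q a l * P c l * x c)"
      by (simp add: distrib_right sum.distrib sum_distrib_right)
    also have "(\<Sum>c<n. \<Sum>l<m. Q a l * P c l * x c) = (\<Sum>l<m. Q a l * (\<Sum>c<n. P c l * x c))"
      by (subst sum.swap) (simp add: sum_distrib_left mult.assoc)
    also have "(\<Sum>c<n. \<Sum>s<r. F a s * F' s c * x c) = (\<Sum>s<r. F a s * (\<Sum>c<n. F' s c * x c))"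
      by (subst sum.swap) (simp add: sum_distrib_left mult.assoc)
    finally show ?thesis by (simp add: x)
  qed
  define nu where "nu s t = (\<Sum>a<n. \<Sum>e<n. csc (F' s a * F e t) (ur a e))" for s t
  have Fur: "(\<Sum>e<n. csc (F e t) (ur a e)) = (\<Sum>s<r. csc (F a s) (nu s t))" if a: "a < n" and t: "t < r" for a t
  proof (rule U.spn_eqI)
    fix p assume p: "p < m"
    define x where "x c = U.co p (\<Sum>e<n. csc (F e t) (ur c e))" for c
    have "(\<Sum>c<n. P c l * x c) = 0" if l: "l < m" for l
    proof -
      have "(\<Sum>c<n. P c l * x c) = U.co p (\<Sum>e<n. csc (F e t) (\<Sum>c<n. csc (P c l) (ur c e)))"
        by (simp add: x_def U.co_sum sum_distrib_left mult_ac) (rule sum.swap)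
      also have "\<dots> = U.co p (\<Sum>e<n. \<Sum>k<m. csc (F e t * P e k) (U.ct l k))"
        using l by (simp add: ur_P csc_sum_right)
      also have "\<dots> = U.co p (\<Sum>k<m. csc (\<Sum>e<n. P e k * F e t) (U.ct l k))"
        by (subst sum.swap) (simp add: csc_sum_left mult.commute)
      also have "\<dots> = 0" using t by (simp add: PF)
      finally show ?thesis .
    qed
    then have "x a = (\<Sum>s<r. F a s * (\<Sum>c<n. F' s c * x c))" using proj[of a x] a by blast
    also have "\<dots> = U.co p (\<Sum>s<r. csc (F a s) (nu s t))"
      by (simp add: x_def nu_def U.co_sum sum_distrib_left mult_ac)
    finally show "U.co p (\<Sum>e<n. csc (F e t) (ur a e)) = U.co p (\<Sum>s<r. csc (F a s) (nu s t))"
      by (simp add: x_def)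
  qed (auto simp: nu_def)
  have nu: "U.corep {..<r} nu"
    using U.corep_sub[OF corep_ur, of "{..<r}" F' F] F'F Fur unfolding nu_def by simp
  define I' where "I' = cons_set r I"
  define v' where "v' = U.cons_tens nu v"
  have v': "U.corep I' v'"
    unfolding I'_def v'_def by (rule U.corep_cons_tens[OF nu v])
  define V where "V = power_space n I {..<n} (Itw I v)"
  have V: "fv.subspace V" "V \<subseteq> supp_on (cons_set n I \<times> {..<n})"
    unfolding V_def using subspace_power_space[OF subspace_Itw] by (auto simp: power_space_def)
  define om where "om Z = (\<lambda>(i, y). if i \<in> I \<and> y < n then (\<Sum>a<n. \<Sum>w<n. Z (a # i, w) * hmu H a w y) else 0)"
    for Z :: "nat list \<times> nat \<Rightarrow> complex"
  have om: "flin om"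
    by (auto simp: flin_def om_def fun_eq_iff algebra_simps sum.distrib sum_distrib_left)
  define K where "K = {Z\<in>V. om Z = 0}"
  define psi where "psi Z = (\<lambda>(x, y). if x \<in> I' \<and> y < n then (\<Sum>d<n. F' (hd x) d * phi Z d (tl x) y) else 0)"
    for Z
  have psi: "flin psi"
    by (auto simp: flin_def psi_def phi_def fun_eq_iff algebra_simps sum.distrib sum_distrib_left)
  have PK: "(\<Sum>c<n. P c l * phi Z c i y) = 0" if Z: "Z \<in> K" and "i \<in> I" "y < n" "l < m" for Z i y l
  proof (rule phi_counit_zero[OF _ v])
    show "Z \<in> power_space n I {..<n} (Itw I v)" using Z by (simp add: K_def V_def)
    fix i y assume "i \<in> I" "y < n"
    moreover have "om Z (i, y) = 0" using Z by (simp add: K_def)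
    ultimately show "(\<Sum>d<n. heps H d * phi Z d i y) = 0" by (simp add: om_def ep_phi)
  qed fact+
  have Fpsi: "(\<Sum>s<r. F d s * psi Z (s # i, y)) = phi Z d i y" if Z: "Z \<in> K" and "i \<in> I" "y < n" "d < n" for Z i y d
    using proj[of d "\<lambda>d. phi Z d i y"] PK that by (simp add: psi_def I'_def)
  have omV: "om ` V \<subseteq> supp_on (I \<times> {..<n})"
    by (auto simp: om_def supp_on_def)
  have "fv.dim V \<le> fv.dim K + fv.dim (supp_on (I \<times> {..<n}))"
    unfolding K_def
    by (rule rank_nullity[where X = "cons_set n I \<times> {..<n}" and Y = "I \<times> {..<n}"])
      (use V fI om omV in simp_all)
  also have "fv.dim (supp_on (I \<times> {..<n})) = n * card I"
    using fI by (simp add: fv_dim_supp_on card_cartesian_product mult.commute)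
  also have "fv.dim K \<le> fv.dim (Itw I' v')"
  proof (rule fv_dim_inj[where X = "cons_set n I \<times> {..<n}" and Y = "I' \<times> {..<n}" and f = psi])
    have om0: "om 0 = 0" by (simp add: om_def fun_eq_iff)
    show "fv.subspace K"
      using V(1) om om0 by (auto simp: K_def fv.subspace_def flin_def zero_fun_def)
    show "psi ` K \<subseteq> Itw I' v'"
    proof clarify
      fix Z assume Z: "Z \<in> K"
      have "(\<Sum>x\<in>I'. csc (psi Z (x, y)) (v' (s0 # j) x)) = (\<Sum>w<n. csc (psi Z (s0 # j, w)) (u w y))"
        if s0: "s0 < r" and j: "j \<in> I" and y: "y < n" for s0 j y
      proof -
        have "(\<Sum>x\<in>I'. csc (psi Z (x, y)) (v' (s0 # j) x))
            = (\<Sum>s<r. \<Sum>i\<in>I. csc (psi Z (s # i, y)) (nu s0 s * v j i))"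
          by (simp add: I'_def v'_def sum_cons_set U.cons_tens_def)
        also have "\<dots> = (\<Sum>s<r. \<Sum>i\<in>I. \<Sum>a<n. \<Sum>e<n. csc (F' s0 a * (F e s * psi Z (s # i, y))) (ur a e * v j i))"
          by (simp add: nu_def sum_distrib_right csc_sum_right mult_ac)
        also have "\<dots> = (\<Sum>a<n. \<Sum>e<n. \<Sum>s<r. \<Sum>i\<in>I. csc (F' s0 a * (F e s * psi Z (s # i, y))) (ur a e * v j i))"
          by (rule sum_rot4)
        also have "\<dots> = (\<Sum>a<n. \<Sum>e<n. \<Sum>i\<in>I. \<Sum>s<r. csc (F' s0 a * (F e s * psi Z (s # i, y))) (ur a e * v j i))"
          by (intro sum.cong refl sum.swap)
        also have "\<dots> = (\<Sum>a<n. csc (F' s0 a) (\<Sum>e<n. \<Sum>i\<in>I. csc (\<Sum>s<r. F e s * psi Z (s # i, y)) (ur a e * v j i)))"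
          by (simp add: csc_sum_right csc_sum_left)
        also have "\<dots> = (\<Sum>a<n. csc (F' s0 a) (\<Sum>e<n. \<Sum>i\<in>I. csc (phi Z e i y) (ur a e * v j i)))"
          using Z y by (simp add: Fpsi)
        also have "\<dots> = (\<Sum>a<n. csc (F' s0 a) (\<Sum>t<n. csc (phi Z a j t) (u t y)))"
          using Z y j by (simp add: phi_equivariant K_def V_def)
        also have "\<dots> = (\<Sum>t<n. csc (\<Sum>a<n. F' s0 a * phi Z a j t) (u t y))"
          by (simp add: csc_sum_left csc_sum_right) (rule sum.swap)
        finally show ?thesis using s0 j by (simp add: psi_def I'_def)
      qed
      then show "psi Z \<in> Itw I' v'"
        by (auto simp: Itw_def supp_on_def I'_def elim!: cons_setE) (simp add: psi_def I'_def)+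
    qed
    show "Z = 0" if Z: "Z \<in> K" and 0: "psi Z = 0" for Z
    proof
      fix x
      have "Z (a # i, w) = 0" if "a < n" "i \<in> I" "w < n" for a i w
        by (rule phi_inj) (use that Fpsi[OF Z, symmetric] 0 in auto)
      moreover have "Z \<in> supp_on (cons_set n I \<times> {..<n})" using Z V by (auto simp: K_def)
      ultimately show "Z x = 0 x"
        by (cases x, cases "x \<in> cons_set n I \<times> {..<n}") (auto simp: supp_on_def elim!: cons_setE)
    qed
    show "K \<subseteq> supp_on (cons_set n I \<times> {..<n})" using V(2) by (auto simp: K_def)
  qed (use fI psi Itw_supp in \<open>simp_all add: I'_def\<close>)
  finally have "fv.dim V \<le> fv.dim (Itw I' v') + n * card I" by simp
  moreover have "n * fv.dim (Itw I v) \<le> fv.dim V"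
    unfolding V_def using fI by (intro dim_power_space Itw_supp subspace_Itw) auto
  moreover have "card I' + m * card I = n * card I"
    unfolding I'_def card_cons_set by (simp flip: r add: algebra_simps)
  ultimately show ?thesis using v' by (meson le_trans)
qed

end

context fd_hopf
begin

lemma lint_S_corep:
  assumes f: "lint f" and v: "corep I v" and w: "w \<in> I" and y: "y \<in> I"
  shows "(\<Sum>t\<in>I. csc (ev f (S (v w t))) (v t y)) = csc (ev f (S (v w y))) 1"
proof -
  have eq: "(\<Sum>t\<in>I. csc (ev f (S (v w t))) (S (v t i))) = csc (ev f (S (v w i))) 1" if "i \<in> I" for i
    using lint_corep[OF f corep_transpose_S[OF v] that w] .
  have "(\<Sum>i\<in>I. csc (ev f (S (v w i))) (v i y)) = (\<Sum>i\<in>I. csc (ev f (S (v w i))) 1 * v i y)"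
    by simp
  also have "\<dots> = (\<Sum>i\<in>I. \<Sum>t\<in>I. csc (ev f (S (v w t))) (S (v t i) * v i y))"
    by (intro sum.cong refl) (simp add: sum_distrib_right flip: eq)
  also have "\<dots> = (\<Sum>t\<in>I. csc (ev f (S (v w t))) (\<Sum>i\<in>I. S (v t i) * v i y))"
    by (subst sum.swap) (simp add: csc_sum_right)
  also have "\<dots> = (\<Sum>t\<in>I. if t = y then csc (ev f (S (v w t))) 1 else 0)"
    using y by (intro sum.cong refl) (simp add: corep_S_left[OF v])
  also have "\<dots> = csc (ev f (S (v w y))) 1" using y corep_fin[OF v] by simp
  finally show ?thesis .
qed

lemma corep_L:
  assumes v: "corep I v" and i: "i \<in> I" and y: "y \<in> I" and j: "j < n"
  shows "(\<Sum>k<n. csc (co k (v i y)) (ct j k)) = (\<Sum>w\<in>I. csc (co j (v i w)) (v w y))"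
proof (rule spn_eqI)
  fix q assume q: "q < n"
  have "co q (\<Sum>k<n. csc (co k (v i y)) (ct j k)) = co j (R q (v i y))"
    using q j by (simp add: R_def co_sum co_c co_ct)
  also have "\<dots> = co q (\<Sum>w\<in>I. csc (co j (v i w)) (v w y))"
    using q i y by (simp add: corep_R[OF v] co_sum mult.commute)
  finally show "co q (\<Sum>k<n. csc (co k (v i y)) (ct j k)) = co q (\<Sum>w\<in>I. csc (co j (v i w)) (v w y))" .
qed (use corep_spn[OF v] i y in \<open>auto intro!: spn_sum\<close>)

lemma corep_triv: "corep {[]} (\<lambda>_ _. 1)"
  by (auto simp: corep_def R_one co_one)

lemma n_pos: "n > 0"
  using ep_unit by (cases n) auto

end

context hopf_surj
begin

lemma Itw_bound_aux:
  "U.corep I v \<Longrightarrow> int n ^ k * (int m * int (fv.dim (Itw I v)) - int n * int (card I))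
     \<le> int m * int n * (int n - int m) ^ k * int (card I)"
proof (induction k arbitrary: I v)
  case 0
  have "fv.dim (Itw I v) \<le> n * card I"
    using fv_dim_le[OF _ Itw_supp[of I v]] U.corep_fin[OF 0]
    by (simp add: card_cartesian_product mult.commute)
  then have "int (fv.dim (Itw I v)) \<le> int n * int (card I)"
    by (metis of_nat_le_iff of_nat_mult)
  then have "int m * int (fv.dim (Itw I v)) \<le> int m * (int n * int (card I))"
    by (rule mult_left_mono) simp
  moreover have "0 \<le> int n * int (card I)" by simp
  ultimately show ?case by (simp only: power_0 mult_1 mult_1_right mult.assoc)
next
  case (Suc k)
  obtain I' v' where v': "U.corep I' v'" and c: "card I' + m * card I = n * card I"
    and d: "n * fv.dim (Itw I v) \<le> fv.dim (Itw I' v') + n * card I"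
    using Itw_growth[OF Suc.prems] by blast
  let ?c = "int (fv.dim (Itw I v))" and ?c' = "int (fv.dim (Itw I' v'))" and ?d = "int (card I)" and ?d' = "int (card I')"
  have c: "?d' = (int n - int m) * ?d"
    using arg_cong[OF c, of int] by (simp add: algebra_simps)
  have d: "int n * ?c \<le> ?c' + int n * ?d"
    using d by (metis of_nat_add of_nat_le_iff of_nat_mult)
  have "int m * (int n * ?c) \<le> int m * (?c' + int n * ?d)"
    using d by (rule mult_left_mono) simp
  then have "int n * (int m * ?c - int n * ?d) \<le> int m * ?c' - int n * ?d'"
    by (simp add: c algebra_simps)
  then have "int n ^ k * (int n * (int m * ?c - int n * ?d)) \<le> int n ^ k * (int m * ?c' - int n * ?d')"
    by (rule mult_left_mono) simp
  also have "\<dots> \<le> int m * int n * (int n - int m) ^ k * ?d'"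
    by (rule Suc.IH[OF v'])
  finally show ?case by (simp add: c mult_ac)
qed

text \<open>Otherwise the excess over the expected dimension would grow by the factor \<open>n\<close> with each
  tensor power of \<open>ker \<pi>\<close>, whose dimension only grows by \<open>n - m\<close>.\<close>

lemma Itw_bound:
  assumes v: "U.corep I v"
  shows "m * fv.dim (Itw I v) \<le> n * card I"
proof (rule ccontr)
  assume neg: "\<not> ?thesis"
  define e where "e = int m * int (fv.dim (Itw I v)) - int n * int (card I)"
  have "int (n * card I) < int (m * fv.dim (Itw I v))"
    using neg by (simp only: of_nat_less_iff not_le)
  then have e: "e \<ge> 1" unfolding e_def of_nat_mult by linarith
  have m: "m > 0" and n: "n > 0" by (rule U.n_pos H.n_pos)+
  obtain I' :: "nat list set" and v' where "U.corep I' v'" "card I' + m * card I = n * card I"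
    using Itw_growth[OF v] by blast
  then have "m * card I \<le> n * card I" by linarith
  moreover have "card I > 0"
  proof (rule ccontr)
    assume "\<not> card I > 0"
    then have "I = {}" using U.corep_fin[OF v] by simp
    then have "fv.dim (Itw I v) \<le> card ({} :: (nat list \<times> nat) set)"
      using fv_dim_le[OF _ Itw_supp[of I v]] by simp
    then show False using neg by simp
  qed
  ultimately have mn: "m \<le> n" by simp
  define q where "q = (real n - real m) / real n"
  have q: "0 \<le> q" "q < 1" using m n mn by (auto simp: q_def)
  define C where "C = real m * real n * real (card I)"
  have le: "1 \<le> C * q ^ k" for k
  proof -
    have "int n ^ k * e \<le> int m * int n * (int n - int m) ^ k * int (card I)"
      using Itw_bound_aux[OF v, of k] by (simp add: e_def)
    moreover have "int n ^ k * 1 \<le> int n ^ k * e" using e by (intro mult_left_mono) auto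
    ultimately have "int n ^ k \<le> int m * int n * (int n - int m) ^ k * int (card I)" by linarith
    then have "real_of_int (int n ^ k) \<le> real_of_int (int m * int n * (int n - int m) ^ k * int (card I))"
      by (simp only: of_int_le_iff)
    then have "real n ^ k \<le> C * (real n - real m) ^ k" by (simp add: C_def mult_ac)
    then show ?thesis using n by (simp add: q_def power_divide field_simps)
  qed
  have "C > 0" using m n \<open>card I > 0\<close> by (simp add: C_def)
  then obtain k where "q ^ k < 1 / C"
    using real_arch_pow_inv[of "1 / C" q] q by auto
  then show False using le[of k] \<open>C > 0\<close> by (simp add: field_simps)
qed

lemma total_integral_element:
  assumes f: "U.lint f" and nz: "w \<in> U.spn" "U.ev f w \<noteq> 0"
  obtains h where "\<And>y. y < n \<Longrightarrow> (\<Sum>x<n. h x * U.ev f (U.S (u x y))) = heta H y"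
proof -
  define la where "la k = U.ev f (U.S (U.b k))" for k
  have la_ev: "U.ev f (U.S g) = (\<Sum>k<m. la k * U.co k g)" if "g \<in> U.spn" for g
    using U.spn_lin_expand[OF lin_compose[OF U.lin_S U.lin_ev] that, of f] by (simp add: la_def mult.commute)
  have la_ct: "(\<Sum>t<m. csc (la t) (U.ct t y)) = csc (la y) 1" if y: "y < m" for y
  proof -
    have "(\<Sum>t<m. csc (la t) (U.ct t y)) = (\<Sum>t<m. csc (U.ev f (U.S (\<Sum>x<m. csc (heps U x) (U.ct x t)))) (U.ct t y))"
      by (simp add: la_def U.sum_ep_ct)
    also have "\<dots> = (\<Sum>x<m. csc (heps U x) (\<Sum>t<m. csc (U.ev f (U.S (U.ct x t))) (U.ct t y)))"
      by (simp add: U.S_sum U.ev_sum csc_sum_left csc_sum_right) (rule sum.swap)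
    also have "\<dots> = (\<Sum>x<m. csc (heps U x) (csc (U.ev f (U.S (U.ct x y))) 1))"
      using y by (simp add: U.lint_S_corep[OF f U.corep_ct])
    also have "\<dots> = csc (U.ev f (U.S (\<Sum>x<m. csc (heps U x) (U.ct x y)))) 1"
      by (simp add: U.S_sum U.ev_sum csc_sum_left)
    finally show ?thesis using y by (simp add: la_def U.sum_ep_ct)
  qed
  have "\<exists>a<m. la a \<noteq> 0"
  proof (rule ccontr)
    assume "\<not> ?thesis"
    then have "U.ev f (U.S (U.Si w)) = 0" using nz by (simp only: la_ev U.spn_Si) simp
    then show False using nz by simp
  qed
  then obtain a0 where a0: "a0 < m" "la a0 \<noteq> 0" by blast
  define Q where "Q a = (\<lambda>k::nat. (if a = a0 then 1 / la a0 else 0))" for a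
  have "(\<Sum>a<m. la a * Q a k) = (if l = k then 1 else 0)" if "l < 1" "k < 1" for l k :: nat
    using that a0 by (simp add: Q_def if_distrib cong: if_cong)
  then obtain r F F' where r: "r + 1 = m"
    and F'F: "\<And>s t. s < r \<Longrightarrow> t < r \<Longrightarrow> (\<Sum>a<m. F' s a * F a t) = (if s = t then 1 else 0)"
    and FF': "\<And>a c. a < m \<Longrightarrow> c < m \<Longrightarrow> (\<Sum>s<r. F a s * F' s c) + (\<Sum>l<1. Q a l * la c) = (if a = c then 1 else 0)"
    and PF: "\<And>l s. l < (1::nat) \<Longrightarrow> s < r \<Longrightarrow> (\<Sum>a<m. la a * F a s) = 0"
    by (rule kernel_complement[where m = 1 and n = m and P = "\<lambda>l a. la a" and Q = Q]) (assumption, assumption, rule that)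
  have proj: "x a = (\<Sum>s<r. F a s * (\<Sum>c<m. F' s c * x c))"
    if a: "a < m" and x: "(\<Sum>c<m. la c * x c) = 0" for a x
  proof -
    have "x a = (\<Sum>c<m. (if a = c then 1 else 0) * x c)"
      using a by (simp add: H.sum_delta_mult)
    also have "\<dots> = (\<Sum>c<m. ((\<Sum>s<r. F a s * F' s c) + Q a 0 * la c) * x c)"
      using a by (simp flip: FF')
    also have "\<dots> = (\<Sum>c<m. \<Sum>s<r. F a s * F' s c * x c) + Q a 0 * (\<Sum>c<m. la c * x c)"
      by (simp add: distrib_right sum.distrib sum_distrib_right sum_distrib_left mult.assoc)
    also have "(\<Sum>c<m. \<Sum>s<r. F a s * F' s c * x c) = (\<Sum>s<r. F a s * (\<Sum>c<m. F' s c * x c))"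
      by (subst sum.swap) (simp add: sum_distrib_left mult.assoc)
    finally show ?thesis by (simp add: x)
  qed
  define nu where "nu s t = (\<Sum>a<m. \<Sum>e<m. csc (F' s a * F e t) (U.ct a e))" for s t
  have Fct: "(\<Sum>e<m. csc (F e t) (U.ct a e)) = (\<Sum>s<r. csc (F a s) (nu s t))" if a: "a < m" and t: "t < r" for a t
  proof (rule U.spn_eqI)
    fix p assume p: "p < m"
    define x where "x c = U.co p (\<Sum>e<m. csc (F e t) (U.ct c e))" for c
    have "(\<Sum>c<m. la c * x c) = U.co p (\<Sum>e<m. csc (F e t) (\<Sum>c<m. csc (la c) (U.ct c e)))"
      by (simp add: x_def U.co_sum sum_distrib_left mult_ac) (rule sum.swap)
    also have "\<dots> = U.co p (csc (\<Sum>e<m. la e * F e t) 1)"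
      by (simp add: la_ct csc_sum_left mult.commute)
    also have "\<dots> = 0" using PF[of 0 t] t by simp
    finally have "x a = (\<Sum>s<r. F a s * (\<Sum>c<m. F' s c * x c))" using proj[of a x] a by blast
    also have "\<dots> = U.co p (\<Sum>s<r. csc (F a s) (nu s t))"
      by (simp add: x_def nu_def U.co_sum sum_distrib_left mult_ac)
    finally show "U.co p (\<Sum>e<m. csc (F e t) (U.ct a e)) = U.co p (\<Sum>s<r. csc (F a s) (nu s t))"
      by (simp add: x_def)
  qed (auto simp: nu_def)
  have nu: "U.corep {..<r} nu"
    using U.corep_sub[OF U.corep_ct, of "{..<r}" F' F] F'F Fct unfolding nu_def by simp
  define W where "W = Itw {[]} (\<lambda>_ _. 1)"
  define I where "I = cons_set r {[]}"
  define v where "v = U.cons_tens nu (\<lambda>_ _. 1)"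
  have v: "U.corep I v"
    unfolding I_def v_def by (rule U.corep_cons_tens[OF nu U.corep_triv])
  have W: "m * fv.dim W \<le> n"
    using Itw_bound[OF U.corep_triv] by (simp add: W_def)
  have Iv: "m * fv.dim (Itw I v) \<le> n * r"
    using Itw_bound[OF v] by (simp add: I_def card_cons_set)
  define z where "z h k y = (\<Sum>x<n. h x * U.co k (u x y))" for h :: "nat \<Rightarrow> complex" and k y
  have z_ct: "(\<Sum>k<m. csc (z h k y) (U.ct j k)) = (\<Sum>w<n. csc (z h j w) (u w y))" if "j < m" "y < n" for h j y
  proof -
    have "(\<Sum>k<m. csc (z h k y) (U.ct j k)) = (\<Sum>x<n. csc (h x) (\<Sum>k<m. csc (U.co k (u x y)) (U.ct j k)))"
      by (simp add: z_def csc_sum_left csc_sum_right) (rule sum.swap)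
    also have "\<dots> = (\<Sum>x<n. csc (h x) (\<Sum>w<n. csc (U.co j (u x w)) (u w y)))"
      using that by (simp add: U.corep_L[OF corep_u])
    also have "\<dots> = (\<Sum>w<n. csc (z h j w) (u w y))"
      by (simp add: z_def csc_sum_left csc_sum_right) (rule sum.swap)
    finally show ?thesis .
  qed
  have la_z: "(\<Sum>k<m. la k * z h k y) = (\<Sum>x<n. h x * U.ev f (U.S (u x y)))" for h y
    by (simp add: z_def la_ev sum_distrib_left mult_ac) (rule sum.swap)
  define T where "T h = (\<lambda>(i :: nat list, y). if i = [] \<and> y < n then (\<Sum>k<m. la k * z h k y) else 0)" for h
  have T: "flin T"
    by (auto simp: flin_def T_def z_def fun_eq_iff algebra_simps sum.distrib sum_distrib_left)
  define psi where "psi h = (\<lambda>(x, y). if x \<in> I \<and> y < n then (\<Sum>k<m. F' (hd x) k * z h k y) else 0)" for h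
  have psi: "flin psi"
    by (auto simp: flin_def psi_def z_def fun_eq_iff algebra_simps sum.distrib sum_distrib_left)
  let ?V = "supp_on {..<n}"
  define K where "K = {h\<in>?V. T h = 0}"
  have TW: "T ` ?V \<subseteq> W"
  proof clarify
    fix h
    have "csc (\<Sum>k<m. la k * z h k y) 1 = (\<Sum>w<n. csc (\<Sum>k<m. la k * z h k w) (u w y))" if y: "y < n" for y
    proof -
      have "csc (\<Sum>k<m. la k * z h k y) 1 = (\<Sum>x<n. csc (h x) (csc (U.ev f (U.S (u x y))) 1))"
        by (simp add: la_z csc_sum_left)
      also have "\<dots> = (\<Sum>x<n. csc (h x) (\<Sum>w<n. csc (U.ev f (U.S (u x w))) (u w y)))"
        using y by (simp add: U.lint_S_corep[OF f corep_u])
      also have "\<dots> = (\<Sum>w<n. csc (\<Sum>x<n. h x * U.ev f (U.S (u x w))) (u w y))"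
        by (simp add: csc_sum_left csc_sum_right) (rule sum.swap)
      finally show ?thesis by (simp add: la_z)
    qed
    then show "T h \<in> W" by (simp add: W_def Itw_def T_def supp_on_def)
  qed
  have sK: "fv.subspace K"
  proof -
    have "T 0 = 0" by (simp add: T_def z_def fun_eq_iff)
    then show ?thesis
      using T subspace_supp_on[of "{..<n}"] by (auto simp: K_def fv.subspace_def flin_def zero_fun_def)
  qed
  have Wsupp: "W \<subseteq> supp_on ({[]} \<times> {..<n})" unfolding W_def by (rule Itw_supp)
  have n1: "fv.dim ?V \<le> fv.dim K + fv.dim (T ` ?V)"
    unfolding K_def
    by (rule rank_nullity[where X = "{..<n}" and Y = "{[]} \<times> {..<n}"])
      (use T subspace_supp_on subset_trans[OF TW Wsupp] in simp_all)
  have n2: "fv.dim K \<le> fv.dim (Itw I v)"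
  proof (rule fv_dim_inj[where X = "{..<n}" and Y = "I \<times> {..<n}" and f = psi])
    have Fpsi: "(\<Sum>s<r. F d s * psi h ([s], y)) = z h d y" if h: "h \<in> K" and "y < n" "d < m" for h y d
    proof -
      have "T h ([], y) = 0" using h by (simp add: K_def)
      then have "(\<Sum>k<m. la k * z h k y) = 0" using that by (simp add: T_def)
      then show ?thesis using proj[of d "\<lambda>d. z h d y"] that by (simp add: psi_def I_def)
    qed
    show "psi ` K \<subseteq> Itw I v"
    proof clarify
      fix h assume h: "h \<in> K"
      have "(\<Sum>x\<in>I. csc (psi h (x, y)) (v [j] x)) = (\<Sum>w<n. csc (psi h ([j], w)) (u w y))"
        if j: "j < r" and y: "y < n" for j y
      proof -
        have "(\<Sum>x\<in>I. csc (psi h (x, y)) (v [j] x)) = (\<Sum>s<r. csc (psi h ([s], y)) (nu j s))"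
          by (simp add: I_def v_def sum_cons_set U.cons_tens_def)
        also have "\<dots> = (\<Sum>s<r. \<Sum>a<m. \<Sum>e<m. csc (F' j a * (F e s * psi h ([s], y))) (U.ct a e))"
          by (simp add: nu_def csc_sum_right mult_ac)
        also have "\<dots> = (\<Sum>a<m. \<Sum>s<r. \<Sum>e<m. csc (F' j a * (F e s * psi h ([s], y))) (U.ct a e))"
          by (rule sum.swap)
        also have "\<dots> = (\<Sum>a<m. \<Sum>e<m. \<Sum>s<r. csc (F' j a * (F e s * psi h ([s], y))) (U.ct a e))"
          by (intro sum.cong refl sum.swap)
        also have "\<dots> = (\<Sum>a<m. csc (F' j a) (\<Sum>e<m. csc (\<Sum>s<r. F e s * psi h ([s], y)) (U.ct a e)))"
          by (simp add: csc_sum_left csc_sum_right)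
        also have "\<dots> = (\<Sum>a<m. csc (F' j a) (\<Sum>w<n. csc (z h a w) (u w y)))"
          using h y by (simp add: Fpsi z_ct)
        also have "\<dots> = (\<Sum>w<n. csc (\<Sum>a<m. F' j a * z h a w) (u w y))"
          by (simp add: csc_sum_left csc_sum_right) (rule sum.swap)
        finally show ?thesis using j by (simp add: psi_def I_def)
      qed
      then show "psi h \<in> Itw I v"
        by (auto simp: Itw_def supp_on_def I_def elim!: cons_setE) (simp add: psi_def I_def)+
    qed
    show "h = 0" if h: "h \<in> K" and 0: "psi h = 0" for h
    proof
      fix y
      show "h y = 0 y"
      proof (cases "y < n")
        case True
        have "0 = (\<Sum>k<m. heps U k * z h k y)"
          using Fpsi[OF h True, symmetric] 0 by simp
        also have "\<dots> = (\<Sum>x<n. h x * U.cou (u x y))"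
          by (simp add: z_def U.cou_def sum_distrib_left mult_ac) (rule sum.swap)
        also have "\<dots> = h y"
          using True by (simp add: U.corep_cou[OF corep_u] H.sum_delta_mult)
        finally show ?thesis by simp
      qed (use h in \<open>simp add: K_def supp_on_def\<close>)
    qed
    show "K \<subseteq> ?V" by (auto simp: K_def)
  qed (use sK psi Itw_supp in \<open>simp_all add: I_def\<close>)
  have "T ` ?V = W"
  proof (rule fv_dim_eq[where X = "{[]} \<times> {..<n}"])
    show "fv.subspace (T ` ?V)"
      using fvp.linear_subspace_image[OF flin_linear[OF T] subspace_supp_on] .
    have "n \<le> fv.dim (Itw I v) + fv.dim (T ` ?V)"
      using n1 n2 by (simp add: fv_dim_supp_on)
    then have "m * n \<le> m * fv.dim (Itw I v) + m * fv.dim (T ` ?V)"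
      by (metis distrib_left mult_le_mono2)
    also have "\<dots> \<le> n * r + m * fv.dim (T ` ?V)" using Iv by simp
    also have "m * n = n * r + n" by (simp flip: r)
    finally have "m * fv.dim W \<le> m * fv.dim (T ` ?V)" using W by linarith
    then show "fv.dim W \<le> fv.dim (T ` ?V)" using U.n_pos by simp
  qed (use TW Wsupp in simp_all)
  moreover have "(\<lambda>(i, y). if i = [] \<and> y < n then heta H y else 0) \<in> W"
    by (simp add: W_def Itw_def supp_on_def u_unit)
  ultimately have "(\<lambda>(i :: nat list, y). if i = [] \<and> y < n then heta H y else 0) \<in> T ` ?V" by simp
  then obtain h where h: "(\<lambda>(i :: nat list, y). if i = [] \<and> y < n then heta H y else 0) = T h" by (rule imageE)
  show ?thesis
  proof (rule that)
    fix y assume "y < n"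
    then show "(\<Sum>x<n. h x * U.ev f (U.S (u x y))) = heta H y"
      using fun_cong[OF h, of "([], y)"] by (simp add: T_def la_z)
  qed
qed

end

context fd_hopf
begin

text \<open>\<open>M\<close> is a comodule map between the left comodules with matrices \<open>v\<close> and \<open>w\<close>.\<close>

definition intw :: "nat \<Rightarrow> (nat \<Rightarrow> nat \<Rightarrow> lop) \<Rightarrow> nat \<Rightarrow> (nat \<Rightarrow> nat \<Rightarrow> lop) \<Rightarrow> (nat \<Rightarrow> nat \<Rightarrow> complex) \<Rightarrow> bool" where
  "intw a v e w M \<longleftrightarrow> (\<forall>x<a. \<forall>y<e. (\<Sum>z<a. csc (M z y) (v x z)) = (\<Sum>z<e. csc (M x z) (w z y)))"

lemma intw_comp:
  assumes M: "intw a v e w M" and N: "intw e w d z N"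
  shows "intw a v d z (\<lambda>x y. \<Sum>k<e. M x k * N k y)"
  unfolding intw_def
proof (intro allI impI)
  fix x y assume x: "x < a" and y: "y < d"
  have "(\<Sum>i<a. csc (\<Sum>k<e. M i k * N k y) (v x i)) = (\<Sum>k<e. csc (N k y) (\<Sum>i<a. csc (M i k) (v x i)))"
    by (simp add: csc_sum_left csc_sum_right mult.commute) (rule sum.swap)
  also have "\<dots> = (\<Sum>k<e. csc (N k y) (\<Sum>l<e. csc (M x l) (w l k)))"
    using M x by (simp add: intw_def)
  also have "\<dots> = (\<Sum>l<e. csc (M x l) (\<Sum>k<e. csc (N k y) (w l k)))"
    by (simp add: csc_sum_right mult.commute) (rule sum.swap)
  also have "\<dots> = (\<Sum>l<e. csc (M x l) (\<Sum>i<d. csc (N l i) (z i y)))"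
    using N y by (simp add: intw_def)
  also have "\<dots> = (\<Sum>i<d. csc (\<Sum>k<e. M x k * N k i) (z i y))"
    by (simp add: csc_sum_left csc_sum_right) (rule sum.swap)
  finally show "(\<Sum>i<a. csc (\<Sum>k<e. M i k * N k y) (v x i)) = (\<Sum>i<d. csc (\<Sum>k<e. M x k * N k i) (z i y))" .
qed

end

context hopf_surj
begin

abbreviation "from_U \<equiv> U.intw m U.c n u"
abbreviation "to_U \<equiv> U.intw n u m U.c"

lemma to_U_P: "to_U P"
  by (simp add: U.intw_def u_P)

lemma to_U_coeff: "e < n \<Longrightarrow> to_U (\<lambda>x k. U.co k (u x e))"
  unfolding U.intw_def
proof (intro allI impI)
  fix x k assume "e < n" "x < n" "k < m"
  then show "(\<Sum>z<n. csc (U.co k (u z e)) (u x z)) = (\<Sum>l<m. csc (U.co l (u x e)) (U.c l k))"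
    by (simp add: U.corep_R[OF corep_u, symmetric] U.R_def)
qed

lemma from_U_integral:
  assumes f: "U.lint f"
  shows "from_U (\<lambda>k y. \<Sum>w<n. h w * U.ev f (U.b k * U.S (u w y)))"
  unfolding U.intw_def
proof (intro allI impI)
  fix k y assume k: "k < m" and y: "y < n"
  have "(\<Sum>l<m. csc (\<Sum>w<n. h w * U.ev f (U.b l * U.S (u w y))) (U.c k l))
      = (\<Sum>w<n. csc (h w) (\<Sum>l<m. csc (U.ev f (U.b l * U.S (u w y))) (U.c k l)))"
    by (simp add: csc_sum_left csc_sum_right) (rule sum.swap)
  also have "\<dots> = (\<Sum>w<n. csc (h w) (\<Sum>z<n. csc (U.ev f (U.b k * U.S (u w z))) (u z y)))"
    using k y by (simp add: U.lint_mult_S[OF f corep_u])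
  also have "\<dots> = (\<Sum>z<n. csc (\<Sum>w<n. h w * U.ev f (U.b k * U.S (u w z))) (u z y))"
    by (simp add: csc_sum_left csc_sum_right) (rule sum.swap)
  finally show "(\<Sum>l<m. csc (\<Sum>w<n. h w * U.ev f (U.b l * U.S (u w y))) (U.c k l))
      = (\<Sum>z<n. csc (\<Sum>w<n. h w * U.ev f (U.b k * U.S (u w z))) (u z y))" .
qed

lemma section_exists:
  obtains p where "from_U p" "\<And>k l. k < m \<Longrightarrow> l < m \<Longrightarrow> (\<Sum>y<n. p k y * P y l) = (if k = l then 1 else 0)"
proof -
  obtain f w where f: "U.lint f" and w: "w \<in> U.spn" "U.ev f w \<noteq> 0"
    using U.lint_exists by blast
  obtain \<gamma> where \<gamma>: "\<And>k. k < m \<Longrightarrow> (\<Sum>t<m. \<gamma> t * U.ev f (U.b k * U.S (U.b t))) = heps U k"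
    using U.lint_dual_element[OF f w] by metis
  obtain h where h: "\<And>l. l < m \<Longrightarrow> (\<Sum>i<n. h i * P i l) = \<gamma> l"
    using surj[unfolded hom_surjective_def, rule_format, of \<gamma>] by blast
  define p where "p k y = (\<Sum>w<n. h w * U.ev f (U.b k * U.S (u w y)))" for k y
  have "from_U p" unfolding p_def by (rule from_U_integral[OF f])
  moreover have "(\<Sum>y<n. p k y * P y l) = (if k = l then 1 else 0)" if k: "k < m" and l: "l < m" for k l
  proof -
    have "(\<Sum>y<n. p k y * P y l) = (\<Sum>w<n. h w * U.ev f (U.b k * U.S (\<Sum>y<n. csc (P y l) (u w y))))"
      by (simp add: p_def U.S_sum U.ev_sum sum_distrib_left sum_distrib_right mult_ac) (rule sum.swap)
    also have "\<dots> = (\<Sum>w<n. h w * U.ev f (U.b k * U.S (\<Sum>t<m. csc (P w t) (U.c t l))))"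
      using l by (simp add: u_P)
    also have "\<dots> = (\<Sum>t<m. (\<Sum>w<n. h w * P w t) * U.ev f (U.b k * U.S (U.c t l)))"
      by (simp add: U.S_sum U.ev_sum sum_distrib_left sum_distrib_right mult_ac) (rule sum.swap)
    also have "\<dots> = (\<Sum>t<m. \<gamma> t * U.ev f (U.b k * U.S (U.c t l)))"
      by (simp add: h)
    also have "\<dots> = (\<Sum>t<m. \<gamma> t * U.co l (\<Sum>z<m. csc (U.ev f (U.b k * U.S (U.c t z))) (U.b z)))"
      using l by (simp add: U.co_lincomb)
    also have "\<dots> = (\<Sum>t<m. \<gamma> t * U.co l (\<Sum>j<m. csc (U.ev f (U.b j * U.S (U.b t))) (U.c k j)))"
      using k by (simp add: U.lint_mult_S_b[OF f])
    also have "\<dots> = U.co l (\<Sum>j<m. csc (\<Sum>t<m. \<gamma> t * U.ev f (U.b j * U.S (U.b t))) (U.c k j))"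
      by (simp add: U.co_sum csc_sum_left sum_distrib_left sum_distrib_right mult_ac) (rule sum.swap)
    also have "\<dots> = U.co l (U.b k)"
      using k by (simp add: \<gamma> U.sum_ep_c)
    finally show ?thesis using k l by (simp add: U.co_b)
  qed
  ultimately show ?thesis using that by blast
qed

text \<open>A total integral \<open>\<phi> : U \<rightarrow> H\<close> makes the comodule \<open>H\<close> injective:
  \<open>h \<mapsto> \<pi>(h\<^sub>1) \<otimes> h\<^sub>2\<close> is split by \<open>x \<otimes> h \<mapsto> \<phi>(x S(\<pi>(h\<^sub>1))) h\<^sub>2\<close>.\<close>

lemma injectivity_splitting:
  obtains p where "\<And>e. e < n \<Longrightarrow> from_U (p e)"
    "\<And>x y. x < n \<Longrightarrow> y < n \<Longrightarrow> (\<Sum>e<n. \<Sum>k<m. U.co k (u x e) * p e k y) = (if x = y then 1 else 0)"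
proof -
  obtain f w where f: "U.lint f" and w: "w \<in> U.spn" "U.ev f w \<noteq> 0"
    using U.lint_exists by blast
  obtain h where h: "\<And>y. y < n \<Longrightarrow> (\<Sum>x<n. h x * U.ev f (U.S (u x y))) = heta H y"
    using total_integral_element[OF f w] by metis
  define \<phi> where "\<phi> k y = (\<Sum>w<n. h w * U.ev f (U.b k * U.S (u w y)))" for k y
  have \<phi>: "from_U \<phi>" unfolding \<phi>_def by (rule from_U_integral[OF f])
  have \<phi>1: "(\<Sum>k<m. heta U k * \<phi> k y) = heta H y" if "y < n" for y
  proof -
    have "(\<Sum>k<m. heta U k * \<phi> k y) = (\<Sum>w<n. h w * U.ev f ((\<Sum>k<m. csc (heta U k) (U.b k)) * U.S (u w y)))"
      by (simp add: \<phi>_def sum_distrib_left sum_distrib_right U.ev_sum mult_ac) (rule sum.swap)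
    then show ?thesis using h[OF that] by (simp flip: U.one_b)
  qed
  define p where "p e k y = (\<Sum>t<n. \<Sum>l<m. \<Sum>z<n. U.co l (U.b k * U.S (u e t)) * \<phi> l z * hmu H z t y)" for e k y
  have "from_U (p e)" if e: "e < n" for e
    unfolding U.intw_def
  proof (intro allI impI)
    fix k y assume k: "k < m" and y: "y < n"
    have R: "(\<Sum>t<n. U.R l (U.b k * U.S (u e t)) * u t s) = (\<Sum>k'<m. csc (U.co l (U.b k' * U.S (u e s))) (U.c k k'))"
      if l: "l < m" and s: "s < n" for l s
    proof -
      have cor: "U.corep ({..<m} \<times> {..<n}) (U.tens U.c (\<lambda>i j. U.S (u j i)))"
        by (intro U.corep_tens U.corep_c U.corep_transpose_S corep_u)
      have eq: "U.R l (U.b k * U.S (u e t)) = (\<Sum>k'<m. \<Sum>j<n. csc (U.co l (U.b k' * U.S (u e j))) (U.c k k' * U.S (u j t)))"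
        if t: "t < n" for t
      proof -
        have "U.R l (U.b k * U.S (u e t)) = U.R l ((\<Sum>i<m. csc (heps U i) (U.c k i)) * U.S (u e t))"
          using k by (simp add: U.sum_ep_c)
        also have "\<dots> = (\<Sum>i<m. csc (heps U i) (U.R l (U.tens U.c (\<lambda>i j. U.S (u j i)) (k, t) (i, e))))"
          by (simp add: sum_distrib_right U.R_sum U.tens_def)
        also have "\<dots> = (\<Sum>i<m. csc (heps U i) (\<Sum>x\<in>{..<m}\<times>{..<n}.
            csc (U.co l (U.tens U.c (\<lambda>i j. U.S (u j i)) x (i, e))) (U.tens U.c (\<lambda>i j. U.S (u j i)) (k, t) x)))"
          using k t e l by (simp add: U.corep_R[OF cor])
        also have "\<dots> = (\<Sum>x\<in>{..<m}\<times>{..<n}. csc (U.co l ((\<Sum>i<m. csc (heps U i) (U.c (fst x) i)) * U.S (u e (snd x))))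
            (U.c k (fst x) * U.S (u (snd x) t)))"
          by (simp add: csc_sum_right csc_sum_left sum_distrib_right U.co_sum U.tens_def) (rule sum.swap)
        also have "\<dots> = (\<Sum>x\<in>{..<m}\<times>{..<n}. csc (U.co l (U.b (fst x) * U.S (u e (snd x))))
            (U.c k (fst x) * U.S (u (snd x) t)))"
          by (intro sum.cong refl) (auto simp: U.sum_ep_c)
        finally show ?thesis by (simp add: sum.cartesian_product case_prod_unfold)
      qed
      have "(\<Sum>t<n. U.R l (U.b k * U.S (u e t)) * u t s)
          = (\<Sum>t<n. \<Sum>k'<m. \<Sum>j<n. csc (U.co l (U.b k' * U.S (u e j))) (U.c k k' * (U.S (u j t) * u t s)))"
        by (simp add: eq sum_distrib_right mult.assoc)
      also have "\<dots> = (\<Sum>k'<m. \<Sum>t<n. \<Sum>j<n. csc (U.co l (U.b k' * U.S (u e j))) (U.c k k' * (U.S (u j t) * u t s)))"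
        by (rule sum.swap)
      also have "\<dots> = (\<Sum>k'<m. \<Sum>j<n. \<Sum>t<n. csc (U.co l (U.b k' * U.S (u e j))) (U.c k k' * (U.S (u j t) * u t s)))"
        by (intro sum.cong refl sum.swap)
      also have "\<dots> = (\<Sum>k'<m. \<Sum>j<n. csc (U.co l (U.b k' * U.S (u e j))) (U.c k k' * (\<Sum>t<n. U.S (u j t) * u t s)))"
        by (simp add: sum_distrib_left csc_sum_right)
      also have "\<dots> = (\<Sum>k'<m. \<Sum>j<n. if j = s then csc (U.co l (U.b k' * U.S (u e j))) (U.c k k') else 0)"
        using s by (intro sum.cong refl) (simp add: U.corep_S_left[OF corep_u])
      finally show ?thesis using s by simp
    qed
    have "(\<Sum>y'<n. csc (p e k y') (u y' y))
        = (\<Sum>y'<n. \<Sum>t<n. \<Sum>l<m. \<Sum>z<n. csc (U.co l (U.b k * U.S (u e t)) * \<phi> l z) (csc (hmu H z t y') (u y' y)))"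
      by (simp add: p_def csc_sum_left)
    also have "\<dots> = (\<Sum>t<n. \<Sum>y'<n. \<Sum>l<m. \<Sum>z<n. csc (U.co l (U.b k * U.S (u e t)) * \<phi> l z) (csc (hmu H z t y') (u y' y)))"
      by (rule sum.swap)
    also have "\<dots> = (\<Sum>t<n. \<Sum>l<m. \<Sum>y'<n. \<Sum>z<n. csc (U.co l (U.b k * U.S (u e t)) * \<phi> l z) (csc (hmu H z t y') (u y' y)))"
      by (intro sum.cong refl sum.swap)
    also have "\<dots> = (\<Sum>t<n. \<Sum>l<m. \<Sum>z<n. \<Sum>y'<n. csc (U.co l (U.b k * U.S (u e t)) * \<phi> l z) (csc (hmu H z t y') (u y' y)))"
      by (intro sum.cong refl sum.swap)
    also have "\<dots> = (\<Sum>t<n. \<Sum>l<m. \<Sum>z<n. csc (U.co l (U.b k * U.S (u e t)) * \<phi> l z) (\<Sum>y'<n. csc (hmu H z t y') (u y' y)))"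
      by (simp only: csc_sum_right)
    also have "\<dots> = (\<Sum>t<n. \<Sum>l<m. \<Sum>z<n. csc (U.co l (U.b k * U.S (u e t)) * \<phi> l z)
        (\<Sum>z'<n. \<Sum>s<n. csc (hmu H z' s y) (u z z' * u t s)))"
      using y by (simp add: u_mult)
    also have "\<dots> = (\<Sum>t<n. \<Sum>l<m. \<Sum>z<n. \<Sum>z'<n. \<Sum>s<n. csc (U.co l (U.b k * U.S (u e t)) * hmu H z' s y) (csc (\<phi> l z) (u z z') * u t s))"
      by (simp add: csc_sum_right mult_ac)
    also have "\<dots> = (\<Sum>t<n. \<Sum>l<m. \<Sum>z'<n. \<Sum>s<n. \<Sum>z<n. csc (U.co l (U.b k * U.S (u e t)) * hmu H z' s y) (csc (\<phi> l z) (u z z') * u t s))"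
      by (rule sum.cong[OF refl], rule sum.cong[OF refl], rule trans[OF sum.swap], rule sum.cong[OF refl], rule sum.swap)
    also have "\<dots> = (\<Sum>t<n. \<Sum>l<m. \<Sum>z'<n. \<Sum>s<n. csc (U.co l (U.b k * U.S (u e t)) * hmu H z' s y) ((\<Sum>z<n. csc (\<phi> l z) (u z z')) * u t s))"
      by (simp only: csc_sum_right sum_distrib_right)
    also have "\<dots> = (\<Sum>t<n. \<Sum>l<m. \<Sum>z'<n. \<Sum>s<n. csc (U.co l (U.b k * U.S (u e t)) * hmu H z' s y) ((\<Sum>l'<m. csc (\<phi> l' z') (U.c l l')) * u t s))"
      using \<phi> by (simp add: U.intw_def)
    also have "\<dots> = (\<Sum>t<n. \<Sum>l<m. \<Sum>z'<n. \<Sum>s<n. \<Sum>l'<m. csc (\<phi> l' z' * hmu H z' s y) (csc (U.co l (U.b k * U.S (u e t))) (U.c l l') * u t s))"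
      by (simp add: csc_sum_right sum_distrib_right mult_ac)
    also have "\<dots> = (\<Sum>z'<n. \<Sum>s<n. \<Sum>l'<m. \<Sum>t<n. \<Sum>l<m. csc (\<phi> l' z' * hmu H z' s y) (csc (U.co l (U.b k * U.S (u e t))) (U.c l l') * u t s))"
      by (rule sum_rot5)
    also have "\<dots> = (\<Sum>z'<n. \<Sum>s<n. \<Sum>l'<m. csc (\<phi> l' z' * hmu H z' s y) (\<Sum>t<n. U.R l' (U.b k * U.S (u e t)) * u t s))"
      by (simp add: U.R_def csc_sum_right sum_distrib_right)
    also have "\<dots> = (\<Sum>z'<n. \<Sum>s<n. \<Sum>l'<m. \<Sum>k'<m. csc (U.co l' (U.b k' * U.S (u e s)) * \<phi> l' z' * hmu H z' s y) (U.c k k'))"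
      by (simp add: R csc_sum_right mult_ac)
    also have "\<dots> = (\<Sum>l'<m. \<Sum>k'<m. \<Sum>z'<n. \<Sum>s<n. csc (U.co l' (U.b k' * U.S (u e s)) * \<phi> l' z' * hmu H z' s y) (U.c k k'))"
      by (rule sum_rot4)
    also have "\<dots> = (\<Sum>k'<m. \<Sum>l'<m. \<Sum>s<n. \<Sum>z'<n. csc (U.co l' (U.b k' * U.S (u e s)) * \<phi> l' z' * hmu H z' s y) (U.c k k'))"
      by (subst sum.swap) (intro sum.cong refl sum.swap)
    also have "\<dots> = (\<Sum>k'<m. \<Sum>s<n. \<Sum>l'<m. \<Sum>z'<n. csc (U.co l' (U.b k' * U.S (u e s)) * \<phi> l' z' * hmu H z' s y) (U.c k k'))"
      by (intro sum.cong refl sum.swap)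
    also have "\<dots> = (\<Sum>k'<m. csc (p e k' y) (U.c k k'))"
      by (simp add: p_def csc_sum_left)
    finally show "(\<Sum>l<m. csc (p e l y) (U.c k l)) = (\<Sum>z<n. csc (p e k z) (u z y))" by simp
  qed
  moreover have "(\<Sum>e<n. \<Sum>k<m. U.co k (u x e) * p e k y) = (if x = y then 1 else 0)" if x: "x < n" and y: "y < n" for x y
  proof -
    have "(\<Sum>e<n. \<Sum>k<m. U.co k (u x e) * p e k y)
        = (\<Sum>e<n. \<Sum>k<m. \<Sum>t<n. \<Sum>l<m. \<Sum>z<n. U.co l (csc (U.co k (u x e)) (U.b k) * U.S (u e t)) * (\<phi> l z * hmu H z t y))"
      by (simp add: p_def sum_distrib_left mult_ac)
    also have "\<dots> = (\<Sum>t<n. \<Sum>l<m. \<Sum>z<n. \<Sum>e<n. \<Sum>k<m. U.co l (csc (U.co k (u x e)) (U.b k) * U.S (u e t)) * (\<phi> l z * hmu H z t y))"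
      by (rule sum_rot5)
    also have "\<dots> = (\<Sum>t<n. \<Sum>l<m. \<Sum>z<n. U.co l (\<Sum>e<n. (\<Sum>k<m. csc (U.co k (u x e)) (U.b k)) * U.S (u e t)) * (\<phi> l z * hmu H z t y))"
      by (simp only: U.co_sum sum_distrib_right)
    also have "\<dots> = (\<Sum>t<n. \<Sum>l<m. \<Sum>z<n. U.co l (if x = t then 1 else 0) * (\<phi> l z * hmu H z t y))"
      using x by (intro sum.cong refl) (simp add: U.spn_rep U.corep_S_right[OF corep_u])
    also have "\<dots> = (\<Sum>t<n. if x = t then \<Sum>l<m. \<Sum>z<n. heta U l * (\<phi> l z * hmu H z t y) else 0)"
      by (intro sum.cong refl) (simp add: U.co_one)
    also have "\<dots> = (\<Sum>l<m. \<Sum>z<n. heta U l * (\<phi> l z * hmu H z x y))" using x by simp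
    also have "\<dots> = (\<Sum>z<n. (\<Sum>l<m. heta U l * \<phi> l z) * hmu H z x y)"
      by (subst sum.swap) (simp add: sum_distrib_right mult.assoc)
    also have "\<dots> = (\<Sum>z<n. heta H z * hmu H z x y)" by (simp add: \<phi>1)
    finally show ?thesis using x y by (simp add: H.mu_unit_l)
  qed
  ultimately show ?thesis using that by blast
qed

end

section \<open>Matrices over a module algebra\<close>

locale mod_alg = hopf_surj H U P for H U :: hopf and P +
  fixes sc :: "complex \<Rightarrow> 'a::{ring,monoid_mult} \<Rightarrow> 'a" and act :: "(nat \<Rightarrow> complex) \<Rightarrow> 'a \<Rightarrow> 'a"
  assumes alg: "complex_algebra sc" and modalg: "dual_module_algebra U sc act"
begin

lemma sc_add_left: "sc (x + y) a = sc x a + sc y a"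
  and sc_add_right: "sc x (a + b) = sc x a + sc x b"
  and sc_sc [simp]: "sc x (sc y a) = sc (x * y) a"
  and sc_one [simp]: "sc 1 a = a"
  and sc_mult_left [simp]: "sc x a * b = sc x (a * b)"
  and sc_mult_right [simp]: "a * sc x b = sc x (a * b)"
  using alg unfolding complex_algebra_def by metis+

lemma sc_zero_left [simp]: "sc 0 a = 0"
  using sc_add_left[of 0 0 a] by simp
lemma sc_zero_right [simp]: "sc x 0 = 0"
  using sc_add_right[of x 0 0] by simp
lemma sc_sum_right: "sc x (\<Sum>i\<in>I. f i) = (\<Sum>i\<in>I. sc x (f i))"
  by (induction I rule: infinite_finite_induct) (auto simp: sc_add_right)
lemma sc_sum_left: "sc (\<Sum>i\<in>I. f i) a = (\<Sum>i\<in>I. sc (f i) a)"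
  by (induction I rule: infinite_finite_induct) (auto simp: sc_add_left)
lemma sc_delta: "finite I \<Longrightarrow> p \<in> I \<Longrightarrow> (\<Sum>i\<in>I. sc (if i = p then 1 else 0) (f i)) = f p"
    "finite I \<Longrightarrow> p \<in> I \<Longrightarrow> (\<Sum>i\<in>I. sc (if p = i then 1 else 0) (f i)) = f p"
  by (simp_all add: if_distrib if_distribR cong: if_cong)
lemma sc_minus_right: "sc x (- a) = - sc x a"
  by (metis add.right_inverse add_eq_0_iff sc_add_right sc_zero_right)
lemma sc_diff_right: "sc x (a - b) = sc x a - sc x b"
  using sc_add_right[of x a "- b"] by (simp add: sc_minus_right)

lemmas modalg_axs = modalg[unfolded dual_module_algebra_def Let_def]
lemmas act_lin = modalg_axs[THEN conjunct1, rule_format]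
  and act_add = modalg_axs[THEN conjunct2, THEN conjunct1, rule_format]
  and act_sc = modalg_axs[THEN conjunct2, THEN conjunct2, THEN conjunct1, rule_format]
  and act_unit = modalg_axs[THEN conjunct2, THEN conjunct2, THEN conjunct2, THEN conjunct1, rule_format]
  and act_conv = modalg_axs[THEN conjunct2, THEN conjunct2, THEN conjunct2, THEN conjunct2, THEN conjunct1, rule_format]
  and act_mult = modalg_axs[THEN conjunct2, THEN conjunct2, THEN conjunct2, THEN conjunct2, THEN conjunct2, THEN conjunct1, rule_format]
  and act_one = modalg_axs[THEN conjunct2, THEN conjunct2, THEN conjunct2, THEN conjunct2, THEN conjunct2, THEN conjunct2, rule_format]

lemma dvec_sum: "(\<And>i. i \<in> I \<Longrightarrow> \<beta> i \<in> dvec m) \<Longrightarrow> (\<lambda>l. \<Sum>i\<in>I. w i * \<beta> i l) \<in> dvec m"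
  by (auto simp: dvec_def)

lemma act_zero [simp]: "act (\<lambda>l. 0) a = 0"
  using act_lin[of "\<lambda>l. 0" "\<lambda>l. 0" 0 0 a] by (simp add: dvec_def)

lemma act_sum:
  assumes "\<And>i. i \<in> I \<Longrightarrow> \<beta> i \<in> dvec m"
  shows "act (\<lambda>l. \<Sum>i\<in>I. w i * \<beta> i l) a = (\<Sum>i\<in>I. sc (w i) (act (\<beta> i) a))"
  using assms
proof (induction I rule: infinite_finite_induct)
  case (insert i I)
  then show ?case
    using act_lin[of "\<beta> i" "\<lambda>l. \<Sum>i\<in>I. w i * \<beta> i l" "w i" 1 a] dvec_sum[of I \<beta> w] by simp
qed simp_all

lemma santi_inv_support: "l \<ge> m \<or> p \<ge> m \<Longrightarrow> santi_inv U l p = 0"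
proof -
  let ?P = "\<lambda>T. (\<forall>l p. (l \<ge> m \<or> p \<ge> m) \<longrightarrow> T l p = 0) \<and>
       (\<forall>l<m. \<forall>r<m. (\<Sum>p<m. T l p * hant U p r) = (if l = r then 1 else 0))"
  have "?P (santi_inv U)" unfolding santi_inv_def by (rule theI'[OF U.santi_inv_unique])
  then show "l \<ge> m \<or> p \<ge> m \<Longrightarrow> santi_inv U l p = 0" by blast
qed

text \<open>\<open>D\<close> collects the coordinates of the left coaction \<open>a \<mapsto> S\<^sup>-\<^sup>1(a\<^sub>1) \<otimes> a\<^sub>0\<close>,
  where \<open>a \<mapsto> a\<^sub>0 \<otimes> a\<^sub>1\<close> is the right coaction corresponding to the action of the dual of \<open>U\<close>.\<close>

definition D :: "nat \<Rightarrow> 'a \<Rightarrow> 'a" where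
  "D p a = act (\<lambda>l. santi_inv U l p) a"

lemma dvec_santi [simp]: "(\<lambda>l. santi_inv U l p) \<in> dvec m"
  by (simp add: dvec_def santi_inv_support)

lemma dvec_dlt [simp]: "p < m \<Longrightarrow> dlt p \<in> dvec m"
  by (auto simp: dvec_def dlt_def)

lemma D_add [simp]: "D p (a + b) = D p a + D p b"
  by (simp add: D_def act_add)
lemma D_sc [simp]: "D p (sc x a) = sc x (D p a)"
  by (simp add: D_def act_sc)
lemma D_zero [simp]: "D p 0 = 0"
  using D_sc[of p 0 0] by simp
lemma D_sum: "D p (\<Sum>i\<in>I. f i) = (\<Sum>i\<in>I. D p (f i))"
  by (induction I rule: infinite_finite_induct) auto

lemma sum_D:
  assumes "\<beta> \<in> dvec m" "\<And>l. l < m \<Longrightarrow> \<beta> l = (\<Sum>p<m. w p * santi_inv U l p)"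
  shows "(\<Sum>p<m. sc (w p) (D p a)) = act \<beta> a"
proof -
  have "\<beta> = (\<lambda>l. \<Sum>p<m. w p * santi_inv U l p)"
  proof
    fix l show "\<beta> l = (\<Sum>p<m. w p * santi_inv U l p)"
      using assms by (cases "l < m") (auto simp: dvec_def santi_inv_support)
  qed
  then have "act \<beta> a = act (\<lambda>l. \<Sum>p<m. w p * santi_inv U l p) a" by simp
  also have "\<dots> = (\<Sum>p<m. sc (w p) (D p a))"
    unfolding D_def by (rule act_sum) simp
  finally show ?thesis by simp
qed

lemma act_D:
  assumes "\<beta> \<in> dvec m"
  shows "act \<beta> a = (\<Sum>p<m. sc (U.ev \<beta> (U.S (U.b p))) (D p a))"
proof (rule sum_D[OF assms, symmetric])
  fix l assume l: "l < m"
  have "(\<Sum>p<m. U.ev \<beta> (U.S (U.b p)) * santi_inv U l p) = U.ev \<beta> (U.S (U.Si (U.b l)))"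
    using l by (simp add: U.Si_b U.S_sum U.ev_sum mult.commute)
  then show "\<beta> l = (\<Sum>p<m. U.ev \<beta> (U.S (U.b p)) * santi_inv U l p)" using l by simp
qed

lemma act_dlt: "p < m \<Longrightarrow> act (dlt p) a = (\<Sum>q<m. sc (U.co p (U.S (U.b q))) (D q a))"
proof -
  assume p: "p < m"
  have "U.ev (dlt p) g = U.co p g" for g
    using p by (simp add: U.ev_def dlt_def U.sum_delta_mult)
  then show ?thesis using p by (simp add: act_D)
qed

lemma co_Si: "l < m \<Longrightarrow> p < m \<Longrightarrow> U.co p (U.Si (U.b l)) = santi_inv U l p"
  by (simp add: U.Si_b U.co_lincomb)

lemma D_dlt: "p < m \<Longrightarrow> D p a = (\<Sum>l<m. sc (santi_inv U l p) (act (dlt l) a))"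
proof -
  assume "p < m"
  have "(\<lambda>l. santi_inv U l p) = (\<lambda>l. \<Sum>i<m. santi_inv U i p * dlt i l)"
    by (auto simp: fun_eq_iff dlt_def santi_inv_support if_distrib cong: if_cong)
  then have "D p a = act (\<lambda>l. \<Sum>i<m. santi_inv U i p * dlt i l) a" by (simp add: D_def)
  also have "\<dots> = (\<Sum>l<m. sc (santi_inv U l p) (act (dlt l) a))"
    by (rule act_sum) simp
  finally show ?thesis .
qed

lemma D_one: "s < m \<Longrightarrow> D s 1 = sc (heta U s) 1"
proof -
  assume s: "s < m"
  have "dcounit U (\<lambda>l. santi_inv U l s) = U.co s (U.Si (\<Sum>k<m. csc (heta U k) (U.b k)))"
    using s by (simp add: dcounit_def U.Si_sum U.co_sum co_Si)
  also have "\<dots> = heta U s" using s by (simp add: U.co_one flip: U.one_b)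
  finally show ?thesis by (simp add: D_def act_one)
qed

lemma D_eps: "(\<Sum>p<m. sc (heps U p) (D p a)) = a"
proof -
  have "(\<Sum>p<m. sc (heps U p) (D p a)) = act (dunit U) a"
  proof (rule sum_D)
    fix l assume l: "l < m"
    have "(\<Sum>p<m. heps U p * santi_inv U l p) = U.cou (U.Si (U.b l))"
      using l by (simp add: U.Si_b U.cou_sum mult.commute)
    then show "dunit U l = (\<Sum>p<m. heps U p * santi_inv U l p)" using l by (simp add: dunit_def)
  qed (simp add: dvec_def dunit_def)
  then show ?thesis by (simp add: act_unit)
qed

lemma D_mult:
  assumes s: "s < m"
  shows "D s (a * b) = (\<Sum>p<m. \<Sum>q<m. sc (hmu U q p s) (D p a * D q b))"
proof -
  have "(\<Sum>k<m. hmu U i j k * santi_inv U k s) = (\<Sum>p<m. \<Sum>q<m. santi_inv U j q * santi_inv U i p * hmu U q p s)"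
    if ij: "i < m" "j < m" for i j
  proof -
    have "(\<Sum>k<m. hmu U i j k * santi_inv U k s) = U.co s (U.Si (U.b i * U.b j))"
      using ij s by (simp add: U.b_mult U.Si_sum U.co_sum co_Si)
    also have "\<dots> = U.co s (U.Si (U.b j) * U.Si (U.b i))" using ij by (simp add: U.Si_mult)
    also have "\<dots> = (\<Sum>q<m. \<Sum>p<m. santi_inv U j q * santi_inv U i p * hmu U q p s)"
      using ij s by (simp add: U.co_mult co_Si mult_ac)
    also have "\<dots> = (\<Sum>p<m. \<Sum>q<m. santi_inv U j q * santi_inv U i p * hmu U q p s)"
      by (rule sum.swap)
    finally show ?thesis .
  qed
  then have "D s (a * b) = (\<Sum>i<m. \<Sum>j<m. \<Sum>p<m. \<Sum>q<m. sc (santi_inv U j q * santi_inv U i p * hmu U q p s) (act (dlt i) a * act (dlt j) b))"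
    by (simp add: D_def act_mult sc_sum_left)
  also have "\<dots> = (\<Sum>p<m. \<Sum>q<m. \<Sum>i<m. \<Sum>j<m. sc (santi_inv U j q * santi_inv U i p * hmu U q p s) (act (dlt i) a * act (dlt j) b))"
    by (rule sum_rot4)
  also have "\<dots> = (\<Sum>p<m. \<Sum>q<m. sc (hmu U q p s) (D p a * D q b))"
    by (simp add: D_dlt sum_product sc_sum_right mult_ac)
  finally show ?thesis .
qed

lemma dl_santi:
  assumes "k < m" "p < m" "q < m"
  shows "(\<Sum>i<m. \<Sum>j<m. hdelta U k i j * santi_inv U i p * santi_inv U j q) = (\<Sum>t<m. santi_inv U k t * hdelta U t q p)"
proof -
  define g where "g = U.Si (U.b k)"
  have R: "U.R i (U.b k) = (\<Sum>t<m. csc (U.co i (U.S (U.R t g))) (U.S (U.b t)))" if "i < m" for i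
    using U.R_S_eq[of g i] that assms by (simp add: g_def)
  have "(\<Sum>i<m. \<Sum>j<m. hdelta U k i j * santi_inv U i p * santi_inv U j q)
      = U.co p (U.Si (\<Sum>j<m. csc (santi_inv U j q) (U.R j (U.b k))))"
    using assms by (subst sum.swap) (simp add: U.R_b U.c_def U.Si_sum U.co_sum co_Si sum_distrib_left mult_ac)
  also have "(\<Sum>j<m. csc (santi_inv U j q) (U.R j (U.b k)))
      = (\<Sum>j<m. \<Sum>t<m. csc (santi_inv U j q * U.co j (U.S (U.R t g))) (U.S (U.b t)))"
    by (simp add: R csc_sum_right)
  also have "\<dots> = (\<Sum>t<m. csc (\<Sum>j<m. U.co j (U.S (U.R t g)) * U.co q (U.Si (U.b j))) (U.S (U.b t)))"
    using assms by (subst sum.swap) (simp add: csc_sum_left co_Si mult.commute)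
  also have "\<dots> = (\<Sum>t<m. csc (U.co q (U.R t g)) (U.S (U.b t)))"
  proof (intro sum.cong refl)
    fix t assume "t \<in> {..<m}"
    have "(\<Sum>j<m. U.co j (U.S (U.R t g)) * U.co q (U.Si (U.b j))) = U.co q (U.Si (U.S (U.R t g)))"
      by (rule U.spn_lin_expand[OF lin_compose[OF U.lin_Si U.lin_co], symmetric]) simp
    then show "csc (\<Sum>j<m. U.co j (U.S (U.R t g)) * U.co q (U.Si (U.b j))) (U.S (U.b t)) = csc (U.co q (U.R t g)) (U.S (U.b t))"
      by simp
  qed
  also have "U.co p (U.Si (\<Sum>t<m. csc (U.co q (U.R t g)) (U.S (U.b t)))) = U.co q (U.R p g)"
    using assms by (simp add: U.Si_sum U.co_lincomb)
  also have "\<dots> = (\<Sum>t<m. santi_inv U k t * hdelta U t q p)"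
    using assms by (simp add: U.R_def U.co_sum U.co_c g_def co_Si)
  finally show ?thesis .
qed

lemma D_D:
  assumes "p < m" "q < m"
  shows "D p (D q a) = (\<Sum>t<m. sc (hdelta U t q p) (D t a))"
proof -
  have "D p (D q a) = act (dconv U (\<lambda>l. santi_inv U l p) (\<lambda>l. santi_inv U l q)) a"
    by (simp add: D_def act_conv)
  also have "\<dots> = (\<Sum>t<m. sc (hdelta U t q p) (D t a))"
  proof (rule sum_D[symmetric])
    fix l assume "l < m"
    then show "dconv U (\<lambda>l. santi_inv U l p) (\<lambda>l. santi_inv U l q) l = (\<Sum>t<m. hdelta U t q p * santi_inv U l t)"
      using dl_santi[of l p q] assms by (simp add: dconv_def mult.commute)
  qed (simp add: dvec_def dconv_def)
  finally show ?thesis .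
qed

text \<open>\<open>equi a v b w T\<close>: the matrix \<open>T\<close> over \<open>A\<close> commutes with the diagonal coactions of \<open>U\<close>.
  Matrices are indexed by source and then target, and \<open>amul T T'\<close> applies \<open>T'\<close> first.\<close>

definition equi :: "nat \<Rightarrow> (nat \<Rightarrow> nat \<Rightarrow> lop) \<Rightarrow> nat \<Rightarrow> (nat \<Rightarrow> nat \<Rightarrow> lop) \<Rightarrow> (nat \<Rightarrow> nat \<Rightarrow> 'a) \<Rightarrow> bool" where
  "equi a v b w T \<longleftrightarrow> (\<forall>x<a. \<forall>j<b. \<forall>s<m. D s (T x j)
     = (\<Sum>x'<a. \<Sum>y<b. sc (U.co s (v x x' * U.S (w y j))) (T x' y)))"

lemma equi_left:
  assumes M: "U.intw a' v' a v M" and T: "equi a v b w T"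
  shows "equi a' v' b w (\<lambda>k j. \<Sum>x<a. sc (M k x) (T x j))"
  unfolding equi_def
proof (intro allI impI)
  fix k j s assume k: "k < a'" and j: "j < b" and s: "s < m"
  have "D s (\<Sum>x<a. sc (M k x) (T x j)) = (\<Sum>x<a. \<Sum>x'<a. \<Sum>y<b. sc (U.co s (csc (M k x) (v x x') * U.S (w y j))) (T x' y))"
    using T j s by (simp add: D_sum equi_def sc_sum_right)
  also have "\<dots> = (\<Sum>x'<a. \<Sum>x<a. \<Sum>y<b. sc (U.co s (csc (M k x) (v x x') * U.S (w y j))) (T x' y))"
    by (rule sum.swap)
  also have "\<dots> = (\<Sum>x'<a. \<Sum>y<b. \<Sum>x<a. sc (U.co s (csc (M k x) (v x x') * U.S (w y j))) (T x' y))"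
    by (intro sum.cong refl sum.swap)
  also have "\<dots> = (\<Sum>x'<a. \<Sum>y<b. sc (U.co s ((\<Sum>x<a. csc (M k x) (v x x')) * U.S (w y j))) (T x' y))"
    by (simp only: sum_distrib_right U.co_sum sc_sum_left)
  also have "\<dots> = (\<Sum>x'<a. \<Sum>y<b. sc (U.co s ((\<Sum>l<a'. csc (M l x') (v' k l)) * U.S (w y j))) (T x' y))"
    using M k by (simp add: U.intw_def)
  also have "\<dots> = (\<Sum>x'<a. \<Sum>y<b. \<Sum>l<a'. sc (U.co s (v' k l * U.S (w y j))) (sc (M l x') (T x' y)))"
    by (simp add: sum_distrib_right U.co_sum sc_sum_left mult.commute)
  also have "\<dots> = (\<Sum>y<b. \<Sum>x'<a. \<Sum>l<a'. sc (U.co s (v' k l * U.S (w y j))) (sc (M l x') (T x' y)))"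
    by (rule sum.swap)
  also have "\<dots> = (\<Sum>y<b. \<Sum>l<a'. \<Sum>x'<a. sc (U.co s (v' k l * U.S (w y j))) (sc (M l x') (T x' y)))"
    by (intro sum.cong refl sum.swap)
  also have "\<dots> = (\<Sum>l<a'. \<Sum>y<b. \<Sum>x'<a. sc (U.co s (v' k l * U.S (w y j))) (sc (M l x') (T x' y)))"
    by (rule sum.swap)
  finally show "D s (\<Sum>x<a. sc (M k x) (T x j)) = (\<Sum>l<a'. \<Sum>y<b. sc (U.co s (v' k l * U.S (w y j))) (\<Sum>x<a. sc (M l x) (T x y)))"
    by (simp only: sc_sum_right)
qed

lemma equi_right:
  assumes N: "U.intw b w b' w' N" and T: "equi a v b w T"
  shows "equi a v b' w' (\<lambda>x j. \<Sum>l<b. sc (N l j) (T x l))"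
  unfolding equi_def
proof (intro allI impI)
  fix x j s assume x: "x < a" and j: "j < b'" and s: "s < m"
  have "D s (\<Sum>l<b. sc (N l j) (T x l)) = (\<Sum>l<b. \<Sum>x'<a. \<Sum>y<b. sc (U.co s (v x x' * U.S (csc (N l j) (w y l)))) (T x' y))"
    using T x s by (simp add: D_sum equi_def sc_sum_right)
  also have "\<dots> = (\<Sum>x'<a. \<Sum>l<b. \<Sum>y<b. sc (U.co s (v x x' * U.S (csc (N l j) (w y l)))) (T x' y))"
    by (rule sum.swap)
  also have "\<dots> = (\<Sum>x'<a. \<Sum>y<b. \<Sum>l<b. sc (U.co s (v x x' * U.S (csc (N l j) (w y l)))) (T x' y))"
    by (intro sum.cong refl sum.swap)
  also have "\<dots> = (\<Sum>x'<a. \<Sum>y<b. sc (U.co s (v x x' * U.S (\<Sum>l<b. csc (N l j) (w y l)))) (T x' y))"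
    by (simp only: sum_distrib_left U.S_sum U.co_sum sc_sum_left)
  also have "\<dots> = (\<Sum>x'<a. \<Sum>y<b. sc (U.co s (v x x' * U.S (\<Sum>z<b'. csc (N y z) (w' z j)))) (T x' y))"
    using N j by (simp add: U.intw_def)
  also have "\<dots> = (\<Sum>x'<a. \<Sum>y<b. \<Sum>z<b'. sc (U.co s (v x x' * U.S (w' z j))) (sc (N y z) (T x' y)))"
    by (simp add: sum_distrib_left U.S_sum U.co_sum sc_sum_left mult.commute)
  also have "\<dots> = (\<Sum>x'<a. \<Sum>z<b'. \<Sum>y<b. sc (U.co s (v x x' * U.S (w' z j))) (sc (N y z) (T x' y)))"
    by (intro sum.cong refl sum.swap)
  finally show "D s (\<Sum>l<b. sc (N l j) (T x l)) = (\<Sum>x'<a. \<Sum>z<b'. sc (U.co s (v x x' * U.S (w' z j))) (\<Sum>l<b. sc (N l z) (T x' l)))"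
    by (simp only: sc_sum_right)
qed

lemma equi_scalar:
  assumes M: "U.intw a v b w M" and w: "U.corep {..<b} w"
  shows "equi a v b w (\<lambda>x j. sc (M x j) 1)"
  unfolding equi_def
proof (intro allI impI)
  fix x j s assume x: "x < a" and j: "j < b" and s: "s < m"
  have "(\<Sum>x'<a. \<Sum>y<b. sc (U.co s (v x x' * U.S (w y j))) (sc (M x' y) 1))
      = (\<Sum>y<b. \<Sum>x'<a. sc (U.co s (csc (M x' y) (v x x') * U.S (w y j))) 1)"
    by (subst sum.swap) (simp add: mult.commute)
  also have "\<dots> = (\<Sum>y<b. sc (U.co s ((\<Sum>x'<a. csc (M x' y) (v x x')) * U.S (w y j))) 1)"
    by (simp only: sum_distrib_right U.co_sum sc_sum_left)
  also have "\<dots> = (\<Sum>y<b. sc (U.co s ((\<Sum>z<b. csc (M x z) (w z y)) * U.S (w y j))) 1)"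
    using M x by (simp add: U.intw_def)
  also have "\<dots> = (\<Sum>y<b. \<Sum>z<b. sc (M x z * U.co s (w z y * U.S (w y j))) 1)"
    by (simp add: sum_distrib_right U.co_sum sc_sum_left)
  also have "\<dots> = (\<Sum>z<b. sc (M x z * U.co s (\<Sum>y<b. w z y * U.S (w y j))) 1)"
    by (subst sum.swap) (simp add: U.co_sum sc_sum_left sum_distrib_left)
  also have "\<dots> = (\<Sum>z<b. sc (if z = j then 1 else 0) (sc (M x z * heta U s) 1))"
    using j s by (intro sum.cong refl) (simp add: U.corep_S_right[OF w] U.co_one)
  also have "\<dots> = sc (M x j * heta U s) 1"
    using j by (intro sc_delta(1)) auto
  also have "\<dots> = D s (sc (M x j) 1)"
    using s by (simp add: D_one)
  finally show "D s (sc (M x j) 1) = (\<Sum>x'<a. \<Sum>y<b. sc (U.co s (v x x' * U.S (w y j))) (sc (M x' y) 1))" by simp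
qed

lemma D_mult_expand:
  assumes s: "s < m" and fin: "finite I" "finite J"
    and f: "\<And>i. i \<in> I \<Longrightarrow> f i \<in> U.spn" and g: "\<And>j. j \<in> J \<Longrightarrow> g j \<in> U.spn"
    and a: "\<And>p. p < m \<Longrightarrow> D p a = (\<Sum>i\<in>I. sc (U.co p (f i)) (a' i))"
    and b: "\<And>q. q < m \<Longrightarrow> D q b = (\<Sum>j\<in>J. sc (U.co q (g j)) (b' j))"
  shows "D s (a * b) = (\<Sum>i\<in>I. \<Sum>j\<in>J. sc (U.co s (g j * f i)) (a' i * b' j))"
proof -
  have "D s (a * b) = (\<Sum>p<m. \<Sum>q<m. \<Sum>i\<in>I. \<Sum>j\<in>J. sc (hmu U q p s * U.co q (g j) * U.co p (f i)) (a' i * b' j))"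
    using s by (simp add: D_mult a b sum_product sc_sum_right mult_ac)
  also have "\<dots> = (\<Sum>i\<in>I. \<Sum>j\<in>J. \<Sum>p<m. \<Sum>q<m. sc (hmu U q p s * U.co q (g j) * U.co p (f i)) (a' i * b' j))"
    by (rule sum_rot4)
  also have "\<dots> = (\<Sum>i\<in>I. \<Sum>j\<in>J. \<Sum>q<m. \<Sum>p<m. sc (hmu U q p s * U.co q (g j) * U.co p (f i)) (a' i * b' j))"
    by (intro sum.cong refl sum.swap)
  also have "\<dots> = (\<Sum>i\<in>I. \<Sum>j\<in>J. sc (U.co s (g j * f i)) (a' i * b' j))"
    using f g s by (intro sum.cong refl) (simp add: U.co_mult sc_sum_left)
  finally show ?thesis .
qed

lemma equi_mult:
  assumes T: "equi b w d z T" and T': "equi a v b w T'"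
    and v: "U.corep {..<a} v" and w: "U.corep {..<b} w" and z: "U.corep {..<d} z"
  shows "equi a v d z (\<lambda>x j. \<Sum>y<b. T y j * T' x y)"
  unfolding equi_def
proof (intro allI impI)
  fix x j s assume x: "x < a" and j: "j < d" and s: "s < m"
  note sp = U.corep_spn[OF v] U.corep_spn[OF w] U.corep_spn[OF z]
  have D1: "D s (T y j * T' x y) = (\<Sum>e\<in>{..<b}\<times>{..<d}. \<Sum>f\<in>{..<a}\<times>{..<b}.
      sc (U.co s (v x (fst f) * U.S (w (snd f) y) * (w y (fst e) * U.S (z (snd e) j)))) (T (fst e) (snd e) * T' (fst f) (snd f)))"
    if y: "y < b" for y
  proof (rule D_mult_expand[OF s])
    fix p assume "p < m"
    then show "D p (T y j) = (\<Sum>e\<in>{..<b}\<times>{..<d}. sc (U.co p (w y (fst e) * U.S (z (snd e) j))) (T (fst e) (snd e)))"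
      using T y j by (simp add: equi_def sum.cartesian_product case_prod_unfold)
  next
    fix p assume "p < m"
    then show "D p (T' x y) = (\<Sum>e\<in>{..<a}\<times>{..<b}. sc (U.co p (v x (fst e) * U.S (w (snd e) y))) (T' (fst e) (snd e)))"
      using T' y x by (simp add: equi_def sum.cartesian_product case_prod_unfold)
  qed (use x y sp in auto)
  have "D s (\<Sum>y<b. T y j * T' x y) = (\<Sum>y<b. \<Sum>e\<in>{..<b}\<times>{..<d}. \<Sum>f\<in>{..<a}\<times>{..<b}.
      sc (U.co s (v x (fst f) * (U.S (w (snd f) y) * w y (fst e)) * U.S (z (snd e) j))) (T (fst e) (snd e) * T' (fst f) (snd f)))"
    by (simp add: D_sum D1 mult.assoc)
  also have "\<dots> = (\<Sum>e\<in>{..<b}\<times>{..<d}. \<Sum>y<b. \<Sum>f\<in>{..<a}\<times>{..<b}.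
      sc (U.co s (v x (fst f) * (U.S (w (snd f) y) * w y (fst e)) * U.S (z (snd e) j))) (T (fst e) (snd e) * T' (fst f) (snd f)))"
    by (rule sum.swap)
  also have "\<dots> = (\<Sum>e\<in>{..<b}\<times>{..<d}. \<Sum>f\<in>{..<a}\<times>{..<b}. \<Sum>y<b.
      sc (U.co s (v x (fst f) * (U.S (w (snd f) y) * w y (fst e)) * U.S (z (snd e) j))) (T (fst e) (snd e) * T' (fst f) (snd f)))"
    by (intro sum.cong refl sum.swap)
  also have "\<dots> = (\<Sum>e\<in>{..<b}\<times>{..<d}. \<Sum>f\<in>{..<a}\<times>{..<b}.
      sc (U.co s (v x (fst f) * (\<Sum>y<b. U.S (w (snd f) y) * w y (fst e)) * U.S (z (snd e) j))) (T (fst e) (snd e) * T' (fst f) (snd f)))"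
    by (simp add: sum_distrib_left sum_distrib_right U.co_sum sc_sum_left)
  also have "\<dots> = (\<Sum>e\<in>{..<b}\<times>{..<d}. \<Sum>f\<in>{..<a}\<times>{..<b}. if snd f = fst e then
      sc (U.co s (v x (fst f) * U.S (z (snd e) j))) (T (fst e) (snd e) * T' (fst f) (snd f)) else 0)"
    by (intro sum.cong refl) (auto simp: U.corep_S_left[OF w])
  also have "\<dots> = (\<Sum>y<b. \<Sum>i<d. \<Sum>x'<a. \<Sum>y'<b. if y' = y then
      sc (U.co s (v x x' * U.S (z i j))) (T y i * T' x' y') else 0)"
    by (simp only: sum.cartesian_product' fst_conv snd_conv)
  also have "\<dots> = (\<Sum>y<b. \<Sum>i<d. \<Sum>x'<a. sc (U.co s (v x x' * U.S (z i j))) (T y i * T' x' y))"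
    by (intro sum.cong refl) simp
  also have "\<dots> = (\<Sum>y<b. \<Sum>x'<a. \<Sum>i<d. sc (U.co s (v x x' * U.S (z i j))) (T y i * T' x' y))"
    by (intro sum.cong refl sum.swap)
  also have "\<dots> = (\<Sum>x'<a. \<Sum>y<b. \<Sum>i<d. sc (U.co s (v x x' * U.S (z i j))) (T y i * T' x' y))"
    by (rule sum.swap)
  also have "\<dots> = (\<Sum>x'<a. \<Sum>i<d. \<Sum>y<b. sc (U.co s (v x x' * U.S (z i j))) (T y i * T' x' y))"
    by (intro sum.cong refl sum.swap)
  also have "\<dots> = (\<Sum>x'<a. \<Sum>i<d. sc (U.co s (v x x' * U.S (z i j))) (\<Sum>y<b. T y i * T' x' y))"
    by (simp only: sc_sum_right)
  finally show "D s (\<Sum>y<b. T y j * T' x y) = (\<Sum>x'<a. \<Sum>i<d. sc (U.co s (v x x' * U.S (z i j))) (\<Sum>y<b. T y i * T' x' y))" .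
qed

lemma equi_add:
  assumes "equi a v b w T" "equi a v b w T'"
  shows "equi a v b w (\<lambda>x j. T x j + T' x j)"
  using assms by (simp add: equi_def sc_add_right sum.distrib)

end

context fd_hopf
begin

lemma co_expand_left: "g \<in> spn \<Longrightarrow> (\<Sum>r<n. co r g * co j (b r * h)) = co j (g * h)"
  by (rule spn_lin_expand[OF lin_compose[OF lin_mult_right[OF lin_ident] lin_co], symmetric])

lemma co_expand_right: "g \<in> spn \<Longrightarrow> (\<Sum>r<n. co r g * co j (h * b r)) = co j (h * g)"
  by (rule spn_lin_expand[OF lin_compose[OF lin_mult_left[OF lin_ident] lin_co], symmetric])

lemma co_b_c: "k < n \<Longrightarrow> y < n \<Longrightarrow> co y (b k * c x l) = (\<Sum>i<n. dl x i l * mu k i y)"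
  by (simp add: c_def sum_distrib_left co_sum co_b_mult)

end

context mod_alg
begin

text \<open>\<open>Th\<close> sends \<open>\<Sum>l. s l \<otimes> \<delta>\<^sub>l\<close> to the operator \<open>x \<mapsto> \<Sum>l. s l x\<^sub>1 \<delta>\<^sub>l(x\<^sub>2)\<close> on \<open>A \<otimes> H\<close>.\<close>

definition Th :: "(nat \<Rightarrow> nat \<Rightarrow> 'a) \<Rightarrow> nat \<Rightarrow> nat \<Rightarrow> 'a" where
  "Th s x j = (\<Sum>l<n. \<Sum>a<n. sc (H.co j (H.b a * H.c x l)) (s l a))"

definition Ti :: "(nat \<Rightarrow> nat \<Rightarrow> 'a) \<Rightarrow> nat \<Rightarrow> nat \<Rightarrow> 'a" where
  "Ti T l j = (\<Sum>x<n. \<Sum>k<n. sc (H.co j (H.b k * H.Si (H.c l x))) (T x k))"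

lemma Th_cong: "(\<And>l a. l < n \<Longrightarrow> a < n \<Longrightarrow> s l a = s' l a) \<Longrightarrow> Th s x j = Th s' x j"
  by (simp add: Th_def)
lemma Ti_cong: "(\<And>l a. l < n \<Longrightarrow> a < n \<Longrightarrow> s l a = s' l a) \<Longrightarrow> Ti s x j = Ti s' x j"
  by (simp add: Ti_def)

lemma Th_Ti:
  assumes x: "x < n" and j: "j < n"
  shows "Th (Ti T) x j = T x j"
proof -
  have "Th (Ti T) x j = (\<Sum>l<n. \<Sum>a<n. \<Sum>y<n. \<Sum>k<n. sc (H.co a (H.b k * H.Si (H.c l y)) * H.co j (H.b a * H.c x l)) (T y k))"
    by (simp add: Th_def Ti_def sc_sum_right mult.commute)
  also have "\<dots> = (\<Sum>y<n. \<Sum>k<n. \<Sum>l<n. \<Sum>a<n. sc (H.co a (H.b k * H.Si (H.c l y)) * H.co j (H.b a * H.c x l)) (T y k))"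
    by (rule sum_rot4)
  also have "\<dots> = (\<Sum>y<n. \<Sum>k<n. sc (H.co j (H.b k * (\<Sum>l<n. H.Si (H.c l y) * H.c x l))) (T y k))"
    by (intro sum.cong refl) (simp add: H.co_expand_left H.co_sum sum_distrib_left mult.assoc flip: sc_sum_left)
  also have "\<dots> = (\<Sum>y<n. \<Sum>k<n. if x = y then sc (if k = j then 1 else 0) (T y k) else 0)"
    using x j by (intro sum.cong refl) (simp add: H.corep_Si_mult[OF H.corep_c] H.co_b)
  also have "\<dots> = (\<Sum>y<n. if x = y then (\<Sum>k<n. sc (if k = j then 1 else 0) (T y k)) else 0)"
    by (intro sum.cong refl) simp
  also have "\<dots> = T x j" using x j by (simp add: sc_delta)
  finally show ?thesis .
qed

lemma Ti_Th:
  assumes l: "l < n" and j: "j < n"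
  shows "Ti (Th s) l j = s l j"
proof -
  have "Ti (Th s) l j = (\<Sum>x<n. \<Sum>k<n. \<Sum>y<n. \<Sum>a<n. sc (H.co k (H.b a * H.c x y) * H.co j (H.b k * H.Si (H.c l x))) (s y a))"
    by (simp add: Th_def Ti_def sc_sum_right mult.commute)
  also have "\<dots> = (\<Sum>y<n. \<Sum>a<n. \<Sum>x<n. \<Sum>k<n. sc (H.co k (H.b a * H.c x y) * H.co j (H.b k * H.Si (H.c l x))) (s y a))"
    by (rule sum_rot4)
  also have "\<dots> = (\<Sum>y<n. \<Sum>a<n. sc (H.co j (H.b a * (\<Sum>x<n. H.c x y * H.Si (H.c l x)))) (s y a))"
    by (intro sum.cong refl) (simp add: H.co_expand_left H.co_sum sum_distrib_left mult.assoc flip: sc_sum_left)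
  also have "\<dots> = (\<Sum>y<n. \<Sum>a<n. if l = y then sc (if a = j then 1 else 0) (s y a) else 0)"
    using l j by (intro sum.cong refl) (simp add: H.corep_mult_Si[OF H.corep_c] H.co_b)
  also have "\<dots> = (\<Sum>y<n. if l = y then (\<Sum>a<n. sc (if a = j then 1 else 0) (s y a)) else 0)"
    by (intro sum.cong refl) simp
  also have "\<dots> = s l j" using l j by (simp add: sc_delta)
  finally show ?thesis .
qed

lemma Th_equivariance_key:
  assumes l: "l < n" and k: "k < n" and x: "x < n" and j: "j < n"
  shows "(\<Sum>a<n. csc (H.co j (H.b a * H.c x l)) (U.S (u k a)))
    = (\<Sum>x'<n. \<Sum>y<n. csc (H.co y (H.b k * H.c x' l)) (u x x' * U.S (u y j)))"
proof -
  have "(\<Sum>x'<n. \<Sum>y<n. csc (H.co y (H.b k * H.c x' l)) (u x x' * U.S (u y j)))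
      = (\<Sum>x'<n. \<Sum>y<n. \<Sum>i<n. csc (hdelta H x' i l) (u x x') * U.S (csc (hmu H k i y) (u y j)))"
    using k by (simp add: H.co_b_c csc_sum_left mult.commute)
  also have "\<dots> = (\<Sum>x'<n. \<Sum>i<n. \<Sum>y<n. csc (hdelta H x' i l) (u x x') * U.S (csc (hmu H k i y) (u y j)))"
    by (intro sum.cong refl sum.swap)
  also have "\<dots> = (\<Sum>i<n. \<Sum>x'<n. \<Sum>y<n. csc (hdelta H x' i l) (u x x') * U.S (csc (hmu H k i y) (u y j)))"
    by (rule sum.swap)
  also have "\<dots> = (\<Sum>i<n. (\<Sum>x'<n. csc (hdelta H x' i l) (u x x')) * U.S (\<Sum>y<n. csc (hmu H k i y) (u y j)))"
    by (simp only: sum_product U.S_sum)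
  also have "\<dots> = (\<Sum>i<n. (\<Sum>t<n. csc (hdelta H x t l) (u t i)) * U.S (\<Sum>p<n. \<Sum>q<n. csc (hmu H p q j) (u k p * u i q)))"
    using l k x j by (simp add: dl_u u_mult)
  also have "\<dots> = (\<Sum>i<n. \<Sum>t<n. \<Sum>p<n. \<Sum>q<n. csc (hdelta H x t l * hmu H p q j) (u t i * U.S (u i q) * U.S (u k p)))"
    unfolding U.S_sum sum_product
    by (simp add: U.S_mult sum_distrib_left mult.assoc mult.commute[of "hmu _ _ _ _"])
  also have "\<dots> = (\<Sum>t<n. \<Sum>i<n. \<Sum>p<n. \<Sum>q<n. csc (hdelta H x t l * hmu H p q j) (u t i * U.S (u i q) * U.S (u k p)))"
    by (rule sum.swap)
  also have "\<dots> = (\<Sum>t<n. \<Sum>p<n. \<Sum>i<n. \<Sum>q<n. csc (hdelta H x t l * hmu H p q j) (u t i * U.S (u i q) * U.S (u k p)))"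
    by (intro sum.cong refl sum.swap)
  also have "\<dots> = (\<Sum>t<n. \<Sum>p<n. \<Sum>q<n. \<Sum>i<n. csc (hdelta H x t l * hmu H p q j) (u t i * U.S (u i q) * U.S (u k p)))"
    by (intro sum.cong refl sum.swap)
  also have "\<dots> = (\<Sum>t<n. \<Sum>p<n. \<Sum>q<n. csc (hdelta H x t l * hmu H p q j) ((\<Sum>i<n. u t i * U.S (u i q)) * U.S (u k p)))"
    by (simp only: csc_sum_right sum_distrib_right)
  also have "\<dots> = (\<Sum>t<n. \<Sum>p<n. \<Sum>q<n. if t = q then csc (hdelta H x t l * hmu H p q j) (U.S (u k p)) else 0)"
    by (intro sum.cong refl) (simp add: U.corep_S_right[OF corep_u])
  also have "\<dots> = (\<Sum>t<n. \<Sum>p<n. csc (hdelta H x t l * hmu H p t j) (U.S (u k p)))"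
    by (intro sum.cong refl) simp
  also have "\<dots> = (\<Sum>p<n. \<Sum>t<n. csc (hdelta H x t l * hmu H p t j) (U.S (u k p)))"
    by (rule sum.swap)
  also have "\<dots> = (\<Sum>a<n. csc (H.co j (H.b a * H.c x l)) (U.S (u k a)))"
    using j by (simp add: H.co_b_c csc_sum_left)
  finally show ?thesis by simp
qed

definition invd :: "(nat \<Rightarrow> 'a) \<Rightarrow> bool" where
  "invd z \<longleftrightarrow> (\<forall>j<n. \<forall>r<m. D r (z j) = (\<Sum>k<n. sc (U.co r (U.S (u k j))) (z k)))"

lemma Th_defect:
  assumes r: "r < m" and x: "x < n" and j: "j < n"
  shows "Th (\<lambda>l a. D r (s l a) - (\<Sum>k<n. sc (U.co r (U.S (u k a))) (s l k))) x j
    = D r (Th s x j) - (\<Sum>x'<n. \<Sum>y<n. sc (U.co r (u x x' * U.S (u y j))) (Th s x' y))"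
proof -
  have "(\<Sum>l<n. \<Sum>a<n. sc (H.co j (H.b a * H.c x l)) (\<Sum>k<n. sc (U.co r (U.S (u k a))) (s l k)))
      = (\<Sum>l<n. \<Sum>k<n. \<Sum>a<n. sc (U.co r (csc (H.co j (H.b a * H.c x l)) (U.S (u k a)))) (s l k))"
    unfolding sc_sum_right by (simp, rule sum.cong[OF refl], rule sum.swap)
  also have "\<dots> = (\<Sum>l<n. \<Sum>k<n. sc (U.co r (\<Sum>a<n. csc (H.co j (H.b a * H.c x l)) (U.S (u k a)))) (s l k))"
    by (simp only: U.co_sum sc_sum_left)
  also have "\<dots> = (\<Sum>l<n. \<Sum>k<n. sc (U.co r (\<Sum>x'<n. \<Sum>y<n. csc (H.co y (H.b k * H.c x' l)) (u x x' * U.S (u y j)))) (s l k))"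
    using x j by (simp add: Th_equivariance_key)
  also have "\<dots> = (\<Sum>l<n. \<Sum>k<n. \<Sum>x'<n. \<Sum>y<n. sc (U.co r (u x x' * U.S (u y j))) (sc (H.co y (H.b k * H.c x' l)) (s l k)))"
    by (simp add: U.co_sum sc_sum_left mult.commute)
  also have "\<dots> = (\<Sum>x'<n. \<Sum>y<n. \<Sum>l<n. \<Sum>k<n. sc (U.co r (u x x' * U.S (u y j))) (sc (H.co y (H.b k * H.c x' l)) (s l k)))"
    by (rule sum_rot4)
  also have "\<dots> = (\<Sum>x'<n. \<Sum>y<n. sc (U.co r (u x x' * U.S (u y j))) (Th s x' y))"
    by (simp only: Th_def sc_sum_right)
  finally show ?thesis
    by (simp add: Th_def sc_diff_right sum_subtractf D_sum)
qed

lemma invd_iff_equi: "(\<forall>l<n. invd (s l)) \<longleftrightarrow> equi n u n u (Th s)"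
proof
  define E where "E r = (\<lambda>l a. D r (s l a) - (\<Sum>k<n. sc (U.co r (U.S (u k a))) (s l k)))" for r
  {
    assume "\<forall>l<n. invd (s l)"
    then have "E r l a = 0" if "r < m" "l < n" "a < n" for r l a
      using that by (simp add: E_def invd_def)
    then have "Th (E r) x j = 0" if "r < m" for r x j using that by (simp add: Th_def)
    then have "D r (Th s x j) - (\<Sum>x'<n. \<Sum>y<n. sc (U.co r (u x x' * U.S (u y j))) (Th s x' y)) = 0"
      if "r < m" "x < n" "j < n" for r x j
      using that unfolding E_def by (simp flip: Th_defect)
    then show "equi n u n u (Th s)"
      unfolding equi_def by simp
  next
    assume "equi n u n u (Th s)"
    then have "Th (E r) x j = 0" if "r < m" "x < n" "j < n" for r x j
      using that unfolding E_def by (simp add: Th_defect equi_def)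
    then have TE: "Ti (Th (E r)) l a = 0" if "r < m" for r l a using that by (simp add: Ti_def)
    have "E r l a = 0" if "r < m" "l < n" "a < n" for r l a
      using TE[OF that(1), of l a] that by (simp add: Ti_Th)
    then show "\<forall>l<n. invd (s l)" by (simp add: E_def invd_def)
  }
qed

lemma ract_eq:
  assumes j: "j < n"
  shows "ract H U P sc act z \<beta> j = (\<Sum>k<n. \<Sum>p<m. sc (U.ev \<beta> (U.b p * u k j)) (D p (z k)))"
proof -
  have "U.ev \<beta> (U.b p * u k j) = (\<Sum>q<m. \<Sum>i<n. (\<Sum>s<m. hmu U p q s * \<beta> s) * hdelta H k i j * P i q)"
    if "p < m" for p k
  proof -
    have "U.ev \<beta> (U.b p * u k j) = (\<Sum>i<n. \<Sum>q<m. hdelta H k i j * P i q * U.ev \<beta> (U.b p * U.b q))"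
      by (simp add: u_def pi_def sum_distrib_left U.ev_sum csc_sum_right mult_ac)
    also have "\<dots> = (\<Sum>q<m. \<Sum>i<n. hdelta H k i j * P i q * U.ev \<beta> (U.b p * U.b q))"
      by (rule sum.swap)
    also have "\<dots> = (\<Sum>q<m. \<Sum>i<n. (\<Sum>s<m. hmu U p q s * \<beta> s) * hdelta H k i j * P i q)"
      using that by (simp add: U.ev_def U.co_b_mult mult_ac)
    finally show ?thesis .
  qed
  then show ?thesis using j by (simp add: ract_def D_def sc_sum_left)
qed

lemma ev_one: "U.ev \<beta> 1 = dcounit U \<beta>"
  by (simp add: U.ev_def dcounit_def U.co_one mult.commute)

lemma invariants_iff: "z \<in> invariants H U P sc act \<longleftrightarrow> (\<forall>k\<ge>n. z k = 0) \<and> invd z"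
proof (cases "\<forall>k\<ge>n. z k = 0")
  case supp: True
  have "(\<forall>\<beta>\<in>dvec m. ract H U P sc act z \<beta> = (\<lambda>j. sc (dcounit U \<beta>) (z j))) \<longleftrightarrow> invd z"
  proof
    assume inv: "\<forall>\<beta>\<in>dvec m. ract H U P sc act z \<beta> = (\<lambda>j. sc (dcounit U \<beta>) (z j))"
    show "invd z"
      unfolding invd_def
    proof (intro allI impI)
      fix t s assume t: "t < n" and s: "s < m"
      define \<beta> where "\<beta> j l = (if l < m then U.co s (U.b l * U.S (u j t)) else 0)" for j l
      have \<beta>: "\<beta> j \<in> dvec m" for j by (simp add: dvec_def \<beta>_def)
      have ev: "U.ev (\<beta> j) g = U.co s (g * U.S (u j t))" if "g \<in> U.spn" for j g
        using U.co_expand_left[OF that, of s] by (simp add: U.ev_def \<beta>_def mult.commute)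
      have "D s (z t) = (\<Sum>k<n. if k = t then D s (z k) else 0)" using t by simp
      also have "\<dots> = (\<Sum>k<n. if k = t then (\<Sum>p<m. sc (U.co s (U.b p)) (D p (z k))) else 0)"
        using s by (intro sum.cong refl) (simp add: U.co_b sc_delta)
      also have "\<dots> = (\<Sum>k<n. \<Sum>p<m. sc (U.co s (U.b p * (if k = t then 1 else 0))) (D p (z k)))"
        by (intro sum.cong refl) simp
      also have "\<dots> = (\<Sum>k<n. \<Sum>p<m. sc (U.co s (U.b p * (\<Sum>j<n. u k j * U.S (u j t)))) (D p (z k)))"
        using t by (simp add: U.corep_S_right[OF corep_u])
      also have "\<dots> = (\<Sum>k<n. \<Sum>p<m. \<Sum>j<n. sc (U.ev (\<beta> j) (U.b p * u k j)) (D p (z k)))"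
        by (simp add: ev sum_distrib_left U.co_sum sc_sum_left mult.assoc)
      also have "\<dots> = (\<Sum>k<n. \<Sum>j<n. \<Sum>p<m. sc (U.ev (\<beta> j) (U.b p * u k j)) (D p (z k)))"
        by (intro sum.cong refl sum.swap)
      also have "\<dots> = (\<Sum>j<n. \<Sum>k<n. \<Sum>p<m. sc (U.ev (\<beta> j) (U.b p * u k j)) (D p (z k)))"
        by (rule sum.swap)
      also have "\<dots> = (\<Sum>j<n. ract H U P sc act z (\<beta> j) j)"
        by (simp add: ract_eq)
      also have "\<dots> = (\<Sum>j<n. sc (U.ev (\<beta> j) 1) (z j))"
        using inv \<beta> by (simp add: ev_one)
      also have "\<dots> = (\<Sum>j<n. sc (U.co s (U.S (u j t))) (z j))" by (simp add: ev)
      finally show "D s (z t) = (\<Sum>k<n. sc (U.co s (U.S (u k t))) (z k))" .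
    qed
  next
    assume inv: "invd z"
    show "\<forall>\<beta>\<in>dvec m. ract H U P sc act z \<beta> = (\<lambda>j. sc (dcounit U \<beta>) (z j))"
    proof (intro ballI ext)
      fix \<beta> j assume "\<beta> \<in> dvec m"
      show "ract H U P sc act z \<beta> j = sc (dcounit U \<beta>) (z j)"
      proof (cases "j < n")
        case j: True
        have "ract H U P sc act z \<beta> j = (\<Sum>k<n. \<Sum>p<m. \<Sum>i<n. sc (U.ev \<beta> (csc (U.co p (U.S (u i k))) (U.b p) * u k j)) (z i))"
          using j inv by (simp add: ract_eq invd_def sc_sum_right mult.commute)
        also have "\<dots> = (\<Sum>k<n. \<Sum>i<n. \<Sum>p<m. sc (U.ev \<beta> (csc (U.co p (U.S (u i k))) (U.b p) * u k j)) (z i))"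
          by (intro sum.cong refl sum.swap)
        also have "\<dots> = (\<Sum>i<n. \<Sum>k<n. \<Sum>p<m. sc (U.ev \<beta> (csc (U.co p (U.S (u i k))) (U.b p) * u k j)) (z i))"
          by (rule sum.swap)
        also have "\<dots> = (\<Sum>i<n. sc (U.ev \<beta> (\<Sum>k<n. (\<Sum>p<m. csc (U.co p (U.S (u i k))) (U.b p)) * u k j)) (z i))"
          by (simp only: U.ev_sum sum_distrib_right sc_sum_left)
        also have "\<dots> = (\<Sum>i<n. sc (U.ev \<beta> (if i = j then 1 else 0)) (z i))"
          using j by (intro sum.cong refl) (simp add: U.spn_rep U.corep_S_left[OF corep_u])
        also have "\<dots> = (\<Sum>i<n. if i = j then sc (U.ev \<beta> 1) (z i) else 0)"
          by (intro sum.cong refl) simp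
        finally show ?thesis using j by (simp add: ev_one)
      qed (use supp in \<open>simp add: ract_def\<close>)
    qed
  qed
  then show ?thesis using supp by (simp add: invariants_def)
qed (auto simp: invariants_def)

lemma smashH_mult_entry:
  assumes k: "k < n" and r: "r < n"
  shows "(w \<otimes>\<^bsub>smashH H U P sc act\<^esub> w') k r
    = (\<Sum>i<n. \<Sum>j<n. \<Sum>a<n. \<Sum>f<n.
        sc (H.co r (H.b a * (\<Sum>p<n. \<Sum>q<n. csc (hmu H p q i * hdelta H k q j) (H.c f p)))) (w i a * w' j f))"
proof -
  have 1: "tmul H sc y (hact H sc (dlt p) z) r = (\<Sum>a<n. \<Sum>f<n. sc (H.co r (H.b a * H.c f p)) (y a * z f))"
    if p: "p < n" for y z p
  proof -
    have "hact H sc (dlt p) z e = (\<Sum>f<n. sc (hdelta H f e p) (z f))" if "e < n" for e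
      using that p by (simp add: hact_def dlt_def if_distrib if_distribR cong: if_cong)
    then have "tmul H sc y (hact H sc (dlt p) z) r = (\<Sum>a<n. \<Sum>e<n. \<Sum>f<n. sc (hmu H a e r * hdelta H f e p) (y a * z f))"
      using r by (simp add: tmul_def sum_distrib_left sc_sum_right)
    also have "\<dots> = (\<Sum>a<n. \<Sum>f<n. \<Sum>e<n. sc (hmu H a e r * hdelta H f e p) (y a * z f))"
      by (intro sum.cong refl sum.swap)
    also have "\<dots> = (\<Sum>a<n. \<Sum>f<n. sc (H.co r (H.b a * H.c f p)) (y a * z f))"
      using r by (simp add: H.co_b_c sc_sum_left mult.commute)
    finally show ?thesis .
  qed
  have "(w \<otimes>\<^bsub>smashH H U P sc act\<^esub> w') k r
    = (\<Sum>i<n. \<Sum>j<n. \<Sum>p<n. \<Sum>q<n. \<Sum>a<n. \<Sum>f<n.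
        sc (H.co r (H.b a * csc (hmu H p q i * hdelta H k q j) (H.c f p))) (w i a * w' j f))"
    using k by (simp add: smashH_def Let_def 1 sc_sum_right)
  also have "\<dots> = (\<Sum>i<n. \<Sum>j<n. \<Sum>a<n. \<Sum>f<n. \<Sum>p<n. \<Sum>q<n.
        sc (H.co r (H.b a * csc (hmu H p q i * hdelta H k q j) (H.c f p))) (w i a * w' j f))"
    by (rule sum.cong[OF refl], rule sum.cong[OF refl], rule sum_rot4)
  finally show ?thesis by (simp only: sum_distrib_left H.co_sum sc_sum_left)
qed

lemma Th_mult:
  assumes x: "x < n" and y: "y < n"
  shows "Th (w \<otimes>\<^bsub>smashH H U P sc act\<^esub> w') x y = (\<Sum>z<n. Th w z y * Th w' x z)"
proof -
  define K where "K k i j f = (\<Sum>p<n. \<Sum>q<n. csc (hmu H p q i * hdelta H k q j) (H.c f p))" for k i j f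
  have sK [simp]: "K k i j f \<in> H.spn" for k i j f by (simp add: K_def)
  have KR: "(\<Sum>k<n. K k i j f * H.c x k) = H.R i (H.b f * H.c x j)" if "i < n" "j < n" "f < n" for i j f
  proof -
    have "H.R i (H.b f * H.c x j) = (\<Sum>p<n. \<Sum>q<n. csc (hmu H p q i) (H.c f p * (\<Sum>k<n. csc (hdelta H k q j) (H.c x k))))"
      using that x by (simp add: H.R_mult H.R_b H.corep_R[OF H.corep_c] H.co_c)
    also have "\<dots> = (\<Sum>p<n. \<Sum>q<n. \<Sum>k<n. csc (hmu H p q i * hdelta H k q j) (H.c f p * H.c x k))"
      by (simp add: sum_distrib_left csc_sum_right)
    also have "\<dots> = (\<Sum>p<n. \<Sum>k<n. \<Sum>q<n. csc (hmu H p q i * hdelta H k q j) (H.c f p * H.c x k))"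
      by (intro sum.cong refl sum.swap)
    also have "\<dots> = (\<Sum>k<n. \<Sum>p<n. \<Sum>q<n. csc (hmu H p q i * hdelta H k q j) (H.c f p * H.c x k))"
      by (rule sum.swap)
    also have "\<dots> = (\<Sum>k<n. K k i j f * H.c x k)"
      by (simp add: K_def sum_distrib_right)
    finally show ?thesis by simp
  qed
  have "Th (w \<otimes>\<^bsub>smashH H U P sc act\<^esub> w') x y
    = (\<Sum>k<n. \<Sum>r<n. \<Sum>i<n. \<Sum>j<n. \<Sum>a<n. \<Sum>f<n.
        sc (H.co r (H.b a * K k i j f) * H.co y (H.b r * H.c x k)) (w i a * w' j f))"
    by (simp add: Th_def smashH_mult_entry[folded K_def] sc_sum_right mult.commute[of "H.co y _"])
  also have "\<dots> = (\<Sum>i<n. \<Sum>j<n. \<Sum>k<n. \<Sum>r<n. \<Sum>a<n. \<Sum>f<n.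
        sc (H.co r (H.b a * K k i j f) * H.co y (H.b r * H.c x k)) (w i a * w' j f))"
    by (rule sum_rot4)
  also have "\<dots> = (\<Sum>i<n. \<Sum>j<n. \<Sum>a<n. \<Sum>f<n. \<Sum>k<n. \<Sum>r<n.
        sc (H.co r (H.b a * K k i j f) * H.co y (H.b r * H.c x k)) (w i a * w' j f))"
    by (rule sum.cong[OF refl], rule sum.cong[OF refl], rule sum_rot4)
  also have "\<dots> = (\<Sum>i<n. \<Sum>j<n. \<Sum>a<n. \<Sum>f<n. \<Sum>k<n. sc (H.co y (H.b a * (K k i j f * H.c x k))) (w i a * w' j f))"
    by (simp add: H.co_expand_left mult.assoc flip: sc_sum_left)
  also have "\<dots> = (\<Sum>i<n. \<Sum>j<n. \<Sum>a<n. \<Sum>f<n. sc (H.co y (H.b a * H.R i (H.b f * H.c x j))) (w i a * w' j f))"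
    by (simp add: KR flip: H.co_sum sc_sum_left sum_distrib_left)
  also have "\<dots> = (\<Sum>i<n. \<Sum>j<n. \<Sum>a<n. \<Sum>f<n. \<Sum>z<n. sc (H.co y (H.b a * H.c z i) * H.co z (H.b f * H.c x j)) (w i a * w' j f))"
    by (simp add: H.R_def sum_distrib_left H.co_sum sc_sum_left mult.commute)
  also have "\<dots> = (\<Sum>i<n. \<Sum>j<n. \<Sum>a<n. \<Sum>z<n. \<Sum>f<n. sc (H.co y (H.b a * H.c z i) * H.co z (H.b f * H.c x j)) (w i a * w' j f))"
    by (intro sum.cong refl sum.swap)
  also have "\<dots> = (\<Sum>i<n. \<Sum>j<n. \<Sum>z<n. \<Sum>a<n. \<Sum>f<n. sc (H.co y (H.b a * H.c z i) * H.co z (H.b f * H.c x j)) (w i a * w' j f))"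
    by (intro sum.cong refl sum.swap)
  also have "\<dots> = (\<Sum>i<n. \<Sum>z<n. \<Sum>j<n. \<Sum>a<n. \<Sum>f<n. sc (H.co y (H.b a * H.c z i) * H.co z (H.b f * H.c x j)) (w i a * w' j f))"
    by (intro sum.cong refl sum.swap)
  also have "\<dots> = (\<Sum>z<n. \<Sum>i<n. \<Sum>j<n. \<Sum>a<n. \<Sum>f<n. sc (H.co y (H.b a * H.c z i) * H.co z (H.b f * H.c x j)) (w i a * w' j f))"
    by (rule sum.swap)
  also have "\<dots> = (\<Sum>z<n. Th w z y * Th w' x z)"
    unfolding Th_def sum_product by (simp add: mult.commute)
  finally show ?thesis .
qed

end

context fd_hopf
begin

lemma R_SS_b:
  assumes j: "j < n" and k: "k < n"
  shows "R j (S (S (b k))) = (\<Sum>z<n. csc (co j (S (S (b z)))) (S (S (c k z))))"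
proof -
  have "R j (S (S (b k))) = (\<Sum>i<n. csc (ep i) (R j (S (S (c k i)))))"
    using sum_ep_c[OF k, symmetric] by (simp add: S_sum R_sum)
  also have "\<dots> = (\<Sum>i<n. \<Sum>z<n. csc (ep i) (csc (co j (S (S (c z i)))) (S (S (c k z)))))"
    using j k by (simp add: corep_R[OF corep_SS[OF corep_c]] csc_sum_right)
  also have "\<dots> = (\<Sum>z<n. csc (co j (S (S (\<Sum>i<n. csc (ep i) (c z i))))) (S (S (c k z))))"
    by (subst sum.swap) (simp add: S_sum co_sum csc_sum_left)
  finally show ?thesis by (simp add: sum_ep_c)
qed

end

context mod_alg
begin

text \<open>Reading \<open>r\<close> as the linear map \<open>b k \<mapsto> r k\<close> from \<open>U\<close> to \<open>A\<close>, \<open>kap\<close> and \<open>kapi\<close> are the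
  precompositions with \<open>S\<^sup>2\<close> and its inverse.\<close>

definition kap :: "(nat \<Rightarrow> 'a) \<Rightarrow> nat \<Rightarrow> 'a" where
  "kap r k = (\<Sum>v<m. sc (U.co v (U.S (U.S (U.b k)))) (r v))"

definition kapi :: "(nat \<Rightarrow> 'a) \<Rightarrow> nat \<Rightarrow> 'a" where
  "kapi t v = (\<Sum>k<m. sc (U.co k (U.Si (U.Si (U.b v)))) (t k))"

lemma kap_kapi: "k < m \<Longrightarrow> kap (kapi t) k = t k"
proof -
  assume k: "k < m"
  have "kap (kapi t) k = (\<Sum>v<m. \<Sum>j<m. sc (U.co v (U.S (U.S (U.b k))) * U.co j (U.Si (U.Si (U.b v)))) (t j))"
    by (simp add: kap_def kapi_def sc_sum_right)
  also have "\<dots> = (\<Sum>j<m. sc (\<Sum>v<m. U.co v (U.S (U.S (U.b k))) * U.co j (U.Si (U.Si (U.b v)))) (t j))"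
    by (subst sum.swap) (simp add: sc_sum_left)
  also have "\<dots> = (\<Sum>j<m. sc (U.co j (U.Si (U.Si (U.S (U.S (U.b k)))))) (t j))"
    by (intro sum.cong refl arg_cong2[of _ _ _ _ sc] U.spn_lin_expand[symmetric]
        lin_compose[OF U.lin_Si lin_compose[OF U.lin_Si U.lin_co]]) simp
  also have "\<dots> = t k" using k by (simp add: U.co_b sc_delta)
  finally show ?thesis .
qed

lemma kapi_kap: "k < m \<Longrightarrow> kapi (kap t) k = t k"
proof -
  assume k: "k < m"
  have "kapi (kap t) k = (\<Sum>v<m. \<Sum>j<m. sc (U.co v (U.Si (U.Si (U.b k))) * U.co j (U.S (U.S (U.b v)))) (t j))"
    by (simp add: kap_def kapi_def sc_sum_right)
  also have "\<dots> = (\<Sum>j<m. sc (\<Sum>v<m. U.co v (U.Si (U.Si (U.b k))) * U.co j (U.S (U.S (U.b v)))) (t j))"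
    by (subst sum.swap) (simp add: sc_sum_left)
  also have "\<dots> = (\<Sum>j<m. sc (U.co j (U.S (U.S (U.Si (U.Si (U.b k)))))) (t j))"
    by (intro sum.cong refl arg_cong2[of _ _ _ _ sc] U.spn_lin_expand[symmetric]
        lin_compose[OF U.lin_S lin_compose[OF U.lin_S U.lin_co]]) simp
  also have "\<dots> = t k" using k by (simp add: U.co_b sc_delta)
  finally show ?thesis .
qed

lemma D_counit:
  assumes Z: "equi m U.c m U.c Z" and k: "k < m" and q: "q < m"
  shows "D q (\<Sum>l<m. sc (heps U l) (Z k l)) = (\<Sum>z<m. \<Sum>y<m. sc (U.co q (U.c k z * U.S (U.b y))) (Z z y))"
proof -
  have "D q (\<Sum>l<m. sc (heps U l) (Z k l)) = (\<Sum>l<m. \<Sum>z<m. \<Sum>y<m. sc (U.co q (U.c k z * U.S (csc (heps U l) (U.c y l)))) (Z z y))"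
    using Z k q by (simp add: D_sum equi_def sc_sum_right)
  also have "\<dots> = (\<Sum>z<m. \<Sum>l<m. \<Sum>y<m. sc (U.co q (U.c k z * U.S (csc (heps U l) (U.c y l)))) (Z z y))"
    by (rule sum.swap)
  also have "\<dots> = (\<Sum>z<m. \<Sum>y<m. \<Sum>l<m. sc (U.co q (U.c k z * U.S (csc (heps U l) (U.c y l)))) (Z z y))"
    by (intro sum.cong refl sum.swap)
  also have "\<dots> = (\<Sum>z<m. \<Sum>y<m. sc (U.co q (U.c k z * U.S (\<Sum>l<m. csc (heps U l) (U.c y l)))) (Z z y))"
    by (simp only: U.S_sum sum_distrib_left U.co_sum sc_sum_left)
  finally show ?thesis by (simp add: U.sum_ep_c)
qed

lemma act_counit:
  assumes Z: "equi m U.c m U.c Z" and k: "k < m" and p: "p < m"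
  shows "act (dlt p) (\<Sum>l<m. sc (heps U l) (Z k l))
    = (\<Sum>z<m. \<Sum>y<m. sc (U.co p (U.S (U.S (U.b y)) * U.S (U.c k z))) (Z z y))"
proof -
  have "act (dlt p) (\<Sum>l<m. sc (heps U l) (Z k l))
      = (\<Sum>q<m. \<Sum>z<m. \<Sum>y<m. sc (U.co q (U.c k z * U.S (U.b y)) * U.co p (U.S (U.b q))) (Z z y))"
    using p by (simp add: act_dlt D_counit[OF Z k] sc_sum_right mult.commute)
  also have "\<dots> = (\<Sum>z<m. \<Sum>q<m. \<Sum>y<m. sc (U.co q (U.c k z * U.S (U.b y)) * U.co p (U.S (U.b q))) (Z z y))"
    by (rule sum.swap)
  also have "\<dots> = (\<Sum>z<m. \<Sum>y<m. \<Sum>q<m. sc (U.co q (U.c k z * U.S (U.b y)) * U.co p (U.S (U.b q))) (Z z y))"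
    by (intro sum.cong refl sum.swap)
  also have "\<dots> = (\<Sum>z<m. \<Sum>y<m. sc (U.co p (U.S (U.c k z * U.S (U.b y)))) (Z z y))"
    unfolding sc_sum_left[symmetric]
    by (intro sum.cong refl arg_cong2[of _ _ _ _ sc] U.spn_lin_expand[symmetric]
        lin_compose[OF U.lin_S U.lin_co]) simp
  finally show ?thesis by (simp add: U.S_mult)
qed

lemma act_dlt_sum: "p < m \<Longrightarrow> act (dlt p) (\<Sum>i\<in>I. sc (w i) (f i)) = (\<Sum>i\<in>I. sc (w i) (act (dlt p) (f i)))"
  by (simp add: act_dlt D_sum sc_sum_right mult.commute) (rule sum.swap)

lemma kap_smashU_mult:
  assumes Z: "equi m U.c m U.c Z" and r': "\<And>z. z < m \<Longrightarrow> kap r' z = (\<Sum>l<m. sc (heps U l) (Z z l))"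
    and k: "k < m"
  shows "kap (r \<otimes>\<^bsub>smashU U sc act\<^esub> r') k = (\<Sum>y<m. kap r y * Z k y)"
proof -
  let ?g = "U.S (U.S (U.b k))" and ?h = "\<lambda>z. U.S (U.S (U.c k z))"
  have "kap (r \<otimes>\<^bsub>smashU U sc act\<^esub> r') k
    = (\<Sum>v<m. \<Sum>i<m. \<Sum>j<m. \<Sum>p<m. \<Sum>q<m. sc (hmu U p q i * (U.co v ?g * hdelta U v q j)) (r i * act (dlt p) (r' j)))"
    by (simp add: kap_def smashU_def Let_def sc_sum_right mult_ac)
  also have "\<dots> = (\<Sum>i<m. \<Sum>v<m. \<Sum>j<m. \<Sum>p<m. \<Sum>q<m. sc (hmu U p q i * (U.co v ?g * hdelta U v q j)) (r i * act (dlt p) (r' j)))"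
    by (rule sum.swap)
  also have "\<dots> = (\<Sum>i<m. \<Sum>j<m. \<Sum>v<m. \<Sum>p<m. \<Sum>q<m. sc (hmu U p q i * (U.co v ?g * hdelta U v q j)) (r i * act (dlt p) (r' j)))"
    by (intro sum.cong refl sum.swap)
  also have "\<dots> = (\<Sum>i<m. \<Sum>j<m. \<Sum>p<m. \<Sum>v<m. \<Sum>q<m. sc (hmu U p q i * (U.co v ?g * hdelta U v q j)) (r i * act (dlt p) (r' j)))"
    by (intro sum.cong refl sum.swap)
  also have "\<dots> = (\<Sum>i<m. \<Sum>j<m. \<Sum>p<m. \<Sum>q<m. \<Sum>v<m. sc (hmu U p q i * (U.co v ?g * hdelta U v q j)) (r i * act (dlt p) (r' j)))"
    by (intro sum.cong refl sum.swap)
  also have "\<dots> = (\<Sum>i<m. \<Sum>j<m. \<Sum>p<m. \<Sum>q<m. sc (hmu U p q i * U.co q (U.R j ?g)) (r i * act (dlt p) (r' j)))"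
    by (intro sum.cong refl) (simp add: U.R_def U.co_sum U.co_c sum_distrib_left flip: sc_sum_left)
  also have "\<dots> = (\<Sum>i<m. \<Sum>j<m. \<Sum>p<m. \<Sum>q<m. \<Sum>z<m.
      sc (hmu U p q i * U.co q (?h z)) (r i * sc (U.co j (U.S (U.S (U.b z)))) (act (dlt p) (r' j))))"
    using k by (simp add: U.R_SS_b U.co_sum sum_distrib_left sc_sum_left mult_ac)
  also have "\<dots> = (\<Sum>i<m. \<Sum>p<m. \<Sum>j<m. \<Sum>q<m. \<Sum>z<m.
      sc (hmu U p q i * U.co q (?h z)) (r i * sc (U.co j (U.S (U.S (U.b z)))) (act (dlt p) (r' j))))"
    by (intro sum.cong refl sum.swap)
  also have "\<dots> = (\<Sum>i<m. \<Sum>p<m. \<Sum>q<m. \<Sum>j<m. \<Sum>z<m.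
      sc (hmu U p q i * U.co q (?h z)) (r i * sc (U.co j (U.S (U.S (U.b z)))) (act (dlt p) (r' j))))"
    by (intro sum.cong refl sum.swap)
  also have "\<dots> = (\<Sum>i<m. \<Sum>p<m. \<Sum>q<m. \<Sum>z<m. \<Sum>j<m.
      sc (hmu U p q i * U.co q (?h z)) (r i * sc (U.co j (U.S (U.S (U.b z)))) (act (dlt p) (r' j))))"
    by (intro sum.cong refl sum.swap)
  also have "\<dots> = (\<Sum>i<m. \<Sum>p<m. \<Sum>q<m. \<Sum>z<m. sc (hmu U p q i * U.co q (?h z)) (r i * act (dlt p) (kap r' z)))"
    by (intro sum.cong refl) (simp add: kap_def act_dlt_sum sum_distrib_left sc_sum_right)
  also have "\<dots> = (\<Sum>i<m. \<Sum>p<m. \<Sum>z<m. \<Sum>q<m. sc (hmu U p q i * U.co q (?h z)) (r i * act (dlt p) (kap r' z)))"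
    by (intro sum.cong refl sum.swap)
  also have "\<dots> = (\<Sum>i<m. \<Sum>p<m. \<Sum>z<m. sc (\<Sum>q<m. U.co q (?h z) * U.co i (U.b p * U.b q)) (r i * act (dlt p) (kap r' z)))"
    by (simp add: U.co_b_mult mult.commute sc_sum_left)
  also have "\<dots> = (\<Sum>i<m. \<Sum>p<m. \<Sum>z<m. sc (U.co i (U.b p * ?h z)) (r i * act (dlt p) (kap r' z)))"
    by (simp only: U.co_expand_right U.spn_S)
  also have "\<dots> = (\<Sum>i<m. \<Sum>p<m. \<Sum>z<m. \<Sum>z'<m. \<Sum>y<m.
      sc (U.co p (U.S (U.S (U.b y)) * U.S (U.c z z')) * U.co i (U.b p * ?h z)) (r i * Z z' y))"
    by (simp add: r' act_counit[OF Z] sum_distrib_left sc_sum_right mult_ac)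
  also have "\<dots> = (\<Sum>i<m. \<Sum>z<m. \<Sum>p<m. \<Sum>z'<m. \<Sum>y<m.
      sc (U.co p (U.S (U.S (U.b y)) * U.S (U.c z z')) * U.co i (U.b p * ?h z)) (r i * Z z' y))"
    by (intro sum.cong refl sum.swap)
  also have "\<dots> = (\<Sum>i<m. \<Sum>z<m. \<Sum>z'<m. \<Sum>p<m. \<Sum>y<m.
      sc (U.co p (U.S (U.S (U.b y)) * U.S (U.c z z')) * U.co i (U.b p * ?h z)) (r i * Z z' y))"
    by (intro sum.cong refl sum.swap)
  also have "\<dots> = (\<Sum>i<m. \<Sum>z<m. \<Sum>z'<m. \<Sum>y<m. \<Sum>p<m.
      sc (U.co p (U.S (U.S (U.b y)) * U.S (U.c z z')) * U.co i (U.b p * ?h z)) (r i * Z z' y))"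
    by (intro sum.cong refl sum.swap)
  also have "\<dots> = (\<Sum>i<m. \<Sum>z<m. \<Sum>z'<m. \<Sum>y<m. sc (U.co i (U.S (U.S (U.b y)) * (U.S (U.c z z') * ?h z))) (r i * Z z' y))"
    by (simp add: U.co_expand_left mult.assoc flip: sc_sum_left)
  also have "\<dots> = (\<Sum>i<m. \<Sum>z'<m. \<Sum>z<m. \<Sum>y<m. sc (U.co i (U.S (U.S (U.b y)) * (U.S (U.c z z') * ?h z))) (r i * Z z' y))"
    by (intro sum.cong refl sum.swap)
  also have "\<dots> = (\<Sum>i<m. \<Sum>z'<m. \<Sum>y<m. \<Sum>z<m. sc (U.co i (U.S (U.S (U.b y)) * (U.S (U.c z z') * ?h z))) (r i * Z z' y))"
    by (intro sum.cong refl sum.swap)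
  also have "\<dots> = (\<Sum>i<m. \<Sum>z'<m. \<Sum>y<m. sc (U.co i (U.S (U.S (U.b y)) * (\<Sum>z<m. U.S (U.c z z') * ?h z))) (r i * Z z' y))"
    by (simp only: sum_distrib_left U.co_sum sc_sum_left)
  also have "\<dots> = (\<Sum>i<m. \<Sum>z'<m. \<Sum>y<m. if k = z' then sc (U.co i (U.S (U.S (U.b y)))) (r i * Z z' y) else 0)"
    using k by (intro sum.cong refl) (simp add: U.corep_SS_mult_S[OF U.corep_c])
  also have "\<dots> = (\<Sum>i<m. \<Sum>z'<m. if k = z' then (\<Sum>y<m. sc (U.co i (U.S (U.S (U.b y)))) (r i * Z z' y)) else 0)"
    by (intro sum.cong refl) simp
  also have "\<dots> = (\<Sum>i<m. \<Sum>y<m. sc (U.co i (U.S (U.S (U.b y)))) (r i * Z k y))"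
    using k by simp
  also have "\<dots> = (\<Sum>y<m. kap r y * Z k y)"
    by (subst sum.swap) (simp add: kap_def sum_distrib_right)
  finally show ?thesis .
qed

text \<open>A matrix commuting with the coactions on \<open>A \<otimes> U\<close> is determined by, and can be
  reconstructed from, its composition with the counit of \<open>U\<close>, since \<open>U\<close> is cofree.\<close>

lemma equi_counit_zero:
  assumes Z: "equi m U.c m U.c Z" and 0: "\<And>k. k < m \<Longrightarrow> (\<Sum>l<m. sc (heps U l) (Z k l)) = 0"
    and w: "w < m" and l: "l < m"
  shows "Z w l = 0"
proof -
  have S0: "(\<Sum>y<m. sc (U.co r (U.S (U.b y))) (Z w y)) = 0" if r: "r < m" for r
  proof -
    have "0 = (\<Sum>k<m. \<Sum>q<m. sc (U.co r (U.S (U.c w k) * U.b q)) (D q (\<Sum>l<m. sc (heps U l) (Z k l))))"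
      by (simp add: 0)
    also have "\<dots> = (\<Sum>k<m. \<Sum>q<m. \<Sum>z<m. \<Sum>y<m. sc (U.co q (U.c k z * U.S (U.b y)) * U.co r (U.S (U.c w k) * U.b q)) (Z z y))"
      by (simp add: D_counit[OF Z] sc_sum_right mult.commute)
    also have "\<dots> = (\<Sum>z<m. \<Sum>y<m. \<Sum>k<m. \<Sum>q<m. sc (U.co q (U.c k z * U.S (U.b y)) * U.co r (U.S (U.c w k) * U.b q)) (Z z y))"
      by (rule sum_rot4)
    also have "\<dots> = (\<Sum>z<m. \<Sum>y<m. sc (U.co r ((\<Sum>k<m. U.S (U.c w k) * U.c k z) * U.S (U.b y))) (Z z y))"
      by (simp add: U.co_expand_right sum_distrib_right U.co_sum mult.assoc flip: sc_sum_left)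
    also have "\<dots> = (\<Sum>z<m. if w = z then (\<Sum>y<m. sc (U.co r (U.S (U.b y))) (Z z y)) else 0)"
      using w by (intro sum.cong refl) (simp add: U.corep_S_left[OF U.corep_c])
    finally show ?thesis using w by simp
  qed
  have "0 = (\<Sum>r<m. sc (U.co l (U.Si (U.b r))) (\<Sum>y<m. sc (U.co r (U.S (U.b y))) (Z w y)))"
    by (simp add: S0)
  also have "\<dots> = (\<Sum>y<m. \<Sum>r<m. sc (U.co r (U.S (U.b y)) * U.co l (U.Si (U.b r))) (Z w y))"
    by (subst sum.swap) (simp add: sc_sum_right mult.commute)
  also have "\<dots> = (\<Sum>y<m. sc (U.co l (U.Si (U.S (U.b y)))) (Z w y))"
    unfolding sc_sum_left[symmetric]
    by (intro sum.cong refl arg_cong2[of _ _ _ _ sc] U.spn_lin_expand[symmetric]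
        lin_compose[OF U.lin_Si U.lin_co]) simp
  also have "\<dots> = Z w l" using l by (simp add: U.co_b sc_delta)
  finally show ?thesis by simp
qed

lemma equi_counit_exists:
  obtains Z where "equi m U.c m U.c Z" "\<And>k. k < m \<Longrightarrow> (\<Sum>l<m. sc (heps U l) (Z k l)) = t k"
proof
  define Z where "Z k j = (\<Sum>l<m. \<Sum>q<m. sc (U.co j (U.Si (U.b q) * U.c k l)) (D q (t l)))" for k j
  show "(\<Sum>j<m. sc (heps U j) (Z k j)) = t k" if k: "k < m" for k
  proof -
    have "(\<Sum>j<m. sc (heps U j) (Z k j)) = (\<Sum>j<m. \<Sum>l<m. \<Sum>q<m. sc (heps U j * U.co j (U.Si (U.b q) * U.c k l)) (D q (t l)))"
      by (simp add: Z_def sc_sum_right)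
    also have "\<dots> = (\<Sum>l<m. \<Sum>j<m. \<Sum>q<m. sc (heps U j * U.co j (U.Si (U.b q) * U.c k l)) (D q (t l)))"
      by (rule sum.swap)
    also have "\<dots> = (\<Sum>l<m. \<Sum>q<m. \<Sum>j<m. sc (heps U j * U.co j (U.Si (U.b q) * U.c k l)) (D q (t l)))"
      by (intro sum.cong refl sum.swap)
    also have "\<dots> = (\<Sum>l<m. \<Sum>q<m. sc (U.cou (U.Si (U.b q) * U.c k l)) (D q (t l)))"
      by (simp only: U.cou_def sc_sum_left)
    also have "\<dots> = (\<Sum>l<m. if k = l then (\<Sum>q<m. sc (heps U q) (D q (t l))) else 0)"
      using k by (intro sum.cong refl) (simp add: U.corep_cou[OF U.corep_c])
    also have "\<dots> = t k" using k by (simp add: D_eps)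
    finally show ?thesis .
  qed
  have key: "(\<Sum>k'<m. \<Sum>y<m. U.co p (U.c k k' * U.S (U.c y j)) * U.co y (U.Si (U.b s) * U.c k' l))
      = (\<Sum>q<m. hdelta U s q p * U.co j (U.Si (U.b q) * U.c k l))"
    if k: "k < m" and j: "j < m" and p: "p < m" and s: "s < m" and l: "l < m" for k j p s l
  proof -
    define V where "V q = (\<Sum>e<m. csc (hdelta U s q e) (U.Si (U.b e)))" for q
    have sV [simp]: "V q \<in> U.spn" for q by (simp add: V_def)
    have SV: "U.S (V q) = U.ct q s" for q by (simp add: V_def U.S_sum U.ct_def)
    have RSi: "U.R a (U.Si (U.b s)) = (\<Sum>q<m. csc (U.co a (U.Si (U.b q))) (V q))" if a: "a < m" for a
    proof (rule U.spn_eqI)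
      fix r assume r: "r < m"
      have "U.co r (U.R a (U.Si (U.b s))) = (\<Sum>t<m. santi_inv U s t * hdelta U t r a)"
        using r a s by (simp add: U.R_def U.co_sum U.co_c co_Si)
      also have "\<dots> = (\<Sum>q<m. \<Sum>e<m. hdelta U s q e * santi_inv U q a * santi_inv U e r)"
        using dl_santi[OF s a r] by simp
      also have "\<dots> = U.co r (\<Sum>q<m. csc (U.co a (U.Si (U.b q))) (V q))"
        using r a by (simp add: V_def U.co_sum co_Si sum_distrib_left mult_ac)
      finally show "U.co r (U.R a (U.Si (U.b s))) = U.co r (\<Sum>q<m. csc (U.co a (U.Si (U.b q))) (V q))" .
    qed auto
    have R: "U.R j (U.Si (U.b s) * U.c k' l)
        = (\<Sum>q<m. \<Sum>w<m. csc (U.co j (U.Si (U.b q) * U.c w l)) (V q * U.c k' w))" if k': "k' < m" for k'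
    proof -
      have "U.R j (U.Si (U.b s) * U.c k' l) = (\<Sum>a<m. \<Sum>e<m. \<Sum>q<m. \<Sum>w<m.
          csc (hmu U a e j * U.co a (U.Si (U.b q)) * U.co e (U.c w l)) (V q * U.c k' w))"
        using j l k' by (simp add: U.R_mult RSi U.corep_R[OF U.corep_c] sum_product csc_sum_right mult_ac)
      also have "\<dots> = (\<Sum>q<m. \<Sum>w<m. \<Sum>a<m. \<Sum>e<m.
          csc (hmu U a e j * U.co a (U.Si (U.b q)) * U.co e (U.c w l)) (V q * U.c k' w))"
        by (rule sum_rot4)
      also have "\<dots> = (\<Sum>q<m. \<Sum>w<m. csc (U.co j (U.Si (U.b q) * U.c w l)) (V q * U.c k' w))"
        using j by (simp add: U.co_mult csc_sum_left)
      finally show ?thesis .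
    qed
    have "(\<Sum>k'<m. \<Sum>y<m. U.co p (U.c k k' * U.S (U.c y j)) * U.co y (U.Si (U.b s) * U.c k' l))
        = (\<Sum>k'<m. U.co p (U.c k k' * U.S (U.R j (U.Si (U.b s) * U.c k' l))))"
      by (simp add: U.R_def U.S_sum sum_distrib_left U.co_sum mult.commute)
    also have "\<dots> = (\<Sum>k'<m. \<Sum>q<m. \<Sum>w<m. U.co j (U.Si (U.b q) * U.c w l) * U.co p (U.c k k' * U.S (U.c k' w) * U.ct q s))"
      by (simp add: R U.S_sum U.S_mult SV sum_distrib_left U.co_sum mult.assoc)
    also have "\<dots> = (\<Sum>q<m. \<Sum>k'<m. \<Sum>w<m. U.co j (U.Si (U.b q) * U.c w l) * U.co p (U.c k k' * U.S (U.c k' w) * U.ct q s))"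
      by (rule sum.swap)
    also have "\<dots> = (\<Sum>q<m. \<Sum>w<m. \<Sum>k'<m. U.co j (U.Si (U.b q) * U.c w l) * U.co p (U.c k k' * U.S (U.c k' w) * U.ct q s))"
      by (intro sum.cong refl sum.swap)
    also have "\<dots> = (\<Sum>q<m. \<Sum>w<m. U.co j (U.Si (U.b q) * U.c w l) * U.co p ((\<Sum>k'<m. U.c k k' * U.S (U.c k' w)) * U.ct q s))"
      by (simp only: sum_distrib_left sum_distrib_right U.co_sum)
    also have "\<dots> = (\<Sum>q<m. \<Sum>w<m. if k = w then U.co j (U.Si (U.b q) * U.c w l) * U.co p (U.ct q s) else 0)"
      using k by (intro sum.cong refl) (simp add: U.corep_S_right[OF U.corep_c])
    also have "\<dots> = (\<Sum>q<m. hdelta U s q p * U.co j (U.Si (U.b q) * U.c k l))"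
      using k p by (simp add: U.co_ct mult.commute)
    finally show ?thesis .
  qed
  show "equi m U.c m U.c Z"
    unfolding equi_def
  proof (intro allI impI)
    fix k j p assume k: "k < m" and j: "j < m" and p: "p < m"
    have "D p (Z k j) = (\<Sum>l<m. \<Sum>q<m. \<Sum>s<m. sc (hdelta U s q p * U.co j (U.Si (U.b q) * U.c k l)) (D s (t l)))"
      using p by (simp add: Z_def D_sum D_D sc_sum_right mult.commute)
    also have "\<dots> = (\<Sum>l<m. \<Sum>s<m. \<Sum>q<m. sc (hdelta U s q p * U.co j (U.Si (U.b q) * U.c k l)) (D s (t l)))"
      by (intro sum.cong refl sum.swap)
    also have "\<dots> = (\<Sum>l<m. \<Sum>s<m. \<Sum>k'<m. \<Sum>y<m. sc (U.co p (U.c k k' * U.S (U.c y j)) * U.co y (U.Si (U.b s) * U.c k' l)) (D s (t l)))"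
      using k j p by (simp add: key[symmetric] flip: sc_sum_left)
    also have "\<dots> = (\<Sum>k'<m. \<Sum>y<m. \<Sum>l<m. \<Sum>s<m. sc (U.co p (U.c k k' * U.S (U.c y j)) * U.co y (U.Si (U.b s) * U.c k' l)) (D s (t l)))"
      by (rule sum_rot4)
    also have "\<dots> = (\<Sum>k'<m. \<Sum>y<m. sc (U.co p (U.c k k' * U.S (U.c y j))) (Z k' y))"
      by (simp add: Z_def sc_sum_right)
    finally show "D p (Z k j) = (\<Sum>k'<m. \<Sum>y<m. sc (U.co p (U.c k k' * U.S (U.c y j))) (Z k' y))" .
  qed
qed

end

locale mod_alg_section = mod_alg H U P sc act for H U :: hopf and P and sc :: "complex \<Rightarrow> 'a::{ring,monoid_mult} \<Rightarrow> 'a" and act +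
  fixes p :: "nat \<Rightarrow> nat \<Rightarrow> complex"
  assumes p: "from_U p" and pP: "\<And>k l. k < m \<Longrightarrow> l < m \<Longrightarrow> (\<Sum>y<n. p k y * P y l) = (if k = l then 1 else 0)"
begin

definition E :: "nat \<Rightarrow> nat \<Rightarrow> complex" where
  "E x y = (\<Sum>k<m. P x k * p k y)"

text \<open>\<open>Z_of T = \<pi> T p\<close> and \<open>tt T = \<epsilon> \<pi> T p\<close>.\<close>

definition Z_of :: "(nat \<Rightarrow> nat \<Rightarrow> 'a) \<Rightarrow> nat \<Rightarrow> nat \<Rightarrow> 'a" where
  "Z_of T k j = (\<Sum>y<n. sc (P y j) (\<Sum>x<n. sc (p k x) (T x y)))"

definition tt :: "(nat \<Rightarrow> nat \<Rightarrow> 'a) \<Rightarrow> nat \<Rightarrow> 'a" where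
  "tt T k = (\<Sum>x<n. \<Sum>j<n. sc (p k x * heps H j) (T x j))"

definition chi :: "(nat \<Rightarrow> nat \<Rightarrow> 'a) \<Rightarrow> nat \<Rightarrow> 'a" where
  "chi T v = (if v < m then kapi (tt T) v else 0)"

lemma P_ep: "x < n \<Longrightarrow> (\<Sum>l<m. P x l * heps U l) = heps H x"
  using hom_counit by simp

lemma p_ep: "k < m \<Longrightarrow> (\<Sum>x<n. p k x * heps H x) = heps U k"
proof -
  assume k: "k < m"
  have "(\<Sum>x<n. p k x * heps H x) = (\<Sum>l<m. (\<Sum>x<n. p k x * P x l) * heps U l)"
    by (simp add: sum_distrib_left sum_distrib_right mult.assoc flip: P_ep) (rule sum.swap)
  then show ?thesis using k by (simp add: pP U.sum_delta_mult)
qed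

lemma equi_Z_of:
  assumes "equi n u n u T"
  shows "equi m U.c m U.c (Z_of T)"
  unfolding Z_of_def[abs_def] by (rule equi_right[OF to_U_P equi_left[OF p assms]])

lemma Z_of_counit:
  assumes "k < m"
  shows "(\<Sum>l<m. sc (heps U l) (Z_of T k l)) = tt T k"
proof -
  have "(\<Sum>l<m. sc (heps U l) (Z_of T k l)) = (\<Sum>l<m. \<Sum>y<n. sc (P y l * heps U l) (\<Sum>x<n. sc (p k x) (T x y)))"
    unfolding Z_of_def sc_sum_right[of "heps U _"] by (simp add: mult.commute)
  also have "\<dots> = (\<Sum>y<n. sc (heps H y) (\<Sum>x<n. sc (p k x) (T x y)))"
    by (subst sum.swap) (simp add: P_ep flip: sc_sum_left)
  also have "\<dots> = tt T k"
    unfolding tt_def sc_sum_right by (subst sum.swap) (simp add: mult.commute)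
  finally show ?thesis .
qed

lemma tt_mult:
  assumes TE: "\<And>x j. x < n \<Longrightarrow> j < n \<Longrightarrow> (\<Sum>y<n. sc (E x y) (T y j)) = T x j"
  shows "tt (\<lambda>x j. \<Sum>y<n. T y j * T' x y) k = (\<Sum>l<m. tt T l * Z_of T' k l)"
proof -
  define \<tau> where "\<tau> y = (\<Sum>j<n. sc (heps H j) (T y j))" for y
  have \<tau>: "\<tau> y = (\<Sum>l<m. sc (P y l) (tt T l))" if y: "y < n" for y
  proof -
    have "\<tau> y = (\<Sum>j<n. sc (heps H j) (\<Sum>z<n. sc (E y z) (T z j)))"
      using y by (simp add: \<tau>_def TE)
    also have "\<dots> = (\<Sum>j<n. \<Sum>z<n. \<Sum>l<m. sc (P y l) (sc (p l z * heps H j) (T z j)))"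
      by (simp add: E_def sc_sum_right sc_sum_left mult_ac)
    also have "\<dots> = (\<Sum>j<n. \<Sum>l<m. \<Sum>z<n. sc (P y l) (sc (p l z * heps H j) (T z j)))"
      by (intro sum.cong refl sum.swap)
    also have "\<dots> = (\<Sum>l<m. \<Sum>j<n. \<Sum>z<n. sc (P y l) (sc (p l z * heps H j) (T z j)))"
      by (rule sum.swap)
    also have "\<dots> = (\<Sum>l<m. \<Sum>z<n. \<Sum>j<n. sc (P y l) (sc (p l z * heps H j) (T z j)))"
      by (intro sum.cong refl sum.swap)
    finally show ?thesis by (simp only: tt_def sc_sum_right)
  qed
  have "tt (\<lambda>x j. \<Sum>y<n. T y j * T' x y) k = (\<Sum>x<n. \<Sum>j<n. \<Sum>y<n. sc (p k x) (sc (heps H j) (T y j) * T' x y))"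
    by (simp add: tt_def sc_sum_right)
  also have "\<dots> = (\<Sum>x<n. \<Sum>y<n. \<Sum>j<n. sc (p k x) (sc (heps H j) (T y j) * T' x y))"
    by (intro sum.cong refl sum.swap)
  also have "\<dots> = (\<Sum>x<n. \<Sum>y<n. sc (p k x) (\<tau> y * T' x y))"
    by (simp only: \<tau>_def sum_distrib_right sc_sum_right)
  also have "\<dots> = (\<Sum>x<n. \<Sum>y<n. \<Sum>l<m. tt T l * sc (P y l) (sc (p k x) (T' x y)))"
    by (simp add: \<tau> sum_distrib_right sc_sum_right mult.commute)
  also have "\<dots> = (\<Sum>y<n. \<Sum>x<n. \<Sum>l<m. tt T l * sc (P y l) (sc (p k x) (T' x y)))"
    by (rule sum.swap)
  also have "\<dots> = (\<Sum>y<n. \<Sum>l<m. \<Sum>x<n. tt T l * sc (P y l) (sc (p k x) (T' x y)))"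
    by (intro sum.cong refl sum.swap)
  also have "\<dots> = (\<Sum>l<m. \<Sum>y<n. \<Sum>x<n. tt T l * sc (P y l) (sc (p k x) (T' x y)))"
    by (rule sum.swap)
  finally show ?thesis by (simp only: Z_of_def sum_distrib_left sc_sum_right)
qed

lemma chi_mult:
  assumes TE: "\<And>x j. x < n \<Longrightarrow> j < n \<Longrightarrow> (\<Sum>y<n. sc (E x y) (T y j)) = T x j"
    and T': "equi n u n u T'"
  shows "chi (\<lambda>x j. \<Sum>y<n. T y j * T' x y) = chi T \<otimes>\<^bsub>smashU U sc act\<^esub> chi T'"
proof
  fix v
  have kc: "kap (chi T) k = tt T k" if "k < m" for T k
    using kap_kapi[OF that, of "tt T"] by (simp add: kap_def chi_def)
  show "chi (\<lambda>x j. \<Sum>y<n. T y j * T' x y) v = (chi T \<otimes>\<^bsub>smashU U sc act\<^esub> chi T') v"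
  proof (cases "v < m")
    case True
    have "kap (chi T \<otimes>\<^bsub>smashU U sc act\<^esub> chi T') k = tt (\<lambda>x j. \<Sum>y<n. T y j * T' x y) k" if k: "k < m" for k
    proof -
      have "kap (chi T \<otimes>\<^bsub>smashU U sc act\<^esub> chi T') k = (\<Sum>y<m. kap (chi T) y * Z_of T' k y)"
        by (rule kap_smashU_mult[OF equi_Z_of[OF T'] _ k]) (simp add: kc Z_of_counit)
      then show ?thesis by (simp add: tt_mult[OF TE] kc)
    qed
    then have "kapi (kap (chi T \<otimes>\<^bsub>smashU U sc act\<^esub> chi T')) v = kapi (tt (\<lambda>x j. \<Sum>y<n. T y j * T' x y)) v"
      by (simp add: kapi_def)
    then show ?thesis using True by (simp add: chi_def kapi_kap)
  qed (simp add: chi_def smashU_def Let_def)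
qed

lemma chi_inj:
  assumes T: "equi n u n u T" and 0: "\<And>v. v < m \<Longrightarrow> chi T v = 0" and "w < m" "l < m"
  shows "Z_of T w l = 0"
proof (rule equi_counit_zero[OF equi_Z_of[OF T]])
  fix k assume k: "k < m"
  have "tt T k = kap (chi T) k"
    using kap_kapi[OF k, of "tt T"] by (simp add: kap_def chi_def)
  then show "(\<Sum>l<m. sc (heps U l) (Z_of T k l)) = 0"
    using k by (simp add: Z_of_counit 0 kap_def)
qed fact+

lemma chi_surj:
  assumes r: "\<And>v. v \<ge> m \<Longrightarrow> r v = 0"
  obtains Z where "equi n u n u (\<lambda>x j. \<Sum>l<m. sc (p l j) (\<Sum>k<m. sc (P x k) (Z k l)))"
    "chi (\<lambda>x j. \<Sum>l<m. sc (p l j) (\<Sum>k<m. sc (P x k) (Z k l))) = r"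
proof -
  obtain Z where Z: "equi m U.c m U.c Z" and Zr: "\<And>k. k < m \<Longrightarrow> (\<Sum>l<m. sc (heps U l) (Z k l)) = kap r k"
    using equi_counit_exists[of "kap r"] by blast
  let ?T = "\<lambda>x j. \<Sum>l<m. sc (p l j) (\<Sum>k<m. sc (P x k) (Z k l))"
  have 1: "equi n u n u ?T"
    by (rule equi_right[OF p equi_left[OF to_U_P Z]])
  have "tt ?T k = kap r k" if k: "k < m" for k
  proof -
    have "tt ?T k = (\<Sum>x<n. \<Sum>j<n. \<Sum>l<m. \<Sum>i<m. sc (p l j * heps H j) (sc (p k x * P x i) (Z i l)))"
      by (simp add: tt_def sc_sum_right mult_ac)
    also have "\<dots> = (\<Sum>l<m. \<Sum>i<m. \<Sum>x<n. \<Sum>j<n. sc (p l j * heps H j) (sc (p k x * P x i) (Z i l)))"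
      by (rule sum_rot4)
    also have "\<dots> = (\<Sum>l<m. \<Sum>i<m. \<Sum>x<n. sc (heps U l) (sc (p k x * P x i) (Z i l)))"
      by (intro sum.cong refl) (simp only: p_ep lessThan_iff flip: sc_sum_left)
    also have "\<dots> = (\<Sum>l<m. \<Sum>i<m. sc (heps U l) (sc (\<Sum>x<n. p k x * P x i) (Z i l)))"
      by (simp only: sc_sum_left sc_sum_right)
    also have "\<dots> = (\<Sum>l<m. sc (heps U l) (\<Sum>i<m. sc (if k = i then 1 else 0) (Z i l)))"
      unfolding sc_sum_right using k by (intro sum.cong refl) (simp only: pP lessThan_iff)
    also have "\<dots> = kap r k" using k by (simp add: sc_delta Zr)
    finally show ?thesis .
  qed
  then have "kapi (tt ?T) v = kapi (kap r) v" for v by (simp add: kapi_def)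
  then have "chi ?T = r" using r by (auto simp: chi_def fun_eq_iff kapi_kap)
  with 1 that show ?thesis by blast
qed

end

section \<open>Modules over a full corner\<close>

lemma infinite_power_inj:
  fixes k :: nat
  assumes "infinite A"
  shows "\<exists>h. inj_on h (PiE {..<k} (\<lambda>_. A)) \<and> h ` PiE {..<k} (\<lambda>_. A) \<subseteq> A"
proof (induction k)
  case 0
  obtain a where "a \<in> A" using assms by (metis ex_in_conv finite.emptyI)
  then show ?case by (intro exI[of _ "\<lambda>_. a"]) auto
next
  case (Suc k)
  then obtain h where h: "inj_on h (PiE {..<k} (\<lambda>_. A))" "h ` PiE {..<k} (\<lambda>_. A) \<subseteq> A" by blast
  obtain pr where pr: "bij_betw pr (A \<times> A) A"
    by (rule exE[OF card_of_ordIso[THEN iffD2, OF card_of_Times_same_infinite[OF assms]]]) (rule that)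
  define h' where "h' v = pr (v k, h (restrict v {..<k}))" for v
  have r: "restrict v {..<k} \<in> PiE {..<k} (\<lambda>_. A)" "v k \<in> A" if "v \<in> PiE {..<Suc k} (\<lambda>_. A)" for v
    using PiE_mem[OF that] by (simp_all add: restrict_PiE_iff)
  have "inj_on h' (PiE {..<Suc k} (\<lambda>_. A))"
  proof (rule inj_onI)
    fix v w assume v: "v \<in> PiE {..<Suc k} (\<lambda>_. A)" and w: "w \<in> PiE {..<Suc k} (\<lambda>_. A)" and eq: "h' v = h' w"
    have mem: "(v k, h (restrict v {..<k})) \<in> A \<times> A" if "v \<in> PiE {..<Suc k} (\<lambda>_. A)" for v
      using r[OF that] h(2) by blast
    have "(v k, h (restrict v {..<k})) = (w k, h (restrict w {..<k}))"
      by (rule inj_onD[OF bij_betw_imp_inj_on[OF pr] eq[unfolded h'_def] mem[OF v] mem[OF w]])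
    then have k: "v k = w k" and "h (restrict v {..<k}) = h (restrict w {..<k})" by simp_all
    then have res: "restrict v {..<k} = restrict w {..<k}"
      using inj_onD[OF h(1) _ r(1)[OF v] r(1)[OF w]] by blast
    show "v = w"
    proof (rule PiE_ext[OF v w])
      fix i assume "i \<in> {..<Suc k}"
      then show "v i = w i"
        using k fun_cong[OF res, of i] by (cases "i = k") auto
    qed
  qed
  moreover have "h' ` PiE {..<Suc k} (\<lambda>_. A) \<subseteq> A"
  proof
    fix a assume "a \<in> h' ` PiE {..<Suc k} (\<lambda>_. A)"
    then obtain v where v: "v \<in> PiE {..<Suc k} (\<lambda>_. A)" "a = h' v" by blast
    have "(v k, h (restrict v {..<k})) \<in> A \<times> A" using r[OF v(1)] h(2) by blast
    then show "a \<in> A" unfolding v(2) h'_def using bij_betwE[OF pr] by blast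
  qed
  ultimately show ?case by blast
qed

lemma is_lmodD:
  assumes "is_lmod R M"
  shows "mzero M \<in> mcar M"
    "x \<in> mcar M \<Longrightarrow> y \<in> mcar M \<Longrightarrow> madd M x y \<in> mcar M"
    "x \<in> mcar M \<Longrightarrow> y \<in> mcar M \<Longrightarrow> w \<in> mcar M \<Longrightarrow> madd M (madd M x y) w = madd M x (madd M y w)"
    "x \<in> mcar M \<Longrightarrow> y \<in> mcar M \<Longrightarrow> madd M x y = madd M y x"
    "x \<in> mcar M \<Longrightarrow> madd M (mzero M) x = x"
    "x \<in> mcar M \<Longrightarrow> \<exists>y\<in>mcar M. madd M x y = mzero M"
    "r \<in> carrier R \<Longrightarrow> x \<in> mcar M \<Longrightarrow> mact M r x \<in> mcar M"
    "r \<in> carrier R \<Longrightarrow> x \<in> mcar M \<Longrightarrow> y \<in> mcar M \<Longrightarrow> mact M r (madd M x y) = madd M (mact M r x) (mact M r y)"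
    "r \<in> carrier R \<Longrightarrow> s \<in> carrier R \<Longrightarrow> x \<in> mcar M \<Longrightarrow> mact M (r \<oplus>\<^bsub>R\<^esub> s) x = madd M (mact M r x) (mact M s x)"
    "r \<in> carrier R \<Longrightarrow> s \<in> carrier R \<Longrightarrow> x \<in> mcar M \<Longrightarrow> mact M (r \<otimes>\<^bsub>R\<^esub> s) x = mact M r (mact M s x)"
    "x \<in> mcar M \<Longrightarrow> mact M \<one>\<^bsub>R\<^esub> x = x"
  using assms unfolding is_lmod_def Let_def by blast+

lemma lhomD:
  assumes "f \<in> lhom R M N"
  shows "f \<in> extensional (mcar M)" "x \<in> mcar M \<Longrightarrow> f x \<in> mcar N"
    "x \<in> mcar M \<Longrightarrow> y \<in> mcar M \<Longrightarrow> f (madd M x y) = madd N (f x) (f y)"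
    "r \<in> carrier R \<Longrightarrow> x \<in> mcar M \<Longrightarrow> f (mact M r x) = mact N r (f x)"
  using assms by (auto simp: lhom_def)

lemma lmod_add_cancel:
  assumes M: "is_lmod R M" and "x \<in> mcar M" "y \<in> mcar M" "z \<in> mcar M" "madd M x y = madd M x z"
  shows "y = z"
proof -
  obtain w where w: "w \<in> mcar M" "madd M x w = mzero M" using is_lmodD(6)[OF M] assms by blast
  have "madd M (madd M w x) y = madd M (madd M w x) z"
    using assms w by (simp add: is_lmodD(3)[OF M])
  moreover have "madd M w x = mzero M" using w assms is_lmodD(4)[OF M] by metis
  ultimately show ?thesis using assms is_lmodD(5)[OF M] by simp
qed

lemma lmod_idem_zero:
  assumes M: "is_lmod R M" and a: "a \<in> mcar M" "madd M a a = a"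
  shows "a = mzero M"
proof -
  have "madd M a (mzero M) = a"
    using is_lmodD(4)[OF M a(1) is_lmodD(1)[OF M]] is_lmodD(5)[OF M a(1)] by simp
  then show ?thesis using lmod_add_cancel[OF M a(1) a(1) is_lmodD(1)[OF M]] a(2) by simp
qed

lemma act_zero:
  assumes M: "is_lmod R M" and r: "r \<in> carrier R"
  shows "mact M r (mzero M) = mzero M"
proof (rule lmod_idem_zero[OF M])
  note Z = is_lmodD(1)[OF M]
  show "mact M r (mzero M) \<in> mcar M" by (rule is_lmodD(7)[OF M r Z])
  show "madd M (mact M r (mzero M)) (mact M r (mzero M)) = mact M r (mzero M)"
    using is_lmodD(8)[OF M r Z Z] is_lmodD(5)[OF M Z] by simp
qed

definition transport :: "('a \<Rightarrow> 'b) \<Rightarrow> ('r, 'a) lmod \<Rightarrow> ('r, 'b) lmod" where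
  "transport j M = (let i = inv_into (mcar M) j in
     \<lparr>mcar = j ` mcar M, madd = (\<lambda>p q. j (madd M (i p) (i q))), mzero = j (mzero M),
      mact = (\<lambda>r p. j (mact M r (i p)))\<rparr>)"

lemma transport_simps:
  assumes "inj_on j (mcar M)"
  shows "mcar (transport j M) = j ` mcar M" "mzero (transport j M) = j (mzero M)"
    "x \<in> mcar M \<Longrightarrow> y \<in> mcar M \<Longrightarrow> madd (transport j M) (j x) (j y) = j (madd M x y)"
    "x \<in> mcar M \<Longrightarrow> mact (transport j M) r (j x) = j (mact M r x)"
  using assms by (simp_all add: transport_def Let_def)

lemma is_lmod_transport:
  assumes M: "is_lmod R M" and j: "inj_on j (mcar M)"
  shows "is_lmod R (transport j M)"
  unfolding is_lmod_def Let_def transport_simps(1,2)[OF j]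
  using is_lmodD[OF M] transport_simps(3,4)[OF j]
  by (auto simp: image_iff) (metis image_eqI)+

locale full_corner = ring S for S :: "('s, 'y) ring_scheme" (structure) +
  fixes R :: "('r, 'x) ring_scheme" and e :: 's and \<psi> :: "'s \<Rightarrow> 'r" and x y :: "nat \<Rightarrow> 's" and k :: nat
    and \<kappa> :: "complex \<Rightarrow> 's"
  fixes corner eS
  defines "corner \<equiv> {s \<in> carrier S. e \<otimes> s = s \<and> s \<otimes> e = s}" and "eS \<equiv> {s \<in> carrier S. e \<otimes> s = s}"
  assumes e: "e \<in> carrier S" "e \<otimes> e = e"
    and x: "\<And>i. i < k \<Longrightarrow> x i \<in> carrier S" "\<And>i. i < k \<Longrightarrow> x i \<otimes> e = x i"
    and y: "\<And>i. i < k \<Longrightarrow> y i \<in> carrier S" "\<And>i. i < k \<Longrightarrow> e \<otimes> y i = y i"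
    and xy: "(\<Oplus>i\<in>{..<k}. x i \<otimes> y i) = \<one>"
    and \<psi>: "bij_betw \<psi> corner (carrier R)"
    and \<psi>_add: "\<And>s t. s \<in> corner \<Longrightarrow> t \<in> corner \<Longrightarrow> \<psi> (s \<oplus> t) = \<psi> s \<oplus>\<^bsub>R\<^esub> \<psi> t"
    and \<psi>_mult: "\<And>s t. s \<in> corner \<Longrightarrow> t \<in> corner \<Longrightarrow> \<psi> (s \<otimes> t) = \<psi> s \<otimes>\<^bsub>R\<^esub> \<psi> t"
    and \<psi>_one: "\<psi> e = \<one>\<^bsub>R\<^esub>"
    and \<kappa>: "\<And>c. \<kappa> c \<in> corner" "\<kappa> 1 = e" "\<And>c d. \<kappa> (c + d) = \<kappa> c \<oplus> \<kappa> d" "\<And>c d. \<kappa> (c * d) = \<kappa> c \<otimes> \<kappa> d"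
begin

lemma cornerD: "s \<in> corner \<Longrightarrow> s \<in> carrier S" "s \<in> corner \<Longrightarrow> e \<otimes> s = s" "s \<in> corner \<Longrightarrow> s \<otimes> e = s" "s \<in> corner \<Longrightarrow> s \<in> eS"
  by (auto simp: corner_def eS_def)
lemma eSD: "t \<in> eS \<Longrightarrow> t \<in> carrier S" "t \<in> eS \<Longrightarrow> e \<otimes> t = t"
  by (auto simp: eS_def)
lemma e_corner: "e \<in> corner" and e_eS: "e \<in> eS"
  using e by (auto simp: corner_def eS_def)
lemma eS_add: "t \<in> eS \<Longrightarrow> u \<in> eS \<Longrightarrow> t \<oplus> u \<in> eS"
  using e by (auto simp: eS_def r_distr)
lemma eS_mult: "t \<in> eS \<Longrightarrow> s \<in> carrier S \<Longrightarrow> t \<otimes> s \<in> eS"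
  using e by (auto simp: eS_def simp flip: m_assoc)
lemma eS_zero: "\<zero> \<in> eS"
  using e by (auto simp: eS_def)
lemma eS_minus: "t \<in> eS \<Longrightarrow> \<ominus> t \<in> eS"
  using e by (auto simp: eS_def r_minus)
lemma eS_e: "t \<in> eS \<Longrightarrow> t \<otimes> e \<in> corner"
  using e by (auto simp: eS_def corner_def m_assoc simp flip: m_assoc[of e])
lemma corner_mult: "s \<in> corner \<Longrightarrow> t \<in> corner \<Longrightarrow> s \<otimes> t \<in> corner"
  using e by (auto simp: corner_def m_assoc) (simp flip: m_assoc)
lemma corner_eS: "s \<in> corner \<Longrightarrow> t \<in> eS \<Longrightarrow> s \<otimes> t \<in> eS"
  by (intro eS_mult) (auto simp: corner_def eS_def)
lemma \<psi>_carrier: "s \<in> corner \<Longrightarrow> \<psi> s \<in> carrier R"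
  using \<psi> by (auto simp: bij_betw_def)

definition \<phi> :: "'r \<Rightarrow> 's" where "\<phi> = inv_into corner \<psi>"

lemma \<phi>_corner: "r \<in> carrier R \<Longrightarrow> \<phi> r \<in> corner" and \<psi>_\<phi>: "r \<in> carrier R \<Longrightarrow> \<psi> (\<phi> r) = r"
  using \<psi> by (auto simp: \<phi>_def bij_betw_def inv_into_into f_inv_into_f)
lemma \<phi>_\<psi>: "s \<in> corner \<Longrightarrow> \<phi> (\<psi> s) = s"
  using \<psi> by (auto simp: \<phi>_def bij_betw_def)

definition homs :: "('r, 'm) lmod \<Rightarrow> ('s \<Rightarrow> 'm) set" where
  "homs M = {f \<in> extensional eS. (\<forall>t\<in>eS. f t \<in> mcar M)
     \<and> (\<forall>t\<in>eS. \<forall>u\<in>eS. f (t \<oplus> u) = madd M (f t) (f u))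
     \<and> (\<forall>c\<in>corner. \<forall>t\<in>eS. f (c \<otimes> t) = mact M (\<psi> c) (f t))}"

lemma homsD:
  assumes "f \<in> homs M"
  shows "f \<in> extensional eS" "t \<in> eS \<Longrightarrow> f t \<in> mcar M"
    "t \<in> eS \<Longrightarrow> u \<in> eS \<Longrightarrow> f (t \<oplus> u) = madd M (f t) (f u)"
    "c \<in> corner \<Longrightarrow> t \<in> eS \<Longrightarrow> f (c \<otimes> t) = mact M (\<psi> c) (f t)"
  using assms by (auto simp: homs_def)

lemma homs_ext: "f \<in> homs M \<Longrightarrow> g \<in> homs M \<Longrightarrow> (\<And>t. t \<in> eS \<Longrightarrow> f t = g t) \<Longrightarrow> f = g"
  by (rule extensionalityI[of _ eS]) (auto dest: homsD)

lemma homs_zero: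
  assumes M: "is_lmod R M" and f: "f \<in> homs M"
  shows "f \<zero> = mzero M"
proof (rule lmod_idem_zero[OF M])
  show "f \<zero> \<in> mcar M" by (rule homsD(2)[OF f eS_zero])
  show "madd M (f \<zero>) (f \<zero>) = f \<zero>"
    using homsD(3)[OF f eS_zero eS_zero] by simp
qed

definition hom_mod :: "('r, 'm) lmod \<Rightarrow> ('s, 's \<Rightarrow> 'm) lmod" where
  "hom_mod M = \<lparr>mcar = homs M, madd = (\<lambda>f g. \<lambda>t\<in>eS. madd M (f t) (g t)), mzero = (\<lambda>t\<in>eS. mzero M),
     mact = (\<lambda>s f. \<lambda>t\<in>eS. f (t \<otimes> s))\<rparr>"

lemma hom_mod_simps:
  "mcar (hom_mod M) = homs M" "madd (hom_mod M) = (\<lambda>f g. \<lambda>t\<in>eS. madd M (f t) (g t))"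
  "mzero (hom_mod M) = (\<lambda>t\<in>eS. mzero M)" "mact (hom_mod M) = (\<lambda>s f. \<lambda>t\<in>eS. f (t \<otimes> s))"
  by (simp_all add: hom_mod_def)

lemma homs_add:
  assumes M: "is_lmod R M" and f: "f \<in> homs M" and g: "g \<in> homs M"
  shows "(\<lambda>t\<in>eS. madd M (f t) (g t)) \<in> homs M"
proof -
  note [simp] = homsD(2)[OF f] homsD(2)[OF g] is_lmodD(2)[OF M]
  have 4: "madd M (madd M a b) (madd M c d) = madd M (madd M a c) (madd M b d)"
    if "a \<in> mcar M" "b \<in> mcar M" "c \<in> mcar M" "d \<in> mcar M" for a b c d
    using that is_lmodD(3,4)[OF M] is_lmodD(2)[OF M] by metis
  show ?thesis
    by (auto simp: homs_def eS_add corner_eS homsD(3,4)[OF f] homsD(3,4)[OF g] 4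
        is_lmodD(8)[OF M] \<psi>_carrier)
qed

lemma homs_act:
  assumes f: "f \<in> homs M" and s: "s \<in> carrier S"
  shows "(\<lambda>t\<in>eS. f (t \<otimes> s)) \<in> homs M"
  using s by (auto simp: homs_def eS_add eS_mult corner_eS homsD[OF f] l_distr eSD cornerD m_assoc)

lemma is_lmod_hom_mod:
  assumes M: "is_lmod R M"
  shows "is_lmod S (hom_mod M)"
  unfolding is_lmod_def Let_def hom_mod_simps
proof (intro conjI ballI)
  note Z = is_lmodD(1)[OF M]
  show "(\<lambda>t\<in>eS. mzero M) \<in> homs M"
    using Z is_lmodD(5)[OF M Z] by (auto simp: homs_def eS_add corner_eS act_zero[OF M] \<psi>_carrier)
  fix f assume f: "f \<in> homs M"
  show "(\<lambda>t\<in>eS. madd M ((\<lambda>t\<in>eS. mzero M) t) (f t)) = f"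
    by (rule homs_ext[OF homs_add[OF M \<open>(\<lambda>t\<in>eS. mzero M) \<in> homs M\<close> f] f])
      (simp add: is_lmodD(5)[OF M] homsD(2)[OF f])
  have m: "(\<lambda>t\<in>eS. f (\<ominus> t)) \<in> homs M"
    by (auto simp: homs_def eS_add eS_minus corner_eS homsD(2)[OF f] minus_add eSD homsD(3,4)[OF f]
        r_minus[symmetric] cornerD)
  have "madd M (f t) (f (\<ominus> t)) = mzero M" if "t \<in> eS" for t
    using homsD(3)[OF f that eS_minus[OF that]] homs_zero[OF M f] eSD[OF that] by (simp add: r_neg)
  then show "\<exists>g\<in>homs M. (\<lambda>t\<in>eS. madd M (f t) (g t)) = (\<lambda>t\<in>eS. mzero M)"
    using m by (intro bexI[OF _ m]) (auto simp: fun_eq_iff)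
  show "(\<lambda>t\<in>eS. f (t \<otimes> \<one>)) = f"
    by (rule extensionalityI[of _ eS]) (auto simp: homsD(1)[OF f] eSD)
  {
    fix s assume s: "s \<in> carrier S"
    show "(\<lambda>t\<in>eS. f (t \<otimes> s)) \<in> homs M" by (rule homs_act[OF f s])
    fix g assume g: "g \<in> homs M"
    show "(\<lambda>t\<in>eS. (\<lambda>t\<in>eS. madd M (f t) (g t)) (t \<otimes> s)) = (\<lambda>t\<in>eS. madd M ((\<lambda>t\<in>eS. f (t \<otimes> s)) t) ((\<lambda>t\<in>eS. g (t \<otimes> s)) t))"
      using s by (auto simp: fun_eq_iff eS_mult)
  next
    fix s s' assume s: "s \<in> carrier S" "s' \<in> carrier S"
    show "(\<lambda>t\<in>eS. f (t \<otimes> (s \<oplus> s'))) = (\<lambda>t\<in>eS. madd M ((\<lambda>t\<in>eS. f (t \<otimes> s)) t) ((\<lambda>t\<in>eS. f (t \<otimes> s')) t))"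
      using s by (auto simp: fun_eq_iff eS_mult r_distr eSD homsD(3)[OF f])
    show "(\<lambda>t\<in>eS. f (t \<otimes> (s \<otimes> s'))) = (\<lambda>t\<in>eS. (\<lambda>t\<in>eS. f (t \<otimes> s')) (t \<otimes> s))"
      using s by (auto simp: fun_eq_iff eS_mult eSD m_assoc)
  next
    fix g assume g: "g \<in> homs M"
    show "(\<lambda>t\<in>eS. madd M (f t) (g t)) \<in> homs M" by (rule homs_add[OF M f g])
    show "(\<lambda>t\<in>eS. madd M (f t) (g t)) = (\<lambda>t\<in>eS. madd M (g t) (f t))"
      using is_lmodD(4)[OF M] by (auto simp: fun_eq_iff homsD(2)[OF f] homsD(2)[OF g])
    fix h assume h: "h \<in> homs M"
    show "(\<lambda>t\<in>eS. madd M ((\<lambda>t\<in>eS. madd M (f t) (g t)) t) (h t)) = (\<lambda>t\<in>eS. madd M (f t) ((\<lambda>t\<in>eS. madd M (g t) (h t)) t))"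
      using is_lmodD(3)[OF M] by (auto simp: fun_eq_iff homsD(2)[OF f] homsD(2)[OF g] homsD(2)[OF h])
  }
qed

lemma homs_eq_finsum:
  assumes M: "is_lmod R M" and f: "f \<in> homs M" and g: "g \<in> homs M" and "finite B"
    and u: "\<And>i. i \<in> B \<Longrightarrow> u i \<in> eS \<and> f (u i) = g (u i)"
  shows "(\<Oplus>i\<in>B. u i) \<in> eS \<and> f (\<Oplus>i\<in>B. u i) = g (\<Oplus>i\<in>B. u i)"
  using \<open>finite B\<close> u
proof (induction B rule: finite_induct)
  case empty
  then show ?case using homs_zero[OF M f] homs_zero[OF M g] by (simp add: eS_zero)
next
  case (insert i B)
  then have "(\<Oplus>j\<in>insert i B. u j) = u i \<oplus> (\<Oplus>j\<in>B. u j)"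
    by (intro finsum_insert) (auto dest: eSD)
  then show ?case using insert by (auto simp: eS_add homsD(3)[OF f] homsD(3)[OF g])
qed

lemma finsum_xy:
  assumes t: "t \<in> carrier S"
  shows "(\<Oplus>i\<in>{..<k}. t \<otimes> x i \<otimes> y i) = t"
proof -
  have "(\<Oplus>i\<in>{..<k}. t \<otimes> (x i \<otimes> y i)) = t \<otimes> \<one>"
    unfolding xy[symmetric] using t x y by (intro finsum_rdistr[symmetric]) auto
  moreover have "(\<Oplus>i\<in>{..<k}. t \<otimes> x i \<otimes> y i) = (\<Oplus>i\<in>{..<k}. t \<otimes> (x i \<otimes> y i))"
    using t x y by (intro finsum_cong') (auto simp: m_assoc)
  ultimately show ?thesis using t by simp
qed

lemma eS_x: "t \<in> eS \<Longrightarrow> i < k \<Longrightarrow> t \<otimes> x i \<in> corner"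
  using x e by (auto simp: eS_def corner_def m_assoc) (metis m_assoc x(1))

lemma y_eS: "i < k \<Longrightarrow> y i \<in> eS"
  using y by (simp add: eS_def)

lemma homs_determined:
  assumes M: "is_lmod R M" and f: "f \<in> homs M" and g: "g \<in> homs M"
    and eq: "\<And>i. i < k \<Longrightarrow> f (y i) = g (y i)"
  shows "f = g"
proof (rule homs_ext[OF f g])
  fix t assume t: "t \<in> eS"
  have "f (\<Oplus>i\<in>{..<k}. t \<otimes> x i \<otimes> y i) = g (\<Oplus>i\<in>{..<k}. t \<otimes> x i \<otimes> y i)"
    by (rule homs_eq_finsum[OF M f g, THEN conjunct2])
      (auto simp: homsD(4)[OF f] homsD(4)[OF g] eS_x[OF t] y_eS eq intro!: corner_eS)
  then show "f t = g t" using finsum_xy t by (simp add: eSD)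
qed

text \<open>A nonzero module is infinite, hence has at least the cardinality of its finite powers. So
  \<open>Hom\<^sub>R(eS, M)\<close>, whose elements are determined by their values at the \<open>y i\<close>, has a copy in \<open>'m\<close>.\<close>

lemma hom_mod_embeds:
  fixes M :: "('r, 'm) lmod"
  assumes M: "is_lmod R M"
  shows "\<exists>j :: ('s \<Rightarrow> 'm) \<Rightarrow> 'm. inj_on j (homs M)"
proof (cases "mcar M = {mzero M}")
  case True
  have "f = g" if f: "f \<in> homs M" and g: "g \<in> homs M" for f g
    using homsD(2)[OF f] homsD(2)[OF g] by (intro homs_ext[OF f g]) (simp add: True)
  then show ?thesis by (intro exI[of _ "\<lambda>_. mzero M"] inj_onI)
next
  case False
  then obtain v where v: "v \<in> mcar M" "v \<noteq> mzero M" using is_lmodD(1)[OF M] by auto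
  have "inj (\<lambda>c. mact M (\<psi> (\<kappa> c)) v)"
  proof (rule injI, rule ccontr)
    fix c d assume eq: "mact M (\<psi> (\<kappa> c)) v = mact M (\<psi> (\<kappa> d)) v" and "c \<noteq> d"
    have k0: "\<psi> (\<kappa> c) \<in> carrier R" for c using \<kappa>(1) \<psi>_carrier by blast
    have add: "mact M (\<psi> (\<kappa> (c + d))) v = madd M (mact M (\<psi> (\<kappa> c)) v) (mact M (\<psi> (\<kappa> d)) v)" for c d
      using v by (simp add: \<kappa> \<psi>_add is_lmodD(9)[OF M] k0)
    note cl = is_lmodD(7)[OF M k0 v(1)]
    have "madd M (mact M (\<psi> (\<kappa> d)) v) (mact M (\<psi> (\<kappa> (c - d))) v) = madd M (mact M (\<psi> (\<kappa> d)) v) (mact M (\<psi> (\<kappa> 0)) v)"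
      using eq by (simp flip: add)
    then have "mact M (\<psi> (\<kappa> (c - d))) v = mact M (\<psi> (\<kappa> 0)) v"
      using lmod_add_cancel[OF M] cl by blast
    moreover have "mact M (\<psi> (\<kappa> 0)) v = mzero M"
      using add[of 0 0] by (intro lmod_idem_zero[OF M cl]) simp
    ultimately have "mact M (\<psi> (\<kappa> (1 / (c - d)))) (mact M (\<psi> (\<kappa> (c - d))) v) = mzero M"
      by (simp add: act_zero[OF M k0])
    moreover have "mact M (\<psi> (\<kappa> (1 / (c - d)))) (mact M (\<psi> (\<kappa> (c - d))) v) = mact M (\<psi> (\<kappa> (1 / (c - d) * (c - d)))) v"
      unfolding \<kappa>(4) using v by (simp add: \<psi>_mult \<kappa>(1) is_lmodD(10)[OF M] k0)
    ultimately show False using \<open>c \<noteq> d\<close> v by (simp add: \<kappa>(2) \<psi>_one is_lmodD(11)[OF M])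
  qed
  then have "infinite (range (\<lambda>c. mact M (\<psi> (\<kappa> c)) v))"
    using infinite_UNIV_char_0 finite_imageD by blast
  moreover have "range (\<lambda>c. mact M (\<psi> (\<kappa> c)) v) \<subseteq> mcar M"
    using is_lmodD(7)[OF M] v \<kappa>(1) \<psi>_carrier by blast
  ultimately have "infinite (mcar M)" using infinite_super by blast
  then obtain h :: "(nat \<Rightarrow> 'm) \<Rightarrow> 'm" where h: "inj_on h (PiE {..<k} (\<lambda>_. mcar M))"
    using infinite_power_inj[of "mcar M" k] by blast
  show ?thesis
  proof (intro exI[of _ "\<lambda>f. h (\<lambda>i\<in>{..<k}. f (y i))"] inj_onI)
    fix f g assume f: "f \<in> homs M" and g: "g \<in> homs M" and "h (\<lambda>i\<in>{..<k}. f (y i)) = h (\<lambda>i\<in>{..<k}. g (y i))"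
    then have "(\<lambda>i\<in>{..<k}. f (y i)) = (\<lambda>i\<in>{..<k}. g (y i))"
      by (intro inj_onD[OF h]) (auto simp: homsD(2) y_eS)
    then have "f (y i) = g (y i)" if "i < k" for i
      using that by (metis lessThan_iff restrict_apply')
    then show "f = g" by (rule homs_determined[OF M f g])
  qed
qed

definition jj :: "('r, 'm) lmod \<Rightarrow> ('s \<Rightarrow> 'm) \<Rightarrow> 'm" where
  "jj M = (SOME j. inj_on j (homs M))"

lemma jj_inj: "is_lmod R M \<Longrightarrow> inj_on (jj M) (homs M)"
  unfolding jj_def using hom_mod_embeds[of M] by (rule someI_ex)

definition FF :: "('r, 'm) lmod \<Rightarrow> ('s, 'm) lmod" where
  "FF M = transport (jj M) (hom_mod M)"

definition GG :: "('s, 'm) lmod \<Rightarrow> ('r, 'm) lmod" where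
  "GG N = \<lparr>mcar = {v \<in> mcar N. mact N e v = v}, madd = madd N, mzero = mzero N, mact = (\<lambda>r. mact N (\<phi> r))\<rparr>"

definition FFm :: "('r, 'm) lmod \<Rightarrow> ('r, 'm) lmod \<Rightarrow> ('m \<Rightarrow> 'm) \<Rightarrow> 'm \<Rightarrow> 'm" where
  "FFm M N h = (\<lambda>p\<in>mcar (FF M). jj N (\<lambda>t\<in>eS. h (inv_into (homs M) (jj M) p t)))"

definition GGm :: "('s, 'm) lmod \<Rightarrow> ('s, 'm) lmod \<Rightarrow> ('m \<Rightarrow> 'm) \<Rightarrow> 'm \<Rightarrow> 'm" where
  "GGm M N h = restrict h (mcar (GG M))"

lemma FF_simps:
  assumes M: "is_lmod R M"
  shows "mcar (FF M) = jj M ` homs M"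
    "f \<in> homs M \<Longrightarrow> g \<in> homs M \<Longrightarrow> madd (FF M) (jj M f) (jj M g) = jj M (\<lambda>t\<in>eS. madd M (f t) (g t))"
    "f \<in> homs M \<Longrightarrow> mact (FF M) s (jj M f) = jj M (\<lambda>t\<in>eS. f (t \<otimes> s))"
    "f \<in> homs M \<Longrightarrow> FFm M N h (jj M f) = jj N (\<lambda>t\<in>eS. h (f t))"
proof -
  have j: "inj_on (jj M) (mcar (hom_mod M))" by (simp add: hom_mod_simps jj_inj[OF M])
  show 1: "mcar (FF M) = jj M ` homs M"
    by (simp add: FF_def transport_simps[OF j] hom_mod_simps)
  show "f \<in> homs M \<Longrightarrow> g \<in> homs M \<Longrightarrow> madd (FF M) (jj M f) (jj M g) = jj M (\<lambda>t\<in>eS. madd M (f t) (g t))"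
    "f \<in> homs M \<Longrightarrow> mact (FF M) s (jj M f) = jj M (\<lambda>t\<in>eS. f (t \<otimes> s))"
    using transport_simps(3,4)[OF j] by (simp_all add: FF_def hom_mod_simps)
  show "f \<in> homs M \<Longrightarrow> FFm M N h (jj M f) = jj N (\<lambda>t\<in>eS. h (f t))"
    by (simp add: FFm_def 1 inv_into_f_f[OF jj_inj[OF M]])
qed

lemma FF_lmod: "is_lmod R M \<Longrightarrow> is_lmod S (FF M)"
  unfolding FF_def by (intro is_lmod_transport is_lmod_hom_mod) (simp_all add: hom_mod_simps jj_inj)

lemma homs_comp:
  assumes f: "f \<in> homs M" and h: "h \<in> lhom R M N"
  shows "(\<lambda>t\<in>eS. h (f t)) \<in> homs N"
  by (auto simp: homs_def homsD[OF f] lhomD[OF h] eS_add corner_eS \<psi>_carrier)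

lemma FF_functor: "mod_functor R S FF FFm"
  unfolding mod_functor_def
proof (intro conjI allI impI)
  fix M :: "('r, 'm) lmod" assume M: "is_lmod R M"
  show "is_lmod S (FF M)" by (rule FF_lmod[OF M])
  show "FFm M M (restrict id (mcar M)) = restrict id (mcar (FF M))"
  proof (rule extensionalityI[of _ "mcar (FF M)"])
    fix p assume "p \<in> mcar (FF M)"
    then obtain f where f: "f \<in> homs M" "p = jj M f" by (auto simp: FF_simps(1)[OF M])
    have "(\<lambda>t\<in>eS. restrict id (mcar M) (f t)) = f"
      by (rule extensionalityI[of _ eS]) (auto simp: homsD[OF f(1)])
    then show "FFm M M (restrict id (mcar M)) p = restrict id (mcar (FF M)) p"
      using f FF_simps[OF M] by simp
  qed (auto simp: FFm_def)
next
  fix M N :: "('r, 'm) lmod" and h assume *: "is_lmod R M \<and> is_lmod R N \<and> h \<in> lhom R M N"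
  then have M: "is_lmod R M" and N: "is_lmod R N" and h: "h \<in> lhom R M N" by auto
  note s = FF_simps[OF M] FF_simps[OF N]
  show "FFm M N h \<in> lhom S (FF M) (FF N)"
    unfolding lhom_def
  proof (safe)
    show "FFm M N h \<in> extensional (mcar (FF M))" by (simp add: FFm_def)
    fix p assume "p \<in> mcar (FF M)"
    then obtain f where f: "f \<in> homs M" "p = jj M f" by (auto simp: s)
    show "FFm M N h p \<in> mcar (FF N)" using f h by (auto simp: s homs_comp)
    fix r assume r: "r \<in> carrier S"
    have "(\<lambda>t\<in>eS. h ((\<lambda>t\<in>eS. f (t \<otimes> r)) t)) = (\<lambda>t\<in>eS. (\<lambda>t\<in>eS. h (f t)) (t \<otimes> r))"
      using r by (auto simp: fun_eq_iff eS_mult)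
    then show "FFm M N h (mact (FF M) r p) = mact (FF N) r (FFm M N h p)"
      using f r by (simp add: s homs_act homs_comp[OF _ h])
  next
    fix p q assume "p \<in> mcar (FF M)" "q \<in> mcar (FF M)"
    then obtain f g where f: "f \<in> homs M" "p = jj M f" and g: "g \<in> homs M" "q = jj M g" by (auto simp: s)
    have "(\<lambda>t\<in>eS. h ((\<lambda>t\<in>eS. madd M (f t) (g t)) t)) = (\<lambda>t\<in>eS. madd N ((\<lambda>t\<in>eS. h (f t)) t) ((\<lambda>t\<in>eS. h (g t)) t))"
      by (auto simp: fun_eq_iff lhomD(3)[OF h] homsD(2)[OF f(1)] homsD(2)[OF g(1)])
    then show "FFm M N h (madd (FF M) p q) = madd (FF N) (FFm M N h p) (FFm M N h q)"
      using f g by (simp add: s homs_add[OF M] homs_comp[OF _ h])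
  qed
next
  fix M N K :: "('r, 'm) lmod" and f g
  assume *: "is_lmod R M \<and> is_lmod R N \<and> is_lmod R K \<and> f \<in> lhom R M N \<and> g \<in> lhom R N K"
  then have M: "is_lmod R M" and N: "is_lmod R N" and f: "f \<in> lhom R M N" by auto
  show "FFm M K (compose (mcar M) g f) = compose (mcar (FF M)) (FFm N K g) (FFm M N f)"
  proof (rule extensionalityI[of _ "mcar (FF M)"])
    fix p assume "p \<in> mcar (FF M)"
    then obtain a where a: "a \<in> homs M" "p = jj M a" by (auto simp: FF_simps(1)[OF M])
    have "(\<lambda>t\<in>eS. compose (mcar M) g f (a t)) = (\<lambda>t\<in>eS. g ((\<lambda>t\<in>eS. f (a t)) t))"
      by (auto simp: fun_eq_iff compose_def homsD(2)[OF a(1)])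
    then show "FFm M K (compose (mcar M) g f) p = compose (mcar (FF M)) (FFm N K g) (FFm M N f) p"
      using a by (simp add: compose_def FF_simps[OF M] FF_simps(4)[OF N] homs_comp[OF _ f])
  qed (auto simp: FFm_def compose_def)
qed

lemma GG_simps:
  "mcar (GG N) = {v \<in> mcar N. mact N e v = v}" "madd (GG N) = madd N" "mzero (GG N) = mzero N"
  "mact (GG N) = (\<lambda>r. mact N (\<phi> r))"
  by (simp_all add: GG_def)

lemma corner_act: "is_lmod S N \<Longrightarrow> c \<in> corner \<Longrightarrow> v \<in> mcar N \<Longrightarrow> mact N e (mact N c v) = mact N c v"
  using is_lmodD(10)[of S N e c v] e cornerD by metis

lemma GG_lmod:
  assumes N: "is_lmod S N"
  shows "is_lmod R (GG N)"
proof -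
  note c = cornerD(1)[OF \<phi>_corner]
  have hom: "\<phi> (r \<oplus>\<^bsub>R\<^esub> s) = \<phi> r \<oplus> \<phi> s" "\<phi> (r \<otimes>\<^bsub>R\<^esub> s) = \<phi> r \<otimes> \<phi> s"
    if "r \<in> carrier R" "s \<in> carrier R" for r s
  proof -
    have "\<phi> r \<oplus> \<phi> s \<in> corner"
      using \<phi>_corner[OF that(1)] \<phi>_corner[OF that(2)] e by (auto simp: corner_def r_distr l_distr)
    then show "\<phi> (r \<oplus>\<^bsub>R\<^esub> s) = \<phi> r \<oplus> \<phi> s"
      using that \<psi>_add[OF \<phi>_corner[OF that(1)] \<phi>_corner[OF that(2)]] \<phi>_\<psi> by (metis \<psi>_\<phi>)
    show "\<phi> (r \<otimes>\<^bsub>R\<^esub> s) = \<phi> r \<otimes> \<phi> s"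
      using that \<psi>_mult[OF \<phi>_corner[OF that(1)] \<phi>_corner[OF that(2)]] \<phi>_\<psi>
        corner_mult[OF \<phi>_corner[OF that(1)] \<phi>_corner[OF that(2)]] by (metis \<psi>_\<phi>)
  qed
  have one: "\<phi> \<one>\<^bsub>R\<^esub> = e" using \<phi>_\<psi>[OF e_corner] by (simp add: \<psi>_one)
  have zero: "mact N e (mzero N) = mzero N" by (rule act_zero[OF N e(1)])
  show ?thesis
    unfolding is_lmod_def Let_def GG_simps
  proof (intro conjI ballI)
    fix v assume v: "v \<in> {v \<in> mcar N. mact N e v = v}"
    then have vN: "v \<in> mcar N" and ev: "mact N e v = v" by auto
    obtain w where w: "w \<in> mcar N" "madd N v w = mzero N" using is_lmodD(6)[OF N vN] by blast
    have ew: "mact N e w \<in> mcar N" using is_lmodD(7)[OF N e(1) w(1)] .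
    have "madd N v (mact N e w) = mact N e (madd N v w)"
      using is_lmodD(8)[OF N e(1) vN w(1)] ev by simp
    then have "madd N v (mact N e w) = mzero N" by (simp add: w zero)
    moreover have "mact N e (mact N e w) = mact N e w" by (rule corner_act[OF N e_corner w(1)])
    ultimately show "\<exists>y\<in>{v \<in> mcar N. mact N e v = v}. madd N v y = mzero N" using ew by blast
    show "mact N (\<phi> \<one>\<^bsub>R\<^esub>) v = v" using ev one by simp
  qed (use is_lmodD(1-5,7-10)[OF N] c hom zero corner_act[OF N \<phi>_corner] e in \<open>auto\<close>)
qed

lemma GG_functor: "mod_functor S R GG GGm"
  unfolding mod_functor_def
proof (intro conjI allI impI)
  fix M :: "('s, 'm) lmod" assume "is_lmod S M"
  then show "is_lmod R (GG M)" by (rule GG_lmod)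
  have "mcar M \<inter> mcar (GG M) = mcar (GG M)" by (auto simp: GG_simps)
  then show "GGm M M (restrict id (mcar M)) = restrict id (mcar (GG M))" by (simp add: GGm_def)
next
  fix M N :: "('s, 'm) lmod" and h assume *: "is_lmod S M \<and> is_lmod S N \<and> h \<in> lhom S M N"
  then have M: "is_lmod S M" and h: "h \<in> lhom S M N" by auto
  show "GGm M N h \<in> lhom R (GG M) (GG N)"
    unfolding lhom_def
  proof (safe)
    show "GGm M N h \<in> extensional (mcar (GG M))" by (simp add: GGm_def)
    fix v assume v: "v \<in> mcar (GG M)"
    then have vM: "v \<in> mcar M" "mact M e v = v" by (simp_all add: GG_simps)
    show "GGm M N h v \<in> mcar (GG N)"
      using v vM lhomD(2,4)[OF h] e by (simp add: GGm_def GG_simps flip: lhomD(4)[OF h e(1) vM(1)])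
    {
      fix w assume w: "w \<in> mcar (GG M)"
      then have "madd M v w \<in> mcar (GG M)"
        using is_lmodD(2)[OF GG_lmod[OF M] v] by (simp add: GG_simps(2))
      then show "GGm M N h (madd (GG M) v w) = madd (GG N) (GGm M N h v) (GGm M N h w)"
        using v w vM lhomD(3)[OF h, of v w] by (simp add: GGm_def GG_simps)
    }
    fix r assume r: "r \<in> carrier R"
    have "mact M (\<phi> r) v \<in> mcar (GG M)"
      using is_lmodD(7)[OF GG_lmod[OF M] r v] by (simp add: GG_simps(4))
    then show "GGm M N h (mact (GG M) r v) = mact (GG N) r (GGm M N h v)"
      using v vM lhomD(4)[OF h cornerD(1)[OF \<phi>_corner[OF r]] vM(1)] by (simp add: GGm_def GG_simps)
  qed
next
  fix M N K :: "('s, 'm) lmod" and f g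
  assume *: "is_lmod S M \<and> is_lmod S N \<and> is_lmod S K \<and> f \<in> lhom S M N \<and> g \<in> lhom S N K"
  then have f: "f \<in> lhom S M N" by blast
  show "GGm M K (compose (mcar M) g f) = compose (mcar (GG M)) (GGm N K g) (GGm M N f)"
  proof (rule extensionalityI[of _ "mcar (GG M)"])
    fix v assume v: "v \<in> mcar (GG M)"
    then have "f v \<in> mcar (GG N)"
      using lhomD(2)[OF f, of v] lhomD(4)[OF f e(1), of v] by (simp add: GG_simps)
    then show "GGm M K (compose (mcar M) g f) v = compose (mcar (GG M)) (GGm N K g) (GGm M N f) v"
      using v by (simp add: GGm_def GG_simps compose_def)
  qed (simp_all only: GGm_def compose_def restrict_extensional)
qed

definition eta :: "('r, 'm) lmod \<Rightarrow> 'm \<Rightarrow> 'm" where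
  "eta M = (\<lambda>v\<in>mcar M. jj M (\<lambda>t\<in>eS. mact M (\<psi> (t \<otimes> e)) v))"

lemma eta_homs:
  assumes M: "is_lmod R M" and v: "v \<in> mcar M"
  shows "(\<lambda>t\<in>eS. mact M (\<psi> (t \<otimes> e)) v) \<in> homs M"
  unfolding homs_def
proof (safe)
  fix t assume t: "t \<in> eS"
  show "(\<lambda>t\<in>eS. mact M (\<psi> (t \<otimes> e)) v) t \<in> mcar M"
    using is_lmodD(7)[OF M] v t eS_e \<psi>_carrier by simp
  fix u assume u: "u \<in> eS"
  show "(\<lambda>t\<in>eS. mact M (\<psi> (t \<otimes> e)) v) (t \<oplus> u)
      = madd M ((\<lambda>t\<in>eS. mact M (\<psi> (t \<otimes> e)) v) t) ((\<lambda>t\<in>eS. mact M (\<psi> (t \<otimes> e)) v) u)"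
    using t u v eS_e \<psi>_carrier e by (simp add: eS_add l_distr eSD \<psi>_add is_lmodD(9)[OF M])
next
  fix c t assume c: "c \<in> corner" and t: "t \<in> eS"
  have "\<psi> (c \<otimes> t \<otimes> e) = \<psi> c \<otimes>\<^bsub>R\<^esub> \<psi> (t \<otimes> e)"
    using c t eS_e e by (simp add: m_assoc cornerD eSD \<psi>_mult)
  then show "(\<lambda>t\<in>eS. mact M (\<psi> (t \<otimes> e)) v) (c \<otimes> t) = mact M (\<psi> c) ((\<lambda>t\<in>eS. mact M (\<psi> (t \<otimes> e)) v) t)"
    using c t v eS_e \<psi>_carrier by (simp add: corner_eS is_lmodD(10)[OF M])
qed auto

lemma eta_iso:
  assumes M: "is_lmod R M"
  shows "eta M \<in> lhom R M (GG (FF M)) \<and> bij_betw (eta M) (mcar M) (mcar (GG (FF M)))"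
proof -
  note s = FF_simps[OF M] GG_simps
  define \<theta> where "\<theta> v = (\<lambda>t\<in>eS. mact M (\<psi> (t \<otimes> e)) v)" for v
  have \<theta>: "\<theta> v \<in> homs M" if "v \<in> mcar M" for v
    unfolding \<theta>_def by (rule eta_homs[OF M that])
  have \<eta>: "eta M v = jj M (\<theta> v)" if "v \<in> mcar M" for v
    using that by (simp add: eta_def \<theta>_def)
  have \<theta>e: "(\<lambda>t\<in>eS. \<theta> v (t \<otimes> e)) = \<theta> v" for v
    unfolding \<theta>_def using e by (auto simp: fun_eq_iff eS_mult eSD m_assoc)
  have \<theta>1: "\<theta> v e = v" if "v \<in> mcar M" for v
    using that by (simp add: \<theta>_def e_eS e \<psi>_one is_lmodD(11)[OF M])
  have mem: "eta M v \<in> mcar (GG (FF M))" if v: "v \<in> mcar M" for v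
    using \<theta>[OF v] by (auto simp: s \<eta>[OF v] \<theta>e)
  have "eta M \<in> lhom R M (GG (FF M))"
    unfolding lhom_def
  proof (safe)
    show "eta M \<in> extensional (mcar M)" by (simp add: eta_def)
    fix v assume v: "v \<in> mcar M"
    show "eta M v \<in> mcar (GG (FF M))" by (rule mem[OF v])
    {
      fix w assume w: "w \<in> mcar M"
      have "\<theta> (madd M v w) = (\<lambda>t\<in>eS. madd M (\<theta> v t) (\<theta> w t))"
        unfolding \<theta>_def using v w by (auto simp: fun_eq_iff is_lmodD(8)[OF M] \<psi>_carrier eS_e)
      then show "eta M (madd M v w) = madd (GG (FF M)) (eta M v) (eta M w)"
        using v w by (simp add: \<eta> is_lmodD(2)[OF M] s \<theta>)
    }
    fix r assume r: "r \<in> carrier R"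
    have "\<theta> (mact M r v) = (\<lambda>t\<in>eS. \<theta> v (t \<otimes> \<phi> r))"
    proof -
      have "mact M (\<psi> (t \<otimes> e)) (mact M r v) = mact M (\<psi> (t \<otimes> \<phi> r \<otimes> e)) v" if t: "t \<in> eS" for t
      proof -
        note c = \<phi>_corner[OF r]
        have "\<psi> (t \<otimes> \<phi> r \<otimes> e) = \<psi> ((t \<otimes> e) \<otimes> \<phi> r)"
          using t e cornerD[OF c] by (simp add: m_assoc eSD)
        also have "\<dots> = \<psi> (t \<otimes> e) \<otimes>\<^bsub>R\<^esub> r" using \<psi>_mult[OF eS_e[OF t] c] \<psi>_\<phi>[OF r] by simp
        finally show ?thesis using r v t eS_e \<psi>_carrier by (simp add: is_lmodD(10)[OF M])
      qed
      then show ?thesis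
        unfolding \<theta>_def using cornerD(1)[OF \<phi>_corner[OF r]] by (auto simp: fun_eq_iff eS_mult)
    qed
    then show "eta M (mact M r v) = mact (GG (FF M)) r (eta M v)"
      using v r by (simp add: \<eta> is_lmodD(7)[OF M] s \<theta>)
  qed
  moreover have "inj_on (eta M) (mcar M)"
  proof (rule inj_onI)
    fix v w assume v: "v \<in> mcar M" and w: "w \<in> mcar M" and eq: "eta M v = eta M w"
    have "jj M (\<theta> v) = jj M (\<theta> w)" using eq unfolding \<eta>[OF v] \<eta>[OF w] .
    then have "\<theta> v = \<theta> w" by (rule inj_onD[OF jj_inj[OF M] _ \<theta>[OF v] \<theta>[OF w]])
    then have "\<theta> v e = \<theta> w e" by (rule fun_cong)
    then show "v = w" unfolding \<theta>1[OF v] \<theta>1[OF w] .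
  qed
  moreover have "eta M ` mcar M = mcar (GG (FF M))"
  proof
    show "mcar (GG (FF M)) \<subseteq> eta M ` mcar M"
    proof
      fix p assume "p \<in> mcar (GG (FF M))"
      then have "p \<in> jj M ` homs M" and pe: "mact (FF M) e p = p" by (simp_all add: s)
      then obtain f where f: "f \<in> homs M" and p: "p = jj M f" by blast
      have "jj M (\<lambda>t\<in>eS. f (t \<otimes> e)) = jj M f" using pe by (simp add: p s f)
      then have ff: "(\<lambda>t\<in>eS. f (t \<otimes> e)) = f"
        by (rule inj_onD[OF jj_inj[OF M] _ homs_act[OF f e(1)] f])
      have v: "f e \<in> mcar M" by (rule homsD(2)[OF f e_eS])
      have "f = \<theta> (f e)"
      proof (rule homs_ext[OF f \<theta>[OF v]])
        fix t assume t: "t \<in> eS"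
        have "f t = f (t \<otimes> e)" using fun_cong[OF ff, of t] t by simp
        also have "\<dots> = f ((t \<otimes> e) \<otimes> e)" using t e by (simp add: m_assoc eSD)
        also have "\<dots> = mact M (\<psi> (t \<otimes> e)) (f e)" by (rule homsD(4)[OF f eS_e[OF t] e_eS])
        finally show "f t = \<theta> (f e) t" using t by (simp add: \<theta>_def)
      qed
      then show "p \<in> eta M ` mcar M" using v by (intro image_eqI[of _ _ "f e"]) (auto simp: p \<eta>)
    qed
  qed (use mem in auto)
  ultimately show ?thesis by (simp add: bij_betw_def)
qed

lemma eta_natural:
  assumes M: "is_lmod R M" and N: "is_lmod R N" and f: "f \<in> lhom R M N"
  shows "compose (mcar M) (GGm (FF M) (FF N) (FFm M N f)) (eta M) = compose (mcar M) (eta N) f"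
proof (rule extensionalityI[of _ "mcar M"])
  fix v assume v: "v \<in> mcar M"
  have "eta M v \<in> mcar (GG (FF M))" using eta_iso[OF M] v by (auto simp: bij_betw_def)
  moreover have "(\<lambda>t\<in>eS. f ((\<lambda>t\<in>eS. mact M (\<psi> (t \<otimes> e)) v) t)) = (\<lambda>t\<in>eS. mact N (\<psi> (t \<otimes> e)) (f v))"
    using v by (auto simp: fun_eq_iff lhomD(4)[OF f] \<psi>_carrier eS_e)
  ultimately show "compose (mcar M) (GGm (FF M) (FF N) (FFm M N f)) (eta M) v = compose (mcar M) (eta N) f v"
    using v by (simp add: compose_def GGm_def) (simp add: eta_def FF_simps(4)[OF M] eta_homs[OF M] lhomD(2)[OF f])
qed (auto simp: compose_def)

definition th :: "('s, 'm) lmod \<Rightarrow> 'm \<Rightarrow> 'm" where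
  "th N = (\<lambda>v\<in>mcar N. jj (GG N) (\<lambda>t\<in>eS. mact N t v))"

definition epsilon :: "('s, 'm) lmod \<Rightarrow> 'm \<Rightarrow> 'm" where
  "epsilon N = (\<lambda>p\<in>mcar (FF (GG N)). inv_into (mcar N) (th N) p)"

lemma th_homs:
  assumes N: "is_lmod S N" and v: "v \<in> mcar N"
  shows "(\<lambda>t\<in>eS. mact N t v) \<in> homs (GG N)"
  unfolding homs_def GG_simps
proof (safe)
  fix t assume t: "t \<in> eS"
  show "(\<lambda>t\<in>eS. mact N t v) t \<in> mcar N"
    using is_lmodD(7)[OF N] v t eSD by simp
  show "mact N e ((\<lambda>t\<in>eS. mact N t v) t) = (\<lambda>t\<in>eS. mact N t v) t"
    using is_lmodD(10)[OF N e(1) eSD(1)[OF t] v] t eSD(2)[OF t] by simp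
  fix u assume u: "u \<in> eS"
  show "(\<lambda>t\<in>eS. mact N t v) (t \<oplus> u) = madd N ((\<lambda>t\<in>eS. mact N t v) t) ((\<lambda>t\<in>eS. mact N t v) u)"
    using t u v by (simp add: eS_add eSD is_lmodD(9)[OF N])
next
  fix c t assume c: "c \<in> corner" and t: "t \<in> eS"
  then show "(\<lambda>t\<in>eS. mact N t v) (c \<otimes> t) = mact N (\<phi> (\<psi> c)) ((\<lambda>t\<in>eS. mact N t v) t)"
    using v by (simp add: corner_eS \<phi>_\<psi> cornerD eSD is_lmodD(10)[OF N])
qed auto

lemma th_iso:
  assumes N: "is_lmod S N"
  shows "th N \<in> lhom S N (FF (GG N)) \<and> bij_betw (th N) (mcar N) (mcar (FF (GG N)))"
proof -
  note GN = GG_lmod[OF N]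
  note s = FF_simps[OF GN] GG_simps
  define \<theta> where "\<theta> v = (\<lambda>t\<in>eS. mact N t v)" for v
  have \<theta>: "\<theta> v \<in> homs (GG N)" if "v \<in> mcar N" for v
    unfolding \<theta>_def by (rule th_homs[OF N that])
  have th: "th N v = jj (GG N) (\<theta> v)" if "v \<in> mcar N" for v
    using that by (simp add: th_def \<theta>_def)
  have surj: "\<exists>v\<in>mcar N. f = \<theta> v" if f: "f \<in> homs (GG N)" for f
  proof -
    have "\<exists>v\<in>mcar N. \<forall>t\<in>eS. mact N t v = f (\<Oplus>i\<in>B. t \<otimes> x i \<otimes> y i) \<and> (\<Oplus>i\<in>B. t \<otimes> x i \<otimes> y i) \<in> eS"
      if "finite B" "B \<subseteq> {..<k}" for B
      using that
    proof (induction B rule: finite_induct)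
      case empty
      have "mact N t (mzero N) = mzero N" if t: "t \<in> eS" for t
        by (rule act_zero[OF N eSD(1)[OF t]])
      then show ?case using is_lmodD(1)[OF N] homs_zero[OF GN f] by (auto simp: eS_zero GG_simps)
    next
      case (insert i B)
      then obtain v where v: "v \<in> mcar N"
        "\<And>t. t \<in> eS \<Longrightarrow> mact N t v = f (\<Oplus>i\<in>B. t \<otimes> x i \<otimes> y i) \<and> (\<Oplus>i\<in>B. t \<otimes> x i \<otimes> y i) \<in> eS" by auto
      have i: "i < k" using insert by auto
      have fy: "f (y i) \<in> mcar N" using homsD(2)[OF f y_eS[OF i]] by (simp add: GG_simps)
      have xf: "mact N (x i) (f (y i)) \<in> mcar N" using is_lmodD(7)[OF N x(1)[OF i] fy] .
      have "mact N t (madd N (mact N (x i) (f (y i))) v) = f (\<Oplus>j\<in>insert i B. t \<otimes> x j \<otimes> y j)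
          \<and> (\<Oplus>j\<in>insert i B. t \<otimes> x j \<otimes> y j) \<in> eS" if t: "t \<in> eS" for t
      proof -
        have c: "t \<otimes> x i \<in> corner" by (rule eS_x[OF t i])
        have txy: "t \<otimes> x i \<otimes> y i \<in> eS" by (rule corner_eS[OF c y_eS[OF i]])
        have sum: "(\<Oplus>j\<in>insert i B. t \<otimes> x j \<otimes> y j) = t \<otimes> x i \<otimes> y i \<oplus> (\<Oplus>j\<in>B. t \<otimes> x j \<otimes> y j)"
          using insert t x y by (intro finsum_insert) (auto simp: eSD)
        have "mact N t (madd N (mact N (x i) (f (y i))) v) = madd N (mact N t (mact N (x i) (f (y i)))) (mact N t v)"
          using t xf v by (simp add: is_lmodD(8)[OF N] eSD)
        also have "mact N t (mact N (x i) (f (y i))) = mact N (t \<otimes> x i) (f (y i))"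
          using t fy x i by (simp add: is_lmodD(10)[OF N] eSD)
        also have "\<dots> = f (t \<otimes> x i \<otimes> y i)"
          using homsD(4)[OF f c y_eS[OF i]] by (simp add: GG_simps \<phi>_\<psi>[OF c])
        also have "mact N t v = f (\<Oplus>j\<in>B. t \<otimes> x j \<otimes> y j)" using v t by blast
        finally show ?thesis
          using homsD(3)[OF f txy] v(2)[OF t] txy by (simp add: sum GG_simps eS_add)
      qed
      then show ?case using is_lmodD(2)[OF N xf v(1)] by blast
    qed
    from this[OF finite_lessThan subset_refl] obtain v where v: "v \<in> mcar N"
      "\<And>t. t \<in> eS \<Longrightarrow> mact N t v = f (\<Oplus>i\<in>{..<k}. t \<otimes> x i \<otimes> y i)" by blast
    have "f = \<theta> v"
      by (rule homs_ext[OF f \<theta>[OF v(1)]]) (simp add: \<theta>_def v(2) finsum_xy eSD)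
    then show ?thesis using v(1) by blast
  qed
  have inj: "v = w" if v: "v \<in> mcar N" and w: "w \<in> mcar N" and eq: "\<theta> v = \<theta> w" for v w
  proof -
    have "mact N (\<Oplus>i\<in>B. x i \<otimes> y i) v = mact N (\<Oplus>i\<in>B. x i \<otimes> y i) w \<and> (\<Oplus>i\<in>B. x i \<otimes> y i) \<in> carrier S"
      if "finite B" "B \<subseteq> {..<k}" for B
      using that
    proof (induction B rule: finite_induct)
      case empty
      have "mact N \<zero> v = mzero N" if v: "v \<in> mcar N" for v
        using is_lmodD(9)[OF N zero_closed zero_closed v]
        by (intro lmod_idem_zero[OF N is_lmodD(7)[OF N zero_closed v]]) simp
      then show ?case using v w by simp
    next
      case (insert i B)
      have i: "i < k" using insert by auto
      have "mact N (y i) v = mact N (y i) w"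
        using fun_cong[OF eq, of "y i"] y_eS[OF i] by (simp add: \<theta>_def)
      then have "mact N (x i \<otimes> y i) v = mact N (x i \<otimes> y i) w"
        using v w x y i by (simp add: is_lmodD(10)[OF N])
      moreover have "(\<Oplus>j\<in>insert i B. x j \<otimes> y j) = x i \<otimes> y i \<oplus> (\<Oplus>j\<in>B. x j \<otimes> y j)"
        using insert x y by (intro finsum_insert) auto
      ultimately show ?case using insert x y i v w by (simp add: is_lmodD(9)[OF N])
    qed
    from this[OF finite_lessThan subset_refl] show ?thesis
      using v w by (simp add: xy is_lmodD(11)[OF N])
  qed
  have "th N \<in> lhom S N (FF (GG N))"
    unfolding lhom_def
  proof (safe)
    show "th N \<in> extensional (mcar N)" by (simp add: th_def)
    fix v assume v: "v \<in> mcar N"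
    show "th N v \<in> mcar (FF (GG N))" using \<theta>[OF v] by (auto simp: s th[OF v])
    {
      fix w assume w: "w \<in> mcar N"
      have "\<theta> (madd N v w) = (\<lambda>t\<in>eS. madd N (\<theta> v t) (\<theta> w t))"
        unfolding \<theta>_def using v w by (auto simp: fun_eq_iff is_lmodD(8)[OF N] eSD)
      then show "th N (madd N v w) = madd (FF (GG N)) (th N v) (th N w)"
        using v w by (simp add: th is_lmodD(2)[OF N] s \<theta>)
    }
    fix r assume r: "r \<in> carrier S"
    have "\<theta> (mact N r v) = (\<lambda>t\<in>eS. \<theta> v (t \<otimes> r))"
      unfolding \<theta>_def using v r by (auto simp: fun_eq_iff eS_mult is_lmodD(10)[OF N] eSD)
    then show "th N (mact N r v) = mact (FF (GG N)) r (th N v)"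
      using v r by (simp add: th is_lmodD(7)[OF N] s \<theta>)
  qed
  moreover have "bij_betw (th N) (mcar N) (mcar (FF (GG N)))"
    unfolding bij_betw_def
  proof
    show "inj_on (th N) (mcar N)"
    proof (rule inj_onI)
      fix v w assume v: "v \<in> mcar N" and w: "w \<in> mcar N" and eq: "th N v = th N w"
      have "jj (GG N) (\<theta> v) = jj (GG N) (\<theta> w)" using eq unfolding th[OF v] th[OF w] .
      then have "\<theta> v = \<theta> w" by (rule inj_onD[OF jj_inj[OF GN] _ \<theta>[OF v] \<theta>[OF w]])
      then show "v = w" using inj v w by blast
    qed
    show "th N ` mcar N = mcar (FF (GG N))"
    proof (safe)
      fix v assume v: "v \<in> mcar N"
      show "th N v \<in> mcar (FF (GG N))" unfolding s(1) th[OF v] by (rule imageI[OF \<theta>[OF v]])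
    next
      fix p assume "p \<in> mcar (FF (GG N))"
      then obtain f where f: "f \<in> homs (GG N)" "p = jj (GG N) f" unfolding s(1) by blast
      obtain v where v: "v \<in> mcar N" "f = \<theta> v" using surj[OF f(1)] by blast
      show "p \<in> th N ` mcar N" by (rule image_eqI[OF _ v(1)]) (simp add: f(2) v th)
    qed
  qed
  ultimately show ?thesis by blast
qed

lemma epsilon_iso:
  assumes N: "is_lmod S N"
  shows "epsilon N \<in> lhom S (FF (GG N)) N \<and> bij_betw (epsilon N) (mcar (FF (GG N))) (mcar N)"
proof -
  have h: "th N \<in> lhom S N (FF (GG N))" and b: "bij_betw (th N) (mcar N) (mcar (FF (GG N)))"
    using th_iso[OF N] by auto
  have inv: "epsilon N (th N v) = v" if "v \<in> mcar N" for v
    using that b by (auto simp: epsilon_def bij_betw_def)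
  have ex: "\<exists>v\<in>mcar N. p = th N v" if "p \<in> mcar (FF (GG N))" for p
    using that b by (auto simp: bij_betw_def)
  have "epsilon N \<in> lhom S (FF (GG N)) N"
    unfolding lhom_def
  proof (safe)
    show "epsilon N \<in> extensional (mcar (FF (GG N)))" by (simp add: epsilon_def)
    fix p assume "p \<in> mcar (FF (GG N))"
    then obtain v where v: "v \<in> mcar N" "p = th N v" using ex by blast
    show "epsilon N p \<in> mcar N" using v inv by simp
    {
      fix q assume "q \<in> mcar (FF (GG N))"
      then obtain w where w: "w \<in> mcar N" "q = th N w" using ex by blast
      show "epsilon N (madd (FF (GG N)) p q) = madd N (epsilon N p) (epsilon N q)"
        using v w inv is_lmodD(2)[OF N] by (simp flip: lhomD(3)[OF h])
    }
    fix r assume "r \<in> carrier S"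
    then show "epsilon N (mact (FF (GG N)) r p) = mact N r (epsilon N p)"
      using v inv is_lmodD(7)[OF N] by (simp flip: lhomD(4)[OF h])
  qed
  moreover have "bij_betw (epsilon N) (mcar (FF (GG N))) (mcar N)"
    using bij_betw_inv_into[OF b] by (rule bij_betw_cong[THEN iffD1, rotated]) (simp add: epsilon_def)
  ultimately show ?thesis by blast
qed

lemma epsilon_natural:
  assumes N: "is_lmod S N" and N': "is_lmod S N'" and g: "g \<in> lhom S N N'"
  shows "compose (mcar (FF (GG N))) (epsilon N') (FFm (GG N) (GG N') (GGm N N' g))
    = compose (mcar (FF (GG N))) g (epsilon N)"
proof (rule extensionalityI[of _ "mcar (FF (GG N))"])
  have b: "bij_betw (th N) (mcar N) (mcar (FF (GG N)))" and b': "bij_betw (th N') (mcar N') (mcar (FF (GG N')))"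
    using th_iso[OF N] th_iso[OF N'] by auto
  fix p assume p: "p \<in> mcar (FF (GG N))"
  then obtain v where v: "v \<in> mcar N" "p = th N v" using b by (auto simp: bij_betw_def)
  have gv: "g v \<in> mcar N'" by (rule lhomD(2)[OF g v(1)])
  have "(\<lambda>t\<in>eS. GGm N N' g ((\<lambda>t\<in>eS. mact N t v) t)) = (\<lambda>t\<in>eS. mact N' t (g v))"
    using homsD(2)[OF th_homs[OF N v(1)]] v(1) by (auto simp: fun_eq_iff GGm_def lhomD(4)[OF g] eSD)
  then have "FFm (GG N) (GG N') (GGm N N' g) p = th N' (g v)"
    using v gv by (simp add: th_def FF_simps(4)[OF GG_lmod[OF N]] th_homs[OF N])
  moreover have "epsilon N p = v" using v b p by (auto simp: epsilon_def bij_betw_def)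
  moreover have "epsilon N' (th N' (g v)) = g v" using gv b' by (auto simp: epsilon_def bij_betw_def)
  ultimately show "compose (mcar (FF (GG N))) (epsilon N') (FFm (GG N) (GG N') (GGm N N' g)) p
    = compose (mcar (FF (GG N))) g (epsilon N) p"
    using p by (simp add: compose_def)
qed (auto simp: compose_def)

theorem full_corner_Morita: "module_categories_equivalent R S TYPE('m)"
  unfolding module_categories_equivalent_def
proof (intro exI conjI allI impI)
  show "mod_functor R S (FF :: ('r, 'm) lmod \<Rightarrow> _) FFm" by (rule FF_functor)
  show "mod_functor S R (GG :: ('s, 'm) lmod \<Rightarrow> _) GGm" by (rule GG_functor)
  fix M :: "('r, 'm) lmod" assume M: "is_lmod R M"
  show "eta M \<in> lhom R M (GG (FF M))" "bij_betw (eta M) (mcar M) (mcar (GG (FF M)))"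
    using eta_iso[OF M] by auto
  fix N :: "('r, 'm) lmod" and f assume "is_lmod R N \<and> f \<in> lhom R M N"
  then show "compose (mcar M) (GGm (FF M) (FF N) (FFm M N f)) (eta M) = compose (mcar M) (eta N) f"
    using eta_natural[OF M] by blast
next
  fix N :: "('s, 'm) lmod" assume N: "is_lmod S N"
  show "epsilon N \<in> lhom S (FF (GG N)) N" "bij_betw (epsilon N) (mcar (FF (GG N))) (mcar N)"
    using epsilon_iso[OF N] by auto
  fix N' :: "('s, 'm) lmod" and g assume "is_lmod S N' \<and> g \<in> lhom S N N'"
  then show "compose (mcar (FF (GG N))) (epsilon N') (FFm (GG N) (GG N') (GGm N N' g))
    = compose (mcar (FF (GG N))) g (epsilon N)"
    using epsilon_natural[OF N] by blast
qed

end

context mod_alg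
begin

abbreviation "SH \<equiv> smashH H U P sc act"
abbreviation "SU \<equiv> smashU U sc act"

lemma equi_cong:
  assumes "\<And>x j. x < a \<Longrightarrow> j < b \<Longrightarrow> T x j = T' x j" and T: "equi a v b w T"
  shows "equi a v b w T'"
proof -
  have "(\<Sum>x'<a. \<Sum>y<b. sc (f x' y) (T' x' y)) = (\<Sum>x'<a. \<Sum>y<b. sc (f x' y) (T x' y))" for f
    by (intro sum.cong refl) (simp add: assms(1))
  then show ?thesis using T by (simp add: equi_def flip: assms(1))
qed

lemma D_minus [simp]: "D s (- a) = - D s a"
  using D_add[of s a "- a"] by (simp add: eq_neg_iff_add_eq_0 add.commute)

lemma equi_minus: "equi a v b w T \<Longrightarrow> equi a v b w (\<lambda>x j. - T x j)"
  by (simp add: equi_def sc_minus_right sum_negf)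

definition supp :: "(nat \<Rightarrow> nat \<Rightarrow> 'a) \<Rightarrow> bool" where
  "supp w \<longleftrightarrow> (\<forall>l a. l \<ge> n \<or> a \<ge> n \<longrightarrow> w l a = 0)"

lemma SH_carrier: "w \<in> carrier SH \<longleftrightarrow> supp w \<and> equi n u n u (Th w)"
proof -
  have 1: "w \<in> carrier SH \<longleftrightarrow> (\<forall>l<n. \<forall>k\<ge>n. w l k = 0) \<and> (\<forall>l\<ge>n. w l = (\<lambda>_. 0)) \<and> (\<forall>l<n. invd (w l))"
    by (auto simp: smashH_def Let_def invariants_iff)
  have 2: "(\<forall>l<n. \<forall>k\<ge>n. w l k = 0) \<and> (\<forall>l\<ge>n. w l = (\<lambda>_. 0)) \<longleftrightarrow> supp w"
    unfolding supp_def fun_eq_iff by (meson linorder_not_le)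
  show ?thesis unfolding 1 2[symmetric] invd_iff_equi[symmetric] by (simp only: conj_assoc)
qed

lemma SH_eqI:
  assumes w: "w \<in> carrier SH" and w': "w' \<in> carrier SH"
    and eq: "\<And>x j. x < n \<Longrightarrow> j < n \<Longrightarrow> Th w x j = Th w' x j"
  shows "w = w'"
proof (intro ext)
  fix l a
  show "w l a = w' l a"
  proof (cases "l < n \<and> a < n")
    case True
    have "Ti (Th w) l a = Ti (Th w') l a" by (rule Ti_cong[OF eq])
    then show ?thesis using True by (simp add: Ti_Th)
  next
    case False
    then have "l \<ge> n \<or> a \<ge> n" by auto
    then show ?thesis using w w' by (auto simp: SH_carrier supp_def)
  qed
qed

lemma SH_add: "(w \<oplus>\<^bsub>SH\<^esub> w') l a = w l a + w' l a"
  and SH_zero: "\<zero>\<^bsub>SH\<^esub> l a = 0"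
  by (simp_all add: smashH_def Let_def)

lemma Th_add: "Th (w \<oplus>\<^bsub>SH\<^esub> w') x j = Th w x j + Th w' x j"
  by (simp add: Th_def SH_add sc_add_right sum.distrib)

lemma Th_zero: "Th \<zero>\<^bsub>SH\<^esub> x j = 0"
  by (simp add: Th_def SH_zero)

lemma Th_one:
  assumes "x < n" "j < n"
  shows "Th \<one>\<^bsub>SH\<^esub> x j = (if x = j then 1 else 0)"
proof -
  have "Th \<one>\<^bsub>SH\<^esub> x j = (\<Sum>l<n. \<Sum>a<n. sc (H.co j (csc (heta H a) (H.b a) * csc (heps H l) (H.c x l))) 1)"
    by (simp add: Th_def smashH_def Let_def tone_def mult_ac)
  also have "\<dots> = (\<Sum>a<n. \<Sum>l<n. sc (H.co j (csc (heta H a) (H.b a) * csc (heps H l) (H.c x l))) 1)"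
    by (rule sum.swap)
  also have "\<dots> = sc (H.co j ((\<Sum>a<n. csc (heta H a) (H.b a)) * (\<Sum>l<n. csc (heps H l) (H.c x l)))) 1"
    by (simp only: sum_product H.co_sum sc_sum_left)
  also have "\<dots> = sc (H.co j (H.b x)) 1"
    using assms by (simp add: H.sum_ep_c flip: H.one_b)
  finally show ?thesis using assms by (simp add: H.co_b)
qed

lemma SH_mult_supp: "supp (w \<otimes>\<^bsub>SH\<^esub> w')"
  by (auto simp: supp_def smashH_def Let_def tmul_def)

lemma SH_mult_closed:
  assumes w: "w \<in> carrier SH" and w': "w' \<in> carrier SH"
  shows "w \<otimes>\<^bsub>SH\<^esub> w' \<in> carrier SH"
  unfolding SH_carrier
proof
  have "equi n u n u (\<lambda>x j. \<Sum>y<n. Th w y j * Th w' x y)"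
    using w w' by (intro equi_mult[OF _ _ corep_u corep_u corep_u]) (simp_all add: SH_carrier)
  then show "equi n u n u (Th (w \<otimes>\<^bsub>SH\<^esub> w'))"
    by (rule equi_cong[rotated]) (simp add: Th_mult)
qed (rule SH_mult_supp)

lemma SH_one_closed: "\<one>\<^bsub>SH\<^esub> \<in> carrier SH"
  unfolding SH_carrier
proof
  have "equi n u n u (\<lambda>x j. sc (if x = j then 1 else 0) 1)"
    by (rule equi_scalar[OF _ corep_u]) (simp add: U.intw_def if_distrib[of "\<lambda>c. csc c _"] cong: if_cong)
  then show "equi n u n u (Th \<one>\<^bsub>SH\<^esub>)"
    by (rule equi_cong[rotated]) (simp add: Th_one)
qed (auto simp: supp_def smashH_def Let_def tone_def)

lemma SH_add_closed:
  assumes w: "w \<in> carrier SH" and w': "w' \<in> carrier SH"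
  shows "w \<oplus>\<^bsub>SH\<^esub> w' \<in> carrier SH"
  unfolding SH_carrier
proof
  have "equi n u n u (\<lambda>x j. Th w x j + Th w' x j)"
    using w w' by (intro equi_add) (simp_all add: SH_carrier)
  then show "equi n u n u (Th (w \<oplus>\<^bsub>SH\<^esub> w'))"
    by (rule equi_cong[rotated]) (simp add: Th_add)
qed (use w w' in \<open>simp add: SH_carrier supp_def SH_add\<close>)

lemma SH_zero_closed: "\<zero>\<^bsub>SH\<^esub> \<in> carrier SH"
  by (simp add: SH_carrier supp_def SH_zero equi_def Th_zero)

lemma SH_minus_closed:
  assumes w: "w \<in> carrier SH"
  shows "(\<lambda>l a. - w l a) \<in> carrier SH"
  unfolding SH_carrier
proof
  have "equi n u n u (\<lambda>x j. - Th w x j)"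
    using w by (intro equi_minus) (simp add: SH_carrier)
  then show "equi n u n u (Th (\<lambda>l a. - w l a))"
    by (rule equi_cong[rotated]) (simp add: Th_def sc_minus_right sum_negf)
qed (use w in \<open>simp add: SH_carrier supp_def\<close>)

lemma ring_smashH: "ring SH"
proof (rule ringI)
  show "abelian_group SH"
  proof (rule abelian_groupI)
    fix w assume w: "w \<in> carrier SH"
    have "(\<lambda>l a. - w l a) \<oplus>\<^bsub>SH\<^esub> w = \<zero>\<^bsub>SH\<^esub>"
      by (intro ext) (simp add: SH_add SH_zero)
    then show "\<exists>w'\<in>carrier SH. w' \<oplus>\<^bsub>SH\<^esub> w = \<zero>\<^bsub>SH\<^esub>"
      using SH_minus_closed[OF w] by blast
  qed (simp_all add: SH_add_closed SH_zero_closed fun_eq_iff SH_add SH_zero add_ac)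
  show "monoid SH"
  proof (rule monoidI)
    fix x y z assume c: "x \<in> carrier SH" "y \<in> carrier SH" "z \<in> carrier SH"
    show "x \<otimes>\<^bsub>SH\<^esub> y \<otimes>\<^bsub>SH\<^esub> z = x \<otimes>\<^bsub>SH\<^esub> (y \<otimes>\<^bsub>SH\<^esub> z)"
    proof (rule SH_eqI)
      fix i j assume "i < n" "j < n"
      then have "Th (x \<otimes>\<^bsub>SH\<^esub> y \<otimes>\<^bsub>SH\<^esub> z) i j = (\<Sum>k<n. \<Sum>l<n. Th x l j * Th y k l * Th z i k)"
        and "Th (x \<otimes>\<^bsub>SH\<^esub> (y \<otimes>\<^bsub>SH\<^esub> z)) i j = (\<Sum>l<n. \<Sum>k<n. Th x l j * Th y k l * Th z i k)"
        by (simp_all add: Th_mult sum_distrib_left sum_distrib_right mult.assoc)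
      then show "Th (x \<otimes>\<^bsub>SH\<^esub> y \<otimes>\<^bsub>SH\<^esub> z) i j = Th (x \<otimes>\<^bsub>SH\<^esub> (y \<otimes>\<^bsub>SH\<^esub> z)) i j"
        by (simp only:) (rule sum.swap)
    qed (simp_all add: c SH_mult_closed)
  next
    fix x assume x: "x \<in> carrier SH"
    show "\<one>\<^bsub>SH\<^esub> \<otimes>\<^bsub>SH\<^esub> x = x" "x \<otimes>\<^bsub>SH\<^esub> \<one>\<^bsub>SH\<^esub> = x"
      by (rule SH_eqI; simp add: x SH_mult_closed SH_one_closed Th_mult Th_one if_distrib if_distribR cong: if_cong)+
  qed (simp_all add: SH_mult_closed SH_one_closed)
  fix x y z assume c: "x \<in> carrier SH" "y \<in> carrier SH" "z \<in> carrier SH"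
  show "(x \<oplus>\<^bsub>SH\<^esub> y) \<otimes>\<^bsub>SH\<^esub> z = x \<otimes>\<^bsub>SH\<^esub> z \<oplus>\<^bsub>SH\<^esub> y \<otimes>\<^bsub>SH\<^esub> z"
    "z \<otimes>\<^bsub>SH\<^esub> (x \<oplus>\<^bsub>SH\<^esub> y) = z \<otimes>\<^bsub>SH\<^esub> x \<oplus>\<^bsub>SH\<^esub> z \<otimes>\<^bsub>SH\<^esub> y"
    by (rule SH_eqI; simp add: c SH_mult_closed SH_add_closed Th_mult Th_add distrib_left distrib_right sum.distrib)+
qed

lemma Th_finsum:
  assumes "finite B" "\<And>i. i \<in> B \<Longrightarrow> w i \<in> carrier SH"
  shows "Th (\<Oplus>\<^bsub>SH\<^esub>i\<in>B. w i) x j = (\<Sum>i\<in>B. Th (w i) x j)"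
  using assms
proof (induction B rule: finite_induct)
  case empty
  interpret ring SH by (rule ring_smashH)
  show ?case by (simp add: Th_zero)
next
  case (insert i B)
  interpret ring SH by (rule ring_smashH)
  have "(\<Oplus>\<^bsub>SH\<^esub>k\<in>insert i B. w k) = w i \<oplus>\<^bsub>SH\<^esub> (\<Oplus>\<^bsub>SH\<^esub>k\<in>B. w k)"
    using insert by (intro finsum_insert) auto
  then show ?case using insert by (simp add: Th_add)
qed

definition of_mat :: "(nat \<Rightarrow> nat \<Rightarrow> 'a) \<Rightarrow> nat \<Rightarrow> nat \<Rightarrow> 'a" where
  "of_mat T l a = (if l < n \<and> a < n then Ti T l a else 0)"

lemma Th_of_mat: "x < n \<Longrightarrow> j < n \<Longrightarrow> Th (of_mat T) x j = T x j"
  using Th_cong[of "of_mat T" "Ti T" x j] by (simp add: of_mat_def Th_Ti)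

lemma of_mat_closed:
  assumes "equi n u n u T"
  shows "of_mat T \<in> carrier SH"
  unfolding SH_carrier using equi_cong[OF _ assms, of "Th (of_mat T)"]
  by (simp add: Th_of_mat supp_def of_mat_def)

abbreviation commutes :: "(nat \<Rightarrow> nat \<Rightarrow> complex) \<Rightarrow> bool" where
  "commutes \<equiv> U.intw n u n u"

definition scalar :: "(nat \<Rightarrow> nat \<Rightarrow> complex) \<Rightarrow> nat \<Rightarrow> nat \<Rightarrow> 'a" where
  "scalar M = of_mat (\<lambda>x j. sc (M x j) 1)"

lemma Th_scalar: "x < n \<Longrightarrow> j < n \<Longrightarrow> Th (scalar M) x j = sc (M x j) 1"
  by (simp add: scalar_def Th_of_mat)

lemma scalar_closed: "commutes M \<Longrightarrow> scalar M \<in> carrier SH"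
  unfolding scalar_def by (intro of_mat_closed equi_scalar corep_u)

lemma scalar_mult:
  assumes M: "commutes M" and N: "commutes N" and K: "commutes K"
    and eq: "\<And>x j. x < n \<Longrightarrow> j < n \<Longrightarrow> K x j = (\<Sum>z<n. N x z * M z j)"
  shows "scalar M \<otimes>\<^bsub>SH\<^esub> scalar N = scalar K"
  by (rule SH_eqI)
    (simp_all add: SH_mult_closed scalar_closed M N K Th_mult Th_scalar eq sc_sum_left)

end

context mod_alg_section
begin

lemma E_commutes: "commutes E"
  unfolding E_def[abs_def] by (rule U.intw_comp[OF to_U_P p])

lemma E_P: "x < n \<Longrightarrow> k < m \<Longrightarrow> (\<Sum>z<n. E x z * P z k) = P x k"
proof -
  assume k: "k < m"
  have "(\<Sum>z<n. E x z * P z k) = (\<Sum>l<m. P x l * (\<Sum>z<n. p l z * P z k))"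
    by (simp add: E_def sum_distrib_left sum_distrib_right mult.assoc) (rule sum.swap)
  then show ?thesis using k by (simp add: pP if_distrib cong: if_cong)
qed

lemma p_E: "k < m \<Longrightarrow> (\<Sum>z<n. p k z * E z y) = p k y"
proof -
  assume k: "k < m"
  have "(\<Sum>z<n. p k z * E z y) = (\<Sum>l<m. (\<Sum>z<n. p k z * P z l) * p l y)"
    by (simp add: E_def sum_distrib_left sum_distrib_right mult.assoc) (rule sum.swap)
  then show ?thesis using k by (simp add: pP if_distrib if_distribR cong: if_cong)
qed

lemma E_factor_left:
  assumes "x < n"
  shows "(\<Sum>z<n. E x z * (\<Sum>k<m. P z k * q k j)) = (\<Sum>k<m. P x k * q k j)"
proof -
  have "(\<Sum>z<n. E x z * (\<Sum>k<m. P z k * q k j)) = (\<Sum>k<m. (\<Sum>z<n. E x z * P z k) * q k j)"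
    by (simp add: sum_distrib_left sum_distrib_right mult.assoc) (rule sum.swap)
  then show ?thesis using assms by (simp add: E_P)
qed

lemma E_factor_right: "(\<Sum>z<n. (\<Sum>k<m. q x k * p k z) * E z j) = (\<Sum>k<m. q x k * p k j)"
proof -
  have "(\<Sum>z<n. (\<Sum>k<m. q x k * p k z) * E z j) = (\<Sum>k<m. q x k * (\<Sum>z<n. p k z * E z j))"
    by (simp add: sum_distrib_left sum_distrib_right mult.assoc) (rule sum.swap)
  then show ?thesis by (simp add: p_E)
qed

lemma E_E: "x < n \<Longrightarrow> (\<Sum>z<n. E x z * E z j) = E x j"
  using E_factor_left[of x p j] by (simp add: E_def)

lemma scale_E_commutes: "commutes (\<lambda>x j. c * E x j)"
proof -
  have 1: "(\<Sum>z<n. csc (c * E z y) (u x z)) = csc c (\<Sum>z<n. csc (E z y) (u x z))"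
    and 2: "(\<Sum>z<n. csc (c * E x z) (u z y)) = csc c (\<Sum>z<n. csc (E x z) (u z y))" for x y
    by (simp_all add: csc_sum_right)
  show ?thesis using E_commutes unfolding U.intw_def 1 2 by simp
qed

definition eH :: "nat \<Rightarrow> nat \<Rightarrow> 'a" where "eH = scalar E"

lemma eH_closed: "eH \<in> carrier SH"
  unfolding eH_def by (rule scalar_closed[OF E_commutes])

lemma in_corner_iff:
  assumes w: "w \<in> carrier SH"
  shows "eH \<otimes>\<^bsub>SH\<^esub> w = w \<longleftrightarrow> (\<forall>x<n. \<forall>j<n. (\<Sum>z<n. sc (E z j) (Th w x z)) = Th w x j)"
    and "w \<otimes>\<^bsub>SH\<^esub> eH = w \<longleftrightarrow> (\<forall>x<n. \<forall>j<n. (\<Sum>z<n. sc (E x z) (Th w z j)) = Th w x j)"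
proof -
  have 1: "Th (eH \<otimes>\<^bsub>SH\<^esub> w) x j = (\<Sum>z<n. sc (E z j) (Th w x z))"
    and 2: "Th (w \<otimes>\<^bsub>SH\<^esub> eH) x j = (\<Sum>z<n. sc (E x z) (Th w z j))" if "x < n" "j < n" for x j
    using that by (simp_all add: Th_mult eH_def Th_scalar)
  have eq: "w' = w \<longleftrightarrow> (\<forall>x<n. \<forall>j<n. Th w' x j = Th w x j)" if "w' \<in> carrier SH" for w'
    using SH_eqI[OF that w] by blast
  show "eH \<otimes>\<^bsub>SH\<^esub> w = w \<longleftrightarrow> (\<forall>x<n. \<forall>j<n. (\<Sum>z<n. sc (E z j) (Th w x z)) = Th w x j)"
    unfolding eq[OF SH_mult_closed[OF eH_closed w]] by (simp add: 1 cong: imp_cong)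
  show "w \<otimes>\<^bsub>SH\<^esub> eH = w \<longleftrightarrow> (\<forall>x<n. \<forall>j<n. (\<Sum>z<n. sc (E x z) (Th w z j)) = Th w x j)"
    unfolding eq[OF SH_mult_closed[OF w eH_closed]] by (simp add: 2 cong: imp_cong)
qed

definition \<psi> :: "(nat \<Rightarrow> nat \<Rightarrow> 'a) \<Rightarrow> nat \<Rightarrow> 'a" where
  "\<psi> w = chi (Th w)"

lemma chi_cong:
  assumes "\<And>x j. x < n \<Longrightarrow> j < n \<Longrightarrow> T x j = T' x j"
  shows "chi T = chi T'"
  by (rule ext) (simp add: chi_def kapi_def tt_def assms)

lemma chi_linear: "chi (\<lambda>x j. T x j + T' x j) v = chi T v + chi T' v"
  "chi (\<lambda>x j. - T x j) v = - chi T v"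
  by (simp_all add: chi_def kapi_def tt_def sc_add_right sum.distrib sc_minus_right sum_negf)

lemma \<psi>_closed: "\<psi> w \<in> carrier SU"
  by (simp add: smashU_def Let_def \<psi>_def chi_def)

lemma \<psi>_add: "\<psi> (w \<oplus>\<^bsub>SH\<^esub> w') = \<psi> w \<oplus>\<^bsub>SU\<^esub> \<psi> w'"
proof
  fix v
  have "\<psi> (w \<oplus>\<^bsub>SH\<^esub> w') v = chi (\<lambda>x j. Th w x j + Th w' x j) v"
    unfolding \<psi>_def by (rule arg_cong[where f = "\<lambda>f. f v"], rule chi_cong) (simp add: Th_add)
  then show "\<psi> (w \<oplus>\<^bsub>SH\<^esub> w') v = (\<psi> w \<oplus>\<^bsub>SU\<^esub> \<psi> w') v"
    by (simp add: chi_linear \<psi>_def) (simp add: smashU_def Let_def)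
qed

lemma \<psi>_mult:
  assumes w: "w \<in> carrier SH" "w \<otimes>\<^bsub>SH\<^esub> eH = w" and w': "w' \<in> carrier SH"
  shows "\<psi> (w \<otimes>\<^bsub>SH\<^esub> w') = \<psi> w \<otimes>\<^bsub>SU\<^esub> \<psi> w'"
proof -
  have "\<psi> (w \<otimes>\<^bsub>SH\<^esub> w') = chi (\<lambda>x j. \<Sum>y<n. Th w y j * Th w' x y)"
    unfolding \<psi>_def by (rule chi_cong) (simp add: Th_mult)
  also have "\<dots> = \<psi> w \<otimes>\<^bsub>SU\<^esub> \<psi> w'"
    unfolding \<psi>_def using w w' in_corner_iff(2)[OF w(1)] by (intro chi_mult) (simp_all add: SH_carrier)
  finally show ?thesis .
qed

lemma \<psi>_one: "\<psi> eH = \<one>\<^bsub>SU\<^esub>"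
proof
  fix v
  have "\<psi> eH = chi (\<lambda>x j. sc (E x j) 1)"
    unfolding \<psi>_def eH_def by (rule chi_cong) (simp add: Th_scalar)
  moreover have "tt (\<lambda>x j. sc (E x j) 1) k = sc (heps U k) 1" if k: "k < m" for k
  proof -
    have "(\<Sum>j<n. heps H j * E x j) = heps H x" if "x < n" for x
    proof -
      have "(\<Sum>j<n. heps H j * E x j) = (\<Sum>l<m. P x l * (\<Sum>j<n. p l j * heps H j))"
        by (simp add: E_def sum_distrib_left mult_ac) (rule sum.swap)
      then show ?thesis using that by (simp add: p_ep P_ep)
    qed
    then have "(\<Sum>x<n. p k x * (\<Sum>j<n. heps H j * E x j)) = heps U k"
      using k by (simp add: p_ep)
    then show ?thesis
      by (simp add: tt_def sum_distrib_left mult.assoc flip: sc_sum_left)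
  qed
  then have "kapi (tt (\<lambda>x j. sc (E x j) 1)) v = sc (U.cou (U.Si (U.Si (U.b v)))) 1"
    by (simp add: kapi_def U.cou_def sc_sum_left mult.commute)
  ultimately show "\<psi> eH v = \<one>\<^bsub>SU\<^esub> v"
    by (simp add: chi_def) (simp add: smashU_def Let_def)
qed

lemma \<psi>_inj:
  assumes w: "w \<in> carrier SH" "eH \<otimes>\<^bsub>SH\<^esub> w = w" "w \<otimes>\<^bsub>SH\<^esub> eH = w"
    and w': "w' \<in> carrier SH" "eH \<otimes>\<^bsub>SH\<^esub> w' = w'" "w' \<otimes>\<^bsub>SH\<^esub> eH = w'"
    and eq: "\<psi> w = \<psi> w'"
  shows "w = w'"
proof (rule SH_eqI[OF w(1) w'(1)])
  define T where "T x j = Th w x j + - Th w' x j" for x j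
  have T: "equi n u n u T"
    using w(1) w'(1) unfolding T_def[abs_def] by (intro equi_add equi_minus) (simp_all add: SH_carrier)
  have "chi T v = 0" for v
    using fun_cong[OF eq, of v] unfolding T_def[abs_def] by (simp only: chi_linear \<psi>_def) simp
  then have Z: "Z_of T k l = 0" if "k < m" "l < m" for k l
    using chi_inj[OF T _ that] by blast
  fix x j assume x: "x < n" and j: "j < n"
  have ET: "(\<Sum>z<n. sc (E z j) (T x z)) = T x j" if "x < n" "j < n" for x j
    using that in_corner_iff(1)[OF w(1)] in_corner_iff(1)[OF w'(1)] w(2) w'(2)
    by (simp add: T_def sc_diff_right sum_subtractf)
  have TE: "(\<Sum>z<n. sc (E x z) (T z j)) = T x j" if "x < n" "j < n" for x j
    using that in_corner_iff(2)[OF w(1)] in_corner_iff(2)[OF w'(1)] w(3) w'(3)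
    by (simp add: T_def sc_diff_right sum_subtractf)
  have "T x j = (\<Sum>y<n. \<Sum>z<n. sc (E y j) (sc (E x z) (T z y)))"
    using x j by (simp add: ET TE flip: sc_sum_right del: sc_sc)
  also have "\<dots> = (\<Sum>y<n. \<Sum>z<n. \<Sum>l<m. \<Sum>k<m. sc (P y l * p l j) (sc (P x k * p k z) (T z y)))"
    unfolding E_def sc_sum_left unfolding sc_sum_right ..
  also have "\<dots> = (\<Sum>l<m. \<Sum>k<m. \<Sum>y<n. \<Sum>z<n. sc (P y l * p l j) (sc (P x k * p k z) (T z y)))"
    by (rule sum_rot4)
  also have "\<dots> = (\<Sum>l<m. \<Sum>k<m. sc (p l j * P x k) (Z_of T k l))"
    by (simp add: Z_of_def sc_sum_right mult_ac)
  also have "\<dots> = 0" by (simp add: Z)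
  finally show "Th w x j = Th w' x j" by (simp add: T_def)
qed

lemma \<psi>_surj:
  assumes r: "r \<in> carrier SU"
  obtains w where "w \<in> carrier SH" "eH \<otimes>\<^bsub>SH\<^esub> w = w" "w \<otimes>\<^bsub>SH\<^esub> eH = w" "\<psi> w = r"
proof -
  have r0: "r v = 0" if "v \<ge> m" for v using that r by (simp add: smashU_def Let_def)
  obtain Z where T: "equi n u n u (\<lambda>x j. \<Sum>l<m. sc (p l j) (\<Sum>k<m. sc (P x k) (Z k l)))"
    and r: "chi (\<lambda>x j. \<Sum>l<m. sc (p l j) (\<Sum>k<m. sc (P x k) (Z k l))) = r"
    by (rule chi_surj[of r], erule r0, rule that)
  let ?T = "\<lambda>x j. \<Sum>l<m. sc (p l j) (\<Sum>k<m. sc (P x k) (Z k l))"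
  let ?w = "of_mat ?T"
  have c: "?w \<in> carrier SH" by (rule of_mat_closed[OF T])
  have "(\<Sum>z<n. sc (E z j) (?T x z)) = ?T x j" for x j
  proof -
    have "(\<Sum>z<n. sc (E z j) (?T x z)) = (\<Sum>z<n. \<Sum>l<m. sc (p l z * E z j) (\<Sum>k<m. sc (P x k) (Z k l)))"
      unfolding sc_sum_right[of "E _ _"] by (simp only: sc_sc mult.commute)
    also have "\<dots> = (\<Sum>l<m. sc (\<Sum>z<n. p l z * E z j) (\<Sum>k<m. sc (P x k) (Z k l)))"
      unfolding sc_sum_left by (rule sum.swap)
    finally show ?thesis by (simp add: p_E)
  qed
  then have 1: "eH \<otimes>\<^bsub>SH\<^esub> ?w = ?w" using in_corner_iff(1)[OF c] by (simp add: Th_of_mat)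
  have "(\<Sum>z<n. sc (E x z) (?T z j)) = ?T x j" if x: "x < n" for x j
  proof -
    have "(\<Sum>z<n. sc (E x z) (?T z j)) = (\<Sum>z<n. \<Sum>l<m. \<Sum>k<m. sc (E x z * P z k) (sc (p l j) (Z k l)))"
      by (simp add: sc_sum_right mult_ac)
    also have "\<dots> = (\<Sum>l<m. \<Sum>z<n. \<Sum>k<m. sc (E x z * P z k) (sc (p l j) (Z k l)))"
      by (rule sum.swap)
    also have "\<dots> = (\<Sum>l<m. \<Sum>k<m. \<Sum>z<n. sc (E x z * P z k) (sc (p l j) (Z k l)))"
      by (intro sum.cong refl sum.swap)
    also have "\<dots> = (\<Sum>l<m. \<Sum>k<m. sc (P x k) (sc (p l j) (Z k l)))"
      using x by (simp add: E_P flip: sc_sum_left del: sc_sc)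
    finally show ?thesis by (simp add: sc_sum_right mult.commute)
  qed
  then have 2: "?w \<otimes>\<^bsub>SH\<^esub> eH = ?w" using in_corner_iff(2)[OF c] by (simp add: Th_of_mat)
  have "\<psi> ?w = r" unfolding \<psi>_def r[symmetric] by (rule chi_cong) (simp add: Th_of_mat)
  then show ?thesis using that c 1 2 by blast
qed

lemma Morita: "module_categories_equivalent SU SH TYPE('m)"
proof -
  obtain q where q: "\<And>i. i < n \<Longrightarrow> from_U (q i)"
    and split: "\<And>x y. x < n \<Longrightarrow> y < n \<Longrightarrow> (\<Sum>i<n. \<Sum>k<m. U.co k (u x i) * q i k y) = (if x = y then 1 else 0)"
    by (rule injectivity_splitting) (rule that)
  define X where "X i x y = (\<Sum>k<m. P x k * q i k y)" for i x y
  define Y where "Y i x y = (\<Sum>k<m. U.co k (u x i) * p k y)" for i x y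
  have X: "commutes (X i)" if "i < n" for i
    unfolding X_def[abs_def] by (rule U.intw_comp[OF to_U_P q[OF that]])
  have Y: "commutes (Y i)" if "i < n" for i
    unfolding Y_def[abs_def] by (rule U.intw_comp[OF to_U_coeff[OF that] p])
  have ee: "eH \<otimes>\<^bsub>SH\<^esub> eH = eH"
    unfolding eH_def by (rule scalar_mult[OF E_commutes E_commutes E_commutes]) (simp add: E_E)
  have YX: "(\<Sum>z<n. Y i x z * X i z j) = (\<Sum>k<m. U.co k (u x i) * q i k j)" for i x j
  proof -
    have "(\<Sum>z<n. Y i x z * X i z j) = (\<Sum>z<n. \<Sum>k<m. \<Sum>l<m. U.co k (u x i) * (p k z * P z l) * q i l j)"
      by (simp add: X_def Y_def sum_product mult.assoc)
    also have "\<dots> = (\<Sum>k<m. \<Sum>z<n. \<Sum>l<m. U.co k (u x i) * (p k z * P z l) * q i l j)"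
      by (rule sum.swap)
    also have "\<dots> = (\<Sum>k<m. \<Sum>l<m. \<Sum>z<n. U.co k (u x i) * (p k z * P z l) * q i l j)"
      by (intro sum.cong refl sum.swap)
    also have "\<dots> = (\<Sum>k<m. \<Sum>l<m. U.co k (u x i) * (\<Sum>z<n. p k z * P z l) * q i l j)"
      by (simp only: sum_distrib_left sum_distrib_right)
    also have "\<dots> = (\<Sum>k<m. \<Sum>l<m. if k = l then U.co k (u x i) * q i l j else 0)"
      by (intro sum.cong refl) (simp add: pP)
    finally show ?thesis by simp
  qed
  have xy: "(\<Oplus>\<^bsub>SH\<^esub>i\<in>{..<n}. scalar (X i) \<otimes>\<^bsub>SH\<^esub> scalar (Y i)) = \<one>\<^bsub>SH\<^esub>"
  proof (rule SH_eqI[OF _ SH_one_closed])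
    interpret ring SH by (rule ring_smashH)
    show "(\<Oplus>\<^bsub>SH\<^esub>i\<in>{..<n}. scalar (X i) \<otimes>\<^bsub>SH\<^esub> scalar (Y i)) \<in> carrier SH"
      by (intro finsum_closed) (simp add: scalar_closed X Y)
    fix x j assume x: "x < n" and j: "j < n"
    have "Th (\<Oplus>\<^bsub>SH\<^esub>i\<in>{..<n}. scalar (X i) \<otimes>\<^bsub>SH\<^esub> scalar (Y i)) x j
        = (\<Sum>i<n. Th (scalar (X i) \<otimes>\<^bsub>SH\<^esub> scalar (Y i)) x j)"
      by (rule Th_finsum) (simp_all add: scalar_closed X Y)
    also have "\<dots> = sc (\<Sum>i<n. \<Sum>z<n. Y i x z * X i z j) 1"
      using x j by (simp add: Th_mult Th_scalar sc_sum_left)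
    also have "\<dots> = Th \<one>\<^bsub>SH\<^esub> x j" using x j by (simp add: YX split Th_one)
    finally show "Th (\<Oplus>\<^bsub>SH\<^esub>i\<in>{..<n}. scalar (X i) \<otimes>\<^bsub>SH\<^esub> scalar (Y i)) x j = Th \<one>\<^bsub>SH\<^esub> x j" .
  qed
  define \<kappa> where "\<kappa> c = scalar (\<lambda>x j. c * E x j)" for c
  have \<kappa>_mult: "\<kappa> c \<otimes>\<^bsub>SH\<^esub> \<kappa> d = \<kappa> (c * d)" for c d
    unfolding \<kappa>_def
  proof (rule scalar_mult[OF scale_E_commutes scale_E_commutes scale_E_commutes])
    fix x j assume x: "x < n"
    have "(\<Sum>z<n. d * E x z * (c * E z j)) = c * d * (\<Sum>z<n. E x z * E z j)"
      by (simp add: sum_distrib_left mult_ac)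
    then show "c * d * E x j = (\<Sum>z<n. d * E x z * (c * E z j))" by (simp add: E_E[OF x])
  qed
  have \<kappa>_closed: "\<kappa> c \<in> carrier SH" for c
    unfolding \<kappa>_def by (rule scalar_closed[OF scale_E_commutes])
  have \<kappa>_one: "\<kappa> 1 = eH" by (simp add: \<kappa>_def eH_def)
  have \<kappa>_add: "\<kappa> (c + d) = \<kappa> c \<oplus>\<^bsub>SH\<^esub> \<kappa> d" for c d
    by (rule SH_eqI[OF \<kappa>_closed SH_add_closed[OF \<kappa>_closed \<kappa>_closed]])
      (simp add: \<kappa>_def Th_add Th_scalar distrib_right sc_add_left)
  have bij: "bij_betw \<psi> {s \<in> carrier SH. eH \<otimes>\<^bsub>SH\<^esub> s = s \<and> s \<otimes>\<^bsub>SH\<^esub> eH = s} (carrier SU)"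
    unfolding bij_betw_def
  proof
    show "inj_on \<psi> {s \<in> carrier SH. eH \<otimes>\<^bsub>SH\<^esub> s = s \<and> s \<otimes>\<^bsub>SH\<^esub> eH = s}"
      by (rule inj_onI, rule \<psi>_inj) auto
    show "\<psi> ` {s \<in> carrier SH. eH \<otimes>\<^bsub>SH\<^esub> s = s \<and> s \<otimes>\<^bsub>SH\<^esub> eH = s} = carrier SU"
    proof (intro subset_antisym subsetI)
      fix r assume "r \<in> carrier SU"
      then show "r \<in> \<psi> ` {s \<in> carrier SH. eH \<otimes>\<^bsub>SH\<^esub> s = s \<and> s \<otimes>\<^bsub>SH\<^esub> eH = s}"
        by (rule \<psi>_surj) blast
    qed (use \<psi>_closed in blast)
  qed
  have "full_corner SH SU eH \<psi> (\<lambda>i. scalar (X i)) (\<lambda>i. scalar (Y i)) n \<kappa>"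
  proof (intro full_corner.intro ring_smashH full_corner_axioms.intro)
    fix i assume i: "i < n"
    show "scalar (X i) \<otimes>\<^bsub>SH\<^esub> eH = scalar (X i)"
      unfolding eH_def by (rule scalar_mult[OF X[OF i] E_commutes X[OF i]]) (simp add: X_def E_factor_left)
    show "eH \<otimes>\<^bsub>SH\<^esub> scalar (Y i) = scalar (Y i)"
      unfolding eH_def by (rule scalar_mult[OF E_commutes Y[OF i] Y[OF i]])
        (simp add: Y_def E_factor_right[of "\<lambda>x k. U.co k (u x i)"])
  next
    fix c show "\<kappa> c \<in> {s \<in> carrier SH. eH \<otimes>\<^bsub>SH\<^esub> s = s \<and> s \<otimes>\<^bsub>SH\<^esub> eH = s}"
      using \<kappa>_mult[of 1 c] \<kappa>_mult[of c 1] by (simp add: \<kappa>_closed \<kappa>_one)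
  next
    fix s t assume "s \<in> {s \<in> carrier SH. eH \<otimes>\<^bsub>SH\<^esub> s = s \<and> s \<otimes>\<^bsub>SH\<^esub> eH = s}"
      "t \<in> {s \<in> carrier SH. eH \<otimes>\<^bsub>SH\<^esub> s = s \<and> s \<otimes>\<^bsub>SH\<^esub> eH = s}"
    then show "\<psi> (s \<otimes>\<^bsub>SH\<^esub> t) = \<psi> s \<otimes>\<^bsub>SU\<^esub> \<psi> t" by (intro \<psi>_mult) auto
  qed (simp_all add: eH_closed ee scalar_closed X Y xy bij \<psi>_add \<psi>_one \<kappa>_one \<kappa>_add \<kappa>_mult)
  then show ?thesis by (rule full_corner.full_corner_Morita)
qed

end

theorem theorem4p4:
  fixes H U :: hopf
    and P :: "nat \<Rightarrow> nat \<Rightarrow> complex"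
    and sc :: "complex \<Rightarrow> 'a::{ring,monoid_mult} \<Rightarrow> 'a"
    and act :: "(nat \<Rightarrow> complex) \<Rightarrow> 'a \<Rightarrow> 'a"
  assumes "hopf_alg H"
    and "compact_quantum_subgroup H U P"
    and "complex_algebra sc"
    and "dual_module_algebra U sc act"
  shows "module_categories_equivalent (smashU U sc act) (smashH H U P sc act) TYPE('m)"
proof -
  interpret mod_alg H U P sc act
    using assms by unfold_locales (auto simp: compact_quantum_subgroup_def)
  obtain p where p: "from_U p" "\<And>k l. k < hdim U \<Longrightarrow> l < hdim U \<Longrightarrow> (\<Sum>y<hdim H. p k y * P y l) = (if k = l then 1 else 0)"
    by (rule section_exists) (rule that)
  interpret mod_alg_section H U P sc act p
    by unfold_locales (rule p; assumption)+
  show ?thesis by (rule Morita)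
qed

end
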